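(* Let $W$ be an infinite-dimensional vector space over a field $k$ and let $\mathcal C=\operatorname{Sym}(W)$ be the symmetric coalgebra of $W$. Let $$0\longleftarrow k\longleftarrow\mathfrak P_0\longleftarrow\mathfrak P_1\longleftarrow\mathfrak P_2\longleftarrow\cdots$$ denote the Koszul projective resolution of the trivial one-dimensional $\mathcal C$-contramodule $k$ described in the context, with $\mathfrak P_n=\operatorname{Hom}_k(\mathcal C,\Lambda^n(W)^* )$. Denote by $\mathfrak P$ the free $\mathcal C$-contramodule $\operatorname{Hom}_k(\mathcal C,W^* )$ spanned by the vector space $W^*=\operatorname{Hom}_k(W,k)$. Then the complex $$0\longrightarrow\operatorname{Hom}^{\mathcal C}(\mathfrak P_0,\mathfrak P)\longrightarrow\operatorname{Hom}^{\mathcal C}(\mathfrak P_1,\mathfrak P)\longrightarrow\operatorname{Hom}^{\mathcal C}(\mathfrak P_2,\mathfrak P)\longrightarrow\cdots$$ obtained by applying the contravariant functor $\operatorname{Hom}^{\mathcal C}(-,\mathfrak P)$ to the truncated resolution $0\leftarrow\mathfrak P_0\leftarrow\mathfrak P_1\leftarrow\mathfrak P_2\leftarrow\cdots$ is a bounded below, noncontractible, acyclic complex of finitely generated projective left modules over the ring $S=\operatorname{Hom}^{\mathcal C}(\mathfrak P,\mathfrak P)$.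
   Context: Coalgebras are coassociative and counital over the field $k$. Symmetric coalgebra: the tensor coalgebra $\bigoplus_{n\ge0}W^{\otimes n}$ has comultiplication $w_1\otimes\cdots\otimes w_n\mapsto\sum_{i=0}^n(w_1\otimes\cdots\otimes w_i)\otimes(w_{i+1}\otimes\cdots\otimes w_n)$ and counit the projection onto $W^{\otimes0}=k$. The symmetric coalgebra $\operatorname{Sym}(W)=\bigoplus_{n\ge0}\operatorname{Sym}_n(W)$ is the graded subcoalgebra whose component $\operatorname{Sym}_n(W)\subset W^{\otimes n}$ is the subspace of symmetric tensors; so $\operatorname{Sym}_0(W)=k$, $\operatorname{Sym}_1(W)=W$. It is cocommutative. Put $\mathcal C=\operatorname{Sym}(W)$. Contramodules: a left $\mathcal C$-contramodule is a $k$-vector space $\mathfrak Q$ with a $k$-linear contraaction map $\pi\colon\operatorname{Hom}_k(\mathcal C,\mathfrak Q)\to\mathfrak Q$ satisfying contraassociativity (the two maps $\operatorname{Hom}_k(\mathcal C\otimes_k\mathcal C,\mathfrak Q)\simeq\operatorname{Hom}_k(\mathcal C,\operatorname{Hom}_k(\mathcal C,\mathfrak Q))\rightrightarrows\operatorname{Hom}_k(\mathcal C,\mathfrak Q)$, induced by the comultiplication and by $\pi$, have equal compositions with $\pi$) and contraunitality (the composition of the map $\mathfrak Q\to\operatorname{Hom}_k(\mathcal C,\mathfrak Q)$ induced by the counit with $\pi$ is the identity). Morphisms are $k$-linear maps compatible with the contraactions; $\operatorname{Hom}^{\mathcal C}$ denotes the space of morphisms in the (abelian) category of left $\mathcal C$-contramodules.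 The free contramodule spanned by a vector space $V$ is $\operatorname{Hom}_k(\mathcal C,V)$ with contraaction induced by the comultiplication. For any contramodule $\mathfrak Q$, the space $\operatorname{Hom}^{\mathcal C}(\mathfrak Q,\mathfrak P)$ is a left module over $S=\operatorname{Hom}^{\mathcal C}(\mathfrak P,\mathfrak P)$ via postcomposition. The Koszul (co)resolutions: the Koszul cofree comodule coresolution of the trivial one-dimensional $\mathcal C$-comodule $k$ (the coaction being given by $k=\operatorname{Sym}_0(W)\subset\mathcal C$) is $$0\to k\to\mathcal C\to\mathcal C\otimes_kW\to\mathcal C\otimes_k\Lambda^2(W)\to\cdots\to\mathcal C\otimes_k\Lambda^n(W)\to\cdots,$$ where $\Lambda^n$ denotes exterior powers, $k\to\mathcal C$ is the inclusion of $\operatorname{Sym}_0(W)$, and the differential $\mathcal C\otimes_k\Lambda^n(W)\to\mathcal C\otimes_k\Lambda^{n+1}(W)$ is the composition of the map $\mathcal C\otimes_k\Lambda^n(W)\to\mathcal C\otimes_kW\otimes_k\Lambda^n(W)$ induced by the component $\mathcal C\to\mathcal C\otimes_kW$ of the comultiplication and the map induced by the multiplication $W\otimes_k\Lambda^n(W)\to\Lambda^{n+1}(W)$. Applying $\operatorname{Hom}_k(-,k)$ and writing $V^*=\operatorname{Hom}_k(V,k)$, one obtains the Koszul projective (free) contramodule resolution of the trivial one-dimensional contramodule $k$: $$0\leftarrow k\leftarrow\operatorname{Hom}_k(\mathcal C,k)\leftarrow\operatorname{Hom}_k(\mathcal C,W^* )\leftarrow\operatorname{Hom}_k(\mathcal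 C,\Lambda^2(W)^* )\leftarrow\cdots.$$ Complexes are cohomologically graded; bounded below means that the terms vanish in all sufficiently negative degrees. A complex is contractible if its identity endomorphism is homotopic to zero; noncontractible means not contractible (as a complex of left $S$-modules). *)

theory Defs
  imports "HOL-Algebra.Module" "HOL-Algebra.AbelCoset" "HOL-Combinatorics.Permutations"
begin

text \<open>Vector spaces over a field are modules in the sense of HOL-Algebra; the multiplicative
  fields of the module record carry no information and are left undefined in the constructions
  below. Maps between carriers are extensional, so that equality of maps is equality of functions.\<close>


section \<open>Left modules over a ring that need not be commutative\<close>

locale left_module = R?: ring R + M?: abelian_group M
  for R :: "('a, 'r) ring_scheme" (structure) and M :: "('a, 'b, 'm) module_scheme" (structure) +
  assumes smult_closed:
      "\<lbrakk>a \<in> carrier R; x \<in> carrier M\<rbrakk> \<Longrightarrow> a \<odot>\<^bsub>M\<^esub> x \<in> carrier M"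
    and smult_l_distr:
      "\<lbrakk>a \<in> carrier R; b \<in> carrier R; x \<in> carrier M\<rbrakk> \<Longrightarrow>
        (a \<oplus>\<^bsub>R\<^esub> b) \<odot>\<^bsub>M\<^esub> x = a \<odot>\<^bsub>M\<^esub> x \<oplus>\<^bsub>M\<^esub> b \<odot>\<^bsub>M\<^esub> x"
    and smult_r_distr:
      "\<lbrakk>a \<in> carrier R; x \<in> carrier M; y \<in> carrier M\<rbrakk> \<Longrightarrow>
        a \<odot>\<^bsub>M\<^esub> (x \<oplus>\<^bsub>M\<^esub> y) = a \<odot>\<^bsub>M\<^esub> x \<oplus>\<^bsub>M\<^esub> a \<odot>\<^bsub>M\<^esub> y"
    and smult_assoc:
      "\<lbrakk>a \<in> carrier R; b \<in> carrier R; x \<in> carrier M\<rbrakk> \<Longrightarrow>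
        (a \<otimes>\<^bsub>R\<^esub> b) \<odot>\<^bsub>M\<^esub> x = a \<odot>\<^bsub>M\<^esub> (b \<odot>\<^bsub>M\<^esub> x)"
    and smult_one:
      "x \<in> carrier M \<Longrightarrow> \<one>\<^bsub>R\<^esub> \<odot>\<^bsub>M\<^esub> x = x"

definition lin_maps ::
    "('a, 'r) ring_scheme \<Rightarrow> ('a, 'b, 'm) module_scheme \<Rightarrow> ('a, 'c, 'n) module_scheme \<Rightarrow> ('b \<Rightarrow> 'c) set"
  where "lin_maps R M N = {f \<in> carrier M \<rightarrow>\<^sub>E carrier N.
    (\<forall>x \<in> carrier M. \<forall>y \<in> carrier M. f (x \<oplus>\<^bsub>M\<^esub> y) = f x \<oplus>\<^bsub>N\<^esub> f y) \<and>
    (\<forall>a \<in> carrier R. \<forall>x \<in> carrier M. f (a \<odot>\<^bsub>M\<^esub> x) = a \<odot>\<^bsub>N\<^esub> f x)}"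

definition lin_span :: "('a, 'r) ring_scheme \<Rightarrow> ('a, 'b, 'm) module_scheme \<Rightarrow> 'b set \<Rightarrow> 'b set"
  where "lin_span R M A = \<Inter>{N. submodule N R M \<and> A \<subseteq> N}"

definition finitely_generated :: "('a, 'r) ring_scheme \<Rightarrow> ('a, 'b, 'm) module_scheme \<Rightarrow> bool"
  where "finitely_generated R M \<longleftrightarrow>
    (\<exists>A. finite A \<and> A \<subseteq> carrier M \<and> lin_span R M A = carrier M)"

text \<open>The lifting property. A definition cannot quantify over types, so the type \<open>'t\<close> of the
  elements of the test modules is a parameter. A theorem that asserts
  \<open>projective_module TYPE('t) R M\<close> for a type variable \<open>'t\<close> asserts the lifting property against
  all surjections of left modules.\<close>

definition projective_module ::
    "'t itself \<Rightarrow> ('a, 'r) ring_scheme \<Rightarrow> ('a, 'b, 'm) module_scheme \<Rightarrow> bool"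
  where "projective_module T R M \<longleftrightarrow> left_module R M \<and>
    (\<forall>(A :: ('a, 't) module) (B :: ('a, 't) module) g f.
      left_module R A \<and> left_module R B \<and>
      g \<in> lin_maps R A B \<and> g ` carrier A = carrier B \<and> f \<in> lin_maps R M B \<longrightarrow>
      (\<exists>h \<in> lin_maps R M A. \<forall>x \<in> carrier M. g (h x) = f x))"


section \<open>Cohomologically graded complexes of left modules\<close>

record ('a, 'x) cochain =
  obj :: "int \<Rightarrow> ('a, 'x) module"
  differential :: "int \<Rightarrow> 'x \<Rightarrow> 'x"

definition cochain_complex :: "('a, 'r) ring_scheme \<Rightarrow> ('a, 'x) cochain \<Rightarrow> bool"
  where "cochain_complex R X \<longleftrightarrow>
    (\<forall>i. left_module R (obj X i)) \<and>
    (\<forall>i. differential X i \<in> lin_maps R (obj X i) (obj X (i + 1))) \<and>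
    (\<forall>i. \<forall>x \<in> carrier (obj X i).
      differential X (i + 1) (differential X i x) = \<zero>\<^bsub>obj X (i + 1 + 1)\<^esub>)"

definition bounded_below :: "('a, 'x) cochain \<Rightarrow> bool"
  where "bounded_below X \<longleftrightarrow> (\<exists>N. \<forall>i < N. carrier (obj X i) = {\<zero>\<^bsub>obj X i\<^esub>})"

definition acyclic_complex :: "('a, 'x) cochain \<Rightarrow> bool"
  where "acyclic_complex X \<longleftrightarrow>
    (\<forall>i. {x \<in> carrier (obj X i). differential X i x = \<zero>\<^bsub>obj X (i + 1)\<^esub>} =
      differential X (i - 1) ` carrier (obj X (i - 1)))"

definition contractible_complex :: "('a, 'r) ring_scheme \<Rightarrow> ('a, 'x) cochain \<Rightarrow> bool"
  where "contractible_complex R X \<longleftrightarrow>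
    (\<exists>h. (\<forall>i. h i \<in> lin_maps R (obj X i) (obj X (i - 1))) \<and>
      (\<forall>i. \<forall>x \<in> carrier (obj X i).
        x = differential X (i - 1) (h i x) \<oplus>\<^bsub>obj X i\<^esub> h (i + 1) (differential X i x)))"


section \<open>Linear algebra\<close>

definition self_module :: "('k, 'r) ring_scheme \<Rightarrow> ('k, 'k) module"
  where "self_module K = \<lparr>carrier = carrier K, monoid.mult = monoid.mult K, one = one K, zero = zero K,
    add = add K, smult = monoid.mult K\<rparr>"

definition hom_module ::
    "('k, 'r) ring_scheme \<Rightarrow> ('k, 'b, 'm) module_scheme \<Rightarrow> ('k, 'c, 'n) module_scheme \<Rightarrow>
      ('k, 'b \<Rightarrow> 'c) module"
  where "hom_module K M N = \<lparr>carrier = lin_maps K M N, monoid.mult = undefined, one = undefined,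
    zero = (\<lambda>x \<in> carrier M. \<zero>\<^bsub>N\<^esub>),
    add = (\<lambda>f g. \<lambda>x \<in> carrier M. f x \<oplus>\<^bsub>N\<^esub> g x),
    smult = (\<lambda>a f. \<lambda>x \<in> carrier M. a \<odot>\<^bsub>N\<^esub> f x)\<rparr>"

definition dual_module ::
    "('k, 'r) ring_scheme \<Rightarrow> ('k, 'b, 'm) module_scheme \<Rightarrow> ('k, 'b \<Rightarrow> 'k) module"
  where "dual_module K M = hom_module K M (self_module K)"

definition free_module :: "('k, 'r) ring_scheme \<Rightarrow> 'x set \<Rightarrow> ('k, 'x \<Rightarrow> 'k) module"
  where "free_module K X = \<lparr>
    carrier = {f. range f \<subseteq> carrier K \<and> finite {x. f x \<noteq> \<zero>\<^bsub>K\<^esub>} \<and> {x. f x \<noteq> \<zero>\<^bsub>K\<^esub>} \<subseteq> X},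
    monoid.mult = undefined, one = undefined,
    zero = (\<lambda>x. \<zero>\<^bsub>K\<^esub>), add = (\<lambda>f g x. f x \<oplus>\<^bsub>K\<^esub> g x), smult = (\<lambda>a f x. a \<otimes>\<^bsub>K\<^esub> f x)\<rparr>"

definition basis_vec :: "('k, 'r) ring_scheme \<Rightarrow> 'x \<Rightarrow> 'x \<Rightarrow> 'k"
  where "basis_vec K x = (\<lambda>y. if y = x then \<one>\<^bsub>K\<^esub> else \<zero>\<^bsub>K\<^esub>)"

definition quot_module :: "('k, 'b, 'm) module_scheme \<Rightarrow> 'b set \<Rightarrow> ('k, 'b set) module"
  where "quot_module M N = \<lparr>carrier = a_rcosets\<^bsub>M\<^esub> N, monoid.mult = undefined, one = undefined,
    zero = N, add = set_add M,
    smult = (\<lambda>a X. \<Union>x \<in> X. N +>\<^bsub>M\<^esub> (a \<odot>\<^bsub>M\<^esub> x))\<rparr>"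

definition dsum_module :: "(nat \<Rightarrow> ('k, 'b, 'm) module_scheme) \<Rightarrow> ('k, nat \<Rightarrow> 'b) module"
  where "dsum_module V = \<lparr>
    carrier = {x. (\<forall>n. x n \<in> carrier (V n)) \<and> finite {n. x n \<noteq> \<zero>\<^bsub>V n\<^esub>}},
    monoid.mult = undefined, one = undefined,
    zero = (\<lambda>n. \<zero>\<^bsub>V n\<^esub>), add = (\<lambda>x y n. x n \<oplus>\<^bsub>V n\<^esub> y n), smult = (\<lambda>a x n. a \<odot>\<^bsub>V n\<^esub> x n)\<rparr>"

subsection \<open>Tensor products\<close>

definition tensor_rels ::
    "('k, 'r) ring_scheme \<Rightarrow> ('k, 'b, 'm) module_scheme \<Rightarrow> ('k, 'c, 'n) module_scheme \<Rightarrow>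
      ('b \<times> 'c \<Rightarrow> 'k) set"
  where "tensor_rels K M N = (let F = free_module K (carrier M \<times> carrier N) in
    {basis_vec K (a \<odot>\<^bsub>M\<^esub> u \<oplus>\<^bsub>M\<^esub> b \<odot>\<^bsub>M\<^esub> v, y) \<ominus>\<^bsub>F\<^esub>
       (a \<odot>\<^bsub>F\<^esub> basis_vec K (u, y) \<oplus>\<^bsub>F\<^esub> b \<odot>\<^bsub>F\<^esub> basis_vec K (v, y)) | a b u v y.
       a \<in> carrier K \<and> b \<in> carrier K \<and> u \<in> carrier M \<and> v \<in> carrier M \<and> y \<in> carrier N} \<union>
    {basis_vec K (x, a \<odot>\<^bsub>N\<^esub> u \<oplus>\<^bsub>N\<^esub> b \<odot>\<^bsub>N\<^esub> v) \<ominus>\<^bsub>F\<^esub>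
       (a \<odot>\<^bsub>F\<^esub> basis_vec K (x, u) \<oplus>\<^bsub>F\<^esub> b \<odot>\<^bsub>F\<^esub> basis_vec K (x, v)) | a b u v x.
       a \<in> carrier K \<and> b \<in> carrier K \<and> u \<in> carrier N \<and> v \<in> carrier N \<and> x \<in> carrier M})"

definition tensor_null ::
    "('k, 'r) ring_scheme \<Rightarrow> ('k, 'b, 'm) module_scheme \<Rightarrow> ('k, 'c, 'n) module_scheme \<Rightarrow>
      ('b \<times> 'c \<Rightarrow> 'k) set"
  where "tensor_null K M N =
    lin_span K (free_module K (carrier M \<times> carrier N)) (tensor_rels K M N)"

definition tensor ::
    "('k, 'r) ring_scheme \<Rightarrow> ('k, 'b, 'm) module_scheme \<Rightarrow> ('k, 'c, 'n) module_scheme \<Rightarrow>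
      ('k, ('b \<times> 'c \<Rightarrow> 'k) set) module"
  where "tensor K M N =
    quot_module (free_module K (carrier M \<times> carrier N)) (tensor_null K M N)"

definition tens ::
    "('k, 'r) ring_scheme \<Rightarrow> ('k, 'b, 'm) module_scheme \<Rightarrow> ('k, 'c, 'n) module_scheme \<Rightarrow>
      'b \<Rightarrow> 'c \<Rightarrow> ('b \<times> 'c \<Rightarrow> 'k) set"
  where "tens K M N x y =
    tensor_null K M N +>\<^bsub>free_module K (carrier M \<times> carrier N)\<^esub> basis_vec K (x, y)"

text \<open>The linear map on the tensor product induced by a bilinear map \<open>\<beta>\<close>.\<close>

definition tensor_lift ::
    "('k, 'r) ring_scheme \<Rightarrow> ('k, 'b, 'm) module_scheme \<Rightarrow> ('k, 'c, 'n) module_scheme \<Rightarrow>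
      ('k, 'd, 'p) module_scheme \<Rightarrow> ('b \<Rightarrow> 'c \<Rightarrow> 'd) \<Rightarrow> ('b \<times> 'c \<Rightarrow> 'k) set \<Rightarrow> 'd"
  where "tensor_lift K M N Q \<beta> = (THE h. h \<in> lin_maps K (tensor K M N) Q \<and>
    (\<forall>x \<in> carrier M. \<forall>y \<in> carrier N. h (tens K M N x y) = \<beta> x y))"

definition tensor_map ::
    "('k, 'r) ring_scheme \<Rightarrow> ('k, 'b, 'm) module_scheme \<Rightarrow> ('k, 'c, 'n) module_scheme \<Rightarrow>
      ('k, 'd, 'p) module_scheme \<Rightarrow> ('k, 'e, 'q) module_scheme \<Rightarrow> ('b \<Rightarrow> 'd) \<Rightarrow> ('c \<Rightarrow> 'e) \<Rightarrow>
      ('b \<times> 'c \<Rightarrow> 'k) set \<Rightarrow> ('d \<times> 'e \<Rightarrow> 'k) set"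
  where "tensor_map K M N M' N' f g =
    tensor_lift K M N (tensor K M' N') (\<lambda>x y. tens K M' N' (f x) (g y))"

definition tensor_assoc ::
    "('k, 'r) ring_scheme \<Rightarrow> ('k, 'b, 'm) module_scheme \<Rightarrow> ('k, 'c, 'n) module_scheme \<Rightarrow>
      ('k, 'd, 'p) module_scheme \<Rightarrow>
      (('b \<times> 'c \<Rightarrow> 'k) set \<times> 'd \<Rightarrow> 'k) set \<Rightarrow> ('b \<times> ('c \<times> 'd \<Rightarrow> 'k) set \<Rightarrow> 'k) set"
  where "tensor_assoc K L M N =
    (THE h. h \<in> lin_maps K (tensor K (tensor K L M) N) (tensor K L (tensor K M N)) \<and>
      (\<forall>x \<in> carrier L. \<forall>y \<in> carrier M. \<forall>z \<in> carrier N.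
        h (tens K (tensor K L M) N (tens K L M x y) z) =
        tens K L (tensor K M N) x (tens K M N y z)))"

subsection \<open>Tensor powers and exterior powers\<close>

definition tpow_free :: "('k, 'r) ring_scheme \<Rightarrow> ('k, 'w, 'm) module_scheme \<Rightarrow> nat \<Rightarrow>
    ('k, 'w list \<Rightarrow> 'k) module"
  where "tpow_free K W n = free_module K {ws. set ws \<subseteq> carrier W \<and> length ws = n}"

definition tpow_null :: "('k, 'r) ring_scheme \<Rightarrow> ('k, 'w, 'm) module_scheme \<Rightarrow> nat \<Rightarrow>
    ('w list \<Rightarrow> 'k) set"
  where "tpow_null K W n = (let F = tpow_free K W n in lin_span K F
    {basis_vec K (xs @ (a \<odot>\<^bsub>W\<^esub> u \<oplus>\<^bsub>W\<^esub> b \<odot>\<^bsub>W\<^esub> v) # ys) \<ominus>\<^bsub>F\<^esub>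
       (a \<odot>\<^bsub>F\<^esub> basis_vec K (xs @ u # ys) \<oplus>\<^bsub>F\<^esub> b \<odot>\<^bsub>F\<^esub> basis_vec K (xs @ v # ys)) | a b u v xs ys.
       a \<in> carrier K \<and> b \<in> carrier K \<and> u \<in> carrier W \<and> v \<in> carrier W \<and>
       set xs \<subseteq> carrier W \<and> set ys \<subseteq> carrier W \<and> length xs + 1 + length ys = n})"

definition tensor_power :: "('k, 'r) ring_scheme \<Rightarrow> ('k, 'w, 'm) module_scheme \<Rightarrow> nat \<Rightarrow>
    ('k, ('w list \<Rightarrow> 'k) set) module"
  where "tensor_power K W n = quot_module (tpow_free K W n) (tpow_null K W n)"

definition tword :: "('k, 'r) ring_scheme \<Rightarrow> ('k, 'w, 'm) module_scheme \<Rightarrow> 'w list \<Rightarrow>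
    ('w list \<Rightarrow> 'k) set"
  where "tword K W ws =
    tpow_null K W (length ws) +>\<^bsub>tpow_free K W (length ws)\<^esub> basis_vec K ws"

definition alt_null :: "('k, 'r) ring_scheme \<Rightarrow> ('k, 'w, 'm) module_scheme \<Rightarrow> nat \<Rightarrow>
    ('w list \<Rightarrow> 'k) set set"
  where "alt_null K W n = lin_span K (tensor_power K W n)
    {tword K W ws | ws. set ws \<subseteq> carrier W \<and> length ws = n \<and> \<not> distinct ws}"

definition ext_power :: "('k, 'r) ring_scheme \<Rightarrow> ('k, 'w, 'm) module_scheme \<Rightarrow> nat \<Rightarrow>
    ('k, ('w list \<Rightarrow> 'k) set set) module"
  where "ext_power K W n = quot_module (tensor_power K W n) (alt_null K W n)"

definition wedge :: "('k, 'r) ring_scheme \<Rightarrow> ('k, 'w, 'm) module_scheme \<Rightarrow> 'w list \<Rightarrow>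
    ('w list \<Rightarrow> 'k) set set"
  where "wedge K W ws =
    alt_null K W (length ws) +>\<^bsub>tensor_power K W (length ws)\<^esub> tword K W ws"

text \<open>The multiplication map from \<open>W \<otimes> \<Lambda>\<^sup>n W\<close> to \<open>\<Lambda>\<^sup>n\<^sup>+\<^sup>1 W\<close>.\<close>

definition ext_mult :: "('k, 'r) ring_scheme \<Rightarrow> ('k, 'w, 'm) module_scheme \<Rightarrow> nat \<Rightarrow>
    ('w \<times> ('w list \<Rightarrow> 'k) set set \<Rightarrow> 'k) set \<Rightarrow> ('w list \<Rightarrow> 'k) set set"
  where "ext_mult K W n =
    (THE h. h \<in> lin_maps K (tensor K W (ext_power K W n)) (ext_power K W (Suc n)) \<and>
      (\<forall>w \<in> carrier W. \<forall>ws. set ws \<subseteq> carrier W \<and> length ws = n \<longrightarrow>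
        h (tens K W (ext_power K W n) w (wedge K W ws)) = wedge K W (w # ws)))"


section \<open>Coalgebras\<close>

record ('k, 'c) coalgebra = "('k, 'c) module" +
  comult :: "'c \<Rightarrow> ('c \<times> 'c \<Rightarrow> 'k) set"
  counit :: "'c \<Rightarrow> 'k"

locale coalgebra = K?: field K + C?: module K C
  for K :: "('k, 'r) ring_scheme" (structure) and C :: "('k, 'c, 'm) coalgebra_scheme" (structure) +
  assumes comult_linear: "comult C \<in> lin_maps K C (tensor K C C)"
    and counit_linear: "counit C \<in> lin_maps K C (self_module K)"
    and coassociative: "c \<in> carrier C \<Longrightarrow>
      tensor_assoc K C C C (tensor_map K C C (tensor K C C) C (comult C) (\<lambda>x \<in> carrier C. x) (comult C c)) =
      tensor_map K C C C (tensor K C C) (\<lambda>x \<in> carrier C. x) (comult C) (comult C c)"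
    and counital_left: "c \<in> carrier C \<Longrightarrow>
      tensor_lift K C C C (\<lambda>x y. counit C x \<odot>\<^bsub>C\<^esub> y) (comult C c) = c"
    and counital_right: "c \<in> carrier C \<Longrightarrow>
      tensor_lift K C C C (\<lambda>x y. counit C y \<odot>\<^bsub>C\<^esub> x) (comult C c) = c"

text \<open>For a subcoalgebra \<open>D\<close> of \<open>C\<close>, the space \<open>D \<otimes> D\<close> embeds into \<open>C \<otimes> C\<close>; the comultiplication
  of \<open>C\<close> restricted to \<open>D\<close> is read through this embedding.\<close>

definition subcoalgebra ::
    "('k, 'r) ring_scheme \<Rightarrow> ('k, 'c) coalgebra \<Rightarrow> 'c set \<Rightarrow> ('k, 'c) coalgebra"
  where "subcoalgebra K C D = (let E = C\<lparr>carrier := D\<rparr>; j = (\<lambda>x \<in> D. x) in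
    E\<lparr>comult := (\<lambda>c \<in> D. THE z. z \<in> carrier (tensor K E E) \<and>
         tensor_map K E E C C j j z = comult C c),
      counit := (\<lambda>c \<in> D. counit C c)\<rparr>)"

definition tword_at :: "('k, 'r) ring_scheme \<Rightarrow> ('k, 'w, 'm) module_scheme \<Rightarrow> 'w list \<Rightarrow>
    nat \<Rightarrow> ('w list \<Rightarrow> 'k) set"
  where "tword_at K W ws =
    (\<lambda>n. if n = length ws then tword K W ws else \<zero>\<^bsub>tensor_power K W n\<^esub>)"

definition tensor_coalgebra :: "('k, 'r) ring_scheme \<Rightarrow> ('k, 'w, 'm) module_scheme \<Rightarrow>
    ('k, nat \<Rightarrow> ('w list \<Rightarrow> 'k) set) coalgebra"
  where "tensor_coalgebra K W = (let T = dsum_module (tensor_power K W) in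
    module.extend T \<lparr>
      comult = (THE h. h \<in> lin_maps K T (tensor K T T) \<and>
        (\<forall>ws. set ws \<subseteq> carrier W \<longrightarrow> h (tword_at K W ws) =
          (\<Oplus>\<^bsub>tensor K T T\<^esub> i \<in> {..length ws}.
            tens K T T (tword_at K W (take i ws)) (tword_at K W (drop i ws))))),
      counit = (\<lambda>x \<in> carrier T. THE a. a \<in> carrier K \<and>
        x 0 = a \<odot>\<^bsub>tensor_power K W 0\<^esub> tword K W [])\<rparr>)"

definition perm_action :: "('k, 'r) ring_scheme \<Rightarrow> ('k, 'w, 'm) module_scheme \<Rightarrow> nat \<Rightarrow>
    (nat \<Rightarrow> nat) \<Rightarrow> ('w list \<Rightarrow> 'k) set \<Rightarrow> ('w list \<Rightarrow> 'k) set"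
  where "perm_action K W n \<sigma> =
    (THE h. h \<in> lin_maps K (tensor_power K W n) (tensor_power K W n) \<and>
      (\<forall>ws. set ws \<subseteq> carrier W \<and> length ws = n \<longrightarrow>
        h (tword K W ws) = tword K W (permute_list \<sigma> ws)))"

definition symmetric_tensors :: "('k, 'r) ring_scheme \<Rightarrow> ('k, 'w, 'm) module_scheme \<Rightarrow> nat \<Rightarrow>
    ('w list \<Rightarrow> 'k) set set"
  where "symmetric_tensors K W n = {t \<in> carrier (tensor_power K W n).
    \<forall>\<sigma>. \<sigma> permutes {..<n} \<longrightarrow> perm_action K W n \<sigma> t = t}"

definition Sym :: "('k, 'r) ring_scheme \<Rightarrow> ('k, 'w, 'm) module_scheme \<Rightarrow>
    ('k, nat \<Rightarrow> ('w list \<Rightarrow> 'k) set) coalgebra"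
  where "Sym K W = subcoalgebra K (tensor_coalgebra K W)
    {x \<in> carrier (tensor_coalgebra K W). \<forall>n. x n \<in> symmetric_tensors K W n}"


section \<open>Contramodules\<close>

record ('k, 'c, 'q) contramodule = "('k, 'q) module" +
  contra :: "('c \<Rightarrow> 'q) \<Rightarrow> 'q"

text \<open>Left contramodules use the identification of a map \<open>h\<close> on \<open>C \<otimes> C\<close> with the map sending
  \<open>d\<close> to \<open>h (\<hyphen> \<otimes> d)\<close>. For cocommutative \<open>C\<close>, left and right contramodules agree.\<close>

locale contramodule = C?: coalgebra K C + Q?: module K Q
  for K :: "('k, 'r) ring_scheme" (structure) and C :: "('k, 'c, 'm) coalgebra_scheme" (structure)
    and Q :: "('k, 'c, 'q, 'n) contramodule_scheme" (structure) +
  assumes contra_linear: "restrict (contra Q) (lin_maps K C Q) \<in> lin_maps K (hom_module K C Q) Q"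
    and contraassociative: "h \<in> lin_maps K (tensor K C C) Q \<Longrightarrow>
      contra Q (compose (carrier C) h (comult C)) =
      contra Q (\<lambda>d \<in> carrier C. contra Q (\<lambda>c \<in> carrier C. h (tens K C C c d)))"
    and contraunital: "q \<in> carrier Q \<Longrightarrow>
      contra Q (\<lambda>c \<in> carrier C. counit C c \<odot>\<^bsub>Q\<^esub> q) = q"

definition free_contramodule ::
    "('k, 'r) ring_scheme \<Rightarrow> ('k, 'c, 'm) coalgebra_scheme \<Rightarrow> ('k, 'v, 'n) module_scheme \<Rightarrow>
      ('k, 'c, 'c \<Rightarrow> 'v) contramodule"
  where "free_contramodule K C V = module.extend (hom_module K C V) \<lparr>
    contra = (\<lambda>\<Phi>. \<lambda>c \<in> carrier C. tensor_lift K C C V (\<lambda>x y. \<Phi> y x) (comult C c))\<rparr>"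

definition contra_morphisms ::
    "('k, 'r) ring_scheme \<Rightarrow> ('k, 'c, 'm) coalgebra_scheme \<Rightarrow>
      ('k, 'c, 'q, 'n) contramodule_scheme \<Rightarrow> ('k, 'c, 'p, 'l) contramodule_scheme \<Rightarrow> ('q \<Rightarrow> 'p) set"
  where "contra_morphisms K C Q P = {f \<in> lin_maps K Q P.
    \<forall>\<Phi> \<in> lin_maps K C Q. f (contra Q \<Phi>) = contra P (compose (carrier C) f \<Phi>)}"

definition contra_end_ring ::
    "('k, 'r) ring_scheme \<Rightarrow> ('k, 'c, 'm) coalgebra_scheme \<Rightarrow>
      ('k, 'c, 'p, 'l) contramodule_scheme \<Rightarrow> ('p \<Rightarrow> 'p) ring"
  where "contra_end_ring K C P = \<lparr>carrier = contra_morphisms K C P P,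
    monoid.mult = (\<lambda>s t. compose (carrier P) s t), one = (\<lambda>x \<in> carrier P. x),
    zero = (\<lambda>x \<in> carrier P. \<zero>\<^bsub>P\<^esub>), add = (\<lambda>s t. \<lambda>x \<in> carrier P. s x \<oplus>\<^bsub>P\<^esub> t x)\<rparr>"

definition contra_hom ::
    "('k, 'r) ring_scheme \<Rightarrow> ('k, 'c, 'm) coalgebra_scheme \<Rightarrow>
      ('k, 'c, 'q, 'n) contramodule_scheme \<Rightarrow> ('k, 'c, 'p, 'l) contramodule_scheme \<Rightarrow>
      ('p \<Rightarrow> 'p, 'q \<Rightarrow> 'p) module"
  where "contra_hom K C Q P = \<lparr>carrier = contra_morphisms K C Q P,
    monoid.mult = undefined, one = undefined,
    zero = (\<lambda>x \<in> carrier Q. \<zero>\<^bsub>P\<^esub>), add = (\<lambda>f g. \<lambda>x \<in> carrier Q. f x \<oplus>\<^bsub>P\<^esub> g x),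
    smult = (\<lambda>s f. compose (carrier Q) s f)\<rparr>"

definition zero_module :: "'x \<Rightarrow> ('a, 'x) module"
  where "zero_module z = \<lparr>carrier = {z}, monoid.mult = undefined, one = undefined, zero = z,
    add = (\<lambda>_ _. z), smult = (\<lambda>_ _. z)\<rparr>"

text \<open>The complex of left modules over \<open>contra_end_ring K C P\<close> obtained by applying the contravariant
  functor of morphisms into \<open>P\<close> to a complex of contramodules with terms \<open>Q n\<close> and differentials
  \<open>d n\<close> from \<open>Q (n + 1)\<close> to \<open>Q n\<close>. The terms in negative degrees are zero.\<close>

definition hom_complex ::
    "('k, 'r) ring_scheme \<Rightarrow> ('k, 'c, 'm) coalgebra_scheme \<Rightarrow>
      (nat \<Rightarrow> ('k, 'c, 'q, 'n) contramodule_scheme) \<Rightarrow> (nat \<Rightarrow> 'q \<Rightarrow> 'q) \<Rightarrow>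
      ('k, 'c, 'p, 'l) contramodule_scheme \<Rightarrow> ('p \<Rightarrow> 'p, 'q \<Rightarrow> 'p) cochain"
  where "hom_complex K C Q d P = (let
      X = (\<lambda>i :: int. if 0 \<le> i then contra_hom K C (Q (nat i)) P else zero_module undefined)
    in \<lparr>obj = X,
      differential = (\<lambda>i. \<lambda>f \<in> carrier (X i).
        if 0 \<le> i then compose (carrier (Q (nat i + 1))) f (d (nat i)) else \<zero>\<^bsub>X (i + 1)\<^esub>)\<rparr>)"


section \<open>The Koszul resolution of the trivial contramodule over the symmetric coalgebra\<close>

text \<open>The projection of \<open>Sym K W\<close> onto its degree-one component, identified with \<open>W\<close>.\<close>

definition Sym_proj1 :: "('k, 'r) ring_scheme \<Rightarrow> ('k, 'w, 'm) module_scheme \<Rightarrow>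
    (nat \<Rightarrow> ('w list \<Rightarrow> 'k) set) \<Rightarrow> 'w"
  where "Sym_proj1 K W =
    (\<lambda>c \<in> carrier (Sym K W). THE w. w \<in> carrier W \<and> c 1 = tword K W [w])"

text \<open>The differential \<open>C \<otimes> \<Lambda>\<^sup>n W \<rightarrow> C \<otimes> W \<otimes> \<Lambda>\<^sup>n W \<rightarrow> C \<otimes> \<Lambda>\<^sup>n\<^sup>+\<^sup>1 W\<close> of the Koszul coresolution.\<close>

definition koszul_codiff :: "('k, 'r) ring_scheme \<Rightarrow> ('k, 'w, 'm) module_scheme \<Rightarrow> nat \<Rightarrow>
    ((nat \<Rightarrow> ('w list \<Rightarrow> 'k) set) \<times> ('w list \<Rightarrow> 'k) set set \<Rightarrow> 'k) set \<Rightarrow>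
    ((nat \<Rightarrow> ('w list \<Rightarrow> 'k) set) \<times> ('w list \<Rightarrow> 'k) set set \<Rightarrow> 'k) set"
  where "koszul_codiff K W n = (let
      C = Sym K W; \<Lambda> = ext_power K W; idC = (\<lambda>c \<in> carrier C. c); id\<Lambda> = (\<lambda>\<omega> \<in> carrier (\<Lambda> n). \<omega>);
      comult1 = compose (carrier C) (tensor_map K C C C W idC (Sym_proj1 K W)) (comult C)
    in (\<lambda>z \<in> carrier (tensor K C (\<Lambda> n)).
      tensor_map K C (tensor K W (\<Lambda> n)) C (\<Lambda> (Suc n)) idC (ext_mult K W n)
        (tensor_assoc K C W (\<Lambda> n)
          (tensor_map K C (\<Lambda> n) (tensor K C W) (\<Lambda> n) comult1 id\<Lambda> z))))"

definition koszul_contra :: "('k, 'r) ring_scheme \<Rightarrow> ('k, 'w, 'm) module_scheme \<Rightarrow> nat \<Rightarrow>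
    ('k, nat \<Rightarrow> ('w list \<Rightarrow> 'k) set,
      (nat \<Rightarrow> ('w list \<Rightarrow> 'k) set) \<Rightarrow> ('w list \<Rightarrow> 'k) set set \<Rightarrow> 'k) contramodule"
  where "koszul_contra K W n =
    free_contramodule K (Sym K W) (dual_module K (ext_power K W n))"

text \<open>The \<open>k\<close>-dual of \<open>koszul_codiff\<close>, under the identification of \<open>Hom(C \<otimes> V, k)\<close> with
  \<open>Hom(C, Hom(V, k))\<close>.\<close>

definition koszul_diff :: "('k, 'r) ring_scheme \<Rightarrow> ('k, 'w, 'm) module_scheme \<Rightarrow> nat \<Rightarrow>
    ((nat \<Rightarrow> ('w list \<Rightarrow> 'k) set) \<Rightarrow> ('w list \<Rightarrow> 'k) set set \<Rightarrow> 'k) \<Rightarrow>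
    ((nat \<Rightarrow> ('w list \<Rightarrow> 'k) set) \<Rightarrow> ('w list \<Rightarrow> 'k) set set \<Rightarrow> 'k)"
  where "koszul_diff K W n = (let C = Sym K W; \<Lambda> = ext_power K W in
    (\<lambda>\<phi> \<in> carrier (koszul_contra K W (Suc n)).
      \<lambda>c \<in> carrier C. \<lambda>\<omega> \<in> carrier (\<Lambda> n).
        tensor_lift K C (\<Lambda> (Suc n)) (self_module K) \<phi>
          (koszul_codiff K W n (tens K C (\<Lambda> n) c \<omega>))))"

end

theory Submission
  imports Defs
begin

text \<open>A basis \<open>B\<close> of \<open>W\<close> gives \<open>Sym W\<close> the basis of divided powers \<open>dpow m\<close>, indexed by the finite
  multisets \<open>m\<close> on \<open>B\<close>; the comultiplication sends \<open>dpow m\<close> to the sum of all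
  \<open>dpow a \<otimes> dpow (m - a)\<close> with \<open>a\<close> contained in \<open>m\<close>. A morphism from a free contramodule is an
  arbitrary linear map on the spanning space, so the complex of morphisms into \<open>P\<close> is the complex of
  linear maps into the dual of \<open>W\<close> on the chain complex \<open>D n = Sym W \<otimes> (\<Lambda>\<^sup>n W)\<^sup>*\<close> with differential
  \<open>dpow m \<otimes> \<eta> \<mapsto> \<Sum> dpow (m - {b}) \<otimes> \<iota> b \<eta>\<close>, the sum running over the basis vectors \<open>b\<close> in \<open>m\<close>.

  This chain complex is exact because \<open>B\<close> is infinite. A cycle involves finitely many basis vectors.
  For any other basis vector \<open>e\<close>, the homotopy \<open>dpow m \<otimes> \<eta> \<mapsto> dpow (m + {e}) \<otimes> (e\<^sup>* \<and> \<eta>)\<close> shows that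
  the cycle is homologous to its image under the operator that restricts forms to the wedges with a
  factor \<open>e\<close>. Repeating this with more distinct vectors \<open>e\<close> than the degree of the forms yields zero.

  As \<open>W\<close> is infinite-dimensional, its dual has every dual of an exterior power as a direct summand;
  hence the terms of the complex are direct summands of \<open>S\<close>. A contraction would split the first
  Koszul differential, which is impossible because its image vanishes at \<open>dpow {#}\<close>.\<close>

section \<open>Linear maps\<close>

text \<open>A cycle involves finitely many basis vectors only in its symmetric factor. Its forms lie
  in the full dual of an exterior power and may involve all basis vectors at once, so no
  \<open>e\<close> is foreign to them. One homotopy therefore only exchanges a cycle for its part
  whose forms contain \<open>e\<close>; the process ends because the degree of the forms is finite.
  The classical Euler homotopy would sum over all directions and divide by the total degree; neither
  is possible for infinite \<open>B\<close> in arbitrary characteristic, while a homotopy for a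
  single \<open>e\<close> needs neither.

  Exactness passes from the chain complex to the maps into the dual of \<open>W\<close> because
  vector spaces are injective: a map that vanishes on cycles factors through the differential. Since
  the terms of the resolution are retracts of \<open>P\<close>, an \<open>S\<close>-linear map
  between the nonzero terms of the complex is composition with a contramodule morphism. This is how
  a contraction of modules becomes a section of the first differential.\<close>

lemma lin_maps_closed: "f \<in> lin_maps K M N \<Longrightarrow> x \<in> carrier M \<Longrightarrow> f x \<in> carrier N"
  by (auto simp: lin_maps_def)

lemma lin_maps_add:
  "f \<in> lin_maps K M N \<Longrightarrow> x \<in> carrier M \<Longrightarrow> y \<in> carrier M \<Longrightarrow> f (x \<oplus>\<^bsub>M\<^esub> y) = f x \<oplus>\<^bsub>N\<^esub> f y"
  by (auto simp: lin_maps_def)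

lemma lin_maps_smult:
  "f \<in> lin_maps K M N \<Longrightarrow> a \<in> carrier K \<Longrightarrow> x \<in> carrier M \<Longrightarrow> f (a \<odot>\<^bsub>M\<^esub> x) = a \<odot>\<^bsub>N\<^esub> f x"
  by (auto simp: lin_maps_def)

lemma lin_maps_arb: "f \<in> lin_maps K M N \<Longrightarrow> x \<notin> carrier M \<Longrightarrow> f x = undefined"
  unfolding lin_maps_def by (blast intro: PiE_arb)

lemma lin_maps_eqI:
  "f \<in> lin_maps K M N \<Longrightarrow> g \<in> lin_maps K M N' \<Longrightarrow> (\<And>x. x \<in> carrier M \<Longrightarrow> f x = g x) \<Longrightarrow> f = g"
  by (rule extensionalityI[of _ "carrier M"]) (auto simp: lin_maps_def PiE_def)

lemma lin_maps_restrictI: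
  assumes "module K M"
    and "\<And>x. x \<in> carrier M \<Longrightarrow> g x \<in> carrier N"
    and "\<And>x y. x \<in> carrier M \<Longrightarrow> y \<in> carrier M \<Longrightarrow> g (x \<oplus>\<^bsub>M\<^esub> y) = g x \<oplus>\<^bsub>N\<^esub> g y"
    and "\<And>a x. a \<in> carrier K \<Longrightarrow> x \<in> carrier M \<Longrightarrow> g (a \<odot>\<^bsub>M\<^esub> x) = a \<odot>\<^bsub>N\<^esub> g x"
  shows "(\<lambda>x \<in> carrier M. g x) \<in> lin_maps K M N"
proof -
  interpret M: module K M by fact
  show ?thesis using assms(2-) by (auto simp: lin_maps_def)
qed

lemma lin_maps_zero:
  assumes "module K M" "module K N" "f \<in> lin_maps K M N"
  shows "f \<zero>\<^bsub>M\<^esub> = \<zero>\<^bsub>N\<^esub>"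
proof -
  interpret M: module K M by fact
  interpret N: module K N by fact
  have "f (\<zero>\<^bsub>K\<^esub> \<odot>\<^bsub>M\<^esub> \<zero>\<^bsub>M\<^esub>) = \<zero>\<^bsub>K\<^esub> \<odot>\<^bsub>N\<^esub> f \<zero>\<^bsub>M\<^esub>"
    by (rule lin_maps_smult[OF assms(3)]) auto
  then show ?thesis using lin_maps_closed[OF assms(3), of "\<zero>\<^bsub>M\<^esub>"] by simp
qed

lemma lin_maps_minus:
  assumes "module K M" "module K N" "f \<in> lin_maps K M N" "x \<in> carrier M"
  shows "f (\<ominus>\<^bsub>M\<^esub> x) = \<ominus>\<^bsub>N\<^esub> f x"
proof -
  interpret M: module K M by fact
  interpret N: module K N by fact
  have "f (\<ominus>\<^bsub>M\<^esub> x \<oplus>\<^bsub>M\<^esub> x) = f (\<ominus>\<^bsub>M\<^esub> x) \<oplus>\<^bsub>N\<^esub> f x"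
    by (rule lin_maps_add[OF assms(3)]) (use assms in auto)
  then have "f (\<ominus>\<^bsub>M\<^esub> x) \<oplus>\<^bsub>N\<^esub> f x = \<zero>\<^bsub>N\<^esub>"
    using assms lin_maps_zero[OF assms(1-3)] by (simp add: M.l_neg)
  then show ?thesis using assms lin_maps_closed[OF assms(3)] by (metis M.a_inv_closed N.minus_equality)
qed

lemma lin_maps_a_minus:
  assumes "module K M" "module K N" "f \<in> lin_maps K M N" "x \<in> carrier M" "y \<in> carrier M"
  shows "f (x \<ominus>\<^bsub>M\<^esub> y) = f x \<ominus>\<^bsub>N\<^esub> f y"
proof -
  interpret M: module K M by fact
  show ?thesis unfolding a_minus_def using assms by (simp add: lin_maps_add lin_maps_minus)
qed

lemma lin_maps_finsum:
  assumes "module K M" "module K N" "f \<in> lin_maps K M N" "g \<in> A \<rightarrow> carrier M"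
  shows "f (\<Oplus>\<^bsub>M\<^esub>i\<in>A. g i) = (\<Oplus>\<^bsub>N\<^esub>i\<in>A. f (g i))"
proof -
  interpret M: module K M by fact
  interpret N: module K N by fact
  show ?thesis
  proof (cases "finite A")
    case True
    then show ?thesis using assms(4)
    proof (induction A)
      case empty
      then show ?case using lin_maps_zero[OF assms(1-3)] by simp
    next
      case (insert x A)
      have "(\<lambda>i. f (g i)) \<in> A \<rightarrow> carrier N" "f (g x) \<in> carrier N"
        using insert.prems lin_maps_closed[OF assms(3)] by (auto simp: Pi_def)
      then show ?case using insert
        by (simp add: M.finsum_closed Pi_def lin_maps_add[OF assms(3)])
    qed
  next
    case False
    then show ?thesis using lin_maps_zero[OF assms(1-3)] by (simp add: M.add.finprod_infinite N.add.finprod_infinite)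
  qed
qed

lemma lin_maps_compose:
  assumes "module K L" "f \<in> lin_maps K L M" "g \<in> lin_maps K M N"
  shows "compose (carrier L) g f \<in> lin_maps K L N"
  unfolding compose_def using assms
  by (intro lin_maps_restrictI) (auto simp: lin_maps_closed lin_maps_add lin_maps_smult)

lemma lin_maps_id: "module K M \<Longrightarrow> (\<lambda>x \<in> carrier M. x) \<in> lin_maps K M M"
  by (rule lin_maps_restrictI) auto

lemma lin_maps_const_zero:
  assumes "module K M" "module K N"
  shows "(\<lambda>x \<in> carrier M. \<zero>\<^bsub>N\<^esub>) \<in> lin_maps K M N"
proof -
  interpret N: module K N by fact
  show ?thesis by (rule lin_maps_restrictI) (use assms in auto)
qed

lemma equalizer_submodule:
  assumes "module K M" "module K N" "f \<in> lin_maps K M N" "g \<in> lin_maps K M N"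
  shows "submodule {x \<in> carrier M. f x = g x} K M"
proof -
  interpret M: module K M by fact
  show ?thesis
    by (rule M.submoduleI)
      (use assms in \<open>auto simp: lin_maps_zero lin_maps_minus lin_maps_add lin_maps_smult\<close>)
qed

lemma kernel_submodule:
  assumes "module K M" "module K N" "f \<in> lin_maps K M N"
  shows "submodule {x \<in> carrier M. f x = \<zero>\<^bsub>N\<^esub>} K M"
proof -
  have "{x \<in> carrier M. f x = \<zero>\<^bsub>N\<^esub>} = {x \<in> carrier M. f x = (\<lambda>x \<in> carrier M. \<zero>\<^bsub>N\<^esub>) x}" by auto
  then show ?thesis using equalizer_submodule[OF assms lin_maps_const_zero[OF assms(1,2)]] by simp
qed

lemma image_submodule:
  assumes "module K M" "module K N" "f \<in> lin_maps K M N"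
  shows "submodule (f ` carrier M) K N"
proof -
  interpret M: module K M by fact
  interpret N: module K N by fact
  show ?thesis
  proof (rule N.submoduleI)
    show "f ` carrier M \<subseteq> carrier N" using assms(3) by (auto simp: lin_maps_closed)
    show "\<zero>\<^bsub>N\<^esub> \<in> f ` carrier M" using lin_maps_zero[OF assms] by (metis M.zero_closed imageI)
    show "\<ominus>\<^bsub>N\<^esub> a \<in> f ` carrier M" if "a \<in> f ` carrier M" for a
      using that by (auto simp flip: lin_maps_minus[OF assms])
    show "a \<oplus>\<^bsub>N\<^esub> b \<in> f ` carrier M" if "a \<in> f ` carrier M" "b \<in> f ` carrier M" for a b
      using that by (auto simp flip: lin_maps_add[OF assms(3)])
    show "a \<odot>\<^bsub>N\<^esub> x \<in> f ` carrier M" if "a \<in> carrier K" "x \<in> f ` carrier M" for a x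
      using that by (auto simp flip: lin_maps_smult[OF assms(3)])
  qed
qed

lemma submodule_subset: "submodule N K M \<Longrightarrow> N \<subseteq> carrier M"
  using subgroup.subset submodule.axioms(1) by fastforce

lemma submodule_zero: "submodule N K M \<Longrightarrow> \<zero>\<^bsub>M\<^esub> \<in> N"
  using subgroup.one_closed submodule.axioms(1) by fastforce

lemma submodule_add: "submodule N K M \<Longrightarrow> x \<in> N \<Longrightarrow> y \<in> N \<Longrightarrow> x \<oplus>\<^bsub>M\<^esub> y \<in> N"
  using subgroup.m_closed submodule.axioms(1) by fastforce

lemma submodule_smult: "submodule N K M \<Longrightarrow> a \<in> carrier K \<Longrightarrow> x \<in> N \<Longrightarrow> a \<odot>\<^bsub>M\<^esub> x \<in> N"
  by (rule submodule.smult_closed)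

lemma submodule_minus: "submodule N K M \<Longrightarrow> x \<in> N \<Longrightarrow> \<ominus>\<^bsub>M\<^esub> x \<in> N"
  unfolding a_inv_def by (rule subgroup.m_inv_closed[OF submodule.axioms(1)])

lemma submodule_finsum:
  assumes "module K M" "submodule N K M" "\<And>i. i \<in> A \<Longrightarrow> g i \<in> N"
  shows "(\<Oplus>\<^bsub>M\<^esub>i\<in>A. g i) \<in> N"
proof -
  interpret M: module K M by fact
  have sub: "N \<subseteq> carrier M" using assms(2) by (rule submodule_subset)
  show ?thesis
  proof (cases "finite A")
    case True
    then show ?thesis using assms(3)
    proof (induction A)
      case (insert x A)
      then have "g \<in> A \<rightarrow> carrier M" "g x \<in> carrier M" using sub by auto
      then show ?case using insert by (simp add: submodule_add[OF assms(2)])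
    qed (simp add: submodule_zero[OF assms(2)])
  qed (simp add: M.add.finprod_infinite submodule_zero[OF assms(2)])
qed

lemma lin_span_submodule:
  assumes "module K M" "A \<subseteq> carrier M"
  shows "submodule (lin_span K M A) K M"
proof -
  interpret M: module K M by fact
  have ne: "\<exists>N. submodule N K M \<and> A \<subseteq> N" using M.carrier_is_submodule assms(2) by blast
  show ?thesis unfolding lin_span_def
  proof (rule M.submoduleI)
    show "\<Inter> {N. submodule N K M \<and> A \<subseteq> N} \<subseteq> carrier M" using ne by (auto dest: submodule_subset)
  qed (auto intro: submodule_zero submodule_add submodule_smult submodule_minus)
qed

lemma lin_span_superset: "A \<subseteq> lin_span K M A"
  by (auto simp: lin_span_def)

lemma lin_span_least: "submodule N K M \<Longrightarrow> A \<subseteq> N \<Longrightarrow> lin_span K M A \<subseteq> N"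
  by (auto simp: lin_span_def)

lemma lin_span_mono: "A \<subseteq> A' \<Longrightarrow> lin_span K M A \<subseteq> lin_span K M A'"
  by (auto simp: lin_span_def)

text \<open>The set where two linear maps agree is a submodule, so it contains the span of
  \<open>A\<close>.\<close>

lemma lin_maps_eq_on_span:
  assumes "module K M" "module K N" "f \<in> lin_maps K M N" "g \<in> lin_maps K M N"
    and "\<And>x. x \<in> A \<Longrightarrow> f x = g x" "A \<subseteq> carrier M" "x \<in> lin_span K M A"
  shows "f x = g x"
proof -
  have "lin_span K M A \<subseteq> {x \<in> carrier M. f x = g x}"
    by (rule lin_span_least[OF equalizer_submodule[OF assms(1-4)]]) (use assms in auto)
  then show ?thesis using assms(7) by auto
qed

lemma lin_maps_eqI_span:
  assumes "module K M" "module K N" "f \<in> lin_maps K M N" "g \<in> lin_maps K M N"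
    and "lin_span K M A = carrier M" "\<And>x. x \<in> A \<Longrightarrow> f x = g x"
  shows "f = g"
proof (rule lin_maps_eqI[OF assms(3,4)])
  have A: "A \<subseteq> carrier M" using assms(5) lin_span_superset by metis
  fix x assume "x \<in> carrier M"
  then show "f x = g x" using lin_maps_eq_on_span[OF assms(1-4,6) A] assms(5) by auto
qed

lemma self_module_simps [simp]:
  "carrier (self_module K) = carrier K" "zero (self_module K) = zero K"
  "add (self_module K) = add K" "smult (self_module K) = monoid.mult K"
  by (simp_all add: self_module_def)

lemma self_module_module:
  assumes "cring K" shows "module K (self_module K)"
proof -
  interpret cring K by fact
  have "abelian_group (self_module K)"
  proof (rule abelian_groupI)
    fix x assume "x \<in> carrier (self_module K)"
    then show "\<exists>y\<in>carrier (self_module K). y \<oplus>\<^bsub>self_module K\<^esub> x = \<zero>\<^bsub>self_module K\<^esub>"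
      by (intro bexI[of _ "\<ominus>\<^bsub>K\<^esub> x"]) (auto simp: l_neg)
  qed (auto simp: add.m_ac)
  then show ?thesis
    by (rule moduleI[OF assms]) (auto simp: r_distr l_distr m_assoc)
qed

lemma hom_module_simps [simp]:
  "carrier (hom_module K M N) = lin_maps K M N"
  "zero (hom_module K M N) = (\<lambda>x \<in> carrier M. \<zero>\<^bsub>N\<^esub>)"
  "add (hom_module K M N) = (\<lambda>f g. \<lambda>x \<in> carrier M. f x \<oplus>\<^bsub>N\<^esub> g x)"
  "smult (hom_module K M N) = (\<lambda>a f. \<lambda>x \<in> carrier M. a \<odot>\<^bsub>N\<^esub> f x)"
  by (simp_all add: hom_module_def)

lemma lin_maps_plus:
  assumes "module K M" "module K N" "f \<in> lin_maps K M N" "g \<in> lin_maps K M N"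
  shows "(\<lambda>x \<in> carrier M. f x \<oplus>\<^bsub>N\<^esub> g x) \<in> lin_maps K M N"
proof -
  interpret N: module K N by fact
  show ?thesis by (rule lin_maps_restrictI)
    (use assms in \<open>auto simp: lin_maps_closed lin_maps_add lin_maps_smult N.add.m_ac N.smult_r_distr\<close>)
qed

lemma lin_maps_scale:
  assumes "module K M" "module K N" "f \<in> lin_maps K M N" "a \<in> carrier K"
  shows "(\<lambda>x \<in> carrier M. a \<odot>\<^bsub>N\<^esub> f x) \<in> lin_maps K M N"
proof -
  interpret N: module K N by fact
  show ?thesis by (rule lin_maps_restrictI)
    (use assms in \<open>auto simp: lin_maps_closed lin_maps_add lin_maps_smult N.smult_r_distr N.m_comm
      simp flip: N.smult_assoc1\<close>)
qed

lemma hom_module_module: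
  assumes "module K M" "module K N"
  shows "module K (hom_module K M N)"
proof -
  interpret M: module K M by fact
  interpret N: module K N by fact
  note cl = lin_maps_closed[of _ K M N]
  have inv: "(\<lambda>x \<in> carrier M. \<ominus>\<^bsub>N\<^esub> f x) \<in> lin_maps K M N" if "f \<in> lin_maps K M N" for f
    by (rule lin_maps_restrictI) (use assms that in \<open>auto simp: lin_maps_closed lin_maps_add lin_maps_smult
      N.minus_add N.add.m_comm N.smult_r_minus\<close>)
  have ab: "abelian_group (hom_module K M N)"
  proof (rule abelian_groupI)
    fix f assume f: "f \<in> carrier (hom_module K M N)"
    show "\<exists>g\<in>carrier (hom_module K M N). g \<oplus>\<^bsub>hom_module K M N\<^esub> f = \<zero>\<^bsub>hom_module K M N\<^esub>"
      using inv[of f] f by (intro bexI[of _ "\<lambda>x \<in> carrier M. \<ominus>\<^bsub>N\<^esub> f x"])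
        (auto simp: fun_eq_iff cl N.l_neg)
    show "\<zero>\<^bsub>hom_module K M N\<^esub> \<oplus>\<^bsub>hom_module K M N\<^esub> f = f"
      using f by (auto simp: fun_eq_iff cl[of f] restrict_def lin_maps_arb[of f K M N])
  qed (auto simp: lin_maps_plus[OF assms] lin_maps_const_zero[OF assms] fun_eq_iff cl N.add.m_ac)
  show ?thesis
  proof (rule moduleI[OF M.is_cring ab])
    fix f assume f: "f \<in> carrier (hom_module K M N)"
    show "\<one>\<^bsub>K\<^esub> \<odot>\<^bsub>hom_module K M N\<^esub> f = f"
      using f by (auto simp: fun_eq_iff cl[of f] restrict_def lin_maps_arb[of f K M N])
  qed (auto simp: lin_maps_scale[OF assms] fun_eq_iff cl N.smult_l_distr N.smult_r_distr N.smult_assoc1)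
qed

text \<open>Evaluation at \<open>x\<close> is itself linear on the space of maps, hence commutes
  with finite sums.\<close>

lemma hom_module_finsum:
  assumes "module K M" "module K N" "g \<in> A \<rightarrow> lin_maps K M N" "x \<in> carrier M"
  shows "(\<Oplus>\<^bsub>hom_module K M N\<^esub>i\<in>A. g i) x = (\<Oplus>\<^bsub>N\<^esub>i\<in>A. g i x)"
proof -
  interpret N: module K N by fact
  let ?H = "hom_module K M N"
  have H: "module K ?H" by (rule hom_module_module[OF assms(1,2)])
  have "(\<lambda>f \<in> carrier ?H. f x) \<in> lin_maps K ?H N"
    by (rule lin_maps_restrictI[OF H]) (use assms(4) in \<open>auto simp: lin_maps_closed\<close>)
  from lin_maps_finsum[OF H assms(2) this, of g A]
  have "(\<Oplus>\<^bsub>?H\<^esub>i\<in>A. g i) x = (\<Oplus>\<^bsub>N\<^esub>i\<in>A. (\<lambda>f \<in> carrier ?H. f x) (g i))"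
    using assms(3) submodule_finsum[OF H module.carrier_is_submodule[OF H], of A g] by (auto simp: Pi_iff)
  also have "\<dots> = (\<Oplus>\<^bsub>N\<^esub>i\<in>A. g i x)"
    by (rule N.finsum_cong') (use assms(3,4) in \<open>auto simp: Pi_iff lin_maps_closed[of _ K M N]\<close>)
  finally show ?thesis .
qed

section \<open>Quotients and presentations\<close>

abbreviation "comb M a u b v \<equiv> a \<odot>\<^bsub>M\<^esub> u \<oplus>\<^bsub>M\<^esub> b \<odot>\<^bsub>M\<^esub> v"
abbreviation "tuples A n \<equiv> {ws. set ws \<subseteq> A \<and> length ws = n}"
abbreviation "kron K x y \<equiv> if x = y then \<one>\<^bsub>K\<^esub> else \<zero>\<^bsub>K\<^esub>"
abbreviation "submsets m \<equiv> {a. a \<subseteq># m}"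

text \<open>The relations of tensor products and tensor powers are stated through combinations of
  two vectors. The choice \<open>a = b = 1\<close> returns additivity, and \<open>b = 0\<close>
  returns homogeneity.\<close>

lemma lin_maps_combI:
  assumes "module K M" "module K N" "\<And>x. x \<in> carrier M \<Longrightarrow> g x \<in> carrier N"
    and comb: "\<And>a b u v. a \<in> carrier K \<Longrightarrow> b \<in> carrier K \<Longrightarrow> u \<in> carrier M \<Longrightarrow> v \<in> carrier M \<Longrightarrow>
      g (comb M a u b v) = a \<odot>\<^bsub>N\<^esub> g u \<oplus>\<^bsub>N\<^esub> b \<odot>\<^bsub>N\<^esub> g v"
  shows "(\<lambda>x \<in> carrier M. g x) \<in> lin_maps K M N"
proof -
  interpret M: module K M by fact
  interpret N: module K N by fact
  show ?thesis
  proof (rule lin_maps_restrictI[OF assms(1,3)])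
    fix x y assume "x \<in> carrier M" "y \<in> carrier M"
    then show "g (x \<oplus>\<^bsub>M\<^esub> y) = g x \<oplus>\<^bsub>N\<^esub> g y"
      using comb[of "\<one>\<^bsub>K\<^esub>" "\<one>\<^bsub>K\<^esub>" x y] assms(3) by simp
  next
    fix a x assume "a \<in> carrier K" "x \<in> carrier M"
    then show "g (a \<odot>\<^bsub>M\<^esub> x) = a \<odot>\<^bsub>N\<^esub> g x"
      using comb[of a "\<zero>\<^bsub>K\<^esub>" x x] assms(3) by simp
  qed
qed

text \<open>The module axioms pass along a surjection that respects the operations: equations are
  images of equations, and negatives are images of negatives. It serves for quotients and for
  records that share their operations.\<close>

lemma module_surj_image:
  assumes "module K M"
    and carr: "carrier Q = p ` carrier M"
    and add: "\<And>x y. x \<in> carrier M \<Longrightarrow> y \<in> carrier M \<Longrightarrow> p x \<oplus>\<^bsub>Q\<^esub> p y = p (x \<oplus>\<^bsub>M\<^esub> y)"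
    and zero: "\<zero>\<^bsub>Q\<^esub> = p \<zero>\<^bsub>M\<^esub>"
    and smult: "\<And>a x. a \<in> carrier K \<Longrightarrow> x \<in> carrier M \<Longrightarrow> a \<odot>\<^bsub>Q\<^esub> p x = p (a \<odot>\<^bsub>M\<^esub> x)"
  shows "module K Q"
proof -
  interpret M: module K M by fact
  have "abelian_group Q"
  proof (rule abelian_groupI)
    fix y assume "y \<in> carrier Q"
    then obtain x where x: "x \<in> carrier M" "y = p x" using carr by auto
    show "\<exists>z\<in>carrier Q. z \<oplus>\<^bsub>Q\<^esub> y = \<zero>\<^bsub>Q\<^esub>"
      by (rule bexI[of _ "p (\<ominus>\<^bsub>M\<^esub> x)"]) (use x carr in \<open>auto simp: add zero M.l_neg\<close>)
  qed (auto simp: carr add zero M.add.m_ac)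
  then show ?thesis
    by (rule moduleI[OF M.is_cring])
      (auto simp: carr add zero smult M.smult_l_distr M.smult_r_distr M.smult_assoc1)
qed

lemma submodule_coset_eq:
  assumes "module K M" "submodule N K M" "x \<in> carrier M" "y \<in> carrier M"
  shows "N +>\<^bsub>M\<^esub> x = N +>\<^bsub>M\<^esub> y \<longleftrightarrow> x \<ominus>\<^bsub>M\<^esub> y \<in> N"
proof -
  interpret M: module K M by fact
  have sub: "h \<in> carrier M" if "h \<in> N" for h using that submodule_subset[OF assms(2)] by auto
  show ?thesis
  proof
    assume "N +>\<^bsub>M\<^esub> x = N +>\<^bsub>M\<^esub> y"
    moreover have "x \<in> N +>\<^bsub>M\<^esub> x"
      using assms submodule_zero[OF assms(2)] by (auto simp: a_r_coset_def' intro!: bexI[of _ "\<zero>\<^bsub>M\<^esub>"])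
    ultimately obtain h where h: "h \<in> N" "x = h \<oplus>\<^bsub>M\<^esub> y" by (auto simp: a_r_coset_def')
    then show "x \<ominus>\<^bsub>M\<^esub> y \<in> N" using assms(4) sub by (simp add: a_minus_def M.a_assoc M.r_neg)
  next
    assume d: "x \<ominus>\<^bsub>M\<^esub> y \<in> N"
    have x: "x = (x \<ominus>\<^bsub>M\<^esub> y) \<oplus>\<^bsub>M\<^esub> y" and y: "y = \<ominus>\<^bsub>M\<^esub> (x \<ominus>\<^bsub>M\<^esub> y) \<oplus>\<^bsub>M\<^esub> x"
      using assms(3,4) M.a_comm[of "\<ominus>\<^bsub>M\<^esub> x" y]
      by (simp_all add: a_minus_def M.a_assoc M.l_neg M.minus_add)
    have *: "h \<oplus>\<^bsub>M\<^esub> x = (h \<oplus>\<^bsub>M\<^esub> (x \<ominus>\<^bsub>M\<^esub> y)) \<oplus>\<^bsub>M\<^esub> y" "h \<oplus>\<^bsub>M\<^esub> y = (h \<oplus>\<^bsub>M\<^esub> \<ominus>\<^bsub>M\<^esub> (x \<ominus>\<^bsub>M\<^esub> y)) \<oplus>\<^bsub>M\<^esub> x" if "h \<in> N" for h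
      using arg_cong[OF x, of "\<lambda>z. h \<oplus>\<^bsub>M\<^esub> z"] arg_cong[OF y, of "\<lambda>z. h \<oplus>\<^bsub>M\<^esub> z"] sub that assms(3,4)
      by (simp_all add: M.a_assoc)
    have "h \<oplus>\<^bsub>M\<^esub> x \<in> N +>\<^bsub>M\<^esub> y" "h \<oplus>\<^bsub>M\<^esub> y \<in> N +>\<^bsub>M\<^esub> x" if "h \<in> N" for h
      unfolding a_r_coset_def' *[OF that]
      using submodule_add[OF assms(2) that d] submodule_add[OF assms(2) that submodule_minus[OF assms(2) d]]
      by blast+
    then show "N +>\<^bsub>M\<^esub> x = N +>\<^bsub>M\<^esub> y" by (force simp: a_r_coset_def')
  qed
qed

lemma quot_module_simps:
  assumes "module K M" "submodule N K M"
  shows "carrier (quot_module M N) = (\<lambda>x. N +>\<^bsub>M\<^esub> x) ` carrier M"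
    and "\<zero>\<^bsub>quot_module M N\<^esub> = N +>\<^bsub>M\<^esub> \<zero>\<^bsub>M\<^esub>"
    and "x \<in> carrier M \<Longrightarrow> y \<in> carrier M \<Longrightarrow>
      (N +>\<^bsub>M\<^esub> x) \<oplus>\<^bsub>quot_module M N\<^esub> (N +>\<^bsub>M\<^esub> y) = N +>\<^bsub>M\<^esub> (x \<oplus>\<^bsub>M\<^esub> y)"
    and "a \<in> carrier K \<Longrightarrow> x \<in> carrier M \<Longrightarrow>
      a \<odot>\<^bsub>quot_module M N\<^esub> (N +>\<^bsub>M\<^esub> x) = N +>\<^bsub>M\<^esub> (a \<odot>\<^bsub>M\<^esub> x)"
proof -
  interpret M: module K M by fact
  have sub: "h \<in> carrier M" if "h \<in> N" for h using that submodule_subset[OF assms(2)] by auto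
  have z: "\<zero>\<^bsub>M\<^esub> \<in> N" by (rule submodule_zero[OF assms(2)])
  show "carrier (quot_module M N) = (\<lambda>x. N +>\<^bsub>M\<^esub> x) ` carrier M"
    by (auto simp: quot_module_def A_RCOSETS_def')
  show "\<zero>\<^bsub>quot_module M N\<^esub> = N +>\<^bsub>M\<^esub> \<zero>\<^bsub>M\<^esub>"
    using sub by (auto simp: quot_module_def a_r_coset_def' intro!: bexI)
  show "(N +>\<^bsub>M\<^esub> x) \<oplus>\<^bsub>quot_module M N\<^esub> (N +>\<^bsub>M\<^esub> y) = N +>\<^bsub>M\<^esub> (x \<oplus>\<^bsub>M\<^esub> y)"
    if xy: "x \<in> carrier M" "y \<in> carrier M"
  proof -
    have 1: "(h \<oplus>\<^bsub>M\<^esub> x) \<oplus>\<^bsub>M\<^esub> (h' \<oplus>\<^bsub>M\<^esub> y) = (h \<oplus>\<^bsub>M\<^esub> h') \<oplus>\<^bsub>M\<^esub> (x \<oplus>\<^bsub>M\<^esub> y)" if "h \<in> N" "h' \<in> N" for h h'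
      using that sub xy by (simp add: M.add.m_ac)
    have 2: "h \<oplus>\<^bsub>M\<^esub> (x \<oplus>\<^bsub>M\<^esub> y) = (h \<oplus>\<^bsub>M\<^esub> x) \<oplus>\<^bsub>M\<^esub> (\<zero>\<^bsub>M\<^esub> \<oplus>\<^bsub>M\<^esub> y)" if "h \<in> N" for h
      using that sub xy by (simp add: M.add.m_ac)
    show ?thesis
    proof
      show "(N +>\<^bsub>M\<^esub> x) \<oplus>\<^bsub>quot_module M N\<^esub> (N +>\<^bsub>M\<^esub> y) \<subseteq> N +>\<^bsub>M\<^esub> (x \<oplus>\<^bsub>M\<^esub> y)"
        using 1 submodule_add[OF assms(2)] by (fastforce simp: quot_module_def a_r_coset_def' set_add_def set_mult_def)
      show "N +>\<^bsub>M\<^esub> (x \<oplus>\<^bsub>M\<^esub> y) \<subseteq> (N +>\<^bsub>M\<^esub> x) \<oplus>\<^bsub>quot_module M N\<^esub> (N +>\<^bsub>M\<^esub> y)"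
      proof
        fix z assume "z \<in> N +>\<^bsub>M\<^esub> (x \<oplus>\<^bsub>M\<^esub> y)"
        then obtain h where "h \<in> N" "z = (h \<oplus>\<^bsub>M\<^esub> x) \<oplus>\<^bsub>M\<^esub> (\<zero>\<^bsub>M\<^esub> \<oplus>\<^bsub>M\<^esub> y)"
          using 2 by (auto simp: a_r_coset_def')
        then show "z \<in> (N +>\<^bsub>M\<^esub> x) \<oplus>\<^bsub>quot_module M N\<^esub> (N +>\<^bsub>M\<^esub> y)"
          using z by (auto simp: quot_module_def a_r_coset_def' set_add_def set_mult_def)
      qed
    qed
  qed
  show "a \<odot>\<^bsub>quot_module M N\<^esub> (N +>\<^bsub>M\<^esub> x) = N +>\<^bsub>M\<^esub> (a \<odot>\<^bsub>M\<^esub> x)"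
    if ax: "a \<in> carrier K" "x \<in> carrier M"
  proof -
    have *: "N +>\<^bsub>M\<^esub> (a \<odot>\<^bsub>M\<^esub> y) = N +>\<^bsub>M\<^esub> (a \<odot>\<^bsub>M\<^esub> x)" if y: "y \<in> N +>\<^bsub>M\<^esub> x" for y
    proof -
      obtain h where h: "h \<in> N" "y = h \<oplus>\<^bsub>M\<^esub> x" using y by (auto simp: a_r_coset_def')
      have "a \<odot>\<^bsub>M\<^esub> y \<ominus>\<^bsub>M\<^esub> a \<odot>\<^bsub>M\<^esub> x = a \<odot>\<^bsub>M\<^esub> h"
        using h sub ax by (simp add: a_minus_def M.smult_r_distr M.a_assoc M.r_neg)
      then show ?thesis
        using h sub ax submodule_smult[OF assms(2)] by (simp add: submodule_coset_eq[OF assms])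
    qed
    have "x \<in> N +>\<^bsub>M\<^esub> x" using z ax by (auto simp: a_r_coset_def' intro!: bexI[of _ "\<zero>\<^bsub>M\<^esub>"])
    then have "(\<Union>y \<in> N +>\<^bsub>M\<^esub> x. N +>\<^bsub>M\<^esub> (a \<odot>\<^bsub>M\<^esub> y)) = N +>\<^bsub>M\<^esub> (a \<odot>\<^bsub>M\<^esub> x)"
      by (rule UN_constant_eq) (use * in blast)
    then show ?thesis by (simp add: quot_module_def)
  qed
qed

lemma quot_module_module:
  assumes "module K M" "submodule N K M"
  shows "module K (quot_module M N)"
  by (rule module_surj_image[OF assms(1), where p = "\<lambda>x. N +>\<^bsub>M\<^esub> x"])
    (simp_all add: quot_module_simps[OF assms])

lemma quot_proj_lin:
  assumes "module K M" "submodule N K M"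
  shows "(\<lambda>x \<in> carrier M. N +>\<^bsub>M\<^esub> x) \<in> lin_maps K M (quot_module M N)"
  by (rule lin_maps_restrictI[OF assms(1)]) (simp_all add: quot_module_simps[OF assms])

lemma quot_module_lift:
  assumes "module K M" "submodule N K M" "module K Q" "f \<in> lin_maps K M Q"
    and "\<And>x. x \<in> N \<Longrightarrow> f x = \<zero>\<^bsub>Q\<^esub>"
  shows "\<exists>h \<in> lin_maps K (quot_module M N) Q. \<forall>x \<in> carrier M. h (N +>\<^bsub>M\<^esub> x) = f x"
proof -
  interpret M: module K M by fact
  interpret Q: module K Q by fact
  note simps = quot_module_simps[OF assms(1,2)]
  \<comment> \<open>The value is read at an arbitrary representative; two representatives differ by
    an element of \<open>N\<close>, which \<open>f\<close> kills.\<close>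
  define h where "h X = f (SOME x. x \<in> carrier M \<and> X = N +>\<^bsub>M\<^esub> x)" for X
  have h: "h (N +>\<^bsub>M\<^esub> x) = f x" if "x \<in> carrier M" for x
  proof -
    define y where "y = (SOME y. y \<in> carrier M \<and> N +>\<^bsub>M\<^esub> x = N +>\<^bsub>M\<^esub> y)"
    have y: "y \<in> carrier M" "N +>\<^bsub>M\<^esub> x = N +>\<^bsub>M\<^esub> y"
      using someI[of "\<lambda>y. y \<in> carrier M \<and> N +>\<^bsub>M\<^esub> x = N +>\<^bsub>M\<^esub> y" x] that by (auto simp: y_def)
    then have "f (x \<ominus>\<^bsub>M\<^esub> y) = \<zero>\<^bsub>Q\<^esub>" using assms(5) submodule_coset_eq[OF assms(1,2) that] by auto
    then have "f x \<ominus>\<^bsub>Q\<^esub> f y = \<zero>\<^bsub>Q\<^esub>" using that y lin_maps_a_minus[OF assms(1,3,4)] by simp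
    then have "f x = f y"
      using that y lin_maps_closed[OF assms(4)] by (metis Q.minus_equality Q.minus_minus Q.a_inv_closed a_minus_def)
    then show ?thesis unfolding h_def y_def by simp
  qed
  have "(\<lambda>X \<in> carrier (quot_module M N). h X) \<in> lin_maps K (quot_module M N) Q"
    by (rule lin_maps_restrictI[OF quot_module_module[OF assms(1,2)]])
      (auto simp: simps h lin_maps_closed[OF assms(4)] lin_maps_add[OF assms(4)] lin_maps_smult[OF assms(4)])
  then show ?thesis by (rule bexI[rotated]) (auto simp: simps h)
qed

text \<open>This works as induction over a span: a property of the form \<open>f x \<in> S\<close>
  holds on the span as soon as it holds on the generators.\<close>

lemma preimage_submodule:
  assumes "module K M" "module K N" "f \<in> lin_maps K M N" and S: "submodule S K N"
  shows "submodule {x \<in> carrier M. f x \<in> S} K M"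
proof -
  interpret M: module K M by fact
  show ?thesis
  proof (rule M.submoduleI)
    show "\<zero>\<^bsub>M\<^esub> \<in> {x \<in> carrier M. f x \<in> S}"
      using submodule_zero[OF S] by (simp add: lin_maps_zero[OF assms(1-3)])
    fix x y assume x: "x \<in> {x \<in> carrier M. f x \<in> S}"
    show "\<ominus>\<^bsub>M\<^esub> x \<in> {x \<in> carrier M. f x \<in> S}"
      using submodule_minus[OF S] x by (simp add: lin_maps_minus[OF assms(1-3)])
    show "x \<oplus>\<^bsub>M\<^esub> y \<in> {x \<in> carrier M. f x \<in> S}"
      if "y \<in> {x \<in> carrier M. f x \<in> S}"
      using submodule_add[OF S] x that by (simp add: lin_maps_add[OF assms(3)])
    show "a \<odot>\<^bsub>M\<^esub> x \<in> {x \<in> carrier M. f x \<in> S}" if "a \<in> carrier K" for a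
      using submodule_smult[OF S] x that by (simp add: lin_maps_smult[OF assms(3)])
  qed auto
qed

lemma lin_span_surj_image:
  assumes "module K M" "module K N" "f \<in> lin_maps K M N" "f ` carrier M = carrier N"
    and "lin_span K M A = carrier M"
  shows "lin_span K N (f ` A) = carrier N"
proof
  interpret M: module K M by fact
  have A: "A \<subseteq> carrier M" using assms(5) lin_span_superset by metis
  have fA: "f ` A \<subseteq> carrier N" using A assms(3) by (auto simp: lin_maps_closed)
  show "lin_span K N (f ` A) \<subseteq> carrier N"
    by (rule submodule_subset[OF lin_span_submodule[OF assms(2) fA]])
  have S: "submodule (lin_span K N (f ` A)) K N" by (rule lin_span_submodule[OF assms(2) fA])
  have "submodule {x \<in> carrier M. f x \<in> lin_span K N (f ` A)} K M"
    by (rule preimage_submodule[OF assms(1-3) S])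
  then have "lin_span K M A \<subseteq> {x \<in> carrier M. f x \<in> lin_span K N (f ` A)}"
    by (rule lin_span_least) (use A lin_span_superset[of "f ` A" K N] in auto)
  then show "carrier N \<subseteq> lin_span K N (f ` A)" unfolding assms(5) assms(4)[symmetric] by auto
qed

section \<open>Free modules, generators and relations\<close>

lemma free_module_simps:
  "\<zero>\<^bsub>free_module K X\<^esub> = (\<lambda>x. \<zero>\<^bsub>K\<^esub>)"
  "add (free_module K X) = (\<lambda>f g x. f x \<oplus>\<^bsub>K\<^esub> g x)"
  "smult (free_module K X) = (\<lambda>a f x. a \<otimes>\<^bsub>K\<^esub> f x)"
  by (simp_all add: free_module_def)

lemma free_module_carrier:
  "f \<in> carrier (free_module K X) \<longleftrightarrow>
    (\<forall>x. f x \<in> carrier K) \<and> finite {x. f x \<noteq> \<zero>\<^bsub>K\<^esub>} \<and> (\<forall>x. x \<notin> X \<longrightarrow> f x = \<zero>\<^bsub>K\<^esub>)"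
  by (auto simp: free_module_def)

lemma free_module_module:
  assumes "cring K" shows "module K (free_module K X)"
proof -
  interpret cring K by fact
  note free_module_simps [simp]
  let ?F = "free_module K X"
  have ab: "abelian_group ?F"
  proof (rule abelian_groupI)
    fix f g assume f: "f \<in> carrier ?F" and g: "g \<in> carrier ?F"
    have "{x. f x \<oplus>\<^bsub>K\<^esub> g x \<noteq> \<zero>\<^bsub>K\<^esub>} \<subseteq> {x. f x \<noteq> \<zero>\<^bsub>K\<^esub>} \<union> {x. g x \<noteq> \<zero>\<^bsub>K\<^esub>}" by auto
    then show "f \<oplus>\<^bsub>?F\<^esub> g \<in> carrier ?F"
      using f g by (auto simp: free_module_carrier intro: finite_subset)
  next
    fix f assume f: "f \<in> carrier ?F"
    have "{x. \<ominus>\<^bsub>K\<^esub> f x \<noteq> \<zero>\<^bsub>K\<^esub>} \<subseteq> {x. f x \<noteq> \<zero>\<^bsub>K\<^esub>}" by auto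
    then show "\<exists>g\<in>carrier ?F. g \<oplus>\<^bsub>?F\<^esub> f = \<zero>\<^bsub>?F\<^esub>"
      using f by (intro bexI[of _ "\<lambda>x. \<ominus>\<^bsub>K\<^esub> f x"])
        (auto simp: free_module_carrier l_neg intro: finite_subset)
  qed (auto simp: free_module_carrier fun_eq_iff add.m_ac)
  show ?thesis
  proof (rule moduleI[OF assms ab])
    fix a f assume f: "f \<in> carrier ?F" and a: "a \<in> carrier K"
    have "{x. a \<otimes>\<^bsub>K\<^esub> f x \<noteq> \<zero>\<^bsub>K\<^esub>} \<subseteq> {x. f x \<noteq> \<zero>\<^bsub>K\<^esub>}" using a by auto
    then show "a \<odot>\<^bsub>?F\<^esub> f \<in> carrier ?F"
      using f a by (auto simp: free_module_carrier intro: finite_subset)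
  qed (auto simp: free_module_carrier fun_eq_iff l_distr r_distr m_assoc)
qed

lemma basis_vec_closed:
  assumes "cring K" "x \<in> X" shows "basis_vec K x \<in> carrier (free_module K X)"
proof -
  interpret cring K by fact
  have "{y. basis_vec K x y \<noteq> \<zero>\<^bsub>K\<^esub>} \<subseteq> {x}" by (auto simp: basis_vec_def)
  then show ?thesis using assms(2)
    by (auto simp: free_module_carrier basis_vec_def intro: finite_subset)
qed

lemma free_module_span:
  assumes "cring K"
  shows "lin_span K (free_module K X) (basis_vec K ` X) = carrier (free_module K X)"
proof
  interpret cring K by fact
  note free_module_simps [simp]
  let ?F = "free_module K X" let ?N = "lin_span K (free_module K X) (basis_vec K ` X)"
  have F: "module K ?F" by (rule free_module_module[OF assms])
  have N: "submodule ?N K ?F"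
    by (rule lin_span_submodule[OF F]) (use basis_vec_closed[OF assms] in auto)
  show "?N \<subseteq> carrier ?F" by (rule submodule_subset[OF N])
  \<comment> \<open>The induction runs over a finite set that contains the support. One coordinate
    is split off at a time; at an index outside \<open>X\<close> the coefficient is zero
    already.\<close>
  have *: "finite S \<Longrightarrow> f \<in> carrier ?F \<Longrightarrow> {x. f x \<noteq> \<zero>\<^bsub>K\<^esub>} \<subseteq> S \<Longrightarrow> f \<in> ?N" for f S
  proof (induction S arbitrary: f rule: finite_induct)
    case empty
    then have "f = \<zero>\<^bsub>?F\<^esub>" by (auto simp: fun_eq_iff)
    then show ?case using submodule_zero[OF N] by simp
  next
    case (insert x S)
    show ?case
    proof (cases "x \<in> X")
      case True
      let ?g = "f(x := \<zero>\<^bsub>K\<^esub>)"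
      have g: "?g \<in> ?N"
      proof (rule insert.IH)
        have "{y. ?g y \<noteq> \<zero>\<^bsub>K\<^esub>} \<subseteq> {y. f y \<noteq> \<zero>\<^bsub>K\<^esub>}" by auto
        then show "?g \<in> carrier ?F"
          using insert.prems(1) by (auto simp: free_module_carrier intro: finite_subset)
      qed (use insert.prems(2) in auto)
      have "f = ?g \<oplus>\<^bsub>?F\<^esub> (f x \<odot>\<^bsub>?F\<^esub> basis_vec K x)"
        using insert.prems(1) by (auto simp: fun_eq_iff basis_vec_def free_module_carrier)
      moreover have "f x \<odot>\<^bsub>?F\<^esub> basis_vec K x \<in> ?N"
        by (rule submodule_smult[OF N]) (use insert.prems(1) True lin_span_superset[of "basis_vec K ` X" K ?F] in \<open>auto simp: free_module_carrier\<close>)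
      ultimately show ?thesis using submodule_add[OF N g] by metis
    next
      case False
      then show ?thesis using insert by (intro insert.IH) (auto simp: free_module_carrier)
    qed
  qed
  show "carrier ?F \<subseteq> ?N" using * by (auto simp: free_module_carrier)
qed

lemma free_module_lift:
  assumes "module K Q" "g \<in> X \<rightarrow> carrier Q"
  shows "\<exists>h \<in> lin_maps K (free_module K X) Q. \<forall>x \<in> X. h (basis_vec K x) = g x"
proof -
  interpret Q: module K Q by fact
  note free_module_simps [simp]
  let ?F = "free_module K X"
  have F: "module K ?F" by (rule free_module_module[OF Q.is_cring])
  define h where "h f = (\<Oplus>\<^bsub>Q\<^esub>x\<in>{x. f x \<noteq> \<zero>\<^bsub>K\<^esub>}. f x \<odot>\<^bsub>Q\<^esub> g x)" for f
  have cl: "f x \<odot>\<^bsub>Q\<^esub> g x \<in> carrier Q" if "f \<in> carrier ?F" "x \<in> X" for f x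
    using that assms(2) by (auto simp: free_module_carrier)
  \<comment> \<open>The sum over the support may be taken over any larger finite subset of
    \<open>X\<close>. This puts \<open>f\<close>, \<open>f'\<close> and their sum, whose supports
    differ, over one index set.\<close>
  have S: "h f = (\<Oplus>\<^bsub>Q\<^esub>x\<in>S. f x \<odot>\<^bsub>Q\<^esub> g x)"
    if "f \<in> carrier ?F" "finite S" "S \<subseteq> X" "{x. f x \<noteq> \<zero>\<^bsub>K\<^esub>} \<subseteq> S" for f S
    unfolding h_def using that cl[OF that(1)] assms(2)
    by (intro Q.add.finprod_mono_neutral_cong_left) (auto simp: subset_iff Pi_iff)
  have "(\<lambda>f \<in> carrier ?F. h f) \<in> lin_maps K ?F Q"
  proof (rule lin_maps_restrictI[OF F])
    fix f assume f: "f \<in> carrier ?F"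
    show "h f \<in> carrier Q" unfolding h_def
      by (rule Q.finsum_closed) (use cl[OF f] f in \<open>auto simp: free_module_carrier\<close>)
  next
    fix f f' assume f: "f \<in> carrier ?F" "f' \<in> carrier ?F"
    let ?S = "{x. f x \<noteq> \<zero>\<^bsub>K\<^esub>} \<union> {x. f' x \<noteq> \<zero>\<^bsub>K\<^esub>}"
    have fin: "finite ?S" "?S \<subseteq> X" using f by (auto simp: free_module_carrier)
    have sum: "f \<oplus>\<^bsub>?F\<^esub> f' \<in> carrier ?F" using f module.carrier_is_submodule[OF F] submodule_add by metis
    have "h (f \<oplus>\<^bsub>?F\<^esub> f') = (\<Oplus>\<^bsub>Q\<^esub>x\<in>?S. (f \<oplus>\<^bsub>?F\<^esub> f') x \<odot>\<^bsub>Q\<^esub> g x)"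
      by (rule S[OF sum fin]) (use f in \<open>auto simp: free_module_carrier\<close>)
    also have "\<dots> = (\<Oplus>\<^bsub>Q\<^esub>x\<in>?S. f x \<odot>\<^bsub>Q\<^esub> g x \<oplus>\<^bsub>Q\<^esub> f' x \<odot>\<^bsub>Q\<^esub> g x)"
      by (rule Q.finsum_cong') (use f assms(2) fin in \<open>auto simp: free_module_carrier Q.smult_l_distr Pi_iff subset_iff\<close>)
    also have "\<dots> = h f \<oplus>\<^bsub>Q\<^esub> h f'"
      using S[OF f(1) fin] S[OF f(2) fin] cl[OF f(1)] cl[OF f(2)] fin by (subst Q.finsum_addf) auto
    finally show "h (f \<oplus>\<^bsub>?F\<^esub> f') = h f \<oplus>\<^bsub>Q\<^esub> h f'" .
  next
    fix a f assume f: "f \<in> carrier ?F" and a: "a \<in> carrier K"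
    let ?S = "{x. f x \<noteq> \<zero>\<^bsub>K\<^esub>}"
    have fin: "finite ?S" "?S \<subseteq> X" using f by (auto simp: free_module_carrier)
    have sm: "a \<odot>\<^bsub>?F\<^esub> f \<in> carrier ?F" using f a module.carrier_is_submodule[OF F] submodule_smult by metis
    have "h (a \<odot>\<^bsub>?F\<^esub> f) = (\<Oplus>\<^bsub>Q\<^esub>x\<in>?S. (a \<odot>\<^bsub>?F\<^esub> f) x \<odot>\<^bsub>Q\<^esub> g x)"
      by (rule S[OF sm fin]) (use f a in \<open>auto simp: free_module_carrier\<close>)
    also have "\<dots> = (\<Oplus>\<^bsub>Q\<^esub>x\<in>?S. a \<odot>\<^bsub>Q\<^esub> (f x \<odot>\<^bsub>Q\<^esub> g x))"
      by (rule Q.finsum_cong') (use f a assms(2) fin in \<open>auto simp: free_module_carrier Q.smult_assoc1 Pi_iff subset_iff\<close>)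
    also have "\<dots> = a \<odot>\<^bsub>Q\<^esub> h f"
      unfolding h_def using cl[OF f] fin a by (subst Q.finsum_smult_ldistr) auto
    finally show "h (a \<odot>\<^bsub>?F\<^esub> f) = a \<odot>\<^bsub>Q\<^esub> h f" .
  qed
  moreover have "h (basis_vec K x) = g x" if "x \<in> X" for x
  proof -
    have "h (basis_vec K x) = (\<Oplus>\<^bsub>Q\<^esub>y\<in>{x}. basis_vec K x y \<odot>\<^bsub>Q\<^esub> g y)"
      by (rule S) (use that basis_vec_closed[OF Q.is_cring] in \<open>auto simp: basis_vec_def\<close>)
    then show ?thesis using that assms(2) by (simp add: basis_vec_def Pi_iff)
  qed
  moreover have "basis_vec K x \<in> carrier ?F" if "x \<in> X" for x
    by (rule basis_vec_closed[OF Q.is_cring that])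
  ultimately show ?thesis by (intro bexI) auto
qed

text \<open>The common universal property behind \<open>tensor\<close> and
  \<open>tensor_power\<close>, both quotients of a free module by a span of relations. The premise
  \<open>rel\<close> speaks of any linear \<open>h\<close> with the prescribed values on basis
  vectors, so each instance reduces to a computation with \<open>g\<close>.\<close>

lemma presented_module_lift:
  fixes K (structure) and g :: "'x \<Rightarrow> 'q" and X :: "'x set"
  defines "F \<equiv> free_module K X"
  assumes "module K Q" "R \<subseteq> carrier F" "g \<in> X \<rightarrow> carrier Q"
    and rel: "\<And>h r. h \<in> lin_maps K F Q \<Longrightarrow> \<forall>x \<in> X. h (basis_vec K x) = g x \<Longrightarrow> r \<in> R \<Longrightarrow> h r = \<zero>\<^bsub>Q\<^esub>"
  shows "\<exists>h \<in> lin_maps K (quot_module F (lin_span K F R)) Q.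
    \<forall>x \<in> X. h (lin_span K F R +>\<^bsub>F\<^esub> basis_vec K x) = g x"
proof -
  interpret Q: module K Q by fact
  have F: "module K F" unfolding F_def by (rule free_module_module[OF Q.is_cring])
  have N: "submodule (lin_span K F R) K F" by (rule lin_span_submodule[OF F assms(3)])
  obtain h where h: "h \<in> lin_maps K F Q" "\<forall>x \<in> X. h (basis_vec K x) = g x"
    using free_module_lift[OF assms(2,4)] unfolding F_def by auto
  have "lin_span K F R \<subseteq> {x \<in> carrier F. h x = \<zero>\<^bsub>Q\<^esub>}"
    by (rule lin_span_least[OF kernel_submodule[OF F assms(2) h(1)]]) (use rel h assms(3) in auto)
  then obtain h' where "h' \<in> lin_maps K (quot_module F (lin_span K F R)) Q"
    "\<forall>x \<in> carrier F. h' (lin_span K F R +>\<^bsub>F\<^esub> x) = h x"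
    using quot_module_lift[OF F N assms(2) h(1)] by auto
  moreover have "basis_vec K x \<in> carrier F" if "x \<in> X" for x
    unfolding F_def by (rule basis_vec_closed[OF Q.is_cring that])
  ultimately show ?thesis using h(2) by (intro bexI) auto
qed

lemma presented_module:
  fixes K (structure) and X :: "'x set"
  defines "F \<equiv> free_module K X"
  assumes "cring K" "R \<subseteq> carrier F"
  shows "module K (quot_module F (lin_span K F R))"
    and "lin_span K (quot_module F (lin_span K F R)) ((\<lambda>x. lin_span K F R +>\<^bsub>F\<^esub> basis_vec K x) ` X)
      = carrier (quot_module F (lin_span K F R))"
    and "(\<lambda>x \<in> carrier F. lin_span K F R +>\<^bsub>F\<^esub> x) \<in> lin_maps K F (quot_module F (lin_span K F R))"
proof -
  have F: "module K F" unfolding F_def by (rule free_module_module[OF assms(2)])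
  have N: "submodule (lin_span K F R) K F" by (rule lin_span_submodule[OF F assms(3)])
  show Q: "module K (quot_module F (lin_span K F R))" by (rule quot_module_module[OF F N])
  show lin: "(\<lambda>x \<in> carrier F. lin_span K F R +>\<^bsub>F\<^esub> x) \<in> lin_maps K F (quot_module F (lin_span K F R))"
    by (rule quot_proj_lin[OF F N])
  have *: "(\<lambda>x \<in> carrier F. lin_span K F R +>\<^bsub>F\<^esub> x) ` basis_vec K ` X
    = (\<lambda>x. lin_span K F R +>\<^bsub>F\<^esub> basis_vec K x) ` X"
    unfolding image_image
    by (rule image_cong[OF refl]) (simp add: F_def basis_vec_closed[OF assms(2)])
  have surj: "(\<lambda>x \<in> carrier F. lin_span K F R +>\<^bsub>F\<^esub> x) ` carrier F = carrier (quot_module F (lin_span K F R))"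
    by (auto simp: quot_module_simps[OF F N])
  show "lin_span K (quot_module F (lin_span K F R)) ((\<lambda>x. lin_span K F R +>\<^bsub>F\<^esub> basis_vec K x) ` X)
      = carrier (quot_module F (lin_span K F R))"
    unfolding *[symmetric] by (rule lin_span_surj_image[OF F Q lin surj])
      (simp add: F_def free_module_span[OF assms(2)])
qed

text \<open>All relations in the two constructions have this shape: one basis vector against a
  combination of two others. In the quotient such a relation becomes an equation of cosets;
  \<open>lin_maps_rel_zero\<close> is the matching computation for maps out of the free
  module.\<close>

lemma presented_module_rel:
  fixes K (structure) and X :: "'x set"
  defines "F \<equiv> free_module K X"
  assumes "cring K" "R \<subseteq> carrier F" "s \<in> X" "t \<in> X" "u \<in> X" "a \<in> carrier K" "b \<in> carrier K"
    and "basis_vec K s \<ominus>\<^bsub>F\<^esub> (a \<odot>\<^bsub>F\<^esub> basis_vec K t \<oplus>\<^bsub>F\<^esub> b \<odot>\<^bsub>F\<^esub> basis_vec K u) \<in> R"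
  shows "lin_span K F R +>\<^bsub>F\<^esub> basis_vec K s =
    a \<odot>\<^bsub>quot_module F (lin_span K F R)\<^esub> (lin_span K F R +>\<^bsub>F\<^esub> basis_vec K t)
    \<oplus>\<^bsub>quot_module F (lin_span K F R)\<^esub> b \<odot>\<^bsub>quot_module F (lin_span K F R)\<^esub> (lin_span K F R +>\<^bsub>F\<^esub> basis_vec K u)"
proof -
  have F: "module K F" unfolding F_def by (rule free_module_module[OF assms(2)])
  interpret F: module K F by (rule F)
  have N: "submodule (lin_span K F R) K F" by (rule lin_span_submodule[OF F assms(3)])
  have bv: "basis_vec K x \<in> carrier F" if "x \<in> X" for x
    unfolding F_def by (rule basis_vec_closed[OF assms(2) that])
  have "a \<odot>\<^bsub>F\<^esub> basis_vec K t \<in> carrier F" "b \<odot>\<^bsub>F\<^esub> basis_vec K u \<in> carrier F"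
    using F.smult_closed bv assms by auto
  note cl = this F.a_closed[OF this]
  have "lin_span K F R +>\<^bsub>F\<^esub> basis_vec K s =
    lin_span K F R +>\<^bsub>F\<^esub> (a \<odot>\<^bsub>F\<^esub> basis_vec K t \<oplus>\<^bsub>F\<^esub> b \<odot>\<^bsub>F\<^esub> basis_vec K u)"
    unfolding submodule_coset_eq[OF F N bv[OF \<open>s \<in> X\<close>] cl(3)]
    by (rule subsetD[OF lin_span_superset assms(9)])
  also have "\<dots> = a \<odot>\<^bsub>quot_module F (lin_span K F R)\<^esub> (lin_span K F R +>\<^bsub>F\<^esub> basis_vec K t)
    \<oplus>\<^bsub>quot_module F (lin_span K F R)\<^esub> b \<odot>\<^bsub>quot_module F (lin_span K F R)\<^esub> (lin_span K F R +>\<^bsub>F\<^esub> basis_vec K u)"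
    using quot_module_simps(3)[OF F N cl(1,2)] quot_module_simps(4)[OF F N _ bv] assms by simp
  finally show ?thesis .
qed

lemma lin_maps_rel_zero:
  fixes K (structure) and X :: "'x set"
  defines "F \<equiv> free_module K X"
  assumes "module K Q" "h \<in> lin_maps K F Q" "s \<in> X" "t \<in> X" "u \<in> X" "a \<in> carrier K" "b \<in> carrier K"
    and "h (basis_vec K s) = a \<odot>\<^bsub>Q\<^esub> h (basis_vec K t) \<oplus>\<^bsub>Q\<^esub> b \<odot>\<^bsub>Q\<^esub> h (basis_vec K u)"
  shows "h (basis_vec K s \<ominus>\<^bsub>F\<^esub> (a \<odot>\<^bsub>F\<^esub> basis_vec K t \<oplus>\<^bsub>F\<^esub> b \<odot>\<^bsub>F\<^esub> basis_vec K u)) = \<zero>\<^bsub>Q\<^esub>"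
proof -
  interpret Q: module K Q by fact
  have F: "module K F" unfolding F_def by (rule free_module_module[OF Q.is_cring])
  interpret F: module K F by (rule F)
  have bv: "basis_vec K x \<in> carrier F" if "x \<in> X" for x
    unfolding F_def by (rule basis_vec_closed[OF Q.is_cring that])
  have cl: "a \<odot>\<^bsub>F\<^esub> basis_vec K t \<in> carrier F" "b \<odot>\<^bsub>F\<^esub> basis_vec K u \<in> carrier F"
    using F.smult_closed bv assms by auto
  show ?thesis
    using lin_maps_a_minus[OF F assms(2,3) bv[OF \<open>s \<in> X\<close>] F.a_closed[OF cl]] lin_maps_add[OF assms(3) cl]
      lin_maps_smult[OF assms(3) _ bv] assms lin_maps_closed[OF assms(3) bv]
    by (simp add: a_minus_def Q.r_neg)
qed

lemma presented_rel_closed: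
  assumes "cring K" "s \<in> X" "t \<in> X" "u \<in> X" "a \<in> carrier K" "b \<in> carrier K"
  shows "basis_vec K s \<ominus>\<^bsub>free_module K X\<^esub>
    (a \<odot>\<^bsub>free_module K X\<^esub> basis_vec K t \<oplus>\<^bsub>free_module K X\<^esub> b \<odot>\<^bsub>free_module K X\<^esub> basis_vec K u)
    \<in> carrier (free_module K X)"
proof -
  interpret F: module K "free_module K X" by (rule free_module_module[OF assms(1)])
  show ?thesis by (intro F.minus_closed F.a_closed F.smult_closed basis_vec_closed assms)
qed

section \<open>Tensor products\<close>

text \<open>The partial maps are restricted to the carriers, so \<open>\<beta>\<close> itself need
  not be extensional and each argument is covered by the facts on \<open>lin_maps\<close>.\<close>

definition bilin ::
    "('k, 'r) ring_scheme \<Rightarrow> ('k, 'b, 'm) module_scheme \<Rightarrow> ('k, 'c, 'n) module_scheme \<Rightarrow>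
      ('k, 'd, 'p) module_scheme \<Rightarrow> ('b \<Rightarrow> 'c \<Rightarrow> 'd) \<Rightarrow> bool"
  where "bilin K M N Q \<beta> \<longleftrightarrow>
    (\<forall>x \<in> carrier M. (\<lambda>y \<in> carrier N. \<beta> x y) \<in> lin_maps K N Q) \<and>
    (\<forall>y \<in> carrier N. (\<lambda>x \<in> carrier M. \<beta> x y) \<in> lin_maps K M Q)"

lemma bilinI:
  assumes "module K M" "module K N"
    and "\<And>x y. x \<in> carrier M \<Longrightarrow> y \<in> carrier N \<Longrightarrow> \<beta> x y \<in> carrier Q"
    and "\<And>x y y'. x \<in> carrier M \<Longrightarrow> y \<in> carrier N \<Longrightarrow> y' \<in> carrier N \<Longrightarrow>
      \<beta> x (y \<oplus>\<^bsub>N\<^esub> y') = \<beta> x y \<oplus>\<^bsub>Q\<^esub> \<beta> x y'"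
    and "\<And>a x y. a \<in> carrier K \<Longrightarrow> x \<in> carrier M \<Longrightarrow> y \<in> carrier N \<Longrightarrow>
      \<beta> x (a \<odot>\<^bsub>N\<^esub> y) = a \<odot>\<^bsub>Q\<^esub> \<beta> x y"
    and "\<And>x x' y. x \<in> carrier M \<Longrightarrow> x' \<in> carrier M \<Longrightarrow> y \<in> carrier N \<Longrightarrow>
      \<beta> (x \<oplus>\<^bsub>M\<^esub> x') y = \<beta> x y \<oplus>\<^bsub>Q\<^esub> \<beta> x' y"
    and "\<And>a x y. a \<in> carrier K \<Longrightarrow> x \<in> carrier M \<Longrightarrow> y \<in> carrier N \<Longrightarrow>
      \<beta> (a \<odot>\<^bsub>M\<^esub> x) y = a \<odot>\<^bsub>Q\<^esub> \<beta> x y"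
  shows "bilin K M N Q \<beta>"
  unfolding bilin_def using assms by (auto intro!: lin_maps_restrictI)

lemma bilin_closed: "bilin K M N Q \<beta> \<Longrightarrow> x \<in> carrier M \<Longrightarrow> y \<in> carrier N \<Longrightarrow> \<beta> x y \<in> carrier Q"
  unfolding bilin_def using lin_maps_closed[of "\<lambda>y \<in> carrier N. \<beta> x y" K N Q y] by auto

lemma bilin_comb_left:
  assumes "bilin K M N Q \<beta>" "module K M" "a \<in> carrier K" "b \<in> carrier K"
    and "u \<in> carrier M" "v \<in> carrier M" "y \<in> carrier N"
  shows "\<beta> (comb M a u b v) y = a \<odot>\<^bsub>Q\<^esub> \<beta> u y \<oplus>\<^bsub>Q\<^esub> b \<odot>\<^bsub>Q\<^esub> \<beta> v y"
proof -
  interpret M: module K M by fact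
  have l: "(\<lambda>x \<in> carrier M. \<beta> x y) \<in> lin_maps K M Q" using assms by (auto simp: bilin_def)
  show ?thesis
    using lin_maps_add[OF l, of "a \<odot>\<^bsub>M\<^esub> u" "b \<odot>\<^bsub>M\<^esub> v"] lin_maps_smult[OF l, of a u] lin_maps_smult[OF l, of b v]
      assms by simp
qed

lemma bilin_comb_right:
  assumes "bilin K M N Q \<beta>" "module K N" "a \<in> carrier K" "b \<in> carrier K"
    and "u \<in> carrier N" "v \<in> carrier N" "x \<in> carrier M"
  shows "\<beta> x (comb N a u b v) = a \<odot>\<^bsub>Q\<^esub> \<beta> x u \<oplus>\<^bsub>Q\<^esub> b \<odot>\<^bsub>Q\<^esub> \<beta> x v"
proof -
  have "bilin K N M Q (\<lambda>y x. \<beta> x y)" using assms(1) by (auto simp: bilin_def)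
  from bilin_comb_left[OF this assms(2-7)] show ?thesis .
qed

lemma bilin_finsum_left:
  assumes "bilin K M N Q \<beta>" "module K M" "module K Q" "g \<in> A \<rightarrow> carrier M" "y \<in> carrier N"
  shows "\<beta> (\<Oplus>\<^bsub>M\<^esub>i\<in>A. g i) y = (\<Oplus>\<^bsub>Q\<^esub>i\<in>A. \<beta> (g i) y)"
proof -
  interpret M: module K M by fact
  interpret Q: module K Q by fact
  have l: "(\<lambda>x \<in> carrier M. \<beta> x y) \<in> lin_maps K M Q" using assms by (auto simp: bilin_def)
  have "(\<lambda>x \<in> carrier M. \<beta> x y) (\<Oplus>\<^bsub>M\<^esub>i\<in>A. g i) = (\<Oplus>\<^bsub>Q\<^esub>i\<in>A. (\<lambda>x \<in> carrier M. \<beta> x y) (g i))"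
    by (rule lin_maps_finsum[OF assms(2,3) l assms(4)])
  also have "\<dots> = (\<Oplus>\<^bsub>Q\<^esub>i\<in>A. \<beta> (g i) y)"
    by (rule Q.finsum_cong') (use assms(4,5) bilin_closed[OF assms(1)] in \<open>auto simp: Pi_iff\<close>)
  finally show ?thesis using assms(4) by simp
qed

lemma bilin_finsum_right:
  assumes "bilin K M N Q \<beta>" "module K N" "module K Q" "g \<in> A \<rightarrow> carrier N" "x \<in> carrier M"
  shows "\<beta> x (\<Oplus>\<^bsub>N\<^esub>i\<in>A. g i) = (\<Oplus>\<^bsub>Q\<^esub>i\<in>A. \<beta> x (g i))"
proof -
  have "bilin K N M Q (\<lambda>y x. \<beta> x y)" using assms(1) by (auto simp: bilin_def)
  from bilin_finsum_left[OF this assms(2-5)] show ?thesis .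
qed

lemma bilin_zero_left:
  assumes "bilin K M N Q \<beta>" "module K M" "module K Q" "y \<in> carrier N"
  shows "\<beta> \<zero>\<^bsub>M\<^esub> y = \<zero>\<^bsub>Q\<^esub>"
proof -
  interpret M: module K M by fact
  interpret Q: module K Q by fact
  show ?thesis using bilin_finsum_left[OF assms(1-3), of "\<lambda>_. \<zero>\<^bsub>M\<^esub>" "{}" y] assms(4) by simp
qed

lemma bilin_zero_right:
  assumes "bilin K M N Q \<beta>" "module K N" "module K Q" "x \<in> carrier M"
  shows "\<beta> x \<zero>\<^bsub>N\<^esub> = \<zero>\<^bsub>Q\<^esub>"
proof -
  have "bilin K N M Q (\<lambda>y x. \<beta> x y)" using assms(1) by (auto simp: bilin_def)
  from bilin_zero_left[OF this assms(2-4)] show ?thesis .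
qed

lemma bilin_compose:
  assumes "bilin K M' N' Q \<beta>" "module K M" "module K N" "f \<in> lin_maps K M M'" "g \<in> lin_maps K N N'"
    "h \<in> lin_maps K Q Q'"
  shows "bilin K M N Q' (\<lambda>x y. h (\<beta> (f x) (g y)))"
proof -
  have 1: "compose (carrier N) h (compose (carrier N) (\<lambda>y \<in> carrier N'. \<beta> (f x) y) g) \<in> lin_maps K N Q'"
    if "x \<in> carrier M" for x
    using assms that lin_maps_closed[OF assms(4)]
    by (intro lin_maps_compose[OF assms(3)]) (auto simp: bilin_def)
  have 2: "compose (carrier M) h (compose (carrier M) (\<lambda>x \<in> carrier M'. \<beta> x (g y)) f) \<in> lin_maps K M Q'"
    if "y \<in> carrier N" for y
    using assms that lin_maps_closed[OF assms(5)]
    by (intro lin_maps_compose[OF assms(2)]) (auto simp: bilin_def)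
  have 3: "compose (carrier N) h (compose (carrier N) (\<lambda>y \<in> carrier N'. \<beta> (f x) y) g)
      = (\<lambda>y \<in> carrier N. h (\<beta> (f x) (g y)))" if "x \<in> carrier M" for x
    using lin_maps_closed[OF assms(5)] by (auto simp: compose_def restrict_def)
  have 4: "compose (carrier M) h (compose (carrier M) (\<lambda>x \<in> carrier M'. \<beta> x (g y)) f)
      = (\<lambda>x \<in> carrier M. h (\<beta> (f x) (g y)))" if "y \<in> carrier N" for y
    using lin_maps_closed[OF assms(4)] by (auto simp: compose_def restrict_def)
  show ?thesis unfolding bilin_def using 1 2 3 4 by auto
qed

lemma tensor_rels_closed:
  assumes "module K M" "module K N"
  shows "tensor_rels K M N \<subseteq> carrier (free_module K (carrier M \<times> carrier N))"
proof -
  interpret M: module K M by fact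
  interpret N: module K N by fact
  show ?thesis unfolding tensor_rels_def Let_def
    by (auto intro!: presented_rel_closed[OF M.is_cring])
qed

lemma tensor_module:
  assumes "module K M" "module K N" shows "module K (tensor K M N)"
  using presented_module(1)[OF _ tensor_rels_closed[OF assms]] module.axioms(1)[OF assms(1)]
  by (simp add: tensor_def tensor_null_def)

lemma tensor_span:
  assumes "module K M" "module K N"
  shows "lin_span K (tensor K M N) ((\<lambda>(x, y). tens K M N x y) ` (carrier M \<times> carrier N)) = carrier (tensor K M N)"
  using presented_module(2)[OF _ tensor_rels_closed[OF assms]] module.axioms(1)[OF assms(1)]
  by (simp add: tensor_def tensor_null_def tens_def case_prod_unfold)

lemma tens_closed:
  assumes "module K M" "module K N" "x \<in> carrier M" "y \<in> carrier N"
  shows "tens K M N x y \<in> carrier (tensor K M N)"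
  using lin_span_superset[of "(\<lambda>(x, y). tens K M N x y) ` (carrier M \<times> carrier N)" K "tensor K M N"]
    assms(3,4) unfolding tensor_span[OF assms(1,2)] by auto

lemma tens_bilin:
  assumes "module K M" "module K N"
  shows "bilin K M N (tensor K M N) (tens K M N)"
proof -
  interpret M: module K M by fact
  interpret N: module K N by fact
  note T = tensor_module[OF assms]
  note rel = presented_module_rel[OF M.is_cring tensor_rels_closed[OF assms],
      folded tensor_null_def tensor_def]
  have 1: "tens K M N (comb M a u b v) y =
    a \<odot>\<^bsub>tensor K M N\<^esub> tens K M N u y \<oplus>\<^bsub>tensor K M N\<^esub> b \<odot>\<^bsub>tensor K M N\<^esub> tens K M N v y"
    if "a \<in> carrier K" "b \<in> carrier K" "u \<in> carrier M" "v \<in> carrier M" "y \<in> carrier N" for a b u v y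
    unfolding tens_def by (rule rel) (use that in \<open>auto simp: tensor_rels_def Let_def\<close>)
  have 2: "tens K M N x (comb N a u b v) =
    a \<odot>\<^bsub>tensor K M N\<^esub> tens K M N x u \<oplus>\<^bsub>tensor K M N\<^esub> b \<odot>\<^bsub>tensor K M N\<^esub> tens K M N x v"
    if "a \<in> carrier K" "b \<in> carrier K" "u \<in> carrier N" "v \<in> carrier N" "x \<in> carrier M" for a b u v x
    unfolding tens_def by (rule rel) (use that in \<open>auto simp: tensor_rels_def Let_def\<close>)
  show ?thesis unfolding bilin_def
    by (intro conjI ballI lin_maps_combI assms T tens_closed 1 2)
qed

text \<open>\<open>tensor_lift\<close> is a definite description and needs both halves: existence
  comes from the presentation, uniqueness from the fact that pure tensors span.\<close>

lemma tensor_lift_ex: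
  assumes "module K M" "module K N" "module K Q" "bilin K M N Q \<beta>"
  shows "\<exists>!h. h \<in> lin_maps K (tensor K M N) Q \<and>
    (\<forall>x \<in> carrier M. \<forall>y \<in> carrier N. h (tens K M N x y) = \<beta> x y)"
proof -
  interpret M: module K M by fact
  interpret N: module K N by fact
  let ?X = "carrier M \<times> carrier N"
  have "\<exists>h \<in> lin_maps K (tensor K M N) Q. \<forall>p \<in> ?X.
    h (tensor_null K M N +>\<^bsub>free_module K ?X\<^esub> basis_vec K p) = (\<lambda>(x, y). \<beta> x y) p"
    unfolding tensor_def tensor_null_def
  proof (rule presented_module_lift[OF assms(3) tensor_rels_closed[OF assms(1,2)]])
    show "(\<lambda>(x, y). \<beta> x y) \<in> ?X \<rightarrow> carrier Q" using bilin_closed[OF assms(4)] by auto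
    fix h r assume h: "h \<in> lin_maps K (free_module K ?X) Q"
      and hb: "\<forall>p \<in> ?X. h (basis_vec K p) = (\<lambda>(x, y). \<beta> x y) p" and r: "r \<in> tensor_rels K M N"
    show "h r = \<zero>\<^bsub>Q\<^esub>"
      using r unfolding tensor_rels_def Let_def
      by (auto intro!: lin_maps_rel_zero[OF assms(3) h]
        simp: hb bilin_comb_left[OF assms(4,1)] bilin_comb_right[OF assms(4,2)])
  qed
  then obtain h where "h \<in> lin_maps K (tensor K M N) Q"
    "\<forall>x \<in> carrier M. \<forall>y \<in> carrier N. h (tens K M N x y) = \<beta> x y"
    by (auto simp: tens_def)
  moreover have "h' = h''" if "h' \<in> lin_maps K (tensor K M N) Q" "h'' \<in> lin_maps K (tensor K M N) Q"
    "\<forall>x \<in> carrier M. \<forall>y \<in> carrier N. h' (tens K M N x y) = \<beta> x y"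
    "\<forall>x \<in> carrier M. \<forall>y \<in> carrier N. h'' (tens K M N x y) = \<beta> x y" for h' h''
    by (rule lin_maps_eqI_span[OF tensor_module[OF assms(1,2)] assms(3) that(1,2) tensor_span[OF assms(1,2)]])
      (use that(3,4) in auto)
  ultimately show ?thesis by blast
qed

lemma
  assumes "module K M" "module K N" "module K Q" "bilin K M N Q \<beta>"
  shows tensor_lift_lin: "tensor_lift K M N Q \<beta> \<in> lin_maps K (tensor K M N) Q"
    and tensor_lift_tens: "x \<in> carrier M \<Longrightarrow> y \<in> carrier N \<Longrightarrow>
      tensor_lift K M N Q \<beta> (tens K M N x y) = \<beta> x y"
  unfolding tensor_lift_def using theI'[OF tensor_lift_ex[OF assms]] by auto

lemma tensor_eqI:
  assumes "module K M" "module K N" "module K Q"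
    and "f \<in> lin_maps K (tensor K M N) Q" "g \<in> lin_maps K (tensor K M N) Q"
    and "\<And>x y. x \<in> carrier M \<Longrightarrow> y \<in> carrier N \<Longrightarrow> f (tens K M N x y) = g (tens K M N x y)"
  shows "f = g"
  by (rule lin_maps_eqI_span[OF tensor_module[OF assms(1,2)] assms(3-5) tensor_span[OF assms(1,2)]])
    (use assms(6) in auto)

lemma bilin_tens_maps:
  assumes "module K M" "module K N" "module K M'" "module K N'"
    and "f \<in> lin_maps K M M'" "g \<in> lin_maps K N N'"
  shows "bilin K M N (tensor K M' N') (\<lambda>x y. tens K M' N' (f x) (g y))"
proof -
  have T: "module K (tensor K M' N')" by (rule tensor_module[OF assms(3,4)])
  have "bilin K M N (tensor K M' N') (\<lambda>x y. (\<lambda>z \<in> carrier (tensor K M' N'). z) (tens K M' N' (f x) (g y)))"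
    by (rule bilin_compose[OF tens_bilin[OF assms(3,4)] assms(1,2,5,6) lin_maps_id[OF T]])
  then show ?thesis
    using tens_closed[OF assms(3,4) lin_maps_closed[OF assms(5)] lin_maps_closed[OF assms(6)]]
    by (simp add: bilin_def cong: restrict_cong)
qed

lemma
  assumes "module K M" "module K N" "module K M'" "module K N'"
    and "f \<in> lin_maps K M M'" "g \<in> lin_maps K N N'"
  shows tensor_map_lin: "tensor_map K M N M' N' f g \<in> lin_maps K (tensor K M N) (tensor K M' N')"
    and tensor_map_tens: "x \<in> carrier M \<Longrightarrow> y \<in> carrier N \<Longrightarrow>
      tensor_map K M N M' N' f g (tens K M N x y) = tens K M' N' (f x) (g y)"
  unfolding tensor_map_def
  using tensor_lift_lin[OF assms(1,2) tensor_module[OF assms(3,4)] bilin_tens_maps[OF assms]]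
    tensor_lift_tens[OF assms(1,2) tensor_module[OF assms(3,4)] bilin_tens_maps[OF assms]] by auto

text \<open>For fixed \<open>z\<close> the map \<open>\<alpha> z\<close> sends
  \<open>x \<otimes> y\<close> to \<open>x \<otimes> (y \<otimes> z)\<close>. It depends linearly on
  \<open>z\<close>, so \<open>t\<close> and \<open>z\<close> enter bilinearly and the map lifts to
  the tensor product.\<close>

lemma tensor_assoc_ex:
  assumes L: "module K L" and M: "module K M" and N: "module K N"
  shows "\<exists>!h. h \<in> lin_maps K (tensor K (tensor K L M) N) (tensor K L (tensor K M N)) \<and>
      (\<forall>x \<in> carrier L. \<forall>y \<in> carrier M. \<forall>z \<in> carrier N.
        h (tens K (tensor K L M) N (tens K L M x y) z) =
        tens K L (tensor K M N) x (tens K M N y z))" (is "\<exists>!h. ?P h")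
proof -
  let ?T = "tensor K L (tensor K M N)"
  note LM = tensor_module[OF L M] and MN = tensor_module[OF M N]
  note T = tensor_module[OF L MN]
  have tl: "(\<lambda>y \<in> carrier M. tens K M N y z) \<in> lin_maps K M (tensor K M N)" if "z \<in> carrier N" for z
    using tens_bilin[OF M N] that by (auto simp: bilin_def)
  define \<alpha> where "\<alpha> z = tensor_map K L M L (tensor K M N) (\<lambda>x \<in> carrier L. x) (\<lambda>y \<in> carrier M. tens K M N y z)" for z
  have \<alpha>: "\<alpha> z \<in> lin_maps K (tensor K L M) ?T" if "z \<in> carrier N" for z
    unfolding \<alpha>_def by (rule tensor_map_lin[OF L M L MN lin_maps_id[OF L] tl[OF that]])
  have \<alpha>t: "\<alpha> z (tens K L M x y) = tens K L (tensor K M N) x (tens K M N y z)"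
    if "x \<in> carrier L" "y \<in> carrier M" "z \<in> carrier N" for x y z
    unfolding \<alpha>_def using tensor_map_tens[OF L M L MN lin_maps_id[OF L] tl[OF that(3)] that(1,2)] that by simp
  have H: "module K (hom_module K (tensor K L M) ?T)" by (rule hom_module_module[OF LM T])
  \<comment> \<open>Linearity in \<open>z\<close> is an equation between linear maps on the tensor
    product of \<open>L\<close> and \<open>M\<close>, so pure tensors decide it.\<close>
  have \<alpha>lin: "(\<lambda>z \<in> carrier N. \<alpha> z) \<in> lin_maps K N (hom_module K (tensor K L M) ?T)"
  proof (rule lin_maps_combI[OF N H])
    show "\<alpha> z \<in> carrier (hom_module K (tensor K L M) ?T)" if "z \<in> carrier N" for z
      using \<alpha>[OF that] by simp
    fix a b u v assume ab: "a \<in> carrier K" "b \<in> carrier K" and uv: "u \<in> carrier N" "v \<in> carrier N"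
    interpret N: module K N by (rule N)
    interpret H: module K "hom_module K (tensor K L M) ?T" by (rule H)
    let ?R = "a \<odot>\<^bsub>hom_module K (tensor K L M) ?T\<^esub> \<alpha> u \<oplus>\<^bsub>hom_module K (tensor K L M) ?T\<^esub> b \<odot>\<^bsub>hom_module K (tensor K L M) ?T\<^esub> \<alpha> v"
    have R: "?R \<in> carrier (hom_module K (tensor K L M) ?T)"
      by (intro H.a_closed H.smult_closed ab) (simp_all add: \<alpha> uv)
    show "\<alpha> (comb N a u b v) = ?R"
    proof (rule tensor_eqI[OF L M T])
      show "\<alpha> (comb N a u b v) \<in> lin_maps K (tensor K L M) ?T" by (rule \<alpha>) (use ab uv in simp)
      show "?R \<in> lin_maps K (tensor K L M) ?T" using R by simp
      fix x y assume xy: "x \<in> carrier L" "y \<in> carrier M"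
      show "\<alpha> (comb N a u b v) (tens K L M x y) = ?R (tens K L M x y)"
        using xy uv ab tens_closed[OF L M xy]
        by (simp add: \<alpha>t bilin_comb_right[OF tens_bilin[OF M N] N]
          bilin_comb_right[OF tens_bilin[OF L MN] MN] tens_closed[OF M N])
    qed
  qed
  have bil: "bilin K (tensor K L M) N ?T (\<lambda>t z. \<alpha> z t)"
  proof (rule bilinI[OF LM N])
    show "\<alpha> (y \<oplus>\<^bsub>N\<^esub> y') x = \<alpha> y x \<oplus>\<^bsub>?T\<^esub> \<alpha> y' x"
      if "x \<in> carrier (tensor K L M)" "y \<in> carrier N" "y' \<in> carrier N" for x y y'
    proof -
      interpret N: module K N by (rule N)
      show ?thesis using fun_cong[OF lin_maps_add[OF \<alpha>lin that(2,3)], of x] that by simp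
    qed
    show "\<alpha> (a \<odot>\<^bsub>N\<^esub> y) x = a \<odot>\<^bsub>?T\<^esub> \<alpha> y x"
      if "a \<in> carrier K" "x \<in> carrier (tensor K L M)" "y \<in> carrier N" for a x y
    proof -
      interpret N: module K N by (rule N)
      show ?thesis using fun_cong[OF lin_maps_smult[OF \<alpha>lin that(1,3)], of x] that by simp
    qed
  qed (simp_all add: lin_maps_closed[OF \<alpha>] lin_maps_add[OF \<alpha>] lin_maps_smult[OF \<alpha>])
  let ?h = "tensor_lift K (tensor K L M) N ?T (\<lambda>t z. \<alpha> z t)"
  have "?P ?h"
    using tensor_lift_lin[OF LM N T bil] tensor_lift_tens[OF LM N T bil] by (simp add: \<alpha>t tens_closed[OF L M])
  moreover have "h = h'" if h: "?P h" and h': "?P h'" for h h'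
  proof (rule tensor_eqI[OF LM N T])
    \<comment> \<open>A general \<open>t\<close> is not a pure tensor. With \<open>z\<close> fixed
      both maps are linear in \<open>t\<close> and agree on pure tensors, which proves
      uniqueness.\<close>
    fix t z assume t: "t \<in> carrier (tensor K L M)" and z: "z \<in> carrier N"
    have tl: "(\<lambda>t \<in> carrier (tensor K L M). tens K (tensor K L M) N t z) \<in> lin_maps K (tensor K L M) (tensor K (tensor K L M) N)"
      using tens_bilin[OF LM N] z by (auto simp: bilin_def)
    have "compose (carrier (tensor K L M)) h (\<lambda>t \<in> carrier (tensor K L M). tens K (tensor K L M) N t z)
      = compose (carrier (tensor K L M)) h' (\<lambda>t \<in> carrier (tensor K L M). tens K (tensor K L M) N t z)"
      by (rule tensor_eqI[OF L M T lin_maps_compose[OF LM tl] lin_maps_compose[OF LM tl]])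
        (use h h' z in \<open>auto simp: compose_eq tens_closed[OF L M]\<close>)
    from fun_cong[OF this, of t] show "h (tens K (tensor K L M) N t z) = h' (tens K (tensor K L M) N t z)"
      using t by (simp add: compose_eq)
  qed (use h h' in auto)
  ultimately show ?thesis by blast
qed

lemma
  assumes "module K L" "module K M" "module K N"
  shows tensor_assoc_lin:
      "tensor_assoc K L M N \<in> lin_maps K (tensor K (tensor K L M) N) (tensor K L (tensor K M N))"
    and tensor_assoc_tens: "x \<in> carrier L \<Longrightarrow> y \<in> carrier M \<Longrightarrow> z \<in> carrier N \<Longrightarrow>
      tensor_assoc K L M N (tens K (tensor K L M) N (tens K L M x y) z) =
        tens K L (tensor K M N) x (tens K M N y z)"
  unfolding tensor_assoc_def using theI'[OF tensor_assoc_ex[OF assms]] by auto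

section \<open>Tensor powers and exterior powers\<close>

definition multilin ::
    "('k, 'r) ring_scheme \<Rightarrow> ('k, 'w, 'm) module_scheme \<Rightarrow> nat \<Rightarrow> ('k, 'd, 'p) module_scheme \<Rightarrow>
      ('w list \<Rightarrow> 'd) \<Rightarrow> bool"
  where "multilin K W n Q g \<longleftrightarrow>
    (\<forall>ws. set ws \<subseteq> carrier W \<and> length ws = n \<longrightarrow> g ws \<in> carrier Q) \<and>
    (\<forall>xs ys. set xs \<subseteq> carrier W \<and> set ys \<subseteq> carrier W \<and> length xs + 1 + length ys = n \<longrightarrow>
      (\<lambda>u \<in> carrier W. g (xs @ u # ys)) \<in> lin_maps K W Q)"

lemma multilinI:
  assumes "module K W" "module K Q"
    and "\<And>ws. set ws \<subseteq> carrier W \<Longrightarrow> length ws = n \<Longrightarrow> g ws \<in> carrier Q"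
    and "\<And>a b u v xs ys. a \<in> carrier K \<Longrightarrow> b \<in> carrier K \<Longrightarrow> u \<in> carrier W \<Longrightarrow> v \<in> carrier W \<Longrightarrow>
      set xs \<subseteq> carrier W \<Longrightarrow> set ys \<subseteq> carrier W \<Longrightarrow> length xs + 1 + length ys = n \<Longrightarrow>
      g (xs @ comb W a u b v # ys) =
        a \<odot>\<^bsub>Q\<^esub> g (xs @ u # ys) \<oplus>\<^bsub>Q\<^esub> b \<odot>\<^bsub>Q\<^esub> g (xs @ v # ys)"
  shows "multilin K W n Q g"
  unfolding multilin_def by (auto intro!: lin_maps_combI assms)

lemma multilin_closed:
  "multilin K W n Q g \<Longrightarrow> set ws \<subseteq> carrier W \<Longrightarrow> length ws = n \<Longrightarrow> g ws \<in> carrier Q"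
  by (auto simp: multilin_def)

lemma multilin_comb:
  assumes "multilin K W n Q g" "module K W" "a \<in> carrier K" "b \<in> carrier K" "u \<in> carrier W" "v \<in> carrier W"
      "set xs \<subseteq> carrier W" "set ys \<subseteq> carrier W" "length xs + 1 + length ys = n"
  shows "g (xs @ comb W a u b v # ys) =
        a \<odot>\<^bsub>Q\<^esub> g (xs @ u # ys) \<oplus>\<^bsub>Q\<^esub> b \<odot>\<^bsub>Q\<^esub> g (xs @ v # ys)"
proof -
  interpret W: module K W by fact
  have l: "(\<lambda>u \<in> carrier W. g (xs @ u # ys)) \<in> lin_maps K W Q" using assms by (auto simp: multilin_def)
  show ?thesis
    using lin_maps_add[OF l, of "a \<odot>\<^bsub>W\<^esub> u" "b \<odot>\<^bsub>W\<^esub> v"] lin_maps_smult[OF l, of a u] lin_maps_smult[OF l, of b v]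
      assms by simp
qed

lemma multilin_compose:
  assumes "multilin K W n Q g" "module K W" "module K Q" "module K Q'" "h \<in> lin_maps K Q Q'"
  shows "multilin K W n Q' (\<lambda>ws. h (g ws))"
proof (rule multilinI[OF assms(2,4)])
  interpret Q: module K Q by fact
  show "h (g (xs @ comb W a u b v # ys)) =
        a \<odot>\<^bsub>Q'\<^esub> h (g (xs @ u # ys)) \<oplus>\<^bsub>Q'\<^esub> b \<odot>\<^bsub>Q'\<^esub> h (g (xs @ v # ys))"
    if "a \<in> carrier K" "b \<in> carrier K" "u \<in> carrier W" "v \<in> carrier W"
      "set xs \<subseteq> carrier W" "set ys \<subseteq> carrier W" "length xs + 1 + length ys = n" for a b u v xs ys
    using that multilin_closed[OF assms(1), of "xs @ u # ys"] multilin_closed[OF assms(1), of "xs @ v # ys"]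
    by (simp add: multilin_comb[OF assms(1,2) that] lin_maps_add[OF assms(5)] lin_maps_smult[OF assms(5)])
qed (auto intro!: lin_maps_closed[OF assms(5)] multilin_closed[OF assms(1)])

text \<open>The generators of \<open>tpow_null\<close>, named so that the facts on presented modules
  apply to them.\<close>

definition tpow_rels where
  "tpow_rels K W n = (let F = tpow_free K W n in
    {basis_vec K (xs @ comb W a u b v # ys) \<ominus>\<^bsub>F\<^esub>
       (a \<odot>\<^bsub>F\<^esub> basis_vec K (xs @ u # ys) \<oplus>\<^bsub>F\<^esub> b \<odot>\<^bsub>F\<^esub> basis_vec K (xs @ v # ys)) | a b u v xs ys.
       a \<in> carrier K \<and> b \<in> carrier K \<and> u \<in> carrier W \<and> v \<in> carrier W \<and>
       set xs \<subseteq> carrier W \<and> set ys \<subseteq> carrier W \<and> length xs + 1 + length ys = n})"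

lemma tpow_null_eq: "tpow_null K W n = lin_span K (tpow_free K W n) (tpow_rels K W n)"
  by (simp only: tpow_null_def tpow_rels_def Let_def)

lemma tpow_rels_closed:
  assumes "module K W"
  shows "tpow_rels K W n \<subseteq> carrier (free_module K (tuples (carrier W) n))"
proof -
  interpret W: module K W by fact
  show ?thesis unfolding tpow_rels_def Let_def tpow_free_def
    by (auto intro!: presented_rel_closed[OF W.is_cring])
qed

lemma tensor_power_module:
  assumes "module K W" shows "module K (tensor_power K W n)"
  using presented_module(1)[OF _ tpow_rels_closed[OF assms]] module.axioms(1)[OF assms]
  by (simp add: tensor_power_def tpow_null_eq tpow_free_def)

lemma tensor_power_span:
  assumes "module K W"
  shows "lin_span K (tensor_power K W n) (tword K W ` tuples (carrier W) n)
    = carrier (tensor_power K W n)"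
proof -
  have "tword K W ` tuples (carrier W) n =
    (\<lambda>ws. tpow_null K W n +>\<^bsub>tpow_free K W n\<^esub> basis_vec K ws) ` tuples (carrier W) n"
    by (rule image_cong) (auto simp: tword_def)
  then show ?thesis
    using presented_module(2)[OF _ tpow_rels_closed[OF assms]] module.axioms(1)[OF assms]
    by (simp add: tensor_power_def tpow_null_eq tpow_free_def)
qed

lemma tword_closed:
  assumes "module K W" "set ws \<subseteq> carrier W" "length ws = n"
  shows "tword K W ws \<in> carrier (tensor_power K W n)"
  using lin_span_superset[of "tword K W ` tuples (carrier W) n" K "tensor_power K W n"]
    assms(2,3) unfolding tensor_power_span[OF assms(1)] by auto

lemma tword_multilin:
  assumes "module K W"
  shows "multilin K W n (tensor_power K W n) (tword K W)"
proof (rule multilinI[OF assms tensor_power_module[OF assms]])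
  interpret W: module K W by fact
  note rel = presented_module_rel[OF W.is_cring tpow_rels_closed[OF assms, of n],
      folded tpow_free_def, folded tpow_null_eq, folded tensor_power_def]
  fix a b u v xs ys
  assume *: "a \<in> carrier K" "b \<in> carrier K" "u \<in> carrier W" "v \<in> carrier W"
      "set xs \<subseteq> carrier W" "set ys \<subseteq> carrier W" "length xs + 1 + length ys = n"
  have "tpow_null K W n +>\<^bsub>tpow_free K W n\<^esub> basis_vec K (xs @ comb W a u b v # ys) =
    a \<odot>\<^bsub>tensor_power K W n\<^esub> (tpow_null K W n +>\<^bsub>tpow_free K W n\<^esub> basis_vec K (xs @ u # ys)) \<oplus>\<^bsub>tensor_power K W n\<^esub>
    b \<odot>\<^bsub>tensor_power K W n\<^esub> (tpow_null K W n +>\<^bsub>tpow_free K W n\<^esub> basis_vec K (xs @ v # ys))"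
  proof (rule rel)
    let ?F = "tpow_free K W n"
    show "basis_vec K (xs @ comb W a u b v # ys) \<ominus>\<^bsub>?F\<^esub>
       (a \<odot>\<^bsub>?F\<^esub> basis_vec K (xs @ u # ys) \<oplus>\<^bsub>?F\<^esub> b \<odot>\<^bsub>?F\<^esub> basis_vec K (xs @ v # ys)) \<in> tpow_rels K W n"
      unfolding tpow_rels_def Let_def by (intro CollectI exI conjI, rule refl, (rule *)+)
  qed (use * in auto)
  then show "tword K W (xs @ comb W a u b v # ys) =
      a \<odot>\<^bsub>tensor_power K W n\<^esub> tword K W (xs @ u # ys) \<oplus>\<^bsub>tensor_power K W n\<^esub> b \<odot>\<^bsub>tensor_power K W n\<^esub> tword K W (xs @ v # ys)"
    using * by (simp add: tword_def)
qed (rule tword_closed[OF assms])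

lemma tensor_power_lift:
  assumes "module K W" "module K Q" "multilin K W n Q g"
  shows "\<exists>h \<in> lin_maps K (tensor_power K W n) Q.
    \<forall>ws. set ws \<subseteq> carrier W \<and> length ws = n \<longrightarrow> h (tword K W ws) = g ws"
proof -
  interpret W: module K W by fact
  let ?X = "tuples (carrier W) n"
  have "\<exists>h \<in> lin_maps K (tensor_power K W n) Q.
    \<forall>ws \<in> ?X. h (tpow_null K W n +>\<^bsub>free_module K ?X\<^esub> basis_vec K ws) = g ws"
    unfolding tensor_power_def tpow_null_eq tpow_free_def
  proof (rule presented_module_lift[OF assms(2) tpow_rels_closed[OF assms(1)]])
    show "g \<in> ?X \<rightarrow> carrier Q" using multilin_closed[OF assms(3)] by auto
    fix h r assume h: "h \<in> lin_maps K (free_module K ?X) Q"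
      and hb: "\<forall>p \<in> ?X. h (basis_vec K p) = g p" and r: "r \<in> tpow_rels K W n"
    from r obtain a b u v xs ys where
      r_eq: "r = basis_vec K (xs @ comb W a u b v # ys) \<ominus>\<^bsub>free_module K ?X\<^esub>
       (a \<odot>\<^bsub>free_module K ?X\<^esub> basis_vec K (xs @ u # ys) \<oplus>\<^bsub>free_module K ?X\<^esub>
        b \<odot>\<^bsub>free_module K ?X\<^esub> basis_vec K (xs @ v # ys))"
      and *: "a \<in> carrier K" "b \<in> carrier K" "u \<in> carrier W" "v \<in> carrier W"
       "set xs \<subseteq> carrier W" "set ys \<subseteq> carrier W" "length xs + 1 + length ys = n"
      unfolding tpow_rels_def Let_def tpow_free_def by blast
    have X: "xs @ w # ys \<in> ?X" if "w \<in> carrier W" for w using * that by auto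
    show "h r = \<zero>\<^bsub>Q\<^esub>"
      unfolding r_eq
      by (rule lin_maps_rel_zero[OF assms(2) h])
        (use X * in \<open>simp_all add: hb multilin_comb[OF assms(3,1)]\<close>)
  qed
  then show ?thesis by (auto simp: tword_def tpow_free_def)
qed

lemma tensor_power_eqI:
  assumes "module K W" "module K Q" "f \<in> lin_maps K (tensor_power K W n) Q" "g \<in> lin_maps K (tensor_power K W n) Q"
    and "\<And>ws. set ws \<subseteq> carrier W \<Longrightarrow> length ws = n \<Longrightarrow> f (tword K W ws) = g (tword K W ws)"
  shows "f = g"
  by (rule lin_maps_eqI_span[OF tensor_power_module[OF assms(1)] assms(2-4) tensor_power_span[OF assms(1)]])
    (use assms(5) in auto)

lemma alt_null_submodule:
  assumes "module K W"
  shows "submodule (alt_null K W n) K (tensor_power K W n)"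
  unfolding alt_null_def
  by (rule lin_span_submodule[OF tensor_power_module[OF assms]]) (use tword_closed[OF assms] in auto)

lemma ext_power_module:
  assumes "module K W" shows "module K (ext_power K W n)"
  unfolding ext_power_def
  by (rule quot_module_module[OF tensor_power_module[OF assms] alt_null_submodule[OF assms]])

lemma ext_proj_lin:
  assumes "module K W"
  shows "(\<lambda>t \<in> carrier (tensor_power K W n). alt_null K W n +>\<^bsub>tensor_power K W n\<^esub> t)
    \<in> lin_maps K (tensor_power K W n) (ext_power K W n)"
  unfolding ext_power_def
  by (rule quot_proj_lin[OF tensor_power_module[OF assms] alt_null_submodule[OF assms]])

lemma wedge_eq_proj:
  assumes "module K W" "set ws \<subseteq> carrier W" "length ws = n"
  shows "wedge K W ws = (\<lambda>t \<in> carrier (tensor_power K W n). alt_null K W n +>\<^bsub>tensor_power K W n\<^esub> t) (tword K W ws)"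
  using assms tword_closed[OF assms] by (simp add: wedge_def)

lemma ext_power_span:
  assumes "module K W"
  shows "lin_span K (ext_power K W n) (wedge K W ` tuples (carrier W) n)
    = carrier (ext_power K W n)"
proof -
  let ?p = "\<lambda>t \<in> carrier (tensor_power K W n). alt_null K W n +>\<^bsub>tensor_power K W n\<^esub> t"
  have "wedge K W ` tuples (carrier W) n =
    ?p ` tword K W ` tuples (carrier W) n"
    unfolding image_image by (rule image_cong[OF refl], rule wedge_eq_proj[OF assms]) auto
  moreover have "?p ` carrier (tensor_power K W n) = carrier (ext_power K W n)"
    using quot_module_simps(1)[OF tensor_power_module[OF assms] alt_null_submodule[OF assms], of n]
    by (auto simp: ext_power_def)
  ultimately show ?thesis
    using lin_span_surj_image[OF tensor_power_module[OF assms] ext_power_module[OF assms] ext_proj_lin[OF assms]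
      _ tensor_power_span[OF assms]] by simp
qed

lemma wedge_closed:
  assumes "module K W" "set ws \<subseteq> carrier W" "length ws = n"
  shows "wedge K W ws \<in> carrier (ext_power K W n)"
  unfolding wedge_eq_proj[OF assms] by (rule lin_maps_closed[OF ext_proj_lin[OF assms(1)] tword_closed[OF assms]])

lemma wedge_multilin:
  assumes "module K W"
  shows "multilin K W n (ext_power K W n) (wedge K W)"
proof -
  have m: "multilin K W n (ext_power K W n)
    (\<lambda>ws. (\<lambda>t \<in> carrier (tensor_power K W n). alt_null K W n +>\<^bsub>tensor_power K W n\<^esub> t) (tword K W ws))" (is "multilin K W n ?E ?g")
    by (rule multilin_compose[OF tword_multilin[OF assms] assms tensor_power_module[OF assms]
      ext_power_module[OF assms] ext_proj_lin[OF assms]])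
  interpret W: module K W by fact
  show ?thesis
  proof (rule multilinI[OF assms ext_power_module[OF assms] wedge_closed[OF assms]])
    fix a b u v xs ys
    assume *: "a \<in> carrier K" "b \<in> carrier K" "u \<in> carrier W" "v \<in> carrier W"
      "set xs \<subseteq> carrier W" "set ys \<subseteq> carrier W" "length xs + 1 + length ys = n"
    have "wedge K W (xs @ w # ys) = ?g (xs @ w # ys)" if "w \<in> carrier W" for w
      using * that by (intro wedge_eq_proj[OF assms]) auto
    then show "wedge K W (xs @ comb W a u b v # ys) =
      a \<odot>\<^bsub>?E\<^esub> wedge K W (xs @ u # ys) \<oplus>\<^bsub>?E\<^esub> b \<odot>\<^bsub>?E\<^esub> wedge K W (xs @ v # ys)"
      using multilin_comb[OF m assms *] * by simp
  qed
qed

lemma wedge_nondistinct: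
  assumes "module K W" "set ws \<subseteq> carrier W" "length ws = n" "\<not> distinct ws"
  shows "wedge K W ws = \<zero>\<^bsub>ext_power K W n\<^esub>"
proof -
  interpret T: module K "tensor_power K W n" by (rule tensor_power_module[OF assms(1)])
  have "tword K W ws \<in> alt_null K W n"
    unfolding alt_null_def by (rule subsetD[OF lin_span_superset]) (use assms in auto)
  then have "tword K W ws \<ominus>\<^bsub>tensor_power K W n\<^esub> \<zero>\<^bsub>tensor_power K W n\<^esub> \<in> alt_null K W n"
    using tword_closed[OF assms(1-3)] T.add.inv_one by (simp add: a_minus_def a_inv_def)
  then show ?thesis
    using submodule_coset_eq[OF tensor_power_module[OF assms(1)] alt_null_submodule[OF assms(1)]
      tword_closed[OF assms(1-3)] T.zero_closed] assms
    by (simp add: wedge_def ext_power_def quot_module_simps(2)[OF tensor_power_module[OF assms(1)] alt_null_submodule[OF assms(1)]])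
qed

lemma ext_power_lift:
  assumes "module K W" "module K Q" "multilin K W n Q g"
    and alt: "\<And>ws. set ws \<subseteq> carrier W \<Longrightarrow> length ws = n \<Longrightarrow> \<not> distinct ws \<Longrightarrow> g ws = \<zero>\<^bsub>Q\<^esub>"
  shows "\<exists>h \<in> lin_maps K (ext_power K W n) Q.
    \<forall>ws. set ws \<subseteq> carrier W \<and> length ws = n \<longrightarrow> h (wedge K W ws) = g ws"
proof -
  obtain f where f: "f \<in> lin_maps K (tensor_power K W n) Q"
    "\<forall>ws. set ws \<subseteq> carrier W \<and> length ws = n \<longrightarrow> f (tword K W ws) = g ws"
    using tensor_power_lift[OF assms(1-3)] by blast
  have "alt_null K W n \<subseteq> {x \<in> carrier (tensor_power K W n). f x = \<zero>\<^bsub>Q\<^esub>}"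
    unfolding alt_null_def
    by (rule lin_span_least[OF kernel_submodule[OF tensor_power_module[OF assms(1)] assms(2) f(1)]])
      (use f(2) alt tword_closed[OF assms(1)] in auto)
  then obtain h where "h \<in> lin_maps K (ext_power K W n) Q"
    "\<forall>x \<in> carrier (tensor_power K W n). h (alt_null K W n +>\<^bsub>tensor_power K W n\<^esub> x) = f x"
    using quot_module_lift[OF tensor_power_module[OF assms(1)] alt_null_submodule[OF assms(1)] assms(2) f(1)]
    unfolding ext_power_def by auto
  then show ?thesis using f(2) tword_closed[OF assms(1)] by (intro bexI[of _ h]) (auto simp: wedge_def)
qed

lemma ext_power_eqI:
  assumes "module K W" "module K Q" "f \<in> lin_maps K (ext_power K W n) Q" "g \<in> lin_maps K (ext_power K W n) Q"
    and "\<And>ws. set ws \<subseteq> carrier W \<Longrightarrow> length ws = n \<Longrightarrow> f (wedge K W ws) = g (wedge K W ws)"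
  shows "f = g"
  by (rule lin_maps_eqI_span[OF ext_power_module[OF assms(1)] assms(2-4) ext_power_span[OF assms(1)]])
    (use assms(5) in auto)

section \<open>Complements and bases\<close>

text \<open>The enlargement of a submodule by one vector, for the maximality argument in
  \<open>submodule_complement\<close>.\<close>

lemma smult_sum_submodule:
  assumes "module K M" "submodule U K M" "y \<in> carrier M"
  shows "submodule {u \<oplus>\<^bsub>M\<^esub> a \<odot>\<^bsub>M\<^esub> y | u a. u \<in> U \<and> a \<in> carrier K} K M" (is "submodule ?S K M")
proof -
  interpret M: module K M by fact
  have U: "u \<in> carrier M" if "u \<in> U" for u using that submodule_subset[OF assms(2)] by auto
  show ?thesis
  proof (rule M.submoduleI)
    show "?S \<subseteq> carrier M" using U assms(3) by auto
    have "\<zero>\<^bsub>M\<^esub> = \<zero>\<^bsub>M\<^esub> \<oplus>\<^bsub>M\<^esub> \<zero>\<^bsub>K\<^esub> \<odot>\<^bsub>M\<^esub> y" using assms(3) by simp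
    then show "\<zero>\<^bsub>M\<^esub> \<in> ?S" using submodule_zero[OF assms(2)] by blast
    fix p assume "p \<in> ?S"
    then obtain u a where p: "p = u \<oplus>\<^bsub>M\<^esub> a \<odot>\<^bsub>M\<^esub> y" "u \<in> U" "a \<in> carrier K" by auto
    have "\<ominus>\<^bsub>M\<^esub> p = \<ominus>\<^bsub>M\<^esub> u \<oplus>\<^bsub>M\<^esub> (\<ominus>\<^bsub>K\<^esub> a) \<odot>\<^bsub>M\<^esub> y"
      using p U assms(3) by (simp add: M.minus_add M.smult_l_minus)
    then show "\<ominus>\<^bsub>M\<^esub> p \<in> ?S" using submodule_minus[OF assms(2) p(2)] p(3) by blast
    { fix q assume "q \<in> ?S"
      then obtain v b where q: "q = v \<oplus>\<^bsub>M\<^esub> b \<odot>\<^bsub>M\<^esub> y" "v \<in> U" "b \<in> carrier K" by auto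
      have "p \<oplus>\<^bsub>M\<^esub> q = (u \<oplus>\<^bsub>M\<^esub> v) \<oplus>\<^bsub>M\<^esub> (a \<oplus>\<^bsub>K\<^esub> b) \<odot>\<^bsub>M\<^esub> y"
        using p q U assms(3) by (simp add: M.smult_l_distr M.add.m_ac)
      then show "p \<oplus>\<^bsub>M\<^esub> q \<in> ?S" using submodule_add[OF assms(2) p(2) q(2)] p(3) q(3) by blast }
    { fix b assume b: "b \<in> carrier K"
      have "b \<odot>\<^bsub>M\<^esub> p = b \<odot>\<^bsub>M\<^esub> u \<oplus>\<^bsub>M\<^esub> (b \<otimes>\<^bsub>K\<^esub> a) \<odot>\<^bsub>M\<^esub> y"
        using p U b assms(3) by (simp add: M.smult_r_distr M.smult_assoc1)
      then show "b \<odot>\<^bsub>M\<^esub> p \<in> ?S" using submodule_smult[OF assms(2) b p(2)] p(3) b by blast }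
  qed
qed

lemma chain_Union_submodule:
  assumes "module K M" "\<C> \<noteq> {}" "\<And>N. N \<in> \<C> \<Longrightarrow> submodule N K M"
    and chain: "\<And>N N'. N \<in> \<C> \<Longrightarrow> N' \<in> \<C> \<Longrightarrow> N \<subseteq> N' \<or> N' \<subseteq> N"
  shows "submodule (\<Union>\<C>) K M"
proof -
  interpret M: module K M by fact
  show ?thesis
  proof (rule M.submoduleI)
    show "\<Union>\<C> \<subseteq> carrier M" using submodule_subset[OF assms(3)] by auto
    show "\<zero>\<^bsub>M\<^esub> \<in> \<Union>\<C>" using assms(2) submodule_zero[OF assms(3)] by auto
    show "\<ominus>\<^bsub>M\<^esub> a \<in> \<Union>\<C>" if "a \<in> \<Union>\<C>" for a using that submodule_minus[OF assms(3)] by auto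
    show "b \<odot>\<^bsub>M\<^esub> a \<in> \<Union>\<C>" if "b \<in> carrier K" "a \<in> \<Union>\<C>" for a b
      using that submodule_smult[OF assms(3)] by auto
    fix a b assume "a \<in> \<Union>\<C>" "b \<in> \<Union>\<C>"
    then obtain N where "N \<in> \<C>" "a \<in> N" "b \<in> N" using chain by blast
    then show "a \<oplus>\<^bsub>M\<^esub> b \<in> \<Union>\<C>" using submodule_add[OF assms(3)] by auto
  qed
qed

lemma field_smult_cancel:
  assumes "field K" "module K M" "a \<in> carrier K" "a \<noteq> \<zero>\<^bsub>K\<^esub>" "x \<in> carrier M"
  shows "inv\<^bsub>K\<^esub> a \<in> carrier K" "inv\<^bsub>K\<^esub> a \<odot>\<^bsub>M\<^esub> (a \<odot>\<^bsub>M\<^esub> x) = x"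
proof -
  interpret K: field K by fact
  interpret M: module K M by fact
  have u: "a \<in> Units K" using assms K.field_Units by auto
  then show "inv\<^bsub>K\<^esub> a \<in> carrier K" by (rule K.Units_inv_closed)
  then show "inv\<^bsub>K\<^esub> a \<odot>\<^bsub>M\<^esub> (a \<odot>\<^bsub>M\<^esub> x) = x"
    using u assms by (simp flip: M.smult_assoc1)
qed

lemma (in abelian_group) add_eq_imp_minus:
  assumes "x = u \<oplus> v" "u \<in> carrier G" "v \<in> carrier G"
  shows "v = \<ominus> u \<oplus> x" "u = x \<oplus> \<ominus> v"
  using assms by (simp_all add: r_neg1 a_assoc r_neg)

text \<open>A submodule \<open>H\<close> that is maximal among those containing \<open>V\<close> and
  meeting \<open>U\<close> trivially is a complement: a vector \<open>y\<close> outside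
  \<open>U + H\<close> could be adjoined to \<open>H\<close>. Prescribing \<open>V\<close> permits
  extensions of maps that vanish on a given subspace.\<close>

lemma submodule_complement:
  assumes "field K" "module K M" "submodule U K M" "submodule V K M" "U \<inter> V \<subseteq> {\<zero>\<^bsub>M\<^esub>}"
  obtains H where "submodule H K M" "V \<subseteq> H" "U \<inter> H \<subseteq> {\<zero>\<^bsub>M\<^esub>}"
    "\<And>x. x \<in> carrier M \<Longrightarrow> \<exists>u \<in> U. \<exists>h \<in> H. x = u \<oplus>\<^bsub>M\<^esub> h"
proof -
  interpret K: field K by fact
  interpret M: module K M by fact
  define \<A> where "\<A> = {H. submodule H K M \<and> V \<subseteq> H \<and> U \<inter> H \<subseteq> {\<zero>\<^bsub>M\<^esub>}}"
  have "\<exists>H \<in> \<A>. \<forall>X \<in> \<A>. H \<subseteq> X \<longrightarrow> X = H"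
  proof (rule subset_Zorn_nonempty)
    show "\<A> \<noteq> {}" using assms by (auto simp: \<A>_def)
    fix \<C> assume ne: "\<C> \<noteq> {}" and ch: "subset.chain \<A> \<C>"
    have sub: "\<C> \<subseteq> \<A>" and tot: "\<And>x y. x \<in> \<C> \<Longrightarrow> y \<in> \<C> \<Longrightarrow> x \<subseteq> y \<or> y \<subseteq> x"
      using ch by (auto simp: subset.chain_def)
    have "submodule (\<Union>\<C>) K M"
      by (rule chain_Union_submodule[OF assms(2) ne _ tot]) (use sub in \<open>auto simp: \<A>_def\<close>)
    then show "\<Union>\<C> \<in> \<A>" using sub ne unfolding \<A>_def by blast
  qed
  then obtain H where H: "submodule H K M" "V \<subseteq> H" "U \<inter> H \<subseteq> {\<zero>\<^bsub>M\<^esub>}"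
    and max: "\<And>X. X \<in> \<A> \<Longrightarrow> H \<subseteq> X \<Longrightarrow> X = H" by (auto simp: \<A>_def)
  have Uc: "u \<in> carrier M" if "u \<in> U" for u using that submodule_subset[OF assms(3)] by auto
  have Hc: "u \<in> carrier M" if "u \<in> H" for u using that submodule_subset[OF H(1)] by auto
  have "\<exists>u \<in> U. \<exists>h \<in> H. y = u \<oplus>\<^bsub>M\<^esub> h" if y: "y \<in> carrier M" for y
  proof (rule ccontr)
    assume no: "\<not> (\<exists>u \<in> U. \<exists>h \<in> H. y = u \<oplus>\<^bsub>M\<^esub> h)"
    let ?S = "{h \<oplus>\<^bsub>M\<^esub> a \<odot>\<^bsub>M\<^esub> y | h a. h \<in> H \<and> a \<in> carrier K}"
    have S: "submodule ?S K M" by (rule smult_sum_submodule[OF assms(2) H(1) y])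
    have HS: "H \<subseteq> ?S"
    proof
      fix h assume "h \<in> H"
      moreover from this have "h = h \<oplus>\<^bsub>M\<^esub> \<zero>\<^bsub>K\<^esub> \<odot>\<^bsub>M\<^esub> y" using y Hc by simp
      ultimately show "h \<in> ?S" using K.zero_closed by blast
    qed
    have yS: "y \<in> ?S"
      using submodule_zero[OF H(1)] y by (auto intro!: exI[of _ "\<zero>\<^bsub>M\<^esub>"] exI[of _ "\<one>\<^bsub>K\<^esub>"])
    have yH: "y \<notin> H"
      using no submodule_zero[OF assms(3)] y by (metis M.l_zero)
    have "U \<inter> ?S \<subseteq> {\<zero>\<^bsub>M\<^esub>}"
    proof
      fix u assume "u \<in> U \<inter> ?S"
      then obtain h a where u: "u \<in> U" "u = h \<oplus>\<^bsub>M\<^esub> a \<odot>\<^bsub>M\<^esub> y" "h \<in> H" "a \<in> carrier K" by auto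
      show "u \<in> {\<zero>\<^bsub>M\<^esub>}"
      proof (cases "a = \<zero>\<^bsub>K\<^esub>")
        case True
        then have "u = h" using u y Hc by simp
        then show ?thesis using u H(3) by auto
      next
        \<comment> \<open>A nonzero coefficient can be inverted, so \<open>u = h + a y\<close> would
          express \<open>y\<close> through \<open>U\<close> and \<open>H\<close>.\<close>
        case False
        let ?i = "inv\<^bsub>K\<^esub> a"
        note i = field_smult_cancel[OF assms(1,2) u(4) False y]
        have "a \<odot>\<^bsub>M\<^esub> y = \<ominus>\<^bsub>M\<^esub> h \<oplus>\<^bsub>M\<^esub> u" using M.add_eq_imp_minus(1)[OF u(2)] u y Hc by simp
        then have "y = ?i \<odot>\<^bsub>M\<^esub> (\<ominus>\<^bsub>M\<^esub> h \<oplus>\<^bsub>M\<^esub> u)" using i by simp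
        also have "\<dots> = ?i \<odot>\<^bsub>M\<^esub> u \<oplus>\<^bsub>M\<^esub> ?i \<odot>\<^bsub>M\<^esub> (\<ominus>\<^bsub>M\<^esub> h)"
          using i u Hc Uc by (simp add: M.smult_r_distr M.a_comm)
        finally have "\<exists>u \<in> U. \<exists>h \<in> H. y = u \<oplus>\<^bsub>M\<^esub> h"
          using submodule_smult[OF assms(3) i(1) u(1)]
            submodule_smult[OF H(1) i(1) submodule_minus[OF H(1) u(3)]] by blast
        then show ?thesis using no by simp
      qed
    qed
    then have "?S \<in> \<A>" using S HS H by (auto simp: \<A>_def)
    then show False using max[OF _ HS] yS yH by auto
  qed
  with that H show ?thesis by blast
qed

text \<open>The extension is \<open>g\<close> after the projection onto \<open>U\<close> along a
  complement that contains \<open>V\<close>.\<close>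

lemma lin_map_extend:
  assumes "field K" "module K M" "module K N" "submodule U K M" "submodule V K M" "U \<inter> V \<subseteq> {\<zero>\<^bsub>M\<^esub>}"
    and g: "\<And>u. u \<in> U \<Longrightarrow> g u \<in> carrier N"
      "\<And>u u'. u \<in> U \<Longrightarrow> u' \<in> U \<Longrightarrow> g (u \<oplus>\<^bsub>M\<^esub> u') = g u \<oplus>\<^bsub>N\<^esub> g u'"
      "\<And>a u. a \<in> carrier K \<Longrightarrow> u \<in> U \<Longrightarrow> g (a \<odot>\<^bsub>M\<^esub> u) = a \<odot>\<^bsub>N\<^esub> g u"
  shows "\<exists>f \<in> lin_maps K M N. (\<forall>u \<in> U. f u = g u) \<and> (\<forall>v \<in> V. f v = \<zero>\<^bsub>N\<^esub>)"
proof -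
  interpret M: module K M by fact
  interpret N: module K N by fact
  obtain H where H: "submodule H K M" "V \<subseteq> H" "U \<inter> H \<subseteq> {\<zero>\<^bsub>M\<^esub>}"
    and dec: "\<And>x. x \<in> carrier M \<Longrightarrow> \<exists>u \<in> U. \<exists>h \<in> H. x = u \<oplus>\<^bsub>M\<^esub> h"
    by (rule submodule_complement[OF assms(1,2,4,5,6)]) blast
  have Uc: "u \<in> carrier M" if "u \<in> U" for u using that submodule_subset[OF assms(4)] by auto
  have Hc: "u \<in> carrier M" if "u \<in> H" for u using that submodule_subset[OF H(1)] by auto
  have uniq: "u = u'" if "u \<in> U" "u' \<in> U" "h \<in> H" "h' \<in> H" "u \<oplus>\<^bsub>M\<^esub> h = u' \<oplus>\<^bsub>M\<^esub> h'" for u u' h h'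
  proof -
    have "u = u' \<oplus>\<^bsub>M\<^esub> (h' \<oplus>\<^bsub>M\<^esub> \<ominus>\<^bsub>M\<^esub> h)"
      using M.add_eq_imp_minus(2)[OF that(5)[symmetric]] that Uc Hc by (simp add: M.a_assoc)
    then have e: "\<ominus>\<^bsub>M\<^esub> u' \<oplus>\<^bsub>M\<^esub> u = h' \<oplus>\<^bsub>M\<^esub> \<ominus>\<^bsub>M\<^esub> h"
      using M.add_eq_imp_minus(1)[of u u' "h' \<oplus>\<^bsub>M\<^esub> \<ominus>\<^bsub>M\<^esub> h"] that Uc Hc by simp
    have "\<ominus>\<^bsub>M\<^esub> u' \<oplus>\<^bsub>M\<^esub> u \<in> U \<inter> H"
      using submodule_add[OF assms(4) submodule_minus[OF assms(4) that(2)] that(1)]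
        submodule_add[OF H(1) that(4) submodule_minus[OF H(1) that(3)]] e by simp
    then have "\<ominus>\<^bsub>M\<^esub> u' \<oplus>\<^bsub>M\<^esub> u = \<zero>\<^bsub>M\<^esub>" using H(3) by auto
    then show ?thesis using that Uc by (metis M.a_inv_closed M.minus_equality M.minus_minus M.a_comm)
  qed
  define p where "p x = (SOME u. u \<in> U \<and> (\<exists>h \<in> H. x = u \<oplus>\<^bsub>M\<^esub> h))" for x
  have p: "p (u \<oplus>\<^bsub>M\<^esub> h) = u" if "u \<in> U" "h \<in> H" for u h
  proof -
    have "p (u \<oplus>\<^bsub>M\<^esub> h) \<in> U \<and> (\<exists>h' \<in> H. u \<oplus>\<^bsub>M\<^esub> h = p (u \<oplus>\<^bsub>M\<^esub> h) \<oplus>\<^bsub>M\<^esub> h')"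
      unfolding p_def by (rule someI[of _ u]) (use that in blast)
    then show ?thesis using uniq that by metis
  qed
  have "(\<lambda>x \<in> carrier M. g (p x)) \<in> lin_maps K M N"
  proof (rule lin_maps_restrictI[OF assms(2)])
    fix x assume "x \<in> carrier M"
    then obtain u h where x: "u \<in> U" "h \<in> H" "x = u \<oplus>\<^bsub>M\<^esub> h" using dec by blast
    show "g (p x) \<in> carrier N" using x p g by simp
    { fix y assume "y \<in> carrier M"
      then obtain v k where y: "v \<in> U" "k \<in> H" "y = v \<oplus>\<^bsub>M\<^esub> k" using dec by blast
      have "x \<oplus>\<^bsub>M\<^esub> y = (u \<oplus>\<^bsub>M\<^esub> v) \<oplus>\<^bsub>M\<^esub> (h \<oplus>\<^bsub>M\<^esub> k)" using x y Uc Hc by (simp add: M.add.m_ac)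
      then have "p (x \<oplus>\<^bsub>M\<^esub> y) = u \<oplus>\<^bsub>M\<^esub> v"
        using p[OF submodule_add[OF assms(4) x(1) y(1)] submodule_add[OF H(1) x(2) y(2)]] by simp
      then show "g (p (x \<oplus>\<^bsub>M\<^esub> y)) = g (p x) \<oplus>\<^bsub>N\<^esub> g (p y)" using x y p g by simp }
    { fix a assume a: "a \<in> carrier K"
      have "a \<odot>\<^bsub>M\<^esub> x = a \<odot>\<^bsub>M\<^esub> u \<oplus>\<^bsub>M\<^esub> a \<odot>\<^bsub>M\<^esub> h" using x a Uc Hc by (simp add: M.smult_r_distr)
      then have "p (a \<odot>\<^bsub>M\<^esub> x) = a \<odot>\<^bsub>M\<^esub> u"
        using p[OF submodule_smult[OF assms(4) a x(1)] submodule_smult[OF H(1) a x(2)]] by simp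
      then show "g (p (a \<odot>\<^bsub>M\<^esub> x)) = a \<odot>\<^bsub>N\<^esub> g (p x)" using x a p g by simp }
  qed
  moreover have "g (p u) = g u" if "u \<in> U" for u
    using p[OF that submodule_zero[OF H(1)]] that Uc by simp
  moreover have "g (p v) = \<zero>\<^bsub>N\<^esub>" if "v \<in> V" for v
  proof -
    have z: "\<zero>\<^bsub>M\<^esub> \<in> U" by (rule submodule_zero[OF assms(4)])
    have "g (\<zero>\<^bsub>K\<^esub> \<odot>\<^bsub>M\<^esub> \<zero>\<^bsub>M\<^esub>) = \<zero>\<^bsub>K\<^esub> \<odot>\<^bsub>N\<^esub> g \<zero>\<^bsub>M\<^esub>" by (rule g(3)) (use z in auto)
    then have "g \<zero>\<^bsub>M\<^esub> = \<zero>\<^bsub>N\<^esub>" using g(1)[OF z] by simp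
    moreover have "p v = \<zero>\<^bsub>M\<^esub>" using p[OF z, of v] that H(2) Hc by auto
    ultimately show ?thesis by simp
  qed
  ultimately show ?thesis
    using Uc submodule_subset[OF assms(5)] by (intro bexI[of _ "\<lambda>x \<in> carrier M. g (p x)"]) auto
qed

lemma zero_submodule: "module K M \<Longrightarrow> submodule {\<zero>\<^bsub>M\<^esub>} K M"
proof -
  assume "module K M"
  then interpret M: module K M .
  show ?thesis by (rule M.submoduleI) (use M.minus_equality[of "\<zero>\<^bsub>M\<^esub>" "\<zero>\<^bsub>M\<^esub>"] in auto)
qed

text \<open>On the image of \<open>p\<close> the value at \<open>p x\<close> must be
  \<open>f x\<close>, which the kernel condition makes well defined; over a field this map extends
  from the image to all of \<open>E\<close>. For injective \<open>p\<close> this yields left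
  inverses. For a differential \<open>p\<close> it turns exactness of a complex into exactness of
  the maps out of it.\<close>

lemma lin_map_factor:
  assumes "field K" "module K D" "module K E" "module K N"
    and p: "p \<in> lin_maps K D E" and f: "f \<in> lin_maps K D N"
    and ker: "\<And>x. x \<in> carrier D \<Longrightarrow> p x = \<zero>\<^bsub>E\<^esub> \<Longrightarrow> f x = \<zero>\<^bsub>N\<^esub>"
  shows "\<exists>g \<in> lin_maps K E N. \<forall>x \<in> carrier D. g (p x) = f x"
proof -
  interpret D: module K D by fact
  interpret E: module K E by fact
  interpret N: module K N by fact
  define g where "g y = f (SOME x. x \<in> carrier D \<and> p x = y)" for y
  have g: "g (p x) = f x" if "x \<in> carrier D" for x
  proof -
    define x' where "x' = (SOME x'. x' \<in> carrier D \<and> p x' = p x)"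
    have x': "x' \<in> carrier D" "p x' = p x"
      using someI[of "\<lambda>x'. x' \<in> carrier D \<and> p x' = p x" x] that by (auto simp: x'_def)
    have "p (x' \<ominus>\<^bsub>D\<^esub> x) = \<zero>\<^bsub>E\<^esub>"
      using that x' lin_maps_closed[OF p, of x] lin_maps_a_minus[OF assms(2,3) p, of x' x]
      by (simp add: a_minus_def[of E] E.r_neg)
    then have "f x' \<ominus>\<^bsub>N\<^esub> f x = \<zero>\<^bsub>N\<^esub>" using ker[of "x' \<ominus>\<^bsub>D\<^esub> x"] that x' lin_maps_a_minus[OF assms(2,4) f] by simp
    then have "f x' = f x"
      using that x' lin_maps_closed[OF f] by (metis N.minus_equality N.minus_minus N.a_inv_closed a_minus_def)
    then show ?thesis unfolding g_def x'_def by simp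
  qed
  have "\<exists>h \<in> lin_maps K E N. (\<forall>u \<in> p ` carrier D. h u = g u) \<and> (\<forall>v \<in> {\<zero>\<^bsub>E\<^esub>}. h v = \<zero>\<^bsub>N\<^esub>)"
  proof (rule lin_map_extend[OF assms(1,3,4) image_submodule[OF assms(2,3) p] zero_submodule[OF assms(3)]])
    show "g u \<in> carrier N" if "u \<in> p ` carrier D" for u using that g lin_maps_closed[OF f] by auto
    show "g (u \<oplus>\<^bsub>E\<^esub> u') = g u \<oplus>\<^bsub>N\<^esub> g u'" if "u \<in> p ` carrier D" "u' \<in> p ` carrier D" for u u'
      using that g by (auto simp: lin_maps_add[OF f] simp flip: lin_maps_add[OF p])
    show "g (a \<odot>\<^bsub>E\<^esub> u) = a \<odot>\<^bsub>N\<^esub> g u" if "a \<in> carrier K" "u \<in> p ` carrier D" for a u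
      using that g by (auto simp: lin_maps_smult[OF f] simp flip: lin_maps_smult[OF p])
  qed auto
  then show ?thesis using g by auto
qed

text \<open>The functional reads the coefficient on the line through \<open>b\<close> and vanishes
  on \<open>U\<close>. The line and \<open>U\<close> meet only in zero because \<open>b\<close> lies
  outside \<open>U\<close>.\<close>

lemma separating_functional:
  assumes "field K" "module K M" "submodule U K M" "b \<in> carrier M" "b \<notin> U"
  shows "\<exists>\<delta> \<in> lin_maps K M (self_module K). \<delta> b = \<one>\<^bsub>K\<^esub> \<and> (\<forall>u \<in> U. \<delta> u = \<zero>\<^bsub>K\<^esub>)"
proof -
  interpret K: field K by fact
  interpret M: module K M by fact
  let ?p = "\<lambda>a \<in> carrier (self_module K). a \<odot>\<^bsub>M\<^esub> b"
  have S: "module K (self_module K)" by (rule self_module_module) (rule K.is_cring)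
  have p: "?p \<in> lin_maps K (self_module K) M"
    by (rule lin_maps_restrictI[OF S]) (use assms(4) in \<open>auto simp: M.smult_l_distr M.smult_assoc1\<close>)
  have UZ: "a = \<zero>\<^bsub>K\<^esub>" if "a \<in> carrier K" "a \<odot>\<^bsub>M\<^esub> b \<in> U" for a
    using field_smult_cancel[OF assms(1,2) that(1) _ assms(4)] submodule_smult[OF assms(3) _ that(2)] assms(5)
    by metis
  let ?Kb = "?p ` carrier (self_module K)"
  define g where "g x = (THE a. a \<in> carrier K \<and> x = a \<odot>\<^bsub>M\<^esub> b)" for x
  have g: "g (a \<odot>\<^bsub>M\<^esub> b) = a" if "a \<in> carrier K" for a
    unfolding g_def
  proof (rule the_equality)
    fix a' assume a': "a' \<in> carrier K \<and> a \<odot>\<^bsub>M\<^esub> b = a' \<odot>\<^bsub>M\<^esub> b"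
    have "(a \<oplus>\<^bsub>K\<^esub> \<ominus>\<^bsub>K\<^esub> a') \<odot>\<^bsub>M\<^esub> b = \<zero>\<^bsub>M\<^esub>"
      using a' that assms(4) by (simp add: M.smult_l_distr M.smult_l_minus M.r_neg)
    then have "a \<oplus>\<^bsub>K\<^esub> \<ominus>\<^bsub>K\<^esub> a' = \<zero>\<^bsub>K\<^esub>" using UZ[of "a \<oplus>\<^bsub>K\<^esub> \<ominus>\<^bsub>K\<^esub> a'"] submodule_zero[OF assms(3)] that a' by simp
    then show "a' = a" using that a' by (metis K.minus_equality K.minus_minus K.a_inv_closed)
  qed (use that in simp)
  have "\<exists>f \<in> lin_maps K M (self_module K). (\<forall>u \<in> ?Kb. f u = g u) \<and> (\<forall>v \<in> U. f v = \<zero>\<^bsub>self_module K\<^esub>)"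
  proof (rule lin_map_extend[OF assms(1,2) S image_submodule[OF S assms(2) p] assms(3)])
    show "?Kb \<inter> U \<subseteq> {\<zero>\<^bsub>M\<^esub>}" using assms(4) by (auto dest!: UZ)
    show "g (u \<oplus>\<^bsub>M\<^esub> u') = g u \<oplus>\<^bsub>self_module K\<^esub> g u'" if "u \<in> ?Kb" "u' \<in> ?Kb" for u u'
      using that g assms(4) by (auto simp flip: M.smult_l_distr)
    show "g (a \<odot>\<^bsub>M\<^esub> u) = a \<odot>\<^bsub>self_module K\<^esub> g u" if "a \<in> carrier K" "u \<in> ?Kb" for a u
      using that g assms(4) by (auto simp flip: M.smult_assoc1)
  qed (use g in auto)
  then obtain f where f: "f \<in> lin_maps K M (self_module K)" "\<forall>u \<in> ?Kb. f u = g u" "\<forall>v \<in> U. f v = \<zero>\<^bsub>K\<^esub>"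
    by auto
  have "b \<in> ?Kb" "g b = \<one>\<^bsub>K\<^esub>" using g[of "\<one>\<^bsub>K\<^esub>"] assms(4) by (auto intro!: image_eqI[of _ _ "\<one>\<^bsub>K\<^esub>"])
  then show ?thesis using f by metis
qed

text \<open>The coordinate functionals in this definition express linear independence.\<close>

definition lin_basis ::
    "('k, 'r) ring_scheme \<Rightarrow> ('k, 'b, 'm) module_scheme \<Rightarrow> 'x set \<Rightarrow> ('x \<Rightarrow> 'b) \<Rightarrow> bool"
  where "lin_basis K M X v \<longleftrightarrow> v \<in> X \<rightarrow> carrier M \<and> lin_span K M (v ` X) = carrier M \<and>
    (\<forall>x \<in> X. \<exists>\<delta> \<in> lin_maps K M (self_module K). \<forall>y \<in> X. \<delta> (v y) = kron K y x)"

lemma lin_basis_eqI: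
  assumes "lin_basis K M X v" "module K M" "module K N" "f \<in> lin_maps K M N" "g \<in> lin_maps K M N"
    and "\<And>x. x \<in> X \<Longrightarrow> f (v x) = g (v x)"
  shows "f = g"
  by (rule lin_maps_eqI_span[OF assms(2-5), of "v ` X"]) (use assms(1,6) in \<open>auto simp: lin_basis_def\<close>)

text \<open>The coordinate functionals show that the map from the free module on \<open>X\<close> to
  \<open>M\<close> is injective, so the map that \<open>g\<close> prescribes on the free module
  factors through it.\<close>

lemma lin_basis_lift:
  assumes "field K" "lin_basis K M X v" "module K M" "module K N" "g \<in> X \<rightarrow> carrier N"
  shows "\<exists>h \<in> lin_maps K M N. \<forall>x \<in> X. h (v x) = g x"
proof -
  interpret K: field K by fact
  have c: "cring K" by (rule K.is_cring)
  have S: "module K (self_module K)" by (rule self_module_module[OF c])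
  let ?F = "free_module K X"
  have F: "module K ?F" by (rule free_module_module[OF c])
  have bv: "basis_vec K x \<in> carrier ?F" if "x \<in> X" for x by (rule basis_vec_closed[OF c that])
  have "v \<in> X \<rightarrow> carrier M" using assms(2) by (auto simp: lin_basis_def)
  from free_module_lift[OF assms(3) this] obtain p where
    p: "p \<in> lin_maps K ?F M" "\<forall>x \<in> X. p (basis_vec K x) = v x" by blast
  obtain q where q: "q \<in> lin_maps K ?F N" "\<forall>x \<in> X. q (basis_vec K x) = g x"
    using free_module_lift[OF assms(4,5)] by blast
  have "f = \<zero>\<^bsub>?F\<^esub>" if f: "f \<in> carrier ?F" "p f = \<zero>\<^bsub>M\<^esub>" for f
  proof
    fix x
    show "f x = \<zero>\<^bsub>?F\<^esub> x"
    proof (cases "x \<in> X")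
      case True
      then obtain \<delta> where \<delta>: "\<delta> \<in> lin_maps K M (self_module K)" "\<forall>y \<in> X. \<delta> (v y) = kron K y x"
        using assms(2) by (auto simp: lin_basis_def)
      have ev: "(\<lambda>f \<in> carrier ?F. f x) \<in> lin_maps K ?F (self_module K)"
        by (rule lin_maps_restrictI[OF F]) (auto simp: free_module_carrier free_module_simps)
      have "compose (carrier ?F) \<delta> p = (\<lambda>f \<in> carrier ?F. f x)"
        by (rule lin_maps_eqI_span[OF F S lin_maps_compose[OF F p(1) \<delta>(1)] ev free_module_span[OF c]])
          (use bv p(2) \<delta>(2) in \<open>auto simp: compose_eq basis_vec_def\<close>)
      from fun_cong[OF this, of f] have "f x = \<delta> \<zero>\<^bsub>M\<^esub>" using f by (simp add: compose_eq)
      then show ?thesis using lin_maps_zero[OF assms(3) S \<delta>(1)] by (simp add: free_module_simps)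
    qed (use f in \<open>simp add: free_module_carrier free_module_simps\<close>)
  qed
  then have "\<exists>h \<in> lin_maps K M N. \<forall>x \<in> carrier ?F. h (p x) = q x"
    using lin_maps_zero[OF F assms(4) q(1)] by (intro lin_map_factor[OF assms(1) F assms(3,4) p(1) q(1)]) auto
  then show ?thesis using p(2) q(2) bv by metis
qed

lemma lin_span_closed: "module K M \<Longrightarrow> A \<subseteq> carrier M \<Longrightarrow> lin_span K M A \<subseteq> carrier M"
  by (rule submodule_subset[OF lin_span_submodule])

text \<open>Independence is phrased through spans for the maximality argument and converted to
  coordinate functionals at the end, where \<open>separating_functional\<close> supplies
  them.\<close>

lemma lin_basis_exists:
  assumes "field K" "module K W"
  obtains B where "B \<subseteq> carrier W" "lin_basis K W B (\<lambda>b. b)"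
proof -
  interpret K: field K by fact
  interpret W: module K W by fact
  have S: "module K (self_module K)" by (rule self_module_module) (rule K.is_cring)
  define \<A> where "\<A> = {B. B \<subseteq> carrier W \<and> (\<forall>b \<in> B. b \<notin> lin_span K W (B - {b}))}"
  have "\<exists>B \<in> \<A>. \<forall>X \<in> \<A>. B \<subseteq> X \<longrightarrow> X = B"
  proof (rule subset_Zorn_nonempty)
    show "\<A> \<noteq> {}" by (auto simp: \<A>_def)
    fix \<C> assume ne: "\<C> \<noteq> {}" and ch: "subset.chain \<A> \<C>"
    have sub: "\<C> \<subseteq> \<A>" and tot: "\<And>x y. x \<in> \<C> \<Longrightarrow> y \<in> \<C> \<Longrightarrow> x \<subseteq> y \<or> y \<subseteq> x"
      using ch by (auto simp: subset.chain_def)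
    have cl: "X - {b} \<subseteq> carrier W" if "X \<in> \<C>" for X b using that sub by (auto simp: \<A>_def)
    have "b \<notin> lin_span K W (\<Union>\<C> - {b})" if b: "b \<in> \<Union>\<C>" for b
    proof
      assume bs: "b \<in> lin_span K W (\<Union>\<C> - {b})"
      \<comment> \<open>The spans of the members of the chain without \<open>b\<close> form a chain
        too, so their union is a submodule. Hence a dependence of \<open>b\<close> on the union of
        the chain already occurs within one member.\<close>
      let ?D = "(\<lambda>X. lin_span K W (X - {b})) ` \<C>"
      have tot': "lin_span K W (X - {b}) \<subseteq> lin_span K W (Y - {b}) \<or> lin_span K W (Y - {b}) \<subseteq> lin_span K W (X - {b})"
        if "X \<in> \<C>" "Y \<in> \<C>" for X Y
        using tot[OF that] by (metis Diff_mono lin_span_mono order_refl)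
      have "submodule (\<Union>?D) K W"
      proof (rule chain_Union_submodule[OF assms(2)])
        show "submodule N K W" if "N \<in> ?D" for N using that lin_span_submodule[OF assms(2) cl] by auto
        show "N \<subseteq> N' \<or> N' \<subseteq> N" if "N \<in> ?D" "N' \<in> ?D" for N N' using that tot' by blast
      qed (use ne in simp)
      moreover have "\<Union>\<C> - {b} \<subseteq> \<Union>?D"
      proof
        fix y assume "y \<in> \<Union>\<C> - {b}"
        then obtain X where "X \<in> \<C>" "y \<in> X - {b}" by auto
        then show "y \<in> \<Union>?D" using lin_span_superset[of "X - {b}" K W] by auto
      qed
      ultimately have "lin_span K W (\<Union>\<C> - {b}) \<subseteq> \<Union>?D" by (rule lin_span_least)
      then obtain X where X: "X \<in> \<C>" "b \<in> lin_span K W (X - {b})" using bs by auto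
      obtain Y where Y: "Y \<in> \<C>" "b \<in> Y" using b by auto
      have "X \<union> Y = X \<or> X \<union> Y = Y" using tot[OF X(1) Y(1)] by auto
      then have "X \<union> Y \<in> \<A>" using X Y sub by auto
      moreover have "b \<in> lin_span K W (X \<union> Y - {b})" using lin_span_mono[of "X - {b}" "X \<union> Y - {b}" K W] X by auto
      ultimately show False using Y by (auto simp: \<A>_def)
    qed
    then show "\<Union>\<C> \<in> \<A>" using sub by (auto simp: \<A>_def)
  qed
  then obtain B where B: "B \<subseteq> carrier W" "\<And>b. b \<in> B \<Longrightarrow> b \<notin> lin_span K W (B - {b})"
    and max: "\<And>X. X \<in> \<A> \<Longrightarrow> B \<subseteq> X \<Longrightarrow> X = B" by (auto simp: \<A>_def)
  have SB: "submodule (lin_span K W B) K W" by (rule lin_span_submodule[OF assms(2) B(1)])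
  have span: "lin_span K W B = carrier W"
  proof (rule ccontr)
    assume "lin_span K W B \<noteq> carrier W"
    then obtain y where y: "y \<in> carrier W" "y \<notin> lin_span K W B"
      using lin_span_closed[OF assms(2) B(1)] by blast
    have yB: "y \<notin> B" using y lin_span_superset[of B K W] by auto
    have "b \<notin> lin_span K W (insert y B - {b})" if b: "b \<in> B" for b
    proof -
      have S': "submodule (lin_span K W (B - {b})) K W" using B by (intro lin_span_submodule[OF assms(2)]) auto
      have bW: "b \<in> carrier W" using b B(1) by auto
      obtain \<epsilon> where \<epsilon>: "\<epsilon> \<in> lin_maps K W (self_module K)" "\<epsilon> b = \<one>\<^bsub>K\<^esub>" "\<And>u. u \<in> lin_span K W (B - {b}) \<Longrightarrow> \<epsilon> u = \<zero>\<^bsub>K\<^esub>"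
        using separating_functional[OF assms S' bW B(2)[OF b]] by blast
      obtain \<delta> where \<delta>: "\<delta> \<in> lin_maps K W (self_module K)" "\<delta> y = \<one>\<^bsub>K\<^esub>" "\<And>u. u \<in> lin_span K W B \<Longrightarrow> \<delta> u = \<zero>\<^bsub>K\<^esub>"
        using separating_functional[OF assms SB y] by blast
      have cl: "\<epsilon> y \<in> carrier K" using lin_maps_closed[OF \<epsilon>(1) y(1)] by simp
      \<comment> \<open>This is \<open>\<epsilon> - \<epsilon> y \<delta>\<close>. The correction
        makes it vanish at \<open>y\<close> and leaves the values on \<open>B\<close> unchanged, so
        it separates \<open>b\<close> from the rest of \<open>insert y B\<close>.\<close>
      let ?f = "\<lambda>x \<in> carrier W. \<epsilon> x \<oplus>\<^bsub>self_module K\<^esub> (\<lambda>x \<in> carrier W. (\<ominus>\<^bsub>K\<^esub> \<epsilon> y) \<odot>\<^bsub>self_module K\<^esub> \<delta> x) x"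
      have f: "?f \<in> lin_maps K W (self_module K)"
        by (rule lin_maps_plus[OF assms(2) S \<epsilon>(1) lin_maps_scale[OF assms(2) S \<delta>(1)]]) (use cl in simp)
      have fB: "?f u = \<zero>\<^bsub>K\<^esub>" if "u \<in> B - {b}" for u
        using that B(1) \<epsilon>(3)[OF subsetD[OF lin_span_superset that]] \<delta>(3)[OF subsetD[OF lin_span_superset, of u B]] cl by auto
      have "insert y B - {b} \<subseteq> {u \<in> carrier W. ?f u = \<zero>\<^bsub>self_module K\<^esub>}"
      proof
        fix u assume u: "u \<in> insert y B - {b}"
        show "u \<in> {u \<in> carrier W. ?f u = \<zero>\<^bsub>self_module K\<^esub>}"
        proof (cases "u = y")
          case True
          then show ?thesis using y(1) \<delta>(2) cl by (simp add: K.r_neg)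
        next
          case False
          then have "u \<in> B - {b}" using u by auto
          then show ?thesis using fB[of u] B(1) by auto
        qed
      qed
      then have "lin_span K W (insert y B - {b}) \<subseteq> {u \<in> carrier W. ?f u = \<zero>\<^bsub>self_module K\<^esub>}"
        by (rule lin_span_least[OF kernel_submodule[OF assms(2) S f]])
      moreover have "?f b = \<one>\<^bsub>K\<^esub>"
        using \<epsilon>(2) \<delta>(3)[OF subsetD[OF lin_span_superset b]] bW cl by simp
      ultimately show ?thesis by auto
    qed
    then have "insert y B \<in> \<A>" using B(1) y yB by (auto simp: \<A>_def)
    then show False using max[of "insert y B"] yB by auto
  qed
  have "\<exists>\<delta> \<in> lin_maps K W (self_module K). \<forall>y \<in> B. \<delta> y = kron K y b" if b: "b \<in> B" for b
  proof -
    have S': "submodule (lin_span K W (B - {b})) K W" using B by (intro lin_span_submodule[OF assms(2)]) auto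
    obtain \<delta> where "\<delta> \<in> lin_maps K W (self_module K)" "\<delta> b = \<one>\<^bsub>K\<^esub>" "\<forall>u \<in> lin_span K W (B - {b}). \<delta> u = \<zero>\<^bsub>K\<^esub>"
      using separating_functional[OF assms S' _ B(2)[OF b]] b B(1) by blast
    then show ?thesis using lin_span_superset[of "B - {b}" K W] by (intro bexI[of _ \<delta>]) auto
  qed
  then have "lin_basis K W B (\<lambda>b. b)" using B(1) span by (auto simp: lin_basis_def)
  with that B(1) show ?thesis by blast
qed

section \<open>Words over a basis\<close>

lemma multilin_lin:
  "multilin K W n Q g \<Longrightarrow> set xs \<subseteq> carrier W \<Longrightarrow> set ys \<subseteq> carrier W \<Longrightarrow> length xs + 1 + length ys = n \<Longrightarrow>
    (\<lambda>u \<in> carrier W. g (xs @ u # ys)) \<in> lin_maps K W Q"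
  by (auto simp: multilin_def)

text \<open>Letters are treated from left to right: those in \<open>xs\<close> are basis vectors
  already, those in \<open>ys\<close> are arbitrary. Linearity in the first arbitrary letter reduces
  it to basis vectors.\<close>

lemma multilin_basis_span:
  assumes "module K W" "module K Q" "multilin K W n Q g" "submodule N K Q" "B \<subseteq> carrier W"
    and span: "lin_span K W B = carrier W"
    and N: "\<And>ws. set ws \<subseteq> B \<Longrightarrow> length ws = n \<Longrightarrow> g ws \<in> N"
    and ws: "set ws \<subseteq> carrier W" "length ws = n"
  shows "g ws \<in> N"
proof -
  have "set xs \<subseteq> B \<Longrightarrow> set ys \<subseteq> carrier W \<Longrightarrow> length xs + length ys = n \<Longrightarrow> g (xs @ ys) \<in> N" for xs ys
  proof (induction ys arbitrary: xs)
    case Nil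
    then show ?case using N by simp
  next
    case (Cons y ys)
    have l: "(\<lambda>u \<in> carrier W. g (xs @ u # ys)) \<in> lin_maps K W Q"
      using assms(3,5) Cons.prems by (auto simp: multilin_def)
    have "B \<subseteq> {u \<in> carrier W. (\<lambda>u \<in> carrier W. g (xs @ u # ys)) u \<in> N}"
    proof
      fix b assume b: "b \<in> B"
      have "g ((xs @ [b]) @ ys) \<in> N" by (rule Cons.IH) (use Cons.prems b in auto)
      then show "b \<in> {u \<in> carrier W. (\<lambda>u \<in> carrier W. g (xs @ u # ys)) u \<in> N}" using b assms(5) by auto
    qed
    then have "carrier W \<subseteq> {u \<in> carrier W. (\<lambda>u \<in> carrier W. g (xs @ u # ys)) u \<in> N}"
      unfolding span[symmetric] by (rule lin_span_least[OF preimage_submodule[OF assms(1,2) l assms(4), unfolded span[symmetric]]])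
    then show ?case using Cons.prems by auto
  qed
  from this[of "[]" ws] show ?thesis using ws by simp
qed

lemma tensor_power_basis_span:
  assumes "module K W" "B \<subseteq> carrier W" "lin_span K W B = carrier W"
  shows "lin_span K (tensor_power K W n) (tword K W ` tuples B n) = carrier (tensor_power K W n)"
    (is "lin_span K ?T ?A = _")
proof
  have T: "module K ?T" by (rule tensor_power_module[OF assms(1)])
  have A: "?A \<subseteq> carrier ?T" using tword_closed[OF assms(1)] assms(2) by fast
  show "lin_span K ?T ?A \<subseteq> carrier ?T" by (rule lin_span_closed[OF T A])
  have "tword K W ws \<in> lin_span K ?T ?A" if "set ws \<subseteq> carrier W" "length ws = n" for ws
    by (rule multilin_basis_span[OF assms(1) T tword_multilin[OF assms(1)] lin_span_submodule[OF T A] assms(2,3) _ that])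
      (use lin_span_superset[of ?A K ?T] in auto)
  then have "lin_span K ?T (tword K W ` tuples (carrier W) n) \<subseteq> lin_span K ?T ?A"
    by (intro lin_span_least lin_span_submodule[OF T A]) auto
  then show "carrier ?T \<subseteq> lin_span K ?T ?A" by (simp add: tensor_power_span[OF assms(1)])
qed

lemma ext_power_basis_span:
  assumes "module K W" "B \<subseteq> carrier W" "lin_span K W B = carrier W"
  shows "lin_span K (ext_power K W n) (wedge K W ` tuples B n) = carrier (ext_power K W n)"
    (is "lin_span K ?T ?A = _")
proof
  have T: "module K ?T" by (rule ext_power_module[OF assms(1)])
  have A: "?A \<subseteq> carrier ?T" using wedge_closed[OF assms(1)] assms(2) by fast
  show "lin_span K ?T ?A \<subseteq> carrier ?T" by (rule lin_span_closed[OF T A])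
  have "wedge K W ws \<in> lin_span K ?T ?A" if "set ws \<subseteq> carrier W" "length ws = n" for ws
    by (rule multilin_basis_span[OF assms(1) T wedge_multilin[OF assms(1)] lin_span_submodule[OF T A] assms(2,3) _ that])
      (use lin_span_superset[of ?A K ?T] in auto)
  then have "lin_span K ?T (wedge K W ` tuples (carrier W) n) \<subseteq> lin_span K ?T ?A"
    by (intro lin_span_least lin_span_submodule[OF T A]) auto
  then show "carrier ?T \<subseteq> lin_span K ?T ?A" by (simp add: ext_power_span[OF assms(1)])
qed

text \<open>On lists of equal length this is the tensor product of the functionals
  \<open>\<delta> b\<close>, one factor per letter; it yields the coordinate functionals of the word
  basis. The value one for exhausted lists is the empty product.\<close>

fun coord_prod :: "('k, 'r) ring_scheme \<Rightarrow> ('w \<Rightarrow> 'w \<Rightarrow> 'k) \<Rightarrow> 'w list \<Rightarrow> 'w list \<Rightarrow> 'k" where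
  "coord_prod K \<delta> (b # bs) (u # us) = \<delta> b u \<otimes>\<^bsub>K\<^esub> coord_prod K \<delta> bs us"
| "coord_prod K \<delta> _ _ = \<one>\<^bsub>K\<^esub>"

lemma coord_prod_closed:
  assumes "cring K" "\<And>b. b \<in> B \<Longrightarrow> \<delta> b \<in> lin_maps K W (self_module K)"
    "set bs \<subseteq> B" "set us \<subseteq> carrier W"
  shows "coord_prod K \<delta> bs us \<in> carrier K"
proof -
  interpret cring K by fact
  have "\<delta> b u \<in> carrier K" if "b \<in> B" "u \<in> carrier W" for b u
    using lin_maps_closed[OF assms(2)[OF that(1)] that(2)] by simp
  then show ?thesis using assms(3,4)
  proof (induction bs arbitrary: us)
    case (Cons b bs)
    then show ?case by (cases us) auto
  qed simp
qed

lemma coord_prod_multilin: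
  assumes "module K W" "\<And>b. b \<in> B \<Longrightarrow> \<delta> b \<in> lin_maps K W (self_module K)" "set bs \<subseteq> B"
  shows "multilin K W (length bs) (self_module K) (coord_prod K \<delta> bs)"
proof -
  interpret W: module K W by fact
  have dc: "\<delta> b u \<in> carrier K" if "b \<in> B" "u \<in> carrier W" for b u
    using lin_maps_closed[OF assms(2)[OF that(1)] that(2)] by simp
  note cl = coord_prod_closed[where \<delta> = \<delta> and B = B and W = W, OF W.is_cring assms(2), simplified]
  show ?thesis
  proof (rule multilinI[OF assms(1) self_module_module[OF W.is_cring]])
    show "coord_prod K \<delta> bs ws \<in> carrier (self_module K)" if "set ws \<subseteq> carrier W" "length ws = length bs" for ws
      using cl assms(3) that by simp
    fix a b u v xs ys
    assume *: "a \<in> carrier K" "b \<in> carrier K" "u \<in> carrier W" "v \<in> carrier W"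
      "set xs \<subseteq> carrier W" "set ys \<subseteq> carrier W" "length xs + 1 + length ys = length bs"
    have "coord_prod K \<delta> bs (xs @ comb W a u b v # ys) =
        a \<otimes>\<^bsub>K\<^esub> coord_prod K \<delta> bs (xs @ u # ys) \<oplus>\<^bsub>K\<^esub> b \<otimes>\<^bsub>K\<^esub> coord_prod K \<delta> bs (xs @ v # ys)"
      using *(5,7) assms(3)
    proof (induction xs arbitrary: bs)
      case Nil
      then obtain c cs where bs: "bs = c # cs" by (cases bs) auto
      have d: "\<delta> c (comb W a u b v) = a \<otimes>\<^bsub>K\<^esub> \<delta> c u \<oplus>\<^bsub>K\<^esub> b \<otimes>\<^bsub>K\<^esub> \<delta> c v"
        using Nil.prems bs * lin_maps_add[OF assms(2), of c "a \<odot>\<^bsub>W\<^esub> u" "b \<odot>\<^bsub>W\<^esub> v"]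
          lin_maps_smult[OF assms(2), of c a u] lin_maps_smult[OF assms(2), of c b v] by simp
      have "coord_prod K \<delta> cs ys \<in> carrier K" "\<delta> c u \<in> carrier K" "\<delta> c v \<in> carrier K"
        using cl dc Nil.prems bs * by auto
      then show ?case using d bs * by (simp add: W.l_distr W.m_assoc)
    next
      case (Cons x xs)
      then obtain c cs where bs: "bs = c # cs" by (cases bs) auto
      have IH: "coord_prod K \<delta> cs (xs @ comb W a u b v # ys) =
        a \<otimes>\<^bsub>K\<^esub> coord_prod K \<delta> cs (xs @ u # ys) \<oplus>\<^bsub>K\<^esub> b \<otimes>\<^bsub>K\<^esub> coord_prod K \<delta> cs (xs @ v # ys)"
        by (rule Cons.IH) (use Cons.prems bs in auto)
      have "coord_prod K \<delta> cs (xs @ u # ys) \<in> carrier K" "coord_prod K \<delta> cs (xs @ v # ys) \<in> carrier K"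
        "\<delta> c x \<in> carrier K"
        using cl dc Cons.prems bs * by auto
      then show ?case using bs IH * by (simp add: W.r_distr W.m_lcomm)
    qed
    then show "coord_prod K \<delta> bs (xs @ comb W a u b v # ys) =
        a \<odot>\<^bsub>self_module K\<^esub> coord_prod K \<delta> bs (xs @ u # ys) \<oplus>\<^bsub>self_module K\<^esub> b \<odot>\<^bsub>self_module K\<^esub> coord_prod K \<delta> bs (xs @ v # ys)"
      by simp
  qed
qed

lemma coord_prod_basis:
  assumes "cring K" "\<And>b b'. b \<in> B \<Longrightarrow> b' \<in> B \<Longrightarrow> \<delta> b b' = kron K b' b"
    and "set bs \<subseteq> B" "set cs \<subseteq> B" "length bs = length cs"
  shows "coord_prod K \<delta> bs cs = kron K cs bs"
proof -
  interpret cring K by fact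
  show ?thesis using assms(5,3,4)
    by (induction bs cs rule: list_induct2) (use assms(2) in auto)
qed

lemma tensor_power_basis:
  assumes "module K W" "B \<subseteq> carrier W" "lin_basis K W B (\<lambda>b. b)"
  shows "lin_basis K (tensor_power K W n) (tuples B n) (tword K W)"
proof -
  interpret W: module K W by fact
  have S: "module K (self_module K)" by (rule self_module_module[OF W.is_cring])
  have "\<forall>b \<in> B. \<exists>\<delta> \<in> lin_maps K W (self_module K). \<forall>y \<in> B. \<delta> y = kron K y b"
    using assms(3) by (simp add: lin_basis_def)
  then obtain \<delta> where \<delta>: "\<And>b. b \<in> B \<Longrightarrow> \<delta> b \<in> lin_maps K W (self_module K)"
    "\<And>b b'. b \<in> B \<Longrightarrow> b' \<in> B \<Longrightarrow> \<delta> b b' = kron K b' b" by metis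
  have "\<exists>\<gamma> \<in> lin_maps K (tensor_power K W n) (self_module K).
    \<forall>w' \<in> tuples B n. \<gamma> (tword K W w') = kron K w' w"
    if w: "set w \<subseteq> B" "length w = n" for w
  proof -
    obtain \<gamma> where \<gamma>: "\<gamma> \<in> lin_maps K (tensor_power K W n) (self_module K)"
      "\<forall>ws. set ws \<subseteq> carrier W \<and> length ws = n \<longrightarrow> \<gamma> (tword K W ws) = coord_prod K \<delta> w ws"
      using tensor_power_lift[OF assms(1) S coord_prod_multilin[where \<delta> = \<delta>, OF assms(1) \<delta>(1) w(1)]] w(2) by auto
    show ?thesis
    proof (rule bexI[OF _ \<gamma>(1)], safe)
      fix w' assume w': "set w' \<subseteq> B" "n = length w'"
      show "\<gamma> (tword K W w') = kron K w' w"
        using \<gamma>(2) w' w assms(2) coord_prod_basis[where \<delta> = \<delta>, OF W.is_cring \<delta>(2) w(1) w'(1)] by auto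
    qed
  qed
  moreover have "lin_span K W B = carrier W" using assms(3) by (simp add: lin_basis_def)
  ultimately show ?thesis
    using tensor_power_basis_span[OF assms(1,2)] tword_closed[OF assms(1)] assms(2)
    by (auto simp: lin_basis_def)
qed

section \<open>Exterior multiplication and contraction\<close>

text \<open>For fixed \<open>x\<close> and \<open>x'\<close>, additivity in the first argument is an
  equation of linear maps in \<open>y\<close>, so the generators \<open>A\<close> decide it; scalars
  are treated alike. Linearity in the first argument thus has to be known only at generators of the
  second.\<close>

lemma lin_map_of_family:
  assumes "module K M" "module K N" "module K Q" "lin_span K N A = carrier N"
    and \<alpha>: "\<And>x. x \<in> carrier M \<Longrightarrow> \<alpha> x \<in> lin_maps K N Q"
    and gen: "\<And>y. y \<in> A \<Longrightarrow> (\<lambda>x \<in> carrier M. \<alpha> x y) \<in> lin_maps K M Q"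
  shows "bilin K M N Q \<alpha>"
proof -
  interpret M: module K M by fact
  interpret N: module K N by fact
  interpret Q: module K Q by fact
  have A: "A \<subseteq> carrier N" using assms(4) lin_span_superset by metis
  note cl = lin_maps_closed[OF \<alpha>]
  have H: "module K (hom_module K N Q)" by (rule hom_module_module[OF assms(2,3)])
  interpret H: module K "hom_module K N Q" by (rule H)
  have add: "\<alpha> (x \<oplus>\<^bsub>M\<^esub> x') y = \<alpha> x y \<oplus>\<^bsub>Q\<^esub> \<alpha> x' y"
    if x: "x \<in> carrier M" "x' \<in> carrier M" and y: "y \<in> carrier N" for x x' y
  proof -
    have "\<alpha> (x \<oplus>\<^bsub>M\<^esub> x') = (\<lambda>y \<in> carrier N. \<alpha> x y \<oplus>\<^bsub>Q\<^esub> \<alpha> x' y)"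
    proof (rule lin_maps_eqI_span[OF assms(2,3) _ _ assms(4)])
      fix y assume "y \<in> A"
      then show "\<alpha> (x \<oplus>\<^bsub>M\<^esub> x') y = (\<lambda>y \<in> carrier N. \<alpha> x y \<oplus>\<^bsub>Q\<^esub> \<alpha> x' y) y"
        using lin_maps_add[OF gen x] x A by auto
    qed (use x \<alpha> lin_maps_plus[OF assms(2,3)] in auto)
    then show ?thesis using y by simp
  qed
  have smult: "\<alpha> (a \<odot>\<^bsub>M\<^esub> x) y = a \<odot>\<^bsub>Q\<^esub> \<alpha> x y"
    if x: "x \<in> carrier M" "a \<in> carrier K" and y: "y \<in> carrier N" for x a y
  proof -
    have "\<alpha> (a \<odot>\<^bsub>M\<^esub> x) = (\<lambda>y \<in> carrier N. a \<odot>\<^bsub>Q\<^esub> \<alpha> x y)"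
    proof (rule lin_maps_eqI_span[OF assms(2,3) _ _ assms(4)])
      fix y assume "y \<in> A"
      then show "\<alpha> (a \<odot>\<^bsub>M\<^esub> x) y = (\<lambda>y \<in> carrier N. a \<odot>\<^bsub>Q\<^esub> \<alpha> x y) y"
        using lin_maps_smult[OF gen x(2,1)] x A by auto
    qed (use x \<alpha> lin_maps_scale[OF assms(2,3)] in auto)
    then show ?thesis using y by simp
  qed
  show ?thesis
    by (rule bilinI[OF assms(1,2)]) (simp_all add: cl add smult lin_maps_add[OF \<alpha>] lin_maps_smult[OF \<alpha>])
qed

text \<open>Prefixing a fixed \<open>w\<close> is multilinear in the word and preserves repetitions,
  so it descends to the exterior power. Linearity in \<open>w\<close> is then visible on
  wedges.\<close>

lemma ext_mult_ex:
  assumes "module K W"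
  shows "\<exists>!h. h \<in> lin_maps K (tensor K W (ext_power K W n)) (ext_power K W (Suc n)) \<and>
      (\<forall>w \<in> carrier W. \<forall>ws. set ws \<subseteq> carrier W \<and> length ws = n \<longrightarrow>
        h (tens K W (ext_power K W n) w (wedge K W ws)) = wedge K W (w # ws))" (is "\<exists>!h. ?P h")
proof -
  let ?E = "ext_power K W n" and ?E' = "ext_power K W (Suc n)"
  note E = ext_power_module[OF assms, of n] and E' = ext_power_module[OF assms, of "Suc n"]
  have ml: "multilin K W n ?E' (\<lambda>ws. wedge K W (w # ws))" if w: "w \<in> carrier W" for w
  proof (rule multilinI[OF assms E'])
    show "wedge K W (w # ws) \<in> carrier ?E'" if "set ws \<subseteq> carrier W" "length ws = n" for ws
      by (rule wedge_closed[OF assms]) (use that w in auto)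
    show "wedge K W (w # xs @ comb W a u b v # ys) =
        a \<odot>\<^bsub>?E'\<^esub> wedge K W (w # xs @ u # ys) \<oplus>\<^bsub>?E'\<^esub> b \<odot>\<^bsub>?E'\<^esub> wedge K W (w # xs @ v # ys)"
      if "a \<in> carrier K" "b \<in> carrier K" "u \<in> carrier W" "v \<in> carrier W" "set xs \<subseteq> carrier W"
        "set ys \<subseteq> carrier W" "length xs + 1 + length ys = n" for a b u v xs ys
      using multilin_comb[OF wedge_multilin[OF assms, of "Suc n"] assms that(1-4), of "w # xs" ys] that w by simp
  qed
  have "\<exists>f. f \<in> lin_maps K ?E ?E' \<and> (\<forall>ws. set ws \<subseteq> carrier W \<and> length ws = n \<longrightarrow> f (wedge K W ws) = wedge K W (w # ws))"
    if w: "w \<in> carrier W" for w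
    using ext_power_lift[OF assms E' ml[OF w]] wedge_nondistinct[OF assms] w by fastforce
  then obtain \<alpha> where \<alpha>: "\<And>w. w \<in> carrier W \<Longrightarrow> \<alpha> w \<in> lin_maps K ?E ?E'"
    "\<And>w ws. w \<in> carrier W \<Longrightarrow> set ws \<subseteq> carrier W \<Longrightarrow> length ws = n \<Longrightarrow> \<alpha> w (wedge K W ws) = wedge K W (w # ws)"
    by metis
  have bil: "bilin K W ?E ?E' \<alpha>"
  proof (rule lin_map_of_family[OF assms E E' ext_power_span[OF assms] \<alpha>(1)])
    fix y assume "y \<in> wedge K W ` tuples (carrier W) n"
    then obtain ws where ws: "y = wedge K W ws" "set ws \<subseteq> carrier W" "length ws = n" by auto
    have "(\<lambda>w \<in> carrier W. wedge K W ([] @ w # ws)) \<in> lin_maps K W ?E'"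
      by (rule multilin_lin[OF wedge_multilin[OF assms]]) (use ws in auto)
    then show "(\<lambda>w \<in> carrier W. \<alpha> w y) \<in> lin_maps K W ?E'" using ws \<alpha>(2) by (simp cong: restrict_cong)
  qed
  have "?P (tensor_lift K W ?E ?E' \<alpha>)"
    using tensor_lift_lin[OF assms E E' bil] tensor_lift_tens[OF assms E E' bil] \<alpha>(2) wedge_closed[OF assms] by auto
  moreover have "h = h'" if h: "?P h" and h': "?P h'" for h h'
  proof (rule tensor_eqI[OF assms E E'])
    fix w x assume w: "w \<in> carrier W" and x: "x \<in> carrier ?E"
    have tl: "(\<lambda>x \<in> carrier ?E. tens K W ?E w x) \<in> lin_maps K ?E (tensor K W ?E)"
      using tens_bilin[OF assms E] w by (auto simp: bilin_def)
    have "compose (carrier ?E) h (\<lambda>x \<in> carrier ?E. tens K W ?E w x) = compose (carrier ?E) h' (\<lambda>x \<in> carrier ?E. tens K W ?E w x)"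
      by (rule ext_power_eqI[OF assms E' lin_maps_compose[OF E tl] lin_maps_compose[OF E tl]])
        (use h h' w wedge_closed[OF assms] in \<open>auto simp: compose_eq\<close>)
    from fun_cong[OF this, of x] show "h (tens K W ?E w x) = h' (tens K W ?E w x)" using x by (simp add: compose_eq)
  qed (use h h' in auto)
  ultimately show ?thesis by blast
qed

definition lwedge where "lwedge K W n w x = ext_mult K W n (tens K W (ext_power K W n) w x)"

lemma ext_mult_lin:
  assumes "module K W"
  shows "ext_mult K W n \<in> lin_maps K (tensor K W (ext_power K W n)) (ext_power K W (Suc n))"
  unfolding ext_mult_def using theI'[OF ext_mult_ex[OF assms]] by auto

lemma lwedge_wedge:
  assumes "module K W" "w \<in> carrier W" "set ws \<subseteq> carrier W" "length ws = n"
  shows "lwedge K W n w (wedge K W ws) = wedge K W (w # ws)"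
  unfolding lwedge_def ext_mult_def using theI'[OF ext_mult_ex[OF assms(1)]] assms(2-4) by auto

lemma lwedge_bilin:
  assumes "module K W"
  shows "bilin K W (ext_power K W n) (ext_power K W (Suc n)) (lwedge K W n)"
proof -
  note E = ext_power_module[OF assms, of n]
  have "bilin K W (ext_power K W n) (ext_power K W (Suc n)) (\<lambda>w x. ext_mult K W n (tens K W (ext_power K W n) ((\<lambda>w \<in> carrier W. w) w) ((\<lambda>x \<in> carrier (ext_power K W n). x) x)))"
    by (rule bilin_compose[OF tens_bilin[OF assms E] assms E lin_maps_id[OF assms] lin_maps_id[OF E] ext_mult_lin[OF assms]])
  then show ?thesis by (simp add: bilin_def lwedge_def cong: restrict_cong)
qed

lemma lwedge_lin:
  assumes "module K W" "w \<in> carrier W"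
  shows "(\<lambda>x \<in> carrier (ext_power K W n). lwedge K W n w x) \<in> lin_maps K (ext_power K W n) (ext_power K W (Suc n))"
  using lwedge_bilin[OF assms(1)] assms(2) by (auto simp: bilin_def)

lemma lwedge_closed:
  assumes "module K W" "w \<in> carrier W" "x \<in> carrier (ext_power K W n)"
  shows "lwedge K W n w x \<in> carrier (ext_power K W (Suc n))"
  by (rule bilin_closed[OF lwedge_bilin[OF assms(1)] assms(2,3)])

lemma lwedge_sq:
  assumes "module K W" "w \<in> carrier W" "x \<in> carrier (ext_power K W n)"
  shows "lwedge K W (Suc n) w (lwedge K W n w x) = \<zero>\<^bsub>ext_power K W (Suc (Suc n))\<^esub>"
proof -
  note E = ext_power_module[OF assms(1)]
  have nd: "wedge K W (w # w # ws) = \<zero>\<^bsub>ext_power K W (Suc (Suc n))\<^esub>" if "set ws \<subseteq> carrier W" "length ws = n" for ws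
    by (rule wedge_nondistinct[OF assms(1)]) (use assms that in auto)
  have "compose (carrier (ext_power K W n)) (\<lambda>x \<in> carrier (ext_power K W (Suc n)). lwedge K W (Suc n) w x)
      (\<lambda>x \<in> carrier (ext_power K W n). lwedge K W n w x)
    = (\<lambda>x \<in> carrier (ext_power K W n). \<zero>\<^bsub>ext_power K W (Suc (Suc n))\<^esub>)"
    by (rule ext_power_eqI[OF assms(1) E lin_maps_compose[OF E lwedge_lin[OF assms(1,2)] lwedge_lin[OF assms(1,2)]]
        lin_maps_const_zero[OF E E]])
      (use assms wedge_closed[OF assms(1)] nd in \<open>auto simp: compose_eq lwedge_wedge lwedge_closed\<close>)
  from fun_cong[OF this, of x] show ?thesis using assms lwedge_closed[OF assms] by (simp add: compose_eq)
qed

text \<open>Polarisation of \<open>lwedge_sq\<close> at the sum of \<open>u\<close> and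
  \<open>v\<close>, which works in every characteristic.\<close>

lemma lwedge_swap:
  assumes "module K W" "u \<in> carrier W" "v \<in> carrier W" "x \<in> carrier (ext_power K W n)"
  shows "lwedge K W (Suc n) u (lwedge K W n v x) = \<ominus>\<^bsub>ext_power K W (Suc (Suc n))\<^esub> lwedge K W (Suc n) v (lwedge K W n u x)"
proof -
  interpret W: module K W by fact
  let ?E = "ext_power K W (Suc (Suc n))"
  interpret E: module K ?E by (rule ext_power_module[OF assms(1)])
  have add: "lwedge K W m (p \<oplus>\<^bsub>W\<^esub> q) y = lwedge K W m p y \<oplus>\<^bsub>ext_power K W (Suc m)\<^esub> lwedge K W m q y"
    if "p \<in> carrier W" "q \<in> carrier W" "y \<in> carrier (ext_power K W m)" for m p q y
  proof -
    have "(\<lambda>x \<in> carrier W. lwedge K W m x y) \<in> lin_maps K W (ext_power K W (Suc m))"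
      using lwedge_bilin[OF assms(1), of m] that by (auto simp: bilin_def)
    from lin_maps_add[OF this that(1,2)] that show ?thesis by simp
  qed
  have addr: "lwedge K W (Suc n) p (y \<oplus>\<^bsub>ext_power K W (Suc n)\<^esub> z) = lwedge K W (Suc n) p y \<oplus>\<^bsub>?E\<^esub> lwedge K W (Suc n) p z"
    if "p \<in> carrier W" "y \<in> carrier (ext_power K W (Suc n))" "z \<in> carrier (ext_power K W (Suc n))" for p y z
  proof -
    interpret E': module K "ext_power K W (Suc n)" by (rule ext_power_module[OF assms(1)])
    show ?thesis using lin_maps_add[OF lwedge_lin[OF assms(1) that(1)] that(2,3)] that by simp
  qed
  let ?f = "\<lambda>p q. lwedge K W (Suc n) p (lwedge K W n q x)"
  have cl: "?f p q \<in> carrier ?E" if "p \<in> carrier W" "q \<in> carrier W" for p q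
    using that assms by (simp add: lwedge_closed)
  have sq: "?f p p = \<zero>\<^bsub>?E\<^esub>" if "p \<in> carrier W" for p by (rule lwedge_sq[OF assms(1) that assms(4)])
  have "\<zero>\<^bsub>?E\<^esub> = ?f (u \<oplus>\<^bsub>W\<^esub> v) (u \<oplus>\<^bsub>W\<^esub> v)" using sq assms by simp
  also have "\<dots> = (?f u u \<oplus>\<^bsub>?E\<^esub> ?f u v) \<oplus>\<^bsub>?E\<^esub> (?f v u \<oplus>\<^bsub>?E\<^esub> ?f v v)"
    using assms cl by (simp add: add addr lwedge_closed E.add.m_ac)
  also have "\<dots> = ?f u v \<oplus>\<^bsub>?E\<^esub> ?f v u" using sq assms cl by simp
  finally show ?thesis using cl assms by (metis E.minus_equality)
qed

text \<open>Contraction by the functional \<open>\<epsilon>\<close>, computed on words by the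
  Leibniz rule for the first letter. A word of one letter has its own clause because contracting its
  empty rest would lead to degree -1; the value on the empty word is a placeholder.\<close>

fun contract_word :: "('k, 'r) ring_scheme \<Rightarrow> ('k, 'w, 'm) module_scheme \<Rightarrow> ('w \<Rightarrow> 'k) \<Rightarrow> 'w list \<Rightarrow>
    ('w list \<Rightarrow> 'k) set set" where
  "contract_word K W \<epsilon> [] = \<zero>\<^bsub>ext_power K W 0\<^esub>"
| "contract_word K W \<epsilon> [w] = \<epsilon> w \<odot>\<^bsub>ext_power K W 0\<^esub> wedge K W []"
| "contract_word K W \<epsilon> (w # v # vs) =
    \<epsilon> w \<odot>\<^bsub>ext_power K W (Suc (length vs))\<^esub> wedge K W (v # vs)
    \<ominus>\<^bsub>ext_power K W (Suc (length vs))\<^esub> lwedge K W (length vs) w (contract_word K W \<epsilon> (v # vs))"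

lemma contract_word_closed:
  assumes "module K W" "\<epsilon> \<in> lin_maps K W (self_module K)" "set ws \<subseteq> carrier W" "length ws = Suc n"
  shows "contract_word K W \<epsilon> ws \<in> carrier (ext_power K W n)"
  using assms(3,4)
proof (induction ws arbitrary: n rule: induct_list012)
  case (2 w)
  interpret E: module K "ext_power K W 0" by (rule ext_power_module[OF assms(1)])
  show ?case using 2 lin_maps_closed[OF assms(2), of w] wedge_closed[OF assms(1), of "[]"] by simp
next
  case (3 w v vs)
  interpret E: module K "ext_power K W (Suc (length vs))" by (rule ext_power_module[OF assms(1)])
  have "contract_word K W \<epsilon> (v # vs) \<in> carrier (ext_power K W (length vs))" by (rule 3) (use 3 in auto)
  then show ?case using 3 lin_maps_closed[OF assms(2), of w] wedge_closed[OF assms(1), of "v # vs" "Suc (length vs)"]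
    by (auto intro!: E.minus_closed E.smult_closed lwedge_closed[OF assms(1)])
qed simp

lemma contract_word_multilin:
  assumes "module K W" "\<epsilon> \<in> lin_maps K W (self_module K)"
  shows "multilin K W (Suc n) (ext_power K W n) (contract_word K W \<epsilon>)"
proof (rule multilinI[OF assms(1) ext_power_module[OF assms(1)] contract_word_closed[OF assms]])
  interpret W: module K W by fact
  note E = ext_power_module[OF assms(1)]
  fix a b u v xs ys
  assume *: "a \<in> carrier K" "b \<in> carrier K" "u \<in> carrier W" "v \<in> carrier W"
      "set xs \<subseteq> carrier W" "set ys \<subseteq> carrier W" "length xs + 1 + length ys = Suc n"
  have ec: "\<epsilon> w \<in> carrier K" if "w \<in> carrier W" for w using lin_maps_closed[OF assms(2) that] by simp
  have el: "\<epsilon> (comb W a u b v) = a \<otimes>\<^bsub>K\<^esub> \<epsilon> u \<oplus>\<^bsub>K\<^esub> b \<otimes>\<^bsub>K\<^esub> \<epsilon> v"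
    using * by (simp add: lin_maps_add[OF assms(2)] lin_maps_smult[OF assms(2)])
  show "contract_word K W \<epsilon> (xs @ comb W a u b v # ys) =
        a \<odot>\<^bsub>ext_power K W n\<^esub> contract_word K W \<epsilon> (xs @ u # ys) \<oplus>\<^bsub>ext_power K W n\<^esub>
        b \<odot>\<^bsub>ext_power K W n\<^esub> contract_word K W \<epsilon> (xs @ v # ys)"
    using *(5,7)
  proof (induction xs arbitrary: n)
    \<comment> \<open>The varied letter stands first: it enters through \<open>\<epsilon>\<close>
      and as the left factor of the wedge, but not through the recursive call.\<close>
    case (Nil n)
    interpret En: module K "ext_power K W n" by (rule E)
    show ?case
    proof (cases ys)
      case ys: Nil
      interpret E0: module K "ext_power K W 0" by (rule E)
      have "n = 0" using ys Nil.prems by simp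
      then show ?thesis using ys * ec wedge_closed[OF assms(1), of "[]" 0]
        by (simp add: el E0.smult_l_distr E0.smult_assoc1)
    next
      case (Cons y zs)
      interpret En: module K "ext_power K W (Suc (length zs))" by (rule E)
      let ?c = "contract_word K W \<epsilon> (y # zs)"
      have n: "n = Suc (length zs)" using Nil.prems Cons by simp
      have c: "?c \<in> carrier (ext_power K W (length zs))" by (rule contract_word_closed[OF assms]) (use * Cons in auto)
      have w: "wedge K W (y # zs) \<in> carrier (ext_power K W n)" using * Cons n by (intro wedge_closed[OF assms(1)]) auto
      have l: "lwedge K W (length zs) p ?c \<in> carrier (ext_power K W n)" if "p \<in> carrier W" for p
        unfolding n by (rule lwedge_closed[OF assms(1) that c])
      have "lwedge K W (length zs) (comb W a u b v) ?c =
        a \<odot>\<^bsub>ext_power K W n\<^esub> lwedge K W (length zs) u ?c \<oplus>\<^bsub>ext_power K W n\<^esub> b \<odot>\<^bsub>ext_power K W n\<^esub> lwedge K W (length zs) v ?c"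
        unfolding n by (rule bilin_comb_left[OF lwedge_bilin[OF assms(1)] assms(1)]) (use * c in auto)
      then show ?thesis
        using Cons * w l ec n
        by (simp add: el En.smult_l_distr En.smult_r_distr En.smult_r_minus En.smult_assoc1 a_minus_def En.minus_add En.add.m_ac)
    qed
  next
    \<comment> \<open>The first letter is fixed, so the varied letter enters through the wedge of
      the tail and, by induction, through the contraction of the tail.\<close>
    case (Cons x xs)
    interpret En: module K "ext_power K W n" by (rule E)
    obtain z zs where z: "xs @ u # ys = z # zs" by (cases "xs @ u # ys") auto
    have n: "n = Suc (length xs + length ys)" using Cons.prems by simp
    have cw: "contract_word K W \<epsilon> (x # xs @ p # ys) = \<epsilon> x \<odot>\<^bsub>ext_power K W n\<^esub> wedge K W (xs @ p # ys)
      \<ominus>\<^bsub>ext_power K W n\<^esub> lwedge K W (length xs + length ys) x (contract_word K W \<epsilon> (xs @ p # ys))" for p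
      by (cases xs) (auto simp: n)
    have w: "wedge K W (xs @ p # ys) \<in> carrier (ext_power K W n)" if "p \<in> carrier W" for p
      using * that Cons.prems by (intro wedge_closed[OF assms(1)]) auto
    have c: "contract_word K W \<epsilon> (xs @ p # ys) \<in> carrier (ext_power K W (length xs + length ys))" if "p \<in> carrier W" for p
      using * that Cons.prems by (intro contract_word_closed[OF assms]) auto
    have l: "lwedge K W (length xs + length ys) x (contract_word K W \<epsilon> (xs @ p # ys)) \<in> carrier (ext_power K W n)" if "p \<in> carrier W" for p
      unfolding n by (rule lwedge_closed[OF assms(1) _ c[OF that]]) (use Cons.prems in auto)
    have we: "wedge K W (xs @ comb W a u b v # ys) = a \<odot>\<^bsub>ext_power K W n\<^esub> wedge K W (xs @ u # ys)
      \<oplus>\<^bsub>ext_power K W n\<^esub> b \<odot>\<^bsub>ext_power K W n\<^esub> wedge K W (xs @ v # ys)"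
      by (rule multilin_comb[OF wedge_multilin[OF assms(1)] assms(1)]) (use * Cons.prems n in auto)
    let ?m = "length xs + length ys"
    have IH: "contract_word K W \<epsilon> (xs @ comb W a u b v # ys) =
        a \<odot>\<^bsub>ext_power K W ?m\<^esub> contract_word K W \<epsilon> (xs @ u # ys) \<oplus>\<^bsub>ext_power K W ?m\<^esub>
        b \<odot>\<^bsub>ext_power K W ?m\<^esub> contract_word K W \<epsilon> (xs @ v # ys)"
      by (rule Cons.IH) (use Cons.prems in auto)
    have lw: "lwedge K W ?m x (contract_word K W \<epsilon> (xs @ comb W a u b v # ys)) =
      a \<odot>\<^bsub>ext_power K W n\<^esub> lwedge K W ?m x (contract_word K W \<epsilon> (xs @ u # ys)) \<oplus>\<^bsub>ext_power K W n\<^esub>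
      b \<odot>\<^bsub>ext_power K W n\<^esub> lwedge K W ?m x (contract_word K W \<epsilon> (xs @ v # ys))"
      unfolding IH n by (rule bilin_comb_right[OF lwedge_bilin[OF assms(1)] E]) (use * c Cons.prems in auto)
    have x: "x \<in> carrier W" using Cons.prems by simp
    show ?case
      unfolding append_Cons cw we lw
      using * w l ec[OF x]
      by (simp add: En.smult_r_distr En.smult_r_minus a_minus_def En.minus_add En.add.m_ac W.m_comm flip: En.smult_assoc1)
  qed
qed

lemma contract_word_Cons:
  assumes "module K W" "\<epsilon> \<in> lin_maps K W (self_module K)" "set (w # ws) \<subseteq> carrier W" "length ws = Suc n"
  shows "contract_word K W \<epsilon> (w # ws) = \<epsilon> w \<odot>\<^bsub>ext_power K W (Suc n)\<^esub> wedge K W ws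
    \<ominus>\<^bsub>ext_power K W (Suc n)\<^esub> lwedge K W n w (contract_word K W \<epsilon> ws)"
  using assms(4) by (cases ws) auto

text \<open>The two terms of the Leibniz rule are equal: expanding the second once more produces the
  first and a summand that contains \<open>w \<and> w\<close>. For \<open>n = 0\<close> the
  expansion stops one step earlier.\<close>

lemma contract_word_sq:
  assumes "module K W" "\<epsilon> \<in> lin_maps K W (self_module K)" "set (w # ws) \<subseteq> carrier W" "length ws = n"
  shows "contract_word K W \<epsilon> (w # w # ws) = \<zero>\<^bsub>ext_power K W (Suc n)\<^esub>"
proof -
  note E = ext_power_module[OF assms(1)]
  interpret E: module K "ext_power K W (Suc n)" by (rule E)
  have ew: "\<epsilon> w \<in> carrier K" using lin_maps_closed[OF assms(2), of w] assms(3) by simp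
  have w: "w \<in> carrier W" using assms(3) by simp
  have wc: "wedge K W (w # ws) \<in> carrier (ext_power K W (Suc n))" "wedge K W ws \<in> carrier (ext_power K W n)"
    using assms by (auto intro!: wedge_closed)
  have "lwedge K W n w (contract_word K W \<epsilon> (w # ws)) = \<epsilon> w \<odot>\<^bsub>ext_power K W (Suc n)\<^esub> wedge K W (w # ws)"
  proof (cases n)
    case 0
    then show ?thesis
      using assms(4) wc lin_maps_smult[OF lwedge_lin[OF assms(1) w, of 0] ew, of "wedge K W []"] lwedge_wedge[OF assms(1) w, of "[]" 0]
      module.smult_closed[OF E[of 0] ew] by simp
  next
    case (Suc m)
    interpret En: module K "ext_power K W (Suc m)" by (rule E)
    have c: "contract_word K W \<epsilon> ws \<in> carrier (ext_power K W m)"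
      by (rule contract_word_closed[OF assms(1,2)]) (use assms Suc in auto)
    have l: "lwedge K W m w (contract_word K W \<epsilon> ws) \<in> carrier (ext_power K W n)"
      unfolding Suc by (rule lwedge_closed[OF assms(1) w c])
    have "lwedge K W n w (contract_word K W \<epsilon> (w # ws)) =
      (\<lambda>x \<in> carrier (ext_power K W n). lwedge K W n w x) (\<epsilon> w \<odot>\<^bsub>ext_power K W n\<^esub> wedge K W ws \<ominus>\<^bsub>ext_power K W n\<^esub> lwedge K W m w (contract_word K W \<epsilon> ws))"
      using contract_word_Cons[OF assms(1-3), of m] assms(4) Suc wc l ew by simp
    also have "\<dots> = \<epsilon> w \<odot>\<^bsub>ext_power K W (Suc n)\<^esub> lwedge K W n w (wedge K W ws) \<ominus>\<^bsub>ext_power K W (Suc n)\<^esub> lwedge K W n w (lwedge K W m w (contract_word K W \<epsilon> ws))"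
    proof -
      interpret N: module K "ext_power K W n" by (rule E)
      have s: "\<epsilon> w \<odot>\<^bsub>ext_power K W n\<^esub> wedge K W ws \<in> carrier (ext_power K W n)" using wc ew by simp
      show ?thesis
        using lin_maps_a_minus[OF E E lwedge_lin[OF assms(1) w] s l]
          lin_maps_smult[OF lwedge_lin[OF assms(1) w] ew wc(2)] N.minus_closed[OF s l] s wc l ew by simp
    qed
    also have "\<dots> = \<epsilon> w \<odot>\<^bsub>ext_power K W (Suc n)\<^esub> wedge K W (w # ws)"
    proof -
      interpret N: module K "ext_power K W (Suc (Suc m))" by (rule E)
      show ?thesis
        using lwedge_sq[OF assms(1) w c] wc ew assms N.add.inv_one
        by (simp add: Suc lwedge_wedge[OF assms(1) w] a_minus_def a_inv_def)
    qed
    finally show ?thesis .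
  qed
  then show ?thesis
    using contract_word_Cons[OF assms(1,2), of w "w # ws" n] assms wc ew by (simp add: a_minus_def E.r_neg)
qed

lemma contract_word_swap:
  assumes "module K W" "\<epsilon> \<in> lin_maps K W (self_module K)" "set (u # v # ws) \<subseteq> carrier W" "length ws = n"
  shows "contract_word K W \<epsilon> (u # v # ws) = \<ominus>\<^bsub>ext_power K W (Suc n)\<^esub> contract_word K W \<epsilon> (v # u # ws)"
proof -
  interpret W: module K W by fact
  let ?E = "ext_power K W (Suc n)"
  interpret E: module K ?E by (rule ext_power_module[OF assms(1)])
  let ?f = "\<lambda>p q. contract_word K W \<epsilon> (p # q # ws)"
  have ml: "multilin K W (Suc (Suc n)) ?E (contract_word K W \<epsilon>)" by (rule contract_word_multilin[OF assms(1,2)])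
  have cl: "?f p q \<in> carrier ?E" if "p \<in> carrier W" "q \<in> carrier W" for p q
    by (rule contract_word_closed[OF assms(1,2)]) (use that assms in auto)
  have addl: "?f (p \<oplus>\<^bsub>W\<^esub> p') q = ?f p q \<oplus>\<^bsub>?E\<^esub> ?f p' q" if "p \<in> carrier W" "p' \<in> carrier W" "q \<in> carrier W" for p p' q
    using multilin_comb[OF ml assms(1), of "\<one>\<^bsub>K\<^esub>" "\<one>\<^bsub>K\<^esub>" p p' "[]" "q # ws"] that assms cl by simp
  have addr: "?f q (p \<oplus>\<^bsub>W\<^esub> p') = ?f q p \<oplus>\<^bsub>?E\<^esub> ?f q p'" if "p \<in> carrier W" "p' \<in> carrier W" "q \<in> carrier W" for p p' q
    using multilin_comb[OF ml assms(1), of "\<one>\<^bsub>K\<^esub>" "\<one>\<^bsub>K\<^esub>" p p' "[q]" "ws"] that assms cl by simp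
  have sq: "?f p p = \<zero>\<^bsub>?E\<^esub>" if "p \<in> carrier W" for p by (rule contract_word_sq[OF assms(1,2)]) (use that assms in auto)
  have uv: "u \<in> carrier W" "v \<in> carrier W" using assms by auto
  have "\<zero>\<^bsub>?E\<^esub> = ?f (u \<oplus>\<^bsub>W\<^esub> v) (u \<oplus>\<^bsub>W\<^esub> v)" using sq uv by (simp del: contract_word.simps)
  also have "\<dots> = (?f u u \<oplus>\<^bsub>?E\<^esub> ?f u v) \<oplus>\<^bsub>?E\<^esub> (?f v u \<oplus>\<^bsub>?E\<^esub> ?f v v)"
    using uv cl by (simp add: addl addr E.add.m_ac del: contract_word.simps)
  also have "\<dots> = ?f u v \<oplus>\<^bsub>?E\<^esub> ?f v u" using sq uv cl by (simp del: contract_word.simps)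
  finally show ?thesis using cl uv by (metis E.minus_equality)
qed

text \<open>If the tail has a repetition, both terms of the Leibniz rule vanish, the second by
  induction. Otherwise the first letter is repeated: either the first two letters agree, or
  exchanging them puts both copies into the tail.\<close>

lemma contract_word_nondistinct:
  assumes "module K W" "\<epsilon> \<in> lin_maps K W (self_module K)" "set ws \<subseteq> carrier W" "length ws = Suc n" "\<not> distinct ws"
  shows "contract_word K W \<epsilon> ws = \<zero>\<^bsub>ext_power K W n\<^esub>"
  using assms(3-5)
proof (induction "length ws" arbitrary: n ws rule: less_induct)
  case less
  note E = ext_power_module[OF assms(1)]
  from less.prems obtain u v vs where ws: "ws = u # v # vs"
    by (cases ws rule: remdups_adj.cases) auto
  then have n: "n = Suc (length vs)" using less.prems by simp
  have rec: "contract_word K W \<epsilon> (p # r) = \<zero>\<^bsub>ext_power K W n\<^esub>"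
    if r: "\<not> distinct r" "length r = n" "set (p # r) \<subseteq> carrier W" for p r
  proof -
    interpret E: module K "ext_power K W (Suc (length vs))" by (rule E)
    have "contract_word K W \<epsilon> r = \<zero>\<^bsub>ext_power K W (length vs)\<^esub>"
      by (rule less.hyps) (use r n ws in auto)
    moreover have "wedge K W r = \<zero>\<^bsub>ext_power K W n\<^esub>" by (rule wedge_nondistinct[OF assms(1)]) (use r in auto)
    moreover have "lwedge K W (length vs) p \<zero>\<^bsub>ext_power K W (length vs)\<^esub> = \<zero>\<^bsub>ext_power K W n\<^esub>"
      unfolding n by (rule bilin_zero_right[OF lwedge_bilin[OF assms(1)] E E]) (use r in auto)
    moreover have "\<epsilon> p \<in> carrier K" using lin_maps_closed[OF assms(2), of p] r by simp
    ultimately show ?thesis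
      using contract_word_Cons[OF assms(1,2) r(3), of "length vs"] r n E.add.inv_one by (simp add: a_minus_def a_inv_def)
  qed
  show ?case
  proof (cases "distinct (v # vs)")
    case False
    then show ?thesis unfolding ws by (rule rec) (use less.prems ws n in auto)
  next
    case True
    then have u: "u \<in> set (v # vs)" using less.prems ws by auto
    show ?thesis
    proof (cases "u = v")
      case True
      then show ?thesis using contract_word_sq[OF assms(1,2), of u vs] less.prems ws n by auto
    next
      case False
      interpret E: module K "ext_power K W n" by (rule E)
      have "contract_word K W \<epsilon> (v # u # vs) = \<zero>\<^bsub>ext_power K W n\<^esub>"
        by (rule rec) (use False u less.prems ws n in auto)
      then show ?thesis
        using contract_word_swap[OF assms(1,2), of u v vs "length vs"] less.prems ws n E.add.inv_one
        by (simp add: a_inv_def del: contract_word.simps)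
    qed
  qed
qed

lemma contraction_exists:
  assumes "module K W" "\<epsilon> \<in> lin_maps K W (self_module K)"
  shows "\<exists>c \<in> lin_maps K (ext_power K W (Suc n)) (ext_power K W n).
    \<forall>ws. set ws \<subseteq> carrier W \<and> length ws = Suc n \<longrightarrow> c (wedge K W ws) = contract_word K W \<epsilon> ws"
  by (rule ext_power_lift[OF assms(1) ext_power_module[OF assms(1)] contract_word_multilin[OF assms]
      contract_word_nondistinct[OF assms]])

section \<open>The tensor coalgebra\<close>

lemma lin_basis_dual:
  assumes "lin_basis K M X v"
  obtains \<delta> where "\<And>x. x \<in> X \<Longrightarrow> \<delta> x \<in> lin_maps K M (self_module K)"
    "\<And>x y. x \<in> X \<Longrightarrow> y \<in> X \<Longrightarrow> \<delta> x (v y) = kron K y x"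
proof -
  have "\<forall>x \<in> X. \<exists>\<delta> \<in> lin_maps K M (self_module K). \<forall>y \<in> X. \<delta> (v y) = kron K y x"
    using assms by (simp add: lin_basis_def)
  then obtain \<delta> where "\<forall>x \<in> X. \<delta> x \<in> lin_maps K M (self_module K) \<and> (\<forall>y \<in> X. \<delta> x (v y) = kron K y x)"
    by metis
  then show ?thesis by (intro that[of \<delta>]) auto
qed

text \<open>Each element is the image of a finitely supported function on \<open>X\<close>, and
  \<open>\<delta> x\<close> reads the value of this function at \<open>x\<close>. Both claims then
  concern functions.\<close>

lemma lin_basis_coords:
  assumes "lin_basis K M X v" "module K M"
    and \<delta>: "\<And>x. x \<in> X \<Longrightarrow> \<delta> x \<in> lin_maps K M (self_module K)"
      "\<And>x y. x \<in> X \<Longrightarrow> y \<in> X \<Longrightarrow> \<delta> x (v y) = kron K y x"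
  shows "c \<in> carrier M \<Longrightarrow> finite {x \<in> X. \<delta> x c \<noteq> \<zero>\<^bsub>K\<^esub>}"
    and "c \<in> carrier M \<Longrightarrow> d \<in> carrier M \<Longrightarrow> (\<And>x. x \<in> X \<Longrightarrow> \<delta> x c = \<delta> x d) \<Longrightarrow> c = d"
proof -
  interpret M: module K M by fact
  have ck: "cring K" by (rule M.is_cring)
  have S: "module K (self_module K)" by (rule self_module_module[OF ck])
  let ?F = "free_module K X"
  have F: "module K ?F" by (rule free_module_module[OF ck])
  have "v \<in> X \<rightarrow> carrier M" using assms(1) by (auto simp: lin_basis_def)
  from free_module_lift[OF assms(2) this] obtain p where
    p: "p \<in> lin_maps K ?F M" "\<forall>x \<in> X. p (basis_vec K x) = v x" by blast
  have bv: "basis_vec K x \<in> carrier ?F" if "x \<in> X" for x by (rule basis_vec_closed[OF ck that])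
  have "v ` X \<subseteq> p ` carrier ?F"
  proof
    fix y assume "y \<in> v ` X"
    then obtain x where "x \<in> X" "y = v x" by auto
    then show "y \<in> p ` carrier ?F" using p(2) bv[of x] by (metis imageI)
  qed
  then have "lin_span K M (v ` X) \<subseteq> p ` carrier ?F" by (rule lin_span_least[OF image_submodule[OF F assms(2) p(1)]])
  then have surj: "carrier M \<subseteq> p ` carrier ?F" using assms(1) by (simp add: lin_basis_def)
  have ev: "\<delta> x (p f) = f x" if x: "x \<in> X" and f: "f \<in> carrier ?F" for x f
  proof -
    have ev: "(\<lambda>f \<in> carrier ?F. f x) \<in> lin_maps K ?F (self_module K)"
      by (rule lin_maps_restrictI[OF F]) (auto simp: free_module_carrier free_module_simps)
    have "compose (carrier ?F) (\<delta> x) p = (\<lambda>f \<in> carrier ?F. f x)"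
      by (rule lin_maps_eqI_span[OF F S lin_maps_compose[OF F p(1) \<delta>(1)[OF x]] ev free_module_span[OF ck]])
        (use bv p(2) \<delta>(2)[OF x] x in \<open>auto simp: compose_eq basis_vec_def\<close>)
    from fun_cong[OF this, of f] show ?thesis using f by (simp add: compose_eq)
  qed
  show "finite {x \<in> X. \<delta> x c \<noteq> \<zero>\<^bsub>K\<^esub>}" if c: "c \<in> carrier M" for c
  proof -
    obtain f where f: "f \<in> carrier ?F" "c = p f" using surj c by auto
    then have "{x \<in> X. \<delta> x c \<noteq> \<zero>\<^bsub>K\<^esub>} \<subseteq> {x. f x \<noteq> \<zero>\<^bsub>K\<^esub>}" using ev by auto
    then show ?thesis using f by (auto simp: free_module_carrier intro: finite_subset)
  qed
  show "c = d" if cd: "c \<in> carrier M" "d \<in> carrier M" and eq: "\<And>x. x \<in> X \<Longrightarrow> \<delta> x c = \<delta> x d" for c d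
  proof -
    obtain f where f: "f \<in> carrier ?F" "c = p f" using surj cd by auto
    obtain g where g: "g \<in> carrier ?F" "d = p g" using surj cd by auto
    have "f x = g x" for x
      using eq[of x] ev[of x] f g by (cases "x \<in> X") (auto simp: free_module_carrier)
    then show ?thesis using f g by (metis ext)
  qed
qed

section \<open>Direct sums and the word basis of the tensor coalgebra\<close>

lemma dsum_module_simps:
  "x \<in> carrier (dsum_module V) \<longleftrightarrow> (\<forall>n. x n \<in> carrier (V n)) \<and> finite {n. x n \<noteq> \<zero>\<^bsub>V n\<^esub>}"
  "\<zero>\<^bsub>dsum_module V\<^esub> = (\<lambda>n. \<zero>\<^bsub>V n\<^esub>)"
  "add (dsum_module V) = (\<lambda>x y n. x n \<oplus>\<^bsub>V n\<^esub> y n)"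
  "smult (dsum_module V) = (\<lambda>a x n. a \<odot>\<^bsub>V n\<^esub> x n)"
  by (simp_all add: dsum_module_def)

lemma dsum_module_module:
  assumes "\<And>n. module K (V n)"
  shows "module K (dsum_module V)"
proof -
  interpret V: module K "V i" for i by (rule assms)
  note dsum_module_simps [simp]
  let ?D = "dsum_module V"
  have ab: "abelian_group ?D"
  proof (rule abelian_groupI)
    fix f g assume f: "f \<in> carrier ?D" and g: "g \<in> carrier ?D"
    have "{x. f x \<oplus>\<^bsub>V x\<^esub> g x \<noteq> \<zero>\<^bsub>V x\<^esub>} \<subseteq> {x. f x \<noteq> \<zero>\<^bsub>V x\<^esub>} \<union> {x. g x \<noteq> \<zero>\<^bsub>V x\<^esub>}" by auto
    then show "f \<oplus>\<^bsub>?D\<^esub> g \<in> carrier ?D"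
      using f g by (auto intro: finite_subset)
  next
    fix f assume f: "f \<in> carrier ?D"
    have "{x. \<ominus>\<^bsub>V x\<^esub> f x \<noteq> \<zero>\<^bsub>V x\<^esub>} \<subseteq> {x. f x \<noteq> \<zero>\<^bsub>V x\<^esub>}" using V.add.inv_one by (auto simp: a_inv_def)
    then show "\<exists>g\<in>carrier ?D. g \<oplus>\<^bsub>?D\<^esub> f = \<zero>\<^bsub>?D\<^esub>"
      using f by (intro bexI[of _ "\<lambda>x. \<ominus>\<^bsub>V x\<^esub> f x"])
        (auto simp: V.l_neg intro: finite_subset)
  qed (auto simp: fun_eq_iff V.add.m_ac)
  show ?thesis
  proof (rule moduleI[OF V.is_cring ab])
    fix a f assume f: "f \<in> carrier ?D" and a: "a \<in> carrier K"
    have "{x. a \<odot>\<^bsub>V x\<^esub> f x \<noteq> \<zero>\<^bsub>V x\<^esub>} \<subseteq> {x. f x \<noteq> \<zero>\<^bsub>V x\<^esub>}" using a by auto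
    then show "a \<odot>\<^bsub>?D\<^esub> f \<in> carrier ?D"
      using f a by (auto intro: finite_subset)
  qed (auto simp: fun_eq_iff V.smult_l_distr V.smult_r_distr V.smult_assoc1)
qed

definition dsum_incl where
  "dsum_incl V n = (\<lambda>t \<in> carrier (V n). \<lambda>m. if m = n then t else \<zero>\<^bsub>V m\<^esub>)"

lemma dsum_incl_lin:
  assumes "\<And>n. module K (V n)"
  shows "dsum_incl V n \<in> lin_maps K (V n) (dsum_module V)"
proof -
  interpret V: module K "V i" for i by (rule assms)
  show ?thesis unfolding dsum_incl_def
  proof (rule lin_maps_restrictI[OF assms])
    fix t assume t: "t \<in> carrier (V n)"
    have "{m. (if m = n then t else \<zero>\<^bsub>V m\<^esub>) \<noteq> \<zero>\<^bsub>V m\<^esub>} \<subseteq> {n}" by auto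
    then show "(\<lambda>m. if m = n then t else \<zero>\<^bsub>V m\<^esub>) \<in> carrier (dsum_module V)"
      using t by (auto simp: dsum_module_simps intro: finite_subset)
  qed (auto simp: dsum_module_simps fun_eq_iff)
qed

lemma dsum_proj_lin:
  assumes "\<And>n. module K (V n)"
  shows "(\<lambda>x \<in> carrier (dsum_module V). x n) \<in> lin_maps K (dsum_module V) (V n)"
  by (rule lin_maps_restrictI[OF dsum_module_module[OF assms]]) (auto simp: dsum_module_simps)

lemma dsum_span:
  assumes "\<And>n. module K (V n)" and sub: "submodule N K (dsum_module V)"
    and N: "\<And>n t. t \<in> carrier (V n) \<Longrightarrow> dsum_incl V n t \<in> N"
  shows "N = carrier (dsum_module V)"
proof
  interpret V: module K "V i" for i by (rule assms)
  show "N \<subseteq> carrier (dsum_module V)" by (rule submodule_subset[OF sub])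
  have *: "finite S \<Longrightarrow> x \<in> carrier (dsum_module V) \<Longrightarrow> {n. x n \<noteq> \<zero>\<^bsub>V n\<^esub>} \<subseteq> S \<Longrightarrow> x \<in> N" for S x
  proof (induction S arbitrary: x rule: finite_induct)
    case empty
    then have "x = \<zero>\<^bsub>dsum_module V\<^esub>" by (auto simp: fun_eq_iff dsum_module_simps)
    then show ?case using submodule_zero[OF sub] by simp
  next
    case (insert n S)
    let ?y = "x(n := \<zero>\<^bsub>V n\<^esub>)"
    have "{m. ?y m \<noteq> \<zero>\<^bsub>V m\<^esub>} \<subseteq> {m. x m \<noteq> \<zero>\<^bsub>V m\<^esub>}" by auto
    then have "?y \<in> N"
      using insert.prems by (intro insert.IH) (auto simp: dsum_module_simps intro: finite_subset)
    moreover have xn: "x n \<in> carrier (V n)" using insert.prems by (simp add: dsum_module_simps)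
    moreover have "x = ?y \<oplus>\<^bsub>dsum_module V\<^esub> dsum_incl V n (x n)"
      using insert.prems by (auto simp: fun_eq_iff dsum_module_simps dsum_incl_def)
    ultimately show ?case using submodule_add[OF sub _ N[OF xn]] by metis
  qed
  show "carrier (dsum_module V) \<subseteq> N" using * by (auto simp: dsum_module_simps)
qed

lemma tword_at_eq:
  assumes "module K W" "set ws \<subseteq> carrier W" "length ws = n"
  shows "tword_at K W ws = dsum_incl (tensor_power K W) n (tword K W ws)"
  using tword_closed[OF assms] assms(3) by (auto simp: tword_at_def dsum_incl_def fun_eq_iff)

lemma tword_at_closed:
  assumes "module K W" "set ws \<subseteq> carrier W"
  shows "tword_at K W ws \<in> carrier (dsum_module (tensor_power K W))"
  unfolding tword_at_eq[OF assms refl]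
  by (rule lin_maps_closed[OF dsum_incl_lin[where V = "tensor_power K W", OF tensor_power_module[OF assms(1)]]
    tword_closed[OF assms refl]])

lemma tword_at_multilin:
  assumes "module K W"
  shows "multilin K W n (dsum_module (tensor_power K W)) (tword_at K W)"
proof -
  note TP = tensor_power_module[OF assms] and T = dsum_module_module[where V = "tensor_power K W", OF tensor_power_module[OF assms]]
  have m: "multilin K W n (dsum_module (tensor_power K W)) (\<lambda>ws. dsum_incl (tensor_power K W) n (tword K W ws))"
    by (rule multilin_compose[OF tword_multilin[OF assms] assms TP T dsum_incl_lin[OF TP]])
  interpret W: module K W by fact
  show ?thesis
  proof (rule multilinI[OF assms T tword_at_closed[OF assms]])
    fix a b u v xs ys
    assume *: "a \<in> carrier K" "b \<in> carrier K" "u \<in> carrier W" "v \<in> carrier W"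
      "set xs \<subseteq> carrier W" "set ys \<subseteq> carrier W" "length xs + 1 + length ys = n"
    have "tword_at K W (xs @ w # ys) = dsum_incl (tensor_power K W) n (tword K W (xs @ w # ys))" if "w \<in> carrier W" for w
      by (rule tword_at_eq[OF assms]) (use * that in auto)
    then show "tword_at K W (xs @ comb W a u b v # ys) =
      a \<odot>\<^bsub>dsum_module (tensor_power K W)\<^esub> tword_at K W (xs @ u # ys) \<oplus>\<^bsub>dsum_module (tensor_power K W)\<^esub>
      b \<odot>\<^bsub>dsum_module (tensor_power K W)\<^esub> tword_at K W (xs @ v # ys)"
      using multilin_comb[OF m assms *] * by simp
  qed
qed

lemma tensor_algebra_basis:
  assumes "module K W" "B \<subseteq> carrier W" "lin_basis K W B (\<lambda>b. b)"
  shows "lin_basis K (dsum_module (tensor_power K W)) {ws. set ws \<subseteq> B} (tword_at K W)"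
proof -
  interpret W: module K W by fact
  let ?T = "dsum_module (tensor_power K W)"
  note TP = tensor_power_module[OF assms(1)]
  have T: "module K ?T" by (rule dsum_module_module[OF TP])
  have S: "module K (self_module K)" by (rule self_module_module[OF W.is_cring])
  have span: "lin_span K W B = carrier W" using assms(3) by (simp add: lin_basis_def)
  have A: "tword_at K W ` {ws. set ws \<subseteq> B} \<subseteq> carrier ?T" using tword_at_closed[OF assms(1)] assms(2) by fast
  let ?N = "lin_span K ?T (tword_at K W ` {ws. set ws \<subseteq> B})"
  note N = lin_span_submodule[OF T A]
  have "?N = carrier ?T"
  proof (rule dsum_span[OF TP N])
    fix n t assume t: "t \<in> carrier (tensor_power K W n)"
    have "tword K W ` tuples B n \<subseteq> {t \<in> carrier (tensor_power K W n). dsum_incl (tensor_power K W) n t \<in> ?N}"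
    proof safe
      fix ws assume ws: "set ws \<subseteq> B" "n = length ws"
      then have wW: "set ws \<subseteq> carrier W" using assms(2) by auto
      show "tword K W ws \<in> carrier (tensor_power K W (length ws))" by (rule tword_closed[OF assms(1) wW refl])
      show "dsum_incl (tensor_power K W) (length ws) (tword K W ws) \<in> ?N"
        unfolding tword_at_eq[OF assms(1) wW refl, symmetric]
        by (rule subsetD[OF lin_span_superset]) (use ws in auto)
    qed
    then have "lin_span K (tensor_power K W n) (tword K W ` tuples B n)
      \<subseteq> {t \<in> carrier (tensor_power K W n). dsum_incl (tensor_power K W) n t \<in> ?N}"
      by (rule lin_span_least[OF preimage_submodule[OF TP T dsum_incl_lin[OF TP] N]])
    then show "dsum_incl (tensor_power K W) n t \<in> ?N"
      unfolding tensor_power_basis_span[OF assms(1,2) span] using t by auto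
  qed
  moreover have "\<exists>\<delta> \<in> lin_maps K ?T (self_module K). \<forall>y \<in> {ws. set ws \<subseteq> B}. \<delta> (tword_at K W y) = kron K y w"
    if w: "set w \<subseteq> B" for w
  proof -
    let ?n = "length w"
    obtain \<gamma> where \<gamma>: "\<gamma> \<in> lin_maps K (tensor_power K W ?n) (self_module K)"
      "\<forall>y. set y \<subseteq> B \<and> length y = ?n \<longrightarrow> \<gamma> (tword K W y) = kron K y w"
      using tensor_power_basis[OF assms, of ?n] w unfolding lin_basis_def by auto
    show ?thesis
    proof (rule bexI[OF _ lin_maps_compose[OF T dsum_proj_lin[OF TP] \<gamma>(1)]], safe)
      fix y assume y: "set y \<subseteq> B"
      then have yW: "set y \<subseteq> carrier W" using assms(2) by auto
      show "compose (carrier ?T) \<gamma> (\<lambda>x \<in> carrier ?T. x ?n) (tword_at K W y) = kron K y w"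
      proof (cases "length y = ?n")
        case True
        then have "\<gamma> (tword_at K W y ?n) = kron K y w"
          using \<gamma>(2) y by (simp add: tword_at_def)
        then show ?thesis by (simp add: compose_eq tword_at_closed[OF assms(1) yW])
      next
        case False
        then have "\<gamma> (tword_at K W y ?n) = \<zero>\<^bsub>K\<^esub>"
          using lin_maps_zero[OF TP S \<gamma>(1)] by (simp add: tword_at_def)
        then show ?thesis using False by (auto simp add: compose_eq tword_at_closed[OF assms(1) yW])
      qed
    qed
  qed
  ultimately show ?thesis using A by (auto simp: lin_basis_def)
qed

lemma multilin_finsum:
  assumes "module K W" "module K Q" "\<And>i. i \<in> A \<Longrightarrow> multilin K W n Q (g i)" "finite A"
  shows "multilin K W n Q (\<lambda>ws. \<Oplus>\<^bsub>Q\<^esub>i\<in>A. g i ws)"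
proof -
  interpret Q: module K Q by fact
  show ?thesis
  proof (rule multilinI[OF assms(1,2)])
    show "(\<Oplus>\<^bsub>Q\<^esub>i\<in>A. g i ws) \<in> carrier Q" if "set ws \<subseteq> carrier W" "length ws = n" for ws
      by (rule Q.finsum_closed) (use multilin_closed[OF assms(3) that] in auto)
    fix a b u v xs ys
    assume *: "a \<in> carrier K" "b \<in> carrier K" "u \<in> carrier W" "v \<in> carrier W"
      "set xs \<subseteq> carrier W" "set ys \<subseteq> carrier W" "length xs + 1 + length ys = n"
    have cl: "g i (xs @ w # ys) \<in> carrier Q" if "i \<in> A" "w \<in> carrier W" for i w
      by (rule multilin_closed[OF assms(3)[OF that(1)]]) (use * that in auto)
    have "(\<Oplus>\<^bsub>Q\<^esub>i\<in>A. g i (xs @ comb W a u b v # ys)) =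
      (\<Oplus>\<^bsub>Q\<^esub>i\<in>A. a \<odot>\<^bsub>Q\<^esub> g i (xs @ u # ys) \<oplus>\<^bsub>Q\<^esub> b \<odot>\<^bsub>Q\<^esub> g i (xs @ v # ys))"
    proof (rule Q.finsum_cong')
      show "(\<lambda>i. a \<odot>\<^bsub>Q\<^esub> g i (xs @ u # ys) \<oplus>\<^bsub>Q\<^esub> b \<odot>\<^bsub>Q\<^esub> g i (xs @ v # ys)) \<in> A \<rightarrow> carrier Q"
        using cl * by simp
    qed (simp_all add: multilin_comb[OF assms(3) assms(1) *])
    also have "\<dots> = a \<odot>\<^bsub>Q\<^esub> (\<Oplus>\<^bsub>Q\<^esub>i\<in>A. g i (xs @ u # ys)) \<oplus>\<^bsub>Q\<^esub> b \<odot>\<^bsub>Q\<^esub> (\<Oplus>\<^bsub>Q\<^esub>i\<in>A. g i (xs @ v # ys))"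
      using cl * by (simp add: Q.finsum_addf Q.finsum_smult_ldistr assms(4) Pi_iff)
    finally show "(\<Oplus>\<^bsub>Q\<^esub>i\<in>A. g i (xs @ comb W a u b v # ys)) =
      a \<odot>\<^bsub>Q\<^esub> (\<Oplus>\<^bsub>Q\<^esub>i\<in>A. g i (xs @ u # ys)) \<oplus>\<^bsub>Q\<^esub> b \<odot>\<^bsub>Q\<^esub> (\<Oplus>\<^bsub>Q\<^esub>i\<in>A. g i (xs @ v # ys))" .
  qed
qed

lemma deconcat_multilin:
  assumes "module K W" "i \<le> n"
  defines "T \<equiv> dsum_module (tensor_power K W)"
  shows "multilin K W n (tensor K T T) (\<lambda>ws. tens K T T (tword_at K W (take i ws)) (tword_at K W (drop i ws)))"
proof -
  have T: "module K T" unfolding T_def by (rule dsum_module_module[OF tensor_power_module[OF assms(1)]])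
  note TT = tensor_module[OF T T] and bil = tens_bilin[OF T T]
  have cl: "tword_at K W ws \<in> carrier T" if "set ws \<subseteq> carrier W" for ws
    unfolding T_def by (rule tword_at_closed[OF assms(1) that])
  have sub: "set (take j ws) \<subseteq> carrier W" "set (drop j ws) \<subseteq> carrier W" if "set ws \<subseteq> carrier W" for j ws
    using that set_take_subset[of j ws] set_drop_subset[of j ws] by auto
  show ?thesis
  proof (rule multilinI[OF assms(1) TT])
    show "tens K T T (tword_at K W (take i ws)) (tword_at K W (drop i ws)) \<in> carrier (tensor K T T)"
      if "set ws \<subseteq> carrier W" "length ws = n" for ws
      by (intro tens_closed T cl sub that)
    fix a b u v xs ys
    assume *: "a \<in> carrier K" "b \<in> carrier K" "u \<in> carrier W" "v \<in> carrier W"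
      "set xs \<subseteq> carrier W" "set ys \<subseteq> carrier W" "length xs + 1 + length ys = n"
    show "tens K T T (tword_at K W (take i (xs @ comb W a u b v # ys))) (tword_at K W (drop i (xs @ comb W a u b v # ys))) =
      a \<odot>\<^bsub>tensor K T T\<^esub> tens K T T (tword_at K W (take i (xs @ u # ys))) (tword_at K W (drop i (xs @ u # ys))) \<oplus>\<^bsub>tensor K T T\<^esub>
      b \<odot>\<^bsub>tensor K T T\<^esub> tens K T T (tword_at K W (take i (xs @ v # ys))) (tword_at K W (drop i (xs @ v # ys)))"
    proof (cases "i \<le> length xs")
      \<comment> \<open>The cut at \<open>i\<close> leaves the varied letter in the right factor
        here, and in the left factor in the other case.\<close>
      case True
      have "tword_at K W (drop i xs @ comb W a u b v # ys) =
        a \<odot>\<^bsub>T\<^esub> tword_at K W (drop i xs @ u # ys) \<oplus>\<^bsub>T\<^esub> b \<odot>\<^bsub>T\<^esub> tword_at K W (drop i xs @ v # ys)"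
        unfolding T_def by (rule multilin_comb[OF tword_at_multilin[OF assms(1)] assms(1)]) (use * sub in auto)
      then show ?thesis
        using True * bilin_comb_right[OF bil T *(1,2) cl cl cl[OF sub(1)[OF *(5)]]] sub by simp
    next
      case False
      then obtain j where i: "i = Suc (length xs + j)" using less_imp_Suc_add not_le by blast
      have "tword_at K W (xs @ comb W a u b v # take j ys) =
        a \<odot>\<^bsub>T\<^esub> tword_at K W (xs @ u # take j ys) \<oplus>\<^bsub>T\<^esub> b \<odot>\<^bsub>T\<^esub> tword_at K W (xs @ v # take j ys)"
        unfolding T_def by (rule multilin_comb[OF tword_at_multilin[OF assms(1)] assms(1)]) (use * sub in auto)
      then show ?thesis
        using i * bilin_comb_left[OF bil T *(1,2) cl cl cl[OF sub(2)[OF *(6)]]] sub by simp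
    qed
  qed
qed

text \<open>A tensor product depends only on carriers, addition and scalar multiplication, so
  records with the same operations are interchangeable in it, whether they are modules or
  coalgebras.\<close>

lemma tensor_cong:
  assumes "carrier M = carrier M'" "add M = add M'" "smult M = smult M'"
    and "carrier N = carrier N'" "add N = add N'" "smult N = smult N'"
  shows "tensor K M N = tensor K M' N'" "tens K M N = tens K M' N'"
  by (simp_all add: tensor_def tens_def tensor_null_def tensor_rels_def assms fun_eq_iff)

lemma lin_maps_cong:
  assumes "carrier M = carrier M'" "add M = add M'" "smult M = smult M'"
    and "carrier N = carrier N'" "add N = add N'" "smult N = smult N'"
  shows "lin_maps K M N = lin_maps K M' N'"
  by (simp add: lin_maps_def assms)

lemma module_cong:
  assumes "module K M" "carrier M = carrier M'" "add M = add M'" "zero M = zero M'" "smult M = smult M'"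
  shows "module K M'"
proof -
  show ?thesis
    by (rule module_surj_image[OF assms(1), where p = "\<lambda>x. x"]) (use assms in auto)
qed

lemma tensor_coalgebra_simps:
  "carrier (tensor_coalgebra K W) = carrier (dsum_module (tensor_power K W))"
  "add (tensor_coalgebra K W) = add (dsum_module (tensor_power K W))"
  "zero (tensor_coalgebra K W) = zero (dsum_module (tensor_power K W))"
  "smult (tensor_coalgebra K W) = smult (dsum_module (tensor_power K W))"
  by (simp_all add: tensor_coalgebra_def Let_def module.defs)

lemma tensor_coalgebra_module: "module K W \<Longrightarrow> module K (tensor_coalgebra K W)"
  by (rule module_cong[OF dsum_module_module[OF tensor_power_module]]) (simp_all add: tensor_coalgebra_simps)

text \<open>The defining description prescribes values on all words over \<open>W\<close>, which are
  far from independent. A map is first chosen on words over a basis. On each tensor power it must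
  agree with the lift of the multilinear deconcatenation sum, and that lift has the prescribed
  values on all words.\<close>

lemma tensor_coalgebra_comult:
  assumes "field K" "module K W"
  defines "T \<equiv> dsum_module (tensor_power K W)"
  shows "comult (tensor_coalgebra K W) \<in> lin_maps K T (tensor K T T)"
    and "set ws \<subseteq> carrier W \<Longrightarrow> comult (tensor_coalgebra K W) (tword_at K W ws) =
      (\<Oplus>\<^bsub>tensor K T T\<^esub> i \<in> {..length ws}. tens K T T (tword_at K W (take i ws)) (tword_at K W (drop i ws)))"
proof -
  obtain B where B: "B \<subseteq> carrier W" "lin_basis K W B (\<lambda>b. b)" using lin_basis_exists[OF assms(1,2)] by blast
  note TP = tensor_power_module[OF assms(2)]
  have T: "module K T" unfolding T_def by (rule dsum_module_module[OF TP])
  note TT = tensor_module[OF T T]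
  have bas: "lin_basis K T {ws. set ws \<subseteq> B} (tword_at K W)"
    unfolding T_def by (rule tensor_algebra_basis[OF assms(2) B])
  let ?g = "\<lambda>ws. \<Oplus>\<^bsub>tensor K T T\<^esub> i \<in> {..length ws}. tens K T T (tword_at K W (take i ws)) (tword_at K W (drop i ws))"
  let ?P = "\<lambda>h. h \<in> lin_maps K T (tensor K T T) \<and> (\<forall>ws. set ws \<subseteq> carrier W \<longrightarrow> h (tword_at K W ws) = ?g ws)"
  have ml: "multilin K W n (tensor K T T) (\<lambda>ws. \<Oplus>\<^bsub>tensor K T T\<^esub> i \<in> {..n}. tens K T T (tword_at K W (take i ws)) (tword_at K W (drop i ws)))" for n
    by (rule multilin_finsum[OF assms(2) TT]) (auto simp: T_def intro: deconcat_multilin[OF assms(2)])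
  have gcl: "?g ws \<in> carrier (tensor K T T)" if "set ws \<subseteq> carrier W" for ws
    by (rule multilin_closed[OF ml that refl])
  have "?g \<in> {ws. set ws \<subseteq> B} \<rightarrow> carrier (tensor K T T)" using gcl B(1) by auto
  from lin_basis_lift[OF assms(1) bas T TT this] obtain h where
    h: "h \<in> lin_maps K T (tensor K T T)" "\<forall>ws \<in> {ws. set ws \<subseteq> B}. h (tword_at K W ws) = ?g ws" by blast
  have "h (tword_at K W ws) = ?g ws" if ws: "set ws \<subseteq> carrier W" for ws
  proof -
    let ?n = "length ws"
    obtain g' where g': "g' \<in> lin_maps K (tensor_power K W ?n) (tensor K T T)"
      "\<forall>vs. set vs \<subseteq> carrier W \<and> length vs = ?n \<longrightarrow> g' (tword K W vs) =
        (\<Oplus>\<^bsub>tensor K T T\<^esub> i \<in> {..?n}. tens K T T (tword_at K W (take i vs)) (tword_at K W (drop i vs)))"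
      using tensor_power_lift[OF assms(2) TT ml] by blast
    have inc: "dsum_incl (tensor_power K W) ?n \<in> lin_maps K (tensor_power K W ?n) T"
      unfolding T_def by (rule dsum_incl_lin[OF TP])
    have *: "set vs \<subseteq> B \<Longrightarrow> set vs \<subseteq> carrier W" for vs using B(1) by auto
    have "compose (carrier (tensor_power K W ?n)) h (dsum_incl (tensor_power K W) ?n) = g'"
    proof (rule lin_basis_eqI[OF tensor_power_basis[OF assms(2) B] TP TT lin_maps_compose[OF TP inc h(1)] g'(1)])
      fix x assume "x \<in> tuples B ?n"
      then have x: "set x \<subseteq> B" "length x = ?n" by auto
      show "compose (carrier (tensor_power K W ?n)) h (dsum_incl (tensor_power K W) ?n) (tword K W x) = g' (tword K W x)"
        using x h(2) g'(2) tword_closed[OF assms(2) *[OF x(1)] x(2)] *[OF x(1)]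
        by (simp add: compose_eq tword_at_eq[OF assms(2) *[OF x(1)] x(2), symmetric])
    qed
    from fun_cong[OF this, of "tword K W ws"] show ?thesis
      using g'(2) ws tword_closed[OF assms(2) ws refl]
      by (simp add: compose_eq tword_at_eq[OF assms(2) ws refl, symmetric])
  qed
  then have "?P h" using h(1) by blast
  moreover have "h' = h''" if "?P h'" "?P h''" for h' h''
    by (rule lin_basis_eqI[OF bas T TT]) (use that B(1) in auto)
  ultimately have "\<exists>!h. ?P h" by blast
  then have "?P (THE h. ?P h)" by (rule theI')
  moreover have "comult (tensor_coalgebra K W) = (THE h. ?P h)"
    by (simp add: tensor_coalgebra_def Let_def module.defs T_def)
  ultimately have "?P (comult (tensor_coalgebra K W))" by simp
  then show "comult (tensor_coalgebra K W) \<in> lin_maps K T (tensor K T T)"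
    "set ws \<subseteq> carrier W \<Longrightarrow> comult (tensor_coalgebra K W) (tword_at K W ws) = ?g ws" by auto
qed

section \<open>Symmetric tensors\<close>

text \<open>The letter at position \<open>length xs\<close> moves to the one position
  \<open>j\<close> with \<open>\<sigma> j = length xs\<close>; the other positions hold letters
  independent of \<open>u\<close>. Hence permuting letters preserves multilinearity.\<close>

lemma permute_word_split:
  assumes "\<sigma> permutes {..<n}" "length xs + 1 + length ys = n"
  obtains xs' ys' where "\<And>u. permute_list \<sigma> (xs @ u # ys) = xs' @ u # ys'"
    "set xs' \<subseteq> set xs \<union> set ys" "set ys' \<subseteq> set xs \<union> set ys" "length xs' + 1 + length ys' = n"
proof -
  obtain j where j: "j < n" "\<sigma> j = length xs"
    using assms permutes_surj[OF assms(1)] permutes_in_image[OF assms(1)] by (metis add.commute add_lessD1 less_add_one lessThan_iff permutes_inverses(1) add.assoc)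
  \<comment> \<open>\<open>undefined\<close> fills the position of \<open>u\<close>, which no index
    other than \<open>j\<close> reads.\<close>
  define xs' where "xs' = map (\<lambda>i. (xs @ undefined # ys) ! \<sigma> i) [0..<j]"
  define ys' where "ys' = map (\<lambda>i. (xs @ undefined # ys) ! \<sigma> i) [Suc j..<n]"
  have ne: "\<sigma> i \<noteq> length xs" if "i \<noteq> j" for i
    using that j(2) permutes_inj[OF assms(1)] by (metis injD)
  have nth: "(xs @ u # ys) ! \<sigma> i = (xs @ undefined # ys) ! \<sigma> i" if "i \<noteq> j" for u i
    using ne[OF that] by (simp add: nth_append nth_Cons split: nat.split)
  have mem: "(xs @ undefined # ys) ! \<sigma> i \<in> set xs \<union> set ys" if "i \<noteq> j" "i < n" for i
  proof -
    have "\<sigma> i < n" using permutes_in_image[OF assms(1), of i] that by simp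
    then show ?thesis using ne[OF that(1)] assms(2)
      by (cases "\<sigma> i < length xs") (auto simp: nth_append nth_Cons split: nat.split)
  qed
  have "permute_list \<sigma> (xs @ u # ys) = xs' @ u # ys'" for u
  proof -
    have "[0..<length (xs @ u # ys)] = [0..<j] @ j # [Suc j..<n]"
    proof -
      have "[0..<j + (n - j)] = [0..<j] @ [j..<j + (n - j)]" by (rule upt_add_eq_append) simp
      moreover have "j + (n - j) = n" "length (xs @ u # ys) = n" using j(1) assms(2) by simp_all
      ultimately show ?thesis by (simp only: upt_conv_Cons[OF j(1)])
    qed
    then have "permute_list \<sigma> (xs @ u # ys) = map (\<lambda>i. (xs @ u # ys) ! \<sigma> i) [0..<j] @ (xs @ u # ys) ! \<sigma> j # map (\<lambda>i. (xs @ u # ys) ! \<sigma> i) [Suc j..<n]"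
      by (simp only: permute_list_def map_append list.map)
    also have "map (\<lambda>i. (xs @ u # ys) ! \<sigma> i) [0..<j] = xs'" unfolding xs'_def by (rule map_cong[OF refl], rule nth) auto
    also have "map (\<lambda>i. (xs @ u # ys) ! \<sigma> i) [Suc j..<n] = ys'" unfolding ys'_def by (rule map_cong[OF refl], rule nth) auto
    also have "(xs @ u # ys) ! \<sigma> j = u" using j by simp
    finally show ?thesis .
  qed
  moreover have "set xs' \<subseteq> set xs \<union> set ys"
    unfolding xs'_def set_map by (rule image_subsetI, rule mem) (use j in auto)
  moreover have "set ys' \<subseteq> set xs \<union> set ys"
    unfolding ys'_def set_map by (rule image_subsetI, rule mem) (use j in auto)
  moreover have "length xs' + 1 + length ys' = n" unfolding xs'_def ys'_def using j by auto
  ultimately show ?thesis using that by blast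
qed

lemma perm_action_spec:
  assumes "module K W" "\<sigma> permutes {..<n}"
  shows "perm_action K W n \<sigma> \<in> lin_maps K (tensor_power K W n) (tensor_power K W n)"
    and "set ws \<subseteq> carrier W \<Longrightarrow> length ws = n \<Longrightarrow> perm_action K W n \<sigma> (tword K W ws) = tword K W (permute_list \<sigma> ws)"
proof -
  note TP = tensor_power_module[OF assms(1), of n]
  let ?P = "\<lambda>h. h \<in> lin_maps K (tensor_power K W n) (tensor_power K W n) \<and>
      (\<forall>ws. set ws \<subseteq> carrier W \<and> length ws = n \<longrightarrow> h (tword K W ws) = tword K W (permute_list \<sigma> ws))"
  have "multilin K W n (tensor_power K W n) (\<lambda>ws. tword K W (permute_list \<sigma> ws))"
  proof (rule multilinI[OF assms(1) TP])
    show "tword K W (permute_list \<sigma> ws) \<in> carrier (tensor_power K W n)" if "set ws \<subseteq> carrier W" "length ws = n" for ws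
      by (rule tword_closed[OF assms(1)]) (use that assms(2) in \<open>auto simp: set_permute_list\<close>)
    fix a b u v xs ys
    assume *: "a \<in> carrier K" "b \<in> carrier K" "u \<in> carrier W" "v \<in> carrier W"
      "set xs \<subseteq> carrier W" "set ys \<subseteq> carrier W" "length xs + 1 + length ys = n"
    obtain xs' ys' where p: "\<And>u. permute_list \<sigma> (xs @ u # ys) = xs' @ u # ys'"
      "set xs' \<subseteq> set xs \<union> set ys" "set ys' \<subseteq> set xs \<union> set ys" "length xs' + 1 + length ys' = n"
      using permute_word_split[OF assms(2) *(7)] by blast
    show "tword K W (permute_list \<sigma> (xs @ comb W a u b v # ys)) =
      a \<odot>\<^bsub>tensor_power K W n\<^esub> tword K W (permute_list \<sigma> (xs @ u # ys)) \<oplus>\<^bsub>tensor_power K W n\<^esub>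
      b \<odot>\<^bsub>tensor_power K W n\<^esub> tword K W (permute_list \<sigma> (xs @ v # ys))"
      unfolding p(1) by (rule multilin_comb[OF tword_multilin[OF assms(1)] assms(1)]) (use * p in auto)
  qed
  from tensor_power_lift[OF assms(1) TP this] obtain h where "?P h" by blast
  moreover have "h' = h''" if "?P h'" "?P h''" for h' h''
    by (rule tensor_power_eqI[OF assms(1) TP]) (use that in auto)
  ultimately have "\<exists>!h. ?P h" by blast
  from theI'[OF this] show "perm_action K W n \<sigma> \<in> lin_maps K (tensor_power K W n) (tensor_power K W n)"
    "set ws \<subseteq> carrier W \<Longrightarrow> length ws = n \<Longrightarrow> perm_action K W n \<sigma> (tword K W ws) = tword K W (permute_list \<sigma> ws)"
    unfolding perm_action_def by auto
qed

lemma permute_list_inj: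
  assumes "\<sigma> permutes {..<n}" "length v = n" "length w = n" "permute_list \<sigma> v = permute_list \<sigma> w"
  shows "v = w"
proof -
  have "permute_list (inv_into UNIV \<sigma>) (permute_list \<sigma> u) = u" if "length u = n" for u
    using permute_list_compose[of "inv_into UNIV \<sigma>" u \<sigma>] permutes_inv[OF assms(1)] that permutes_inv_o(1)[OF assms(1)] by simp
  then show ?thesis using assms by metis
qed

lemma symmetric_tensors_submodule:
  assumes "module K W"
  shows "submodule (symmetric_tensors K W n) K (tensor_power K W n)"
proof -
  note TP = tensor_power_module[OF assms(1), of n]
  interpret T: module K "tensor_power K W n" by (rule TP)
  note p = perm_action_spec(1)[OF assms]
  show ?thesis
  proof (rule T.submoduleI)
    show "\<zero>\<^bsub>tensor_power K W n\<^esub> \<in> symmetric_tensors K W n"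
      using lin_maps_zero[OF TP TP p] by (simp add: symmetric_tensors_def)
    show "\<ominus>\<^bsub>tensor_power K W n\<^esub> x \<in> symmetric_tensors K W n" if "x \<in> symmetric_tensors K W n" for x
      using lin_maps_minus[OF TP TP p] that by (simp add: symmetric_tensors_def)
    show "x \<oplus>\<^bsub>tensor_power K W n\<^esub> y \<in> symmetric_tensors K W n" if "x \<in> symmetric_tensors K W n" "y \<in> symmetric_tensors K W n" for x y
      using lin_maps_add[OF p] that by (simp add: symmetric_tensors_def)
    show "a \<odot>\<^bsub>tensor_power K W n\<^esub> x \<in> symmetric_tensors K W n" if "a \<in> carrier K" "x \<in> symmetric_tensors K W n" for x a
      using lin_maps_smult[OF p] that by (simp add: symmetric_tensors_def)
  qed (auto simp: symmetric_tensors_def)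
qed

section \<open>A basis of the symmetric coalgebra\<close>

lemma (in abelian_monoid) finsum_Sigma:
  assumes "finite A" "\<And>x. x \<in> A \<Longrightarrow> finite (B x)" "\<And>x y. x \<in> A \<Longrightarrow> y \<in> B x \<Longrightarrow> f x y \<in> carrier G"
  shows "(\<Oplus>x\<in>A. \<Oplus>y\<in>B x. f x y) = (\<Oplus>p\<in>Sigma A B. f (fst p) (snd p))"
  using assms
proof (induction A rule: finite_induct)
  case (insert a A)
  have S: "Sigma (insert a A) B = Pair a ` B a \<union> Sigma A B" by auto
  have d: "Pair a ` B a \<inter> Sigma A B = {}" using insert.hyps by auto
  have fin: "finite (Pair a ` B a)" "finite (Sigma A B)" using insert by auto
  have "(\<Oplus>p\<in>Sigma (insert a A) B. f (fst p) (snd p)) =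
    (\<Oplus>p\<in>Pair a ` B a. f (fst p) (snd p)) \<oplus> (\<Oplus>p\<in>Sigma A B. f (fst p) (snd p))"
    unfolding S by (rule finsum_Un_disjoint[OF fin d]) (use insert.prems in auto)
  also have "(\<Oplus>p\<in>Pair a ` B a. f (fst p) (snd p)) = (\<Oplus>y\<in>B a. f a y)"
    by (subst finsum_reindex) (use insert.prems in \<open>auto simp: inj_on_def\<close>)
  also have "(\<Oplus>p\<in>Sigma A B. f (fst p) (snd p)) = (\<Oplus>x\<in>A. \<Oplus>y\<in>B x. f x y)"
    by (rule insert.IH[symmetric]) (use insert.prems in auto)
  also have "(\<Oplus>y\<in>B a. f a y) \<oplus> (\<Oplus>x\<in>A. \<Oplus>y\<in>B x. f x y) = (\<Oplus>x\<in>insert a A. \<Oplus>y\<in>B x. f x y)"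
    by (rule finsum_insert[symmetric]) (use insert in \<open>auto intro!: finsum_closed\<close>)
  finally show ?case by simp
qed simp

lemma (in abelian_monoid) finsum_bij:
  assumes "bij_betw h A B" "\<And>y. y \<in> B \<Longrightarrow> f y \<in> carrier G"
  shows "(\<Oplus>y\<in>B. f y) = (\<Oplus>x\<in>A. f (h x))"
  using finsum_reindex[of f h A] assms by (auto simp: bij_betw_def)

lemma finite_submsets: "finite (submsets m)"
proof (induction m)
  case (add x m)
  have "submsets (add_mset x m) \<subseteq> submsets m \<union> add_mset x ` submsets m"
  proof
    fix a assume a: "a \<in> submsets (add_mset x m)"
    show "a \<in> submsets m \<union> add_mset x ` (submsets m)"
    proof (cases "x \<in># a")
      case True
      then obtain a' where "a = add_mset x a'" by (metis insert_DiffM)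
      then show ?thesis using a by auto
    next
      case False
      have "count a y \<le> count m y" for y
        using a False mset_subset_eq_count[of a "add_mset x m" y] by (cases "y = x") (auto simp: not_in_iff)
      then show ?thesis by (simp add: subseteq_mset_def)
    qed
  qed
  then show ?case using add finite_subset by blast
qed simp

lemma finite_words_mset: "finite {w. mset w = m}"
proof -
  obtain xs where "mset xs = m" using ex_mset by blast
  then show ?thesis using mset_eq_finite[of xs] by simp
qed

text \<open>These pairs are counted in two ways: as a word of content \<open>m\<close> with a
  cutting position, and as a content \<open>a\<close> below \<open>m\<close> with an arrangement of
  \<open>a\<close> and one of \<open>m - a\<close>.\<close>

definition mset_splits :: "'a multiset \<Rightarrow> ('a list \<times> 'a list) set" where
  "mset_splits m = {(u, v). mset u + mset v = m}"

lemma mset_splits_deconcat: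
  "bij_betw (\<lambda>(w, i). (take i w, drop i w)) (SIGMA w:{w. mset w = m}. {..length w}) (mset_splits m)"
proof (rule bij_betw_byWitness[where f' = "\<lambda>(u, v). (u @ v, length u)"])
  show "(\<lambda>(w, i). (take i w, drop i w)) ` (SIGMA w:{w. mset w = m}. {..length w}) \<subseteq> mset_splits m"
    by (auto simp: mset_splits_def) (metis append_take_drop_id mset_append)
qed (auto simp: mset_splits_def)

lemma mset_splits_by_content:
  "bij_betw snd (SIGMA a:submsets m. {u. mset u = a} \<times> {v. mset v = m - a}) (mset_splits m)"
proof (rule bij_betw_byWitness[where f' = "\<lambda>(u, v). (mset u, (u, v))"])
qed (auto simp: mset_splits_def)

text \<open>The combinatorial core of the comultiplication of divided powers: cutting all
  arrangements of \<open>m\<close> at all places yields every arrangement of \<open>a\<close> next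
  to every arrangement of \<open>m - a\<close> exactly once.\<close>

lemma (in abelian_monoid) finsum_deconcat_eq_finsum_content:
  assumes "\<And>u v. mset u + mset v = m \<Longrightarrow> f u v \<in> carrier G"
  shows "(\<Oplus>w\<in>{w. mset w = m}. \<Oplus>i\<in>{..length w}. f (take i w) (drop i w)) =
    (\<Oplus>a\<in>submsets m. \<Oplus>u\<in>{u. mset u = a}. \<Oplus>v\<in>{v. mset v = m - a}. f u v)"
proof -
  have "(\<Oplus>w\<in>{w. mset w = m}. \<Oplus>i\<in>{..length w}. f (take i w) (drop i w)) =
    (\<Oplus>p\<in>(SIGMA w:{w. mset w = m}. {..length w}). f (take (snd p) (fst p)) (drop (snd p) (fst p)))"
    by (rule finsum_Sigma[OF finite_words_mset]) (auto intro!: assms simp flip: mset_append)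
  also have "\<dots> = (\<Oplus>p\<in>mset_splits m. f (fst p) (snd p))"
    by (subst finsum_bij[OF mset_splits_deconcat]) (auto simp: mset_splits_def assms case_prod_unfold)
  also have "\<dots> = (\<Oplus>q\<in>(SIGMA a:submsets m. {u. mset u = a} \<times> {v. mset v = m - a}). f (fst (snd q)) (snd (snd q)))"
    by (subst finsum_bij[OF mset_splits_by_content]) (auto simp: mset_splits_def assms)
  also have "\<dots> = (\<Oplus>a\<in>submsets m. \<Oplus>p\<in>{u. mset u = a} \<times> {v. mset v = m - a}. f (fst p) (snd p))"
    by (rule finsum_Sigma[symmetric, OF finite_submsets]) (auto intro!: assms simp: finite_words_mset)
  also have "\<dots> = (\<Oplus>a\<in>submsets m. \<Oplus>u\<in>{u. mset u = a}. \<Oplus>v\<in>{v. mset v = m - a}. f u v)"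
  proof (rule finsum_cong')
    fix a assume "a \<in> submsets m"
    then show "(\<Oplus>p\<in>{u. mset u = a} \<times> {v. mset v = m - a}. f (fst p) (snd p)) =
      (\<Oplus>u\<in>{u. mset u = a}. \<Oplus>v\<in>{v. mset v = m - a}. f u v)"
      by (intro finsum_Sigma[symmetric] finite_words_mset assms) auto
  qed (auto intro!: finsum_closed assms)
  finally show ?thesis .
qed

lemma submodule_cong:
  assumes "carrier M = carrier M'" "add M = add M'" "zero M = zero M'" "smult M = smult M'"
  shows "submodule N K M = submodule N K M'"
  by (simp add: submodule_def submodule_axioms_def subgroup_def m_inv_def assms)

lemma lin_basis_cong:
  assumes "carrier M = carrier M'" "add M = add M'" "zero M = zero M'" "smult M = smult M'"
  shows "lin_basis K M X v = lin_basis K M' X v"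
  unfolding lin_basis_def lin_span_def submodule_cong[OF assms]
  by (simp add: lin_maps_cong[OF assms(1,2,4) refl refl refl] assms(1))

text \<open>The basis is auxiliary: \<open>Sym K W\<close> and the complex do not mention it, and it
  serves for computations in coordinates.\<close>

locale based_space =
  fixes K :: "('k, 'r) ring_scheme" and W :: "('k, 'w, 'm) module_scheme" and B :: "'w set"
  assumes K_field: "field K" and W_module: "module K W"
    and B_subset: "B \<subseteq> carrier W" and B_basis: "lin_basis K W B (\<lambda>b. b)"
begin

abbreviation "TC \<equiv> tensor_coalgebra K W"
abbreviation "words \<equiv> {ws. set ws \<subseteq> B}"
abbreviation "content \<equiv> {m. set_mset m \<subseteq> B}"

lemma K_cring: "cring K"
  using W_module by (simp add: module_def)

lemma self_mod: "module K (self_module K)"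
  by (rule self_module_module[OF K_cring])

lemma TC_module: "module K TC"
  by (rule tensor_coalgebra_module[OF W_module])

lemma TC_basis: "lin_basis K TC words (tword_at K W)"
  using tensor_algebra_basis[OF W_module B_subset B_basis]
  by (subst lin_basis_cong[where M' = "dsum_module (tensor_power K W)"]) (simp_all add: tensor_coalgebra_simps)

lemma words_carrier: "ws \<in> words \<Longrightarrow> set ws \<subseteq> carrier W"
  using B_subset by auto

lemma tword_at_TC: "set ws \<subseteq> carrier W \<Longrightarrow> tword_at K W ws \<in> carrier TC"
  using tword_at_closed[OF W_module] by (simp add: tensor_coalgebra_simps)

lemma TC_comult: "comult TC \<in> lin_maps K TC (tensor K TC TC)"
  "set ws \<subseteq> carrier W \<Longrightarrow> comult TC (tword_at K W ws) =
      (\<Oplus>\<^bsub>tensor K TC TC\<^esub> i \<in> {..length ws}. tens K TC TC (tword_at K W (take i ws)) (tword_at K W (drop i ws)))"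
proof -
  let ?T = "dsum_module (tensor_power K W)"
  have c: "tensor K TC TC = tensor K ?T ?T" "tens K TC TC = tens K ?T ?T"
    by (rule tensor_cong; simp add: tensor_coalgebra_simps)+
  have l: "lin_maps K TC (tensor K TC TC) = lin_maps K ?T (tensor K ?T ?T)"
    unfolding c by (rule lin_maps_cong) (simp_all add: tensor_coalgebra_simps)
  show "comult TC \<in> lin_maps K TC (tensor K TC TC)"
    unfolding l by (rule tensor_coalgebra_comult[OF K_field W_module])
  show "set ws \<subseteq> carrier W \<Longrightarrow> comult TC (tword_at K W ws) =
      (\<Oplus>\<^bsub>tensor K TC TC\<^esub> i \<in> {..length ws}. tens K TC TC (tword_at K W (take i ws)) (tword_at K W (drop i ws)))"
    unfolding c by (rule tensor_coalgebra_comult[OF K_field W_module])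
qed

text \<open>One family of coordinate functionals of the word basis, fixed for all later
  computations; its members are determined by their values because words span.\<close>

definition "coord = (SOME \<gamma>. (\<forall>w \<in> words. \<gamma> w \<in> lin_maps K TC (self_module K)) \<and>
  (\<forall>w \<in> words. \<forall>y \<in> words. \<gamma> w (tword_at K W y) = kron K y w))"

lemma coord_ex: "(\<forall>w \<in> words. coord w \<in> lin_maps K TC (self_module K)) \<and>
  (\<forall>w \<in> words. \<forall>y \<in> words. coord w (tword_at K W y) = kron K y w)"
proof -
  obtain \<gamma> where "\<And>x. x \<in> words \<Longrightarrow> \<gamma> x \<in> lin_maps K TC (self_module K)"
    "\<And>x y. x \<in> words \<Longrightarrow> y \<in> words \<Longrightarrow> \<gamma> x (tword_at K W y) = kron K y x"
    using lin_basis_dual[OF TC_basis] by blast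
  then have "\<exists>\<gamma>. (\<forall>w \<in> words. \<gamma> w \<in> lin_maps K TC (self_module K)) \<and>
    (\<forall>w \<in> words. \<forall>y \<in> words. \<gamma> w (tword_at K W y) = kron K y w)" by blast
  then show ?thesis unfolding coord_def by (rule someI_ex)
qed

lemma coord_lin: "w \<in> words \<Longrightarrow> coord w \<in> lin_maps K TC (self_module K)"
  using coord_ex by blast

lemma coord_word: "w \<in> words \<Longrightarrow> y \<in> words \<Longrightarrow> coord w (tword_at K W y) = kron K y w"
  using coord_ex by blast

lemma coord_finite: "c \<in> carrier TC \<Longrightarrow> finite {w \<in> words. coord w c \<noteq> \<zero>\<^bsub>K\<^esub>}"
  by (rule lin_basis_coords(1)[where \<delta> = coord, OF TC_basis TC_module coord_lin coord_word])

lemma coord_eqI: "c \<in> carrier TC \<Longrightarrow> d \<in> carrier TC \<Longrightarrow> (\<And>w. w \<in> words \<Longrightarrow> coord w c = coord w d) \<Longrightarrow> c = d"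
  by (rule lin_basis_coords(2)[where \<delta> = coord, OF TC_basis TC_module coord_lin coord_word])

lemma TC_proj_lin: "(\<lambda>x \<in> carrier TC. x n) \<in> lin_maps K TC (tensor_power K W n)"
  using dsum_proj_lin[where V = "tensor_power K W", OF tensor_power_module[OF W_module]]
  by (simp add: tensor_coalgebra_simps lin_maps_cong[of TC "dsum_module (tensor_power K W)" "tensor_power K W n" "tensor_power K W n" K])

section \<open>Symmetric tensors in coordinates\<close>

definition "SymC = {x \<in> carrier TC. \<forall>n. x n \<in> symmetric_tensors K W n}"

text \<open>The intermediate record inside \<open>subcoalgebra\<close>, before its comultiplication
  is replaced. The description of the comultiplication of \<open>Sym K W\<close> refers to the
  tensor square of this record.\<close>

definition "SymE = TC\<lparr>carrier := SymC\<rparr>"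

lemma SymC_submodule: "submodule SymC K TC"
proof -
  interpret T: module K TC by (rule TC_module)
  note TP = tensor_power_module[OF W_module]
  define S where "S n = {x \<in> carrier TC. (\<lambda>x \<in> carrier TC. x n) x \<in> symmetric_tensors K W n}" for n
  have s: "submodule (S n) K TC" for n
    unfolding S_def
    by (rule preimage_submodule[OF TC_module TP TC_proj_lin symmetric_tensors_submodule[OF W_module]])
  have eq: "SymC = (\<Inter>n. S n)"
    by (auto simp: SymC_def S_def)
  show ?thesis
    unfolding eq
  proof (rule T.submoduleI)
    show "(\<Inter>n. S n) \<subseteq> carrier TC" by (auto simp: S_def)
  qed (auto intro: submodule_zero[OF s] submodule_minus[OF s] submodule_add[OF s] submodule_smult[OF s])
qed

lemma SymE_module: "module K SymE"
  unfolding SymE_def by (rule submodule.submodule_is_module[OF SymC_submodule TC_module])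

lemma SymE_simps [simp]:
  "carrier SymE = SymC" "add SymE = add TC" "zero SymE = zero TC" "smult SymE = smult TC"
  by (simp_all add: SymE_def)

lemma SymC_TC: "x \<in> SymC \<Longrightarrow> x \<in> carrier TC"
  by (simp add: SymC_def)

lemma incl_lin: "(\<lambda>x \<in> SymC. x) \<in> lin_maps K SymE TC"
  using lin_maps_restrictI[OF SymE_module, of "\<lambda>x. x" TC] SymC_TC by simp

lemma restrict_lin: "f \<in> lin_maps K TC N \<Longrightarrow> (\<lambda>x \<in> SymC. f x) \<in> lin_maps K SymE N"
  using lin_maps_restrictI[OF SymE_module, of f N] SymC_TC
  by (simp add: lin_maps_add lin_maps_smult lin_maps_closed[of f K TC N])

text \<open>The orbit sum over the distinct arrangements of \<open>m\<close>. Taking each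
  arrangement once keeps it nonzero in every characteristic, unlike the sum over all permutations of
  one word.\<close>

definition "dpow m = (\<Oplus>\<^bsub>TC\<^esub>w\<in>{w. mset w = m}. tword_at K W w)"

lemma content_words: "m \<in> content \<Longrightarrow> mset w = m \<Longrightarrow> w \<in> words"
  by auto

lemma dpow_TC: "m \<in> content \<Longrightarrow> dpow m \<in> carrier TC"
  unfolding dpow_def
  by (intro submodule_finsum[OF TC_module module.carrier_is_submodule[OF TC_module]] tword_at_TC)
    (use B_subset in auto)

text \<open>A permutation of positions permutes the arrangements of \<open>m\<close>, hence the
  summands in degree \<open>size m\<close>; the components in all other degrees are zero.\<close>

lemma dpow_SymC:
  assumes m: "m \<in> content"
  shows "dpow m \<in> SymC"
proof -
  note TP = tensor_power_module[OF W_module]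
  have wc: "set w \<subseteq> carrier W" if "mset w = m" for w using that m B_subset by auto
  have comp: "dpow m n = (\<Oplus>\<^bsub>tensor_power K W n\<^esub>w\<in>{w. mset w = m}. tword_at K W w n)" for n
  proof -
    interpret P: module K "tensor_power K W n" by (rule TP)
    have "(\<lambda>x \<in> carrier TC. x n) (dpow m) = (\<Oplus>\<^bsub>tensor_power K W n\<^esub>w\<in>{w. mset w = m}. (\<lambda>x \<in> carrier TC. x n) (tword_at K W w))"
      unfolding dpow_def by (rule lin_maps_finsum[OF TC_module TP TC_proj_lin]) (use tword_at_TC wc in auto)
    also have "\<dots> = (\<Oplus>\<^bsub>tensor_power K W n\<^esub>w\<in>{w. mset w = m}. tword_at K W w n)"
      using tword_at_TC wc lin_maps_closed[OF TC_proj_lin[of n] tword_at_TC] by (intro P.finsum_cong') auto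
    finally show ?thesis using dpow_TC[OF m] by simp
  qed
  have "dpow m n \<in> symmetric_tensors K W n" for n
  proof -
    interpret P: module K "tensor_power K W n" by (rule TP)
    have cl: "tword_at K W w n \<in> carrier (tensor_power K W n)" if "mset w = m" for w
      using lin_maps_closed[OF TC_proj_lin[of n] tword_at_TC[OF wc[OF that]]] tword_at_TC[OF wc[OF that]] by simp
    have "perm_action K W n \<sigma> (dpow m n) = dpow m n" if \<sigma>: "\<sigma> permutes {..<n}" for \<sigma>
    proof (cases "n = size m")
      case True
      have len: "length w = n" if "mset w = m" for w using that True by auto
      have "bij_betw (permute_list \<sigma>) {w. mset w = m} {w. mset w = m}"
      proof -
        have inj: "inj_on (permute_list \<sigma>) {w. mset w = m}"
          by (rule inj_onI) (use permute_list_inj[OF \<sigma>] len in auto)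
        have "permute_list \<sigma> ` {w. mset w = m} \<subseteq> {w. mset w = m}"
          using \<sigma> len by auto
        then have "permute_list \<sigma> ` {w. mset w = m} = {w. mset w = m}"
          by (rule endo_inj_surj[OF finite_words_mset _ inj])
        then show ?thesis using inj by (simp add: bij_betw_def)
      qed
      then have "(\<Oplus>\<^bsub>tensor_power K W n\<^esub>w\<in>{w. mset w = m}. tword_at K W w n) =
        (\<Oplus>\<^bsub>tensor_power K W n\<^esub>w\<in>{w. mset w = m}. tword_at K W (permute_list \<sigma> w) n)"
        by (rule P.finsum_bij) (use cl in auto)
      also have "\<dots> = (\<Oplus>\<^bsub>tensor_power K W n\<^esub>w\<in>{w. mset w = m}. perm_action K W n \<sigma> (tword_at K W w n))"
        using perm_action_spec[OF W_module \<sigma>] wc len cl \<sigma> lin_maps_closed[OF perm_action_spec(1)[OF W_module \<sigma>]]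
        by (intro P.finsum_cong') (auto simp: tword_at_def)
      also have "\<dots> = perm_action K W n \<sigma> (dpow m n)"
        unfolding comp using cl by (intro lin_maps_finsum[OF TP TP perm_action_spec(1)[OF W_module \<sigma>], symmetric]) auto
      finally show ?thesis by (simp add: comp)
    next
      case False
      have "dpow m n = (\<Oplus>\<^bsub>tensor_power K W n\<^esub>w\<in>{w. mset w = m}. \<zero>\<^bsub>tensor_power K W n\<^esub>)"
        unfolding comp by (rule P.finsum_cong') (use False in \<open>auto simp: tword_at_def\<close>)
      then show ?thesis using lin_maps_zero[OF TP TP perm_action_spec(1)[OF W_module \<sigma>]] by simp
    qed
    moreover have "dpow m n \<in> carrier (tensor_power K W n)"
      unfolding comp by (rule P.finsum_closed) (use cl in auto)
    ultimately show ?thesis by (simp add: symmetric_tensors_def)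
  qed
  then show ?thesis using dpow_TC[OF m] by (simp add: SymC_def)
qed

lemma coord_dpow:
  assumes "m \<in> content" "w \<in> words"
  shows "coord w (dpow m) = (if mset w = m then \<one>\<^bsub>K\<^esub> else \<zero>\<^bsub>K\<^esub>)"
proof -
  interpret S: module K "self_module K" by (rule self_mod)
  have "coord w (dpow m) = (\<Oplus>\<^bsub>self_module K\<^esub>y\<in>{y. mset y = m}. coord w (tword_at K W y))"
    unfolding dpow_def
    by (rule lin_maps_finsum[OF TC_module self_mod coord_lin[OF assms(2)]])
      (use assms tword_at_TC B_subset in auto)
  also have "\<dots> = (\<Oplus>\<^bsub>self_module K\<^esub>y\<in>{y. mset y = m}. if w = y then \<one>\<^bsub>K\<^esub> else \<zero>\<^bsub>self_module K\<^esub>)"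
    by (rule S.finsum_cong') (use assms coord_word[OF assms(2)] in auto)
  also have "\<dots> = (if mset w = m then \<one>\<^bsub>K\<^esub> else \<zero>\<^bsub>K\<^esub>)"
  proof (cases "mset w = m")
    case True
    then show ?thesis
      using S.finsum_singleton[of w "{y. mset y = m}" "\<lambda>_. \<one>\<^bsub>K\<^esub>"] finite_words_mset[of m] by simp
  next
    case False
    then have "(\<Oplus>\<^bsub>self_module K\<^esub>y\<in>{y. mset y = m}. if w = y then \<one>\<^bsub>K\<^esub> else \<zero>\<^bsub>self_module K\<^esub>) =
      \<zero>\<^bsub>self_module K\<^esub>"
      by (intro S.add.finprod_one_eqI) auto
    then show ?thesis using False by simp
  qed
  finally show ?thesis .
qed

text \<open>Let \<open>\<sigma>\<close> carry \<open>w'\<close> to \<open>w\<close>. On basis words,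
  \<open>coord w\<close> after the action of \<open>\<sigma>\<close> in degree \<open>n\<close>
  equals \<open>coord w'\<close>, and a symmetric tensor is fixed by this action.\<close>

lemma coord_symmetric:
  assumes c: "c \<in> SymC" and w: "w \<in> words" "w' \<in> words" "mset w = mset w'"
  shows "coord w c = coord w' c"
proof -
  define n where "n = length w'"
  obtain \<sigma> where \<sigma>: "\<sigma> permutes {..<n}" "permute_list \<sigma> w' = w"
    using mset_eq_permutation[OF w(3)] unfolding n_def by blast
  have ln: "length w = n" using w(3) n_def mset_eq_length by blast
  note TP = tensor_power_module[OF W_module]
  note pl = perm_action_spec[OF W_module \<sigma>(1)]
  let ?P = "\<lambda>x \<in> carrier TC. x(n := perm_action K W n \<sigma> (x n))"
  have xn: "x n \<in> carrier (tensor_power K W n)" if "x \<in> carrier TC" for x n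
    using lin_maps_closed[OF TC_proj_lin[of n] that] that by simp
  have P: "?P \<in> lin_maps K TC TC"
  proof (rule lin_maps_restrictI[OF TC_module])
    fix x assume x: "x \<in> carrier TC"
    have "{i. (x(n := perm_action K W n \<sigma> (x n))) i \<noteq> \<zero>\<^bsub>tensor_power K W i\<^esub>} \<subseteq> insert n {i. x i \<noteq> \<zero>\<^bsub>tensor_power K W i\<^esub>}"
      by auto
    then have "finite {i. (x(n := perm_action K W n \<sigma> (x n))) i \<noteq> \<zero>\<^bsub>tensor_power K W i\<^esub>}"
      by (rule finite_subset) (use x in \<open>auto simp: tensor_coalgebra_simps dsum_module_simps\<close>)
    then show "x(n := perm_action K W n \<sigma> (x n)) \<in> carrier TC"
      using x lin_maps_closed[OF pl(1) xn[OF x]] by (auto simp: tensor_coalgebra_simps dsum_module_simps)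
  qed (use xn in \<open>auto simp: tensor_coalgebra_simps(2,4) dsum_module_simps fun_eq_iff lin_maps_add[OF pl(1)] lin_maps_smult[OF pl(1)]\<close>)
  have "compose (carrier TC) (coord w) ?P = coord w'"
  proof (rule lin_basis_eqI[OF TC_basis TC_module self_mod lin_maps_compose[OF TC_module P coord_lin[OF w(1)]] coord_lin[OF w(2)]])
    fix v assume v: "v \<in> words"
    have vc: "set v \<subseteq> carrier W" by (rule words_carrier[OF v])
    show "compose (carrier TC) (coord w) ?P (tword_at K W v) = coord w' (tword_at K W v)"
    proof (cases "length v = n")
      case True
      have pv: "permute_list \<sigma> v \<in> words" using v \<sigma>(1) True by (auto simp: set_permute_list)
      have "(tword_at K W v)(n := perm_action K W n \<sigma> (tword_at K W v n)) = tword_at K W (permute_list \<sigma> v)"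
        using True pl(2)[OF vc True] by (auto simp: tword_at_def fun_eq_iff)
      moreover have "permute_list \<sigma> v = w \<longleftrightarrow> v = w'"
        using permute_list_inj[OF \<sigma>(1) True, of w'] \<sigma>(2) n_def by auto
      ultimately show ?thesis
        using tword_at_TC[OF vc] coord_word[OF w(1) pv] coord_word[OF w(2) v] by (simp add: compose_eq)
    next
      case False
      then have "(tword_at K W v)(n := perm_action K W n \<sigma> (tword_at K W v n)) = tword_at K W v"
        using lin_maps_zero[OF TP TP pl(1)] by (auto simp: tword_at_def fun_eq_iff)
      then show ?thesis
        using tword_at_TC[OF vc] coord_word[OF w(1) v] coord_word[OF w(2) v] False ln n_def by (auto simp add: compose_eq)
    qed
  qed
  from fun_cong[OF this, of c] have "coord w' c = coord w (c(n := perm_action K W n \<sigma> (c n)))"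
    using SymC_TC[OF c] by (simp add: compose_eq)
  moreover have "perm_action K W n \<sigma> (c n) = c n"
    using c \<sigma>(1) by (auto simp: SymC_def symmetric_tensors_def)
  ultimately show ?thesis by simp
qed

text \<open>By \<open>coord_symmetric\<close> the coordinates of a symmetric tensor are constant on
  the arrangements of a multiset. It is therefore the sum of the \<open>dpow m\<close>, each with
  its coordinate at an arbitrary arrangement \<open>rep m\<close> as coefficient; only finitely many
  contents occur.\<close>

lemma SymE_basis: "lin_basis K SymE content dpow"
proof -
  interpret S: module K "self_module K" by (rule self_mod)
  define rep :: "'w multiset \<Rightarrow> 'w list" where "rep m = (SOME w. mset w = m)" for m
  have rep: "mset (rep m) = m" for m unfolding rep_def by (rule someI_ex) (rule ex_mset)
  have repw: "rep m \<in> words" if "m \<in> content" for m using content_words[OF that rep] .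
  have A: "dpow ` content \<subseteq> carrier SymE" using dpow_SymC by auto
  let ?N = "lin_span K SymE (dpow ` content)"
  have N: "submodule ?N K SymE" by (rule lin_span_submodule[OF SymE_module A])
  have "c \<in> ?N" if c: "c \<in> SymC" for c
  proof -
    let ?X = "mset ` {w \<in> words. coord w c \<noteq> \<zero>\<^bsub>K\<^esub>}"
    have fin: "finite ?X" using coord_finite[OF SymC_TC[OF c]] by simp
    have X: "?X \<subseteq> content" by auto
    have cc: "coord w x \<in> carrier K" if "w \<in> words" "x \<in> carrier TC" for w x
      using lin_maps_closed[OF coord_lin[OF that(1)] that(2)] by simp
    let ?t = "\<lambda>m. coord (rep m) c \<odot>\<^bsub>SymE\<^esub> dpow m"
    have tN: "?t m \<in> ?N" if "m \<in> content" for m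
      by (rule submodule_smult[OF N cc[OF repw[OF that] SymC_TC[OF c]] subsetD[OF lin_span_superset]]) (use that in auto)
    have tE: "?t m \<in> SymC" if "m \<in> content" for m using tN[OF that] submodule_subset[OF N] by auto
    define d where "d = (\<Oplus>\<^bsub>SymE\<^esub>m\<in>?X. ?t m)"
    have dN: "d \<in> ?N" unfolding d_def by (rule submodule_finsum[OF SymE_module N]) (use tN X in auto)
    then have dC: "d \<in> SymC" using submodule_subset[OF N] by auto
    have "coord w c = coord w d" if w: "w \<in> words" for w
    proof -
      have mw: "mset w \<in> content" using w by auto
      have eq: "coord (rep (mset w)) c = coord w c"
        by (rule coord_symmetric[OF c repw[OF mw] w rep])
      have "(\<lambda>x \<in> SymC. coord w x) d = (\<Oplus>\<^bsub>self_module K\<^esub>m\<in>?X. (\<lambda>x \<in> SymC. coord w x) (?t m))"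
        unfolding d_def by (rule lin_maps_finsum[OF SymE_module self_mod restrict_lin[OF coord_lin[OF w]]]) (use tE X in auto)
      also have "\<dots> = (\<Oplus>\<^bsub>self_module K\<^esub>m\<in>?X. if mset w = m then coord w c else \<zero>\<^bsub>self_module K\<^esub>)"
      proof (rule S.finsum_cong')
        show "(\<lambda>m. if mset w = m then coord w c else \<zero>\<^bsub>self_module K\<^esub>) \<in> ?X \<rightarrow> carrier (self_module K)"
          using cc[OF w SymC_TC[OF c]] by auto
        fix m assume "m \<in> ?X"
        then have m: "m \<in> content" using X by auto
        have "coord w (?t m) = coord (rep m) c \<otimes>\<^bsub>K\<^esub> coord w (dpow m)"
          using lin_maps_smult[OF coord_lin[OF w] cc[OF repw[OF m] SymC_TC[OF c]] dpow_TC[OF m]] by simp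
        then show "(\<lambda>x \<in> SymC. coord w x) (?t m) = (if mset w = m then coord w c else \<zero>\<^bsub>self_module K\<^esub>)"
          using tE[OF m] coord_dpow[OF m w] eq cc[OF repw[OF m] SymC_TC[OF c]] by auto
      qed simp
      also have "\<dots> = coord w c"
      proof (cases "mset w \<in> ?X")
        case True
        then show ?thesis using S.finsum_singleton[of "mset w" ?X "\<lambda>_. coord w c"] fin cc[OF w SymC_TC[OF c]] by simp
      next
        case False
        then have z: "coord w c = \<zero>\<^bsub>K\<^esub>" using w by blast
        have "(\<Oplus>\<^bsub>self_module K\<^esub>m\<in>?X. if mset w = m then coord w c else \<zero>\<^bsub>self_module K\<^esub>) = \<zero>\<^bsub>self_module K\<^esub>"
          by (rule S.add.finprod_one_eqI) (use z in auto)
        then show ?thesis using z by simp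
      qed
      finally show ?thesis using dC by simp
    qed
    then have "c = d" by (intro coord_eqI SymC_TC c dC)
    then show ?thesis using dN by simp
  qed
  then have "?N = carrier SymE" using submodule_subset[OF N] by auto
  moreover have "\<exists>\<delta> \<in> lin_maps K SymE (self_module K). \<forall>y \<in> content. \<delta> (dpow y) = kron K y m"
    if m: "m \<in> content" for m
  proof (rule bexI[OF _ restrict_lin[OF coord_lin[OF repw[OF m]]]], rule ballI)
    fix y assume "y \<in> content"
    then show "(\<lambda>x \<in> SymC. coord (rep m) x) (dpow y) = kron K y m"
      using coord_dpow[OF _ repw[OF m], of y] dpow_SymC[of y] rep by auto
  qed
  ultimately show ?thesis using A by (auto simp: lin_basis_def)
qed

section \<open>Comultiplication and degree-one projection on divided powers\<close>

abbreviation "incl \<equiv> (\<lambda>x \<in> SymC. x)"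
abbreviation "incl2 \<equiv> tensor_map K SymE SymE TC TC incl incl"

text \<open>Over a field the inclusion has a retraction \<open>r\<close>, and
  \<open>r \<otimes> r\<close> is a left inverse of \<open>incl2\<close>. Injectivity makes the
  element described in \<open>subcoalgebra\<close> unique.\<close>

lemma incl2_inj:
  assumes "z \<in> carrier (tensor K SymE SymE)" "z' \<in> carrier (tensor K SymE SymE)" "incl2 z = incl2 z'"
  shows "z = z'"
proof -
  have "\<exists>r \<in> lin_maps K TC SymE. \<forall>x \<in> carrier SymE. r (incl x) = (\<lambda>x \<in> carrier SymE. x) x"
    by (rule lin_map_factor[OF K_field SymE_module TC_module SymE_module incl_lin lin_maps_id[OF SymE_module]]) auto
  then obtain r where r: "r \<in> lin_maps K TC SymE" "\<And>x. x \<in> SymC \<Longrightarrow> r x = x" by auto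
  note EE = tensor_module[OF SymE_module SymE_module]
  let ?R = "tensor_map K TC TC SymE SymE r r"
  have R: "?R \<in> lin_maps K (tensor K TC TC) (tensor K SymE SymE)"
    by (rule tensor_map_lin[OF TC_module TC_module SymE_module SymE_module r(1) r(1)])
  have I: "incl2 \<in> lin_maps K (tensor K SymE SymE) (tensor K TC TC)"
    by (rule tensor_map_lin[OF SymE_module SymE_module TC_module TC_module incl_lin incl_lin])
  have "compose (carrier (tensor K SymE SymE)) ?R incl2 = (\<lambda>x \<in> carrier (tensor K SymE SymE). x)"
  proof (rule tensor_eqI[OF SymE_module SymE_module EE lin_maps_compose[OF EE I R] lin_maps_id[OF EE]])
    fix x y assume xy: "x \<in> carrier SymE" "y \<in> carrier SymE"
    then show "compose (carrier (tensor K SymE SymE)) ?R incl2 (tens K SymE SymE x y) =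
      (\<lambda>x \<in> carrier (tensor K SymE SymE). x) (tens K SymE SymE x y)"
      using tensor_map_tens[OF SymE_module SymE_module TC_module TC_module incl_lin incl_lin xy]
        tensor_map_tens[OF TC_module TC_module SymE_module SymE_module r(1) r(1) SymC_TC SymC_TC, of x y]
        tens_closed[OF SymE_module SymE_module xy] r(2)
      by (simp add: compose_eq)
  qed
  then have eq: "compose (carrier (tensor K SymE SymE)) ?R incl2 x = (\<lambda>x \<in> carrier (tensor K SymE SymE). x) x" for x
    by (rule fun_cong)
  have "?R (incl2 x) = x" if "x \<in> carrier (tensor K SymE SymE)" for x
    using eq[of x] that by (simp only: compose_eq restrict_apply if_True)
  then show ?thesis using assms by metis
qed

lemma comult_dpow_TC:
  assumes m: "m \<in> content"
  shows "comult TC (dpow m) = (\<Oplus>\<^bsub>tensor K TC TC\<^esub>a\<in>submsets m. tens K TC TC (dpow a) (dpow (m - a)))"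
proof -
  note TT = tensor_module[OF TC_module TC_module] and bil = tens_bilin[OF TC_module TC_module]
  interpret TT: module K "tensor K TC TC" by (rule TT)
  let ?f = "\<lambda>u v. tens K TC TC (tword_at K W u) (tword_at K W v)"
  have uv: "set u \<subseteq> carrier W" if "mset u \<subseteq># m" for u
    using set_mset_mono[OF that] m B_subset by auto
  have tw: "tword_at K W u \<in> carrier TC" if "mset u \<subseteq># m" for u by (rule tword_at_TC[OF uv[OF that]])
  have fc: "?f u v \<in> carrier (tensor K TC TC)" if "mset u + mset v = m" for u v
    by (rule tens_closed[OF TC_module TC_module]) (use tw that in auto)
  have "comult TC (dpow m) = (\<Oplus>\<^bsub>tensor K TC TC\<^esub>w\<in>{w. mset w = m}. comult TC (tword_at K W w))"
    unfolding dpow_def by (rule lin_maps_finsum[OF TC_module TT TC_comult(1)]) (use tw in auto)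
  also have "\<dots> = (\<Oplus>\<^bsub>tensor K TC TC\<^esub>w\<in>{w. mset w = m}. \<Oplus>\<^bsub>tensor K TC TC\<^esub>i\<in>{..length w}. ?f (take i w) (drop i w))"
  proof (rule TT.finsum_cong')
    show "(\<lambda>w. \<Oplus>\<^bsub>tensor K TC TC\<^esub>i\<in>{..length w}. ?f (take i w) (drop i w)) \<in> {w. mset w = m} \<rightarrow> carrier (tensor K TC TC)"
      by (auto intro!: TT.finsum_closed fc simp flip: mset_append)
    fix w assume "w \<in> {w. mset w = m}"
    then show "comult TC (tword_at K W w) = (\<Oplus>\<^bsub>tensor K TC TC\<^esub>i\<in>{..length w}. ?f (take i w) (drop i w))"
      by (intro TC_comult(2) uv) auto
  qed simp
  also have "\<dots> = (\<Oplus>\<^bsub>tensor K TC TC\<^esub>a\<in>submsets m. \<Oplus>\<^bsub>tensor K TC TC\<^esub>u\<in>{u. mset u = a}. \<Oplus>\<^bsub>tensor K TC TC\<^esub>v\<in>{v. mset v = m - a}. ?f u v)"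
    by (rule TT.finsum_deconcat_eq_finsum_content[OF fc])
  also have "\<dots> = (\<Oplus>\<^bsub>tensor K TC TC\<^esub>a\<in>submsets m. tens K TC TC (dpow a) (dpow (m - a)))"
  proof (rule TT.finsum_cong')
    have sub: "a \<in> content" if "a \<subseteq># m" for a using set_mset_mono[OF that] m by auto
    show "(\<lambda>a. tens K TC TC (dpow a) (dpow (m - a))) \<in> submsets m \<rightarrow> carrier (tensor K TC TC)"
      by (auto intro!: tens_closed[OF TC_module TC_module] dpow_TC sub[unfolded mem_Collect_eq])
    fix a assume "a \<in> submsets m"
    then have a: "a \<subseteq># m" by simp
    have ac: "m - a \<in> content" by (rule sub) simp
    have "tens K TC TC (dpow a) (dpow (m - a)) =
      (\<Oplus>\<^bsub>tensor K TC TC\<^esub>u\<in>{u. mset u = a}. tens K TC TC (tword_at K W u) (dpow (m - a)))"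
      unfolding dpow_def[of a]
      by (rule bilin_finsum_left[OF bil TC_module TT]) (use tw a dpow_TC[OF ac] in auto)
    also have "\<dots> = (\<Oplus>\<^bsub>tensor K TC TC\<^esub>u\<in>{u. mset u = a}. \<Oplus>\<^bsub>tensor K TC TC\<^esub>v\<in>{v. mset v = m - a}. ?f u v)"
    proof (rule TT.finsum_cong')
      show "(\<lambda>u. \<Oplus>\<^bsub>tensor K TC TC\<^esub>v\<in>{v. mset v = m - a}. ?f u v) \<in> {u. mset u = a} \<rightarrow> carrier (tensor K TC TC)"
        using a by (auto intro!: TT.finsum_closed fc)
      fix u assume "u \<in> {u. mset u = a}"
      then show "tens K TC TC (tword_at K W u) (dpow (m - a)) = (\<Oplus>\<^bsub>tensor K TC TC\<^esub>v\<in>{v. mset v = m - a}. ?f u v)"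
        unfolding dpow_def
        by (intro bilin_finsum_right[OF bil TC_module TT]) (use tw a in auto)
    qed simp
    finally show "(\<Oplus>\<^bsub>tensor K TC TC\<^esub>u\<in>{u. mset u = a}. \<Oplus>\<^bsub>tensor K TC TC\<^esub>v\<in>{v. mset v = m - a}. ?f u v) =
      tens K TC TC (dpow a) (dpow (m - a))" by simp
  qed simp
  finally show ?thesis .
qed

abbreviation "C \<equiv> Sym K W"

lemma C_simps [simp]: "carrier C = SymC" "add C = add TC" "zero C = zero TC" "smult C = smult TC"
  by (simp_all add: Sym_def subcoalgebra_def Let_def SymC_def)

lemma C_module: "module K C"
  by (rule module_cong[OF SymE_module]) simp_all

lemma C_basis: "lin_basis K C content dpow"
  using SymE_basis by (subst lin_basis_cong[where M' = SymE]) simp_all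

lemma tensor_C: "tensor K C C = tensor K SymE SymE" "tens K C C = tens K SymE SymE"
  by (rule tensor_cong; simp)+

lemma content_sub: "m \<in> content \<Longrightarrow> a \<subseteq># m \<Longrightarrow> a \<in> content"
  using set_mset_mono[of a m] by auto

lemma C_comult_eq:
  "comult C = (\<lambda>c \<in> SymC. THE z. z \<in> carrier (tensor K SymE SymE) \<and> incl2 z = comult TC c)"
  by (simp add: Sym_def subcoalgebra_def Let_def SymC_def SymE_def)

text \<open>Let \<open>h\<close> be the linear map with these values on the basis. Then
  \<open>incl2\<close> after \<open>h\<close> agrees with \<open>comult TC\<close> on the basis,
  hence on all symmetric tensors, and \<open>incl2_inj\<close> identifies \<open>h\<close> with the
  map described in \<open>subcoalgebra\<close>.\<close>

lemma C_comult: "comult C \<in> lin_maps K C (tensor K C C)"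
  "m \<in> content \<Longrightarrow> comult C (dpow m) =
    (\<Oplus>\<^bsub>tensor K C C\<^esub>a\<in>submsets m. tens K C C (dpow a) (dpow (m - a)))"
proof -
  note EE = tensor_module[OF SymE_module SymE_module] and TT = tensor_module[OF TC_module TC_module]
  interpret EE: module K "tensor K SymE SymE" by (rule EE)
  interpret TT: module K "tensor K TC TC" by (rule TT)
  let ?g = "\<lambda>m. \<Oplus>\<^bsub>tensor K SymE SymE\<^esub>a\<in>submsets m. tens K SymE SymE (dpow a) (dpow (m - a))"
  have I: "incl2 \<in> lin_maps K (tensor K SymE SymE) (tensor K TC TC)"
    by (rule tensor_map_lin[OF SymE_module SymE_module TC_module TC_module incl_lin incl_lin])
  have tc: "tens K SymE SymE (dpow a) (dpow (m - a)) \<in> carrier (tensor K SymE SymE)" if "m \<in> content" "a \<subseteq># m" for m a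
    by (rule tens_closed[OF SymE_module SymE_module]) (use dpow_SymC content_sub[OF that(1)] that(2) in auto)
  have "?g \<in> content \<rightarrow> carrier (tensor K SymE SymE)" by (auto intro!: EE.finsum_closed tc)
  from lin_basis_lift[OF K_field SymE_basis SymE_module EE this] obtain h where
    h: "h \<in> lin_maps K SymE (tensor K SymE SymE)" "\<And>m. m \<in> content \<Longrightarrow> h (dpow m) = ?g m" by blast
  have "compose (carrier SymE) incl2 h = (\<lambda>x \<in> SymC. comult TC x)"
  proof (rule lin_basis_eqI[OF SymE_basis SymE_module TT lin_maps_compose[OF SymE_module h(1) I] restrict_lin[OF TC_comult(1)]])
    fix m assume m: "m \<in> content"
    have "incl2 (?g m) = (\<Oplus>\<^bsub>tensor K TC TC\<^esub>a\<in>submsets m. incl2 (tens K SymE SymE (dpow a) (dpow (m - a))))"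
      by (rule lin_maps_finsum[OF EE TT I]) (use tc[OF m] in auto)
    also have "\<dots> = (\<Oplus>\<^bsub>tensor K TC TC\<^esub>a\<in>submsets m. tens K TC TC (dpow a) (dpow (m - a)))"
    proof (rule TT.finsum_cong')
      show "(\<lambda>a. tens K TC TC (dpow a) (dpow (m - a))) \<in> submsets m \<rightarrow> carrier (tensor K TC TC)"
        by (rule Pi_I, rule tens_closed[OF TC_module TC_module])
          (simp_all only: mem_Collect_eq dpow_TC[OF content_sub[OF m]] diff_subset_eq_self)
      fix a assume "a \<in> submsets m"
      then have "dpow a \<in> SymC" "dpow (m - a) \<in> SymC" using content_sub[OF m] dpow_SymC by auto
      then show "incl2 (tens K SymE SymE (dpow a) (dpow (m - a))) = tens K TC TC (dpow a) (dpow (m - a))"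
        using tensor_map_tens[OF SymE_module SymE_module TC_module TC_module incl_lin incl_lin] by simp
    qed simp
    finally show "compose (carrier SymE) incl2 h (dpow m) = (\<lambda>x \<in> SymC. comult TC x) (dpow m)"
      using dpow_SymC[OF m] h(2)[OF m] by (simp add: compose_eq comult_dpow_TC[OF m])
  qed
  then have heq: "compose (carrier SymE) incl2 h c = (\<lambda>x \<in> SymC. comult TC x) c" for c
    by (rule fun_cong)
  have hc: "incl2 (h c) = comult TC c" if "c \<in> SymC" for c
    using heq[of c] that by (simp only: compose_eq restrict_apply if_True SymE_simps(1))
  have "comult C = h"
  proof (rule ext)
    fix c
    show "comult C c = h c"
    proof (cases "c \<in> SymC")
      case True
      have hcl: "h c \<in> carrier (tensor K SymE SymE)" using lin_maps_closed[OF h(1), of c] True by simp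
      have "(THE z. z \<in> carrier (tensor K SymE SymE) \<and> incl2 z = comult TC c) = h c"
      proof (rule the_equality)
        show "h c \<in> carrier (tensor K SymE SymE) \<and> incl2 (h c) = comult TC c" using hcl hc[OF True] by simp
        fix z assume "z \<in> carrier (tensor K SymE SymE) \<and> incl2 z = comult TC c"
        then show "z = h c" using incl2_inj[OF _ hcl, of z] hc[OF True] by simp
      qed
      then show ?thesis using True by (simp add: C_comult_eq)
    next
      case False
      then show ?thesis using lin_maps_arb[OF h(1), of c] by (simp add: C_comult_eq)
    qed
  qed
  moreover have "lin_maps K C (tensor K C C) = lin_maps K SymE (tensor K SymE SymE)"
    unfolding tensor_C by (rule lin_maps_cong) simp_all
  ultimately show "comult C \<in> lin_maps K C (tensor K C C)" "m \<in> content \<Longrightarrow> comult C (dpow m) =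
    (\<Oplus>\<^bsub>tensor K C C\<^esub>a\<in>submsets m. tens K C C (dpow a) (dpow (m - a)))"
    using h unfolding tensor_C by auto
qed

text \<open>The map \<open>L\<close> inverts \<open>w \<mapsto> tword K W [w]\<close> and so
  identifies the first tensor power with \<open>W\<close>. Hence the description in
  \<open>Sym_proj1\<close> denotes \<open>L (c 1)\<close>, and only multisets with one element have
  a component in degree one.\<close>

lemma Sym_proj1: "Sym_proj1 K W \<in> lin_maps K C W"
  "m \<in> content \<Longrightarrow> size m \<noteq> 1 \<Longrightarrow> Sym_proj1 K W (dpow m) = \<zero>\<^bsub>W\<^esub>"
  "b \<in> B \<Longrightarrow> Sym_proj1 K W (dpow {#b#}) = b"
proof -
  interpret W: module K W by (rule W_module)
  note TP = tensor_power_module[OF W_module, of 1]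
  have "multilin K W 1 W hd"
    by (rule multilinI[OF W_module W_module]) (auto simp: length_Suc_conv)
  from tensor_power_lift[OF W_module W_module this] obtain L where
    L: "L \<in> lin_maps K (tensor_power K W 1) W" "\<And>ws. set ws \<subseteq> carrier W \<Longrightarrow> length ws = 1 \<Longrightarrow> L (tword K W ws) = hd ws"
    by blast
  have Lw: "L (tword K W [w]) = w" if "w \<in> carrier W" for w using L(2)[of "[w]"] that by simp
  have tw: "(\<lambda>w \<in> carrier W. tword K W [w]) \<in> lin_maps K W (tensor_power K W 1)"
    using multilin_lin[OF tword_multilin[OF W_module], of "[]" "[]" 1] by simp
  have "compose (carrier (tensor_power K W 1)) (\<lambda>w \<in> carrier W. tword K W [w]) L = (\<lambda>t \<in> carrier (tensor_power K W 1). t)"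
  proof (rule tensor_power_eqI[OF W_module TP lin_maps_compose[OF TP L(1) tw] lin_maps_id[OF TP]])
    fix ws :: "'w list" assume ws: "set ws \<subseteq> carrier W" "length ws = 1"
    then obtain w where w: "ws = [w]" "w \<in> carrier W" by (cases ws) auto
    show "compose (carrier (tensor_power K W 1)) (\<lambda>w \<in> carrier W. tword K W [w]) L (tword K W ws) = (\<lambda>t \<in> carrier (tensor_power K W 1). t) (tword K W ws)"
      using tword_closed[OF W_module ws] w Lw[OF w(2)] by (simp add: compose_eq)
  qed
  then have teq: "compose (carrier (tensor_power K W 1)) (\<lambda>w \<in> carrier W. tword K W [w]) L t = (\<lambda>t \<in> carrier (tensor_power K W 1). t) t" for t
    by (rule fun_cong)
  have tL: "tword K W [L t] = t" if "t \<in> carrier (tensor_power K W 1)" for t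
    using teq[of t] that lin_maps_closed[OF L(1) that] by (simp only: compose_eq restrict_apply if_True)
  have c1: "c 1 \<in> carrier (tensor_power K W 1)" if "c \<in> SymC" for c
    using lin_maps_closed[OF TC_proj_lin[of 1] SymC_TC[OF that]] SymC_TC[OF that] by simp
  have eq: "Sym_proj1 K W = (\<lambda>c \<in> SymC. L (c 1))"
  proof
    fix c
    show "Sym_proj1 K W c = (\<lambda>c \<in> SymC. L (c 1)) c"
    proof (cases "c \<in> SymC")
      case True
      have "(THE w. w \<in> carrier W \<and> c 1 = tword K W [w]) = L (c 1)"
      proof (rule the_equality)
        show "L (c 1) \<in> carrier W \<and> c 1 = tword K W [L (c 1)]"
          using tL[OF c1[OF True]] lin_maps_closed[OF L(1) c1[OF True]] by simp
      qed (use Lw in auto)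
      then show ?thesis using True by (simp add: Sym_proj1_def)
    qed (simp add: Sym_proj1_def)
  qed
  have "(\<lambda>c \<in> SymC. compose (carrier TC) L (\<lambda>x \<in> carrier TC. x 1) c) \<in> lin_maps K SymE W"
    by (rule restrict_lin[OF lin_maps_compose[OF TC_module TC_proj_lin L(1)]])
  moreover have "(\<lambda>c \<in> SymC. compose (carrier TC) L (\<lambda>x \<in> carrier TC. x 1) c) = (\<lambda>c \<in> SymC. L (c 1))"
    using SymC_TC by (auto simp: compose_eq intro!: restrict_ext)
  moreover have "lin_maps K SymE W = lin_maps K C W" by (rule lin_maps_cong) simp_all
  ultimately show lin: "Sym_proj1 K W \<in> lin_maps K C W" unfolding eq by simp
  have comp: "dpow m 1 = (\<Oplus>\<^bsub>tensor_power K W 1\<^esub>w\<in>{w. mset w = m}. tword_at K W w 1)" if m: "m \<in> content" for m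
  proof -
    interpret P: module K "tensor_power K W 1" by (rule TP)
    have wc: "set w \<subseteq> carrier W" if "mset w = m" for w using that m B_subset by auto
    have "(\<lambda>x \<in> carrier TC. x 1) (dpow m) = (\<Oplus>\<^bsub>tensor_power K W 1\<^esub>w\<in>{w. mset w = m}. (\<lambda>x \<in> carrier TC. x 1) (tword_at K W w))"
      unfolding dpow_def by (rule lin_maps_finsum[OF TC_module TP TC_proj_lin]) (use tword_at_TC wc in auto)
    also have "\<dots> = (\<Oplus>\<^bsub>tensor_power K W 1\<^esub>w\<in>{w. mset w = m}. tword_at K W w 1)"
      using tword_at_TC wc lin_maps_closed[OF TC_proj_lin[of 1] tword_at_TC] by (intro P.finsum_cong') auto
    finally show ?thesis using dpow_TC[OF m] by simp
  qed
  interpret P: module K "tensor_power K W 1" by (rule TP)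
  show "Sym_proj1 K W (dpow m) = \<zero>\<^bsub>W\<^esub>" if m: "m \<in> content" "size m \<noteq> 1"
  proof -
    have "dpow m 1 = \<zero>\<^bsub>tensor_power K W 1\<^esub>"
      unfolding comp[OF m(1)] by (rule P.add.finprod_one_eqI) (use m in \<open>auto simp: tword_at_def\<close>)
    then show ?thesis using dpow_SymC[OF m(1)] lin_maps_zero[OF TP W_module L(1)] by (simp add: eq)
  qed
  show "Sym_proj1 K W (dpow {#b#}) = b" if b: "b \<in> B"
  proof -
    have m: "{#b#} \<in> content" using b by simp
    have "{w. mset w = {#b#}} = {[b]}" by auto
    then have s: "dpow {#b#} 1 = (\<Oplus>\<^bsub>tensor_power K W 1\<^esub>w\<in>{[b]}. tword_at K W w 1)"
      using comp[OF m] by simp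
    have "tword K W [b] \<in> carrier (tensor_power K W 1)"
      by (rule tword_closed[OF W_module]) (use b B_subset in auto)
    then have "dpow {#b#} 1 = tword K W [b]"
      unfolding s by (subst P.finsum_insert) (auto simp: tword_at_def simp del: One_nat_def)
    then show ?thesis using dpow_SymC[OF m] Lw b B_subset by (auto simp: eq)
  qed
qed

end

section \<open>Free contramodules\<close>

lemma bilin_curry:
  assumes "module K M" "module K N" "bilin K M N Q \<beta>"
  shows "(\<lambda>x \<in> carrier M. \<lambda>y \<in> carrier N. \<beta> x y) \<in> lin_maps K M (hom_module K N Q)"
proof (rule lin_maps_restrictI[OF assms(1)])
  interpret M: module K M by fact
  show "(\<lambda>y \<in> carrier N. \<beta> x y) \<in> carrier (hom_module K N Q)" if "x \<in> carrier M" for x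
    using that assms(3) by (simp add: bilin_def)
  have l: "(\<lambda>x \<in> carrier M. \<beta> x y) \<in> lin_maps K M Q" if "y \<in> carrier N" for y
    using that assms(3) by (simp add: bilin_def)
  show "(\<lambda>y \<in> carrier N. \<beta> (x \<oplus>\<^bsub>M\<^esub> x') y) = (\<lambda>y \<in> carrier N. \<beta> x y) \<oplus>\<^bsub>hom_module K N Q\<^esub> (\<lambda>y \<in> carrier N. \<beta> x' y)"
    if "x \<in> carrier M" "x' \<in> carrier M" for x x'
    using that lin_maps_add[OF l that] by (auto intro!: restrict_ext)
  show "(\<lambda>y \<in> carrier N. \<beta> (a \<odot>\<^bsub>M\<^esub> x) y) = a \<odot>\<^bsub>hom_module K N Q\<^esub> (\<lambda>y \<in> carrier N. \<beta> x y)"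
    if "a \<in> carrier K" "x \<in> carrier M" for a x
    using that lin_maps_smult[OF l that] by (auto intro!: restrict_ext)
qed

lemma bilin_uncurry:
  assumes "module K M" "module K N" "\<phi> \<in> lin_maps K M (hom_module K N Q)"
  shows "bilin K M N Q \<phi>"
proof -
  have cl: "\<phi> x \<in> lin_maps K N Q" if "x \<in> carrier M" for x using lin_maps_closed[OF assms(3) that] by simp
  show ?thesis
  proof (rule bilinI[OF assms(1,2)])
    show "\<phi> (x \<oplus>\<^bsub>M\<^esub> x') y = \<phi> x y \<oplus>\<^bsub>Q\<^esub> \<phi> x' y" if "x \<in> carrier M" "x' \<in> carrier M" "y \<in> carrier N" for x x' y
      using lin_maps_add[OF assms(3) that(1,2)] that by simp
    show "\<phi> (a \<odot>\<^bsub>M\<^esub> x) y = a \<odot>\<^bsub>Q\<^esub> \<phi> x y" if "a \<in> carrier K" "x \<in> carrier M" "y \<in> carrier N" for a x y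
      using lin_maps_smult[OF assms(3) that(1,2)] that by simp
  qed (simp_all add: lin_maps_closed[OF cl] lin_maps_add[OF cl] lin_maps_smult[OF cl])
qed

lemma bilin_flip: "bilin K M N Q \<beta> \<Longrightarrow> bilin K N M Q (\<lambda>y x. \<beta> x y)"
  by (auto simp: bilin_def)

text \<open>Coassociativity in coordinates: both sides sum over the ordered decompositions
  \<open>m = a + c + d\<close>, with \<open>b = a + c\<close> on the right.\<close>

lemma (in abelian_monoid) finsum_submset_assoc:
  assumes "\<And>a c d. a + c + d = m \<Longrightarrow> g a c d \<in> carrier G"
  shows "(\<Oplus>a\<in>submsets m. \<Oplus>c\<in>submsets (m - a). g a c (m - a - c)) =
    (\<Oplus>b\<in>submsets m. \<Oplus>a\<in>submsets b. g a (b - a) (m - b))"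
proof -
  have sum: "a + c + (m - a - c) = m" if "a \<subseteq># m" "c \<subseteq># m - a" for a c
    using that by (metis subset_mset.add_diff_inverse add.assoc)
  have sum': "a + (b - a) + (m - b) = m" if "a \<subseteq># b" "b \<subseteq># m" for a b
    using that by (simp add: subset_mset.add_diff_inverse)
  have bij: "bij_betw (\<lambda>(b, a). (a, b - a)) (SIGMA b:submsets m. submsets b) (SIGMA a:submsets m. submsets (m - a))"
  proof (rule bij_betw_byWitness[where f' = "\<lambda>(a, c). (a + c, a)"])
    show "(\<lambda>(b, a). (a, b - a)) ` (SIGMA b:submsets m. submsets b) \<subseteq> (SIGMA a:submsets m. submsets (m - a))"
      by (auto intro: subset_mset.trans) (metis subset_mset.add_diff_inverse subset_mset.add_le_cancel_left subset_mset.order_trans)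
    show "(\<lambda>(a, c). (a + c, a)) ` (SIGMA a:submsets m. submsets (m - a)) \<subseteq> (SIGMA b:submsets m. submsets b)"
      by auto (metis subset_mset.add_diff_inverse subset_mset.add_le_cancel_left)
  qed (auto simp: subset_mset.add_diff_inverse)
  have "(\<Oplus>a\<in>submsets m. \<Oplus>c\<in>submsets (m - a). g a c (m - a - c)) =
    (\<Oplus>p\<in>(SIGMA a:submsets m. submsets (m - a)). g (fst p) (snd p) (m - fst p - snd p))"
    by (rule finsum_Sigma[OF finite_submsets finite_submsets]) (rule assms, rule sum, simp_all)
  also have "\<dots> = (\<Oplus>p\<in>(SIGMA b:submsets m. submsets b). g (snd p) (fst p - snd p) (m - fst p))"
  proof (subst finsum_bij[OF bij])
    show "g (fst y) (snd y) (m - fst y - snd y) \<in> carrier G" if "y \<in> (SIGMA a:submsets m. submsets (m - a))" for y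
      by (rule assms, rule sum) (use that in auto)
    show "(\<Oplus>x\<in>(SIGMA b:submsets m. submsets b). g (fst (case x of (b, a) \<Rightarrow> (a, b - a))) (snd (case x of (b, a) \<Rightarrow> (a, b - a)))
        (m - fst (case x of (b, a) \<Rightarrow> (a, b - a)) - snd (case x of (b, a) \<Rightarrow> (a, b - a)))) =
      (\<Oplus>p\<in>(SIGMA b:submsets m. submsets b). g (snd p) (fst p - snd p) (m - fst p))"
    proof (rule finsum_cong')
      show "(\<lambda>p. g (snd p) (fst p - snd p) (m - fst p)) \<in> (SIGMA b:submsets m. submsets b) \<rightarrow> carrier G"
        by (auto intro!: assms sum')
    qed (auto simp: subset_mset.add_diff_inverse diff_diff_add_mset)
  qed
  also have "\<dots> = (\<Oplus>b\<in>submsets m. \<Oplus>a\<in>submsets b. g a (b - a) (m - b))"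
    by (rule finsum_Sigma[symmetric, OF finite_submsets finite_submsets]) (auto intro!: assms sum')
  finally show ?thesis .
qed

lemma submset_diff_diff: "a \<subseteq># m \<Longrightarrow> m - (m - a) = a"
  by (simp add: subseteq_mset_def multiset_eq_iff)

lemma bij_betw_submset_diff: "bij_betw (\<lambda>a. m - a) (submsets m) (submsets m)"
  by (rule bij_betw_byWitness[where f' = "\<lambda>a. m - a"]) (auto simp: submset_diff_diff)

text \<open>The involution \<open>s\<close> cancels the terms in pairs. Fixed points have their own
  premise because a term equal to its negative need not vanish in characteristic two.\<close>

lemma (in abelian_group) finsum_antisymmetric:
  assumes "finite A" "\<And>a. a \<in> A \<Longrightarrow> s a \<in> A" "\<And>a. a \<in> A \<Longrightarrow> s (s a) = a"
    and "\<And>a. a \<in> A \<Longrightarrow> g a \<in> carrier G" "\<And>a. a \<in> A \<Longrightarrow> g (s a) = \<ominus> g a"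
    and "\<And>a. a \<in> A \<Longrightarrow> s a = a \<Longrightarrow> g a = \<zero>"
  shows "(\<Oplus>a\<in>A. g a) = \<zero>"
  using assms
proof (induction A rule: finite_psubset_induct)
  case (psubset A)
  show ?case
  proof (cases "A = {}")
    case False
    then obtain a where a: "a \<in> A" by auto
    let ?A = "A - {a, s a}"
    have IH: "(\<Oplus>a\<in>?A. g a) = \<zero>"
    proof (rule psubset.IH)
      show "?A \<subset> A" using a by auto
      show "s b \<in> ?A" if "b \<in> ?A" for b
        using that psubset.prems(1,2) a by (metis Diff_iff insert_iff empty_iff)
    qed (use psubset.prems in auto)
    have gA: "g \<in> ?A \<rightarrow> carrier G" "g a \<in> carrier G" "g (s a) \<in> carrier G" using psubset.prems a by auto
    show ?thesis
    proof (cases "s a = a")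
      case True
      then have "A = insert a ?A" using a by auto
      then have "(\<Oplus>a\<in>A. g a) = g a \<oplus> (\<Oplus>a\<in>?A. g a)"
        using finsum_insert[of ?A a g] gA psubset.hyps by auto
      then show ?thesis using IH psubset.prems(5)[OF a True] by simp
    next
      case False
      have A: "A = insert a (insert (s a) ?A)" using a psubset.prems(1) by auto
      have "(\<Oplus>a\<in>insert a (insert (s a) ?A). g a) = g a \<oplus> (g (s a) \<oplus> (\<Oplus>a\<in>?A. g a))"
        using False gA psubset.hyps by (subst finsum_insert; (subst finsum_insert)?; auto)
      then show ?thesis using A IH psubset.prems(4)[OF a] gA by (simp add: r_neg)
    qed
  qed simp
qed

context based_space
begin

section \<open>Free contramodules and their morphisms in coordinates\<close>

abbreviation "FC V \<equiv> free_contramodule K C V"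
abbreviation "Mor V U \<equiv> contra_morphisms K C (FC V) (FC U)"
abbreviation "idF V \<equiv> \<lambda>\<phi> \<in> lin_maps K C V. \<phi>"

lemma FC_simps [simp]:
  "carrier (FC V) = lin_maps K C V"
  "zero (FC V) = (\<lambda>x \<in> SymC. \<zero>\<^bsub>V\<^esub>)"
  "add (FC V) = (\<lambda>f g. \<lambda>x \<in> SymC. f x \<oplus>\<^bsub>V\<^esub> g x)"
  "smult (FC V) = (\<lambda>a f. \<lambda>x \<in> SymC. a \<odot>\<^bsub>V\<^esub> f x)"
  "contra (FC V) \<Phi> = (\<lambda>c \<in> SymC. tensor_lift K C C V (\<lambda>x y. \<Phi> y x) (comult C c))"
  by (simp_all add: free_contramodule_def module.defs)

lemma FC_module: "module K V \<Longrightarrow> module K (FC V)"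
  by (rule module_cong[OF hom_module_module[OF C_module]]) simp_all

lemma lin_maps_FC: "lin_maps K M (FC V) = lin_maps K M (hom_module K C V)"
  by (rule lin_maps_cong) simp_all

lemma C_eqI:
  assumes "module K V" "f \<in> lin_maps K C V" "g \<in> lin_maps K C V" "\<And>m. m \<in> content \<Longrightarrow> f (dpow m) = g (dpow m)"
  shows "f = g"
  by (rule lin_basis_eqI[OF C_basis C_module assms(1-3)]) (rule assms(4))

lemma tensor_lift_comult:
  assumes "module K V" "bilin K C C V \<beta>" "m \<in> content"
  shows "tensor_lift K C C V \<beta> (comult C (dpow m)) = (\<Oplus>\<^bsub>V\<^esub>a\<in>submsets m. \<beta> (dpow a) (dpow (m - a)))"
proof -
  interpret V: module K V by fact
  have sv: "dpow a \<in> carrier C" if "a \<subseteq># m" for a using dpow_SymC[OF content_sub[OF assms(3) that]] by simp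
  have "tensor_lift K C C V \<beta> (comult C (dpow m)) =
    (\<Oplus>\<^bsub>V\<^esub>a\<in>submsets m. tensor_lift K C C V \<beta> (tens K C C (dpow a) (dpow (m - a))))"
    unfolding C_comult(2)[OF assms(3)]
    by (rule lin_maps_finsum[OF tensor_module[OF C_module C_module] assms(1) tensor_lift_lin[OF C_module C_module assms(1,2)]])
      (use sv tens_closed[OF C_module C_module] in auto)
  also have "\<dots> = (\<Oplus>\<^bsub>V\<^esub>a\<in>submsets m. \<beta> (dpow a) (dpow (m - a)))"
    using sv tensor_lift_tens[OF C_module C_module assms(1,2)] bilin_closed[OF assms(2)]
    by (intro V.finsum_cong') auto
  finally show ?thesis .
qed

lemma FC_bilin:
  assumes "module K V" "\<Phi> \<in> lin_maps K C (FC V)"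
  shows "bilin K C C V (\<lambda>x y. \<Phi> y x)"
  using assms bilin_flip[OF bilin_uncurry[OF C_module C_module]] by (simp add: lin_maps_FC)

lemma contra_closed:
  assumes "module K V" "\<Phi> \<in> lin_maps K C (FC V)"
  shows "contra (FC V) \<Phi> \<in> lin_maps K C V"
  using lin_maps_compose[OF C_module C_comult(1) tensor_lift_lin[OF C_module C_module assms(1) FC_bilin[OF assms]]]
  by (simp add: compose_def)

lemma contra_dpow:
  assumes "module K V" "\<Phi> \<in> lin_maps K C (FC V)" "m \<in> content"
  shows "contra (FC V) \<Phi> (dpow m) = (\<Oplus>\<^bsub>V\<^esub>a\<in>submsets m. \<Phi> (dpow (m - a)) (dpow a))"
  using tensor_lift_comult[OF assms(1) FC_bilin[OF assms(1,2)] assms(3)] dpow_SymC[OF assms(3)] by simp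

text \<open>At a divided power the contraaction is a finite sum of values of \<open>\<Phi>\<close>,
  from which linearity can be read.\<close>

lemma contra_lin:
  assumes "module K V"
  shows "(\<lambda>\<Phi> \<in> lin_maps K C (FC V). contra (FC V) \<Phi>) \<in> lin_maps K (hom_module K C (FC V)) (FC V)"
proof -
  have P: "module K (FC V)" by (rule FC_module[OF assms])
  interpret V: module K V by fact
  have H: "module K (hom_module K C (FC V))" by (rule hom_module_module[OF C_module P])
  interpret H: module K "hom_module K C (FC V)" by (rule H)
  have cl: "\<Phi> (dpow (m - a)) (dpow a) \<in> carrier V" if "\<Phi> \<in> lin_maps K C (FC V)" "m \<in> content" "a \<subseteq># m" for \<Phi> m a
  proof -
    have "dpow (m - a) \<in> SymC" "dpow a \<in> SymC" using that content_sub[OF that(2)] dpow_SymC by auto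
    then show ?thesis using bilin_closed[OF FC_bilin[OF assms that(1)], of "dpow a" "dpow (m - a)"] by simp
  qed
  have sv: "dpow (m - a) \<in> SymC" "dpow a \<in> SymC" if "m \<in> content" "a \<subseteq># m" for m a
    using that content_sub[OF that(1)] dpow_SymC by auto
  have "(\<lambda>\<Phi> \<in> carrier (hom_module K C (FC V)). contra (FC V) \<Phi>) \<in> lin_maps K (hom_module K C (FC V)) (FC V)"
  proof (rule lin_maps_restrictI[OF H])
    fix \<Phi> assume "\<Phi> \<in> carrier (hom_module K C (FC V))"
    then have \<Phi>: "\<Phi> \<in> lin_maps K C (FC V)" by simp
    show "contra (FC V) \<Phi> \<in> carrier (FC V)" using contra_closed[OF assms \<Phi>] by simp
    { fix \<Psi> assume "\<Psi> \<in> carrier (hom_module K C (FC V))"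
      then have \<Psi>: "\<Psi> \<in> lin_maps K C (FC V)" by simp
      let ?s = "\<Phi> \<oplus>\<^bsub>hom_module K C (FC V)\<^esub> \<Psi>"
      have s: "?s \<in> lin_maps K C (FC V)" using H.a_closed[of \<Phi> \<Psi>] \<Phi> \<Psi> by simp
      show "contra (FC V) ?s = contra (FC V) \<Phi> \<oplus>\<^bsub>FC V\<^esub> contra (FC V) \<Psi>"
      proof (rule C_eqI[OF assms contra_closed[OF assms s]])
        show "contra (FC V) \<Phi> \<oplus>\<^bsub>FC V\<^esub> contra (FC V) \<Psi> \<in> lin_maps K C V"
          using lin_maps_plus[OF C_module assms contra_closed[OF assms \<Phi>] contra_closed[OF assms \<Psi>]] by simp
        fix m assume m: "m \<in> content"
        have "contra (FC V) ?s (dpow m) = (\<Oplus>\<^bsub>V\<^esub>a\<in>submsets m. \<Phi> (dpow (m - a)) (dpow a) \<oplus>\<^bsub>V\<^esub> \<Psi> (dpow (m - a)) (dpow a))"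
          unfolding contra_dpow[OF assms s m]
          by (rule V.finsum_cong') (use cl[OF \<Phi> m] cl[OF \<Psi> m] sv[OF m] in auto)
        also have "\<dots> = contra (FC V) \<Phi> (dpow m) \<oplus>\<^bsub>V\<^esub> contra (FC V) \<Psi> (dpow m)"
          unfolding contra_dpow[OF assms \<Phi> m] contra_dpow[OF assms \<Psi> m]
          by (rule V.finsum_addf) (use cl[OF \<Phi> m] cl[OF \<Psi> m] in auto)
        finally show "contra (FC V) ?s (dpow m) = (contra (FC V) \<Phi> \<oplus>\<^bsub>FC V\<^esub> contra (FC V) \<Psi>) (dpow m)"
          using dpow_SymC[OF m] by (simp del: FC_simps(5))
      qed }
    { fix k assume k: "k \<in> carrier K"
      let ?s = "k \<odot>\<^bsub>hom_module K C (FC V)\<^esub> \<Phi>"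
      have s: "?s \<in> lin_maps K C (FC V)" using H.smult_closed[OF k, of \<Phi>] \<Phi> by simp
      show "contra (FC V) ?s = k \<odot>\<^bsub>FC V\<^esub> contra (FC V) \<Phi>"
      proof (rule C_eqI[OF assms contra_closed[OF assms s]])
        show "k \<odot>\<^bsub>FC V\<^esub> contra (FC V) \<Phi> \<in> lin_maps K C V"
          using lin_maps_scale[OF C_module assms contra_closed[OF assms \<Phi>] k] by simp
        fix m assume m: "m \<in> content"
        have "contra (FC V) ?s (dpow m) = (\<Oplus>\<^bsub>V\<^esub>a\<in>submsets m. k \<odot>\<^bsub>V\<^esub> \<Phi> (dpow (m - a)) (dpow a))"
          unfolding contra_dpow[OF assms s m]
          by (rule V.finsum_cong') (use cl[OF \<Phi> m] k sv[OF m] in auto)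
        also have "\<dots> = k \<odot>\<^bsub>V\<^esub> contra (FC V) \<Phi> (dpow m)"
          unfolding contra_dpow[OF assms \<Phi> m]
          by (rule V.finsum_smult_ldistr[symmetric, OF finite_submsets k]) (use cl[OF \<Phi> m] in auto)
        finally show "contra (FC V) ?s (dpow m) = (k \<odot>\<^bsub>FC V\<^esub> contra (FC V) \<Phi>) (dpow m)"
          using dpow_SymC[OF m] by (simp del: FC_simps(5))
      qed }
  qed
  then show ?thesis by simp
qed

text \<open>The contramodule morphism from the free contramodule on \<open>V\<close> that extends a linear map \<open>F\<close>
  from \<open>V\<close> to the free contramodule on \<open>U\<close>.\<close>

definition "star V U F = (\<lambda>\<phi> \<in> lin_maps K C V. contra (FC U) (compose SymC F \<phi>))"

lemma compose_C: "f \<in> lin_maps K C M \<Longrightarrow> g \<in> lin_maps K M N \<Longrightarrow> compose SymC g f \<in> lin_maps K C N"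
  using lin_maps_compose[OF C_module] by simp

lemma star_closed:
  assumes "module K U" "F \<in> lin_maps K V (FC U)" "\<phi> \<in> lin_maps K C V"
  shows "star V U F \<phi> \<in> lin_maps K C U"
  unfolding star_def using contra_closed[OF assms(1) compose_C[OF assms(3,2)]] assms(3) by (simp del: FC_simps(5))

lemma star_dpow:
  assumes "module K U" "F \<in> lin_maps K V (FC U)" "\<phi> \<in> lin_maps K C V" "m \<in> content"
  shows "star V U F \<phi> (dpow m) = (\<Oplus>\<^bsub>U\<^esub>a\<in>submsets m. F (\<phi> (dpow (m - a))) (dpow a))"
proof -
  interpret U: module K U by fact
  have sv: "dpow (m - a) \<in> SymC" "dpow a \<in> SymC" if "a \<subseteq># m" for a
    using that content_sub[OF assms(4)] dpow_SymC by auto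
  have Fc: "F (\<phi> (dpow (m - a))) (dpow a) \<in> carrier U" if "a \<subseteq># m" for a
    using lin_maps_closed[OF assms(2) lin_maps_closed[OF assms(3), of "dpow (m - a)"]] sv[OF that]
      lin_maps_closed[of "F (\<phi> (dpow (m - a)))" K C U] by simp
  have "star V U F \<phi> (dpow m) = (\<Oplus>\<^bsub>U\<^esub>a\<in>submsets m. compose SymC F \<phi> (dpow (m - a)) (dpow a))"
    using contra_dpow[OF assms(1) compose_C[OF assms(3,2)] assms(4)] assms(3) by (simp add: star_def del: FC_simps(5))
  also have "\<dots> = (\<Oplus>\<^bsub>U\<^esub>a\<in>submsets m. F (\<phi> (dpow (m - a))) (dpow a))"
    by (rule U.finsum_cong') (use Fc sv in \<open>auto simp: compose_eq\<close>)
  finally show ?thesis .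
qed

lemma star_lin:
  assumes "module K V" "module K U" "F \<in> lin_maps K V (FC U)"
  shows "star V U F \<in> lin_maps K (FC V) (FC U)"
proof -
  have PV: "module K (FC V)" using assms FC_module by auto
  let ?H = "hom_module K C (FC U)"
  have "(\<lambda>\<phi> \<in> carrier (FC V). compose SymC F \<phi>) \<in> lin_maps K (FC V) ?H"
  proof (rule lin_maps_restrictI[OF PV])
    fix \<phi> \<psi> assume "\<phi> \<in> carrier (FC V)"
    then have \<phi>: "\<phi> \<in> lin_maps K C V" by simp
    have c: "\<phi> x \<in> carrier V" if "x \<in> SymC" for x using lin_maps_closed[OF \<phi>] that by simp
    show "compose SymC F \<phi> \<in> carrier ?H" using compose_C[OF \<phi> assms(3)] by simp
    show "compose SymC F (\<phi> \<oplus>\<^bsub>FC V\<^esub> \<psi>) = compose SymC F \<phi> \<oplus>\<^bsub>?H\<^esub> compose SymC F \<psi>" if "\<psi> \<in> carrier (FC V)"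
    proof
      fix x
      have "\<psi> x \<in> carrier V" if "x \<in> SymC" using lin_maps_closed[of \<psi> K C V x] that \<open>\<psi> \<in> carrier (FC V)\<close> by simp
      then show "compose SymC F (\<phi> \<oplus>\<^bsub>FC V\<^esub> \<psi>) x = (compose SymC F \<phi> \<oplus>\<^bsub>?H\<^esub> compose SymC F \<psi>) x"
        using lin_maps_add[OF assms(3) c] by (auto simp: compose_def)
    qed
    show "compose SymC F (a \<odot>\<^bsub>FC V\<^esub> \<phi>) = a \<odot>\<^bsub>?H\<^esub> compose SymC F \<phi>" if "a \<in> carrier K" for a
      using lin_maps_smult[OF assms(3) that c] by (auto simp: compose_def restrict_def fun_eq_iff)
  qed
  from lin_maps_compose[OF PV this contra_lin[OF assms(2)]]
  have "compose (lin_maps K C V) (\<lambda>\<Phi> \<in> lin_maps K C (FC U). contra (FC U) \<Phi>) (\<lambda>\<phi> \<in> lin_maps K C V. compose SymC F \<phi>) \<in> lin_maps K (FC V) (FC U)"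
    by (simp del: FC_simps(5))
  moreover have "compose (lin_maps K C V) (\<lambda>\<Phi> \<in> lin_maps K C (FC U). contra (FC U) \<Phi>) (\<lambda>\<phi> \<in> lin_maps K C V. compose SymC F \<phi>) = star V U F"
    using compose_C[OF _ assms(3)] by (auto simp: star_def compose_def restrict_def fun_eq_iff simp del: FC_simps(5))
  ultimately show ?thesis by simp
qed

text \<open>At \<open>dpow m\<close> both sides are the sum of \<open>?g a c d\<close> over the
  decompositions \<open>m = a + c + d\<close>, grouped by \<open>a\<close> on one side and by
  \<open>a + c\<close> on the other.\<close>

lemma star_morphism:
  assumes "module K V" "module K U" "F \<in> lin_maps K V (FC U)"
  shows "star V U F \<in> Mor V U"
proof -
  note lin = star_lin[OF assms]
  interpret V: module K V by fact
  interpret U: module K U by fact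
  have "star V U F (contra (FC V) \<Phi>) = contra (FC U) (compose SymC (star V U F) \<Phi>)"
    if \<Phi>: "\<Phi> \<in> lin_maps K C (FC V)" for \<Phi>
  proof (rule C_eqI[OF assms(2)])
    have comp: "compose SymC (star V U F) \<Phi> \<in> lin_maps K C (FC U)" by (rule compose_C[OF \<Phi> lin])
    show "star V U F (contra (FC V) \<Phi>) \<in> lin_maps K C U" by (rule star_closed[OF assms(2,3) contra_closed[OF assms(1) \<Phi>]])
    show "contra (FC U) (compose SymC (star V U F) \<Phi>) \<in> lin_maps K C U" by (rule contra_closed[OF assms(2) comp])
    fix m assume m: "m \<in> content"
    have sv: "dpow a \<in> SymC" if "a \<subseteq># m" for a using dpow_SymC content_sub[OF m that] by blast
    have \<Phi>c: "\<Phi> (dpow a) \<in> lin_maps K C V" if "a \<subseteq># m" for a using lin_maps_closed[OF \<Phi>] sv[OF that] by simp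
    have \<Phi>cc: "\<Phi> (dpow a) (dpow b) \<in> carrier V" if "a \<subseteq># m" "b \<subseteq># m" for a b
      using lin_maps_closed[OF \<Phi>c[OF that(1)]] sv[OF that(2)] by simp
    have Fa: "(\<lambda>v \<in> carrier V. F v (dpow a)) \<in> lin_maps K V U" if "a \<subseteq># m" for a
      using bilin_uncurry[OF assms(1) C_module assms(3)[unfolded lin_maps_FC]] sv[OF that] by (auto simp: bilin_def)
    have Fc: "F v (dpow a) \<in> carrier U" if "a \<subseteq># m" "v \<in> carrier V" for a v
      using lin_maps_closed[OF Fa[OF that(1)] that(2)] that by simp
    let ?g = "\<lambda>a c d. F (\<Phi> (dpow d) (dpow c)) (dpow a)"
    have g: "?g a c d \<in> carrier U" if "a + c + d = m" for a c d
      by (intro Fc \<Phi>cc) (use that in \<open>auto simp: ac_simps\<close>)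
    have sub: "m - b - c \<subseteq># m" "m - b \<subseteq># m" for b c by (simp_all add: diff_diff_add_mset)
    have sub2: "c \<subseteq># m" if "c \<subseteq># m - a" for a c using that subset_mset.order_trans[OF that sub(2)] by simp
    have "star V U F (contra (FC V) \<Phi>) (dpow m) =
      (\<Oplus>\<^bsub>U\<^esub>a\<in>submsets m. F (contra (FC V) \<Phi> (dpow (m - a))) (dpow a))"
      by (rule star_dpow[OF assms(2,3) contra_closed[OF assms(1) \<Phi>] m])
    also have "\<dots> = (\<Oplus>\<^bsub>U\<^esub>a\<in>submsets m. \<Oplus>\<^bsub>U\<^esub>c\<in>submsets (m - a). ?g a c (m - a - c))"
    proof (rule U.finsum_cong')
      show "(\<lambda>a. \<Oplus>\<^bsub>U\<^esub>c\<in>submsets (m - a). ?g a c (m - a - c)) \<in> submsets m \<rightarrow> carrier U"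
        by (auto intro!: U.finsum_closed Fc \<Phi>cc sub intro: sub2)
      fix a assume "a \<in> submsets m"
      then have a: "a \<subseteq># m" by simp
      have cl: "\<Phi> (dpow (m - a - c)) (dpow c) \<in> carrier V" if "c \<subseteq># m - a" for c
        by (rule \<Phi>cc[OF sub(1) sub2[OF that]])
      have e: "contra (FC V) \<Phi> (dpow (m - a)) = (\<Oplus>\<^bsub>V\<^esub>c\<in>submsets (m - a). \<Phi> (dpow (m - a - c)) (dpow c))"
        by (rule contra_dpow[OF assms(1) \<Phi> content_sub[OF m sub(2)]])
      have "F (contra (FC V) \<Phi> (dpow (m - a))) (dpow a) =
        (\<lambda>v \<in> carrier V. F v (dpow a)) (\<Oplus>\<^bsub>V\<^esub>c\<in>submsets (m - a). \<Phi> (dpow (m - a - c)) (dpow c))"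
        unfolding e using cl by (simp add: V.finsum_closed Pi_iff)
      also have "\<dots> = (\<Oplus>\<^bsub>U\<^esub>c\<in>submsets (m - a). (\<lambda>v \<in> carrier V. F v (dpow a)) (\<Phi> (dpow (m - a - c)) (dpow c)))"
        by (rule lin_maps_finsum[OF assms(1,2) Fa[OF a]]) (use cl in auto)
      also have "\<dots> = (\<Oplus>\<^bsub>U\<^esub>c\<in>submsets (m - a). ?g a c (m - a - c))"
        by (rule U.finsum_cong') (use cl Fc[OF a] in auto)
      finally show "F (contra (FC V) \<Phi> (dpow (m - a))) (dpow a) = (\<Oplus>\<^bsub>U\<^esub>c\<in>submsets (m - a). ?g a c (m - a - c))" .
    qed simp
    also have "\<dots> = (\<Oplus>\<^bsub>U\<^esub>b\<in>submsets m. \<Oplus>\<^bsub>U\<^esub>a\<in>submsets b. ?g a (b - a) (m - b))"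
      by (rule U.finsum_submset_assoc[OF g])
    also have "\<dots> = (\<Oplus>\<^bsub>U\<^esub>b\<in>submsets m. compose SymC (star V U F) \<Phi> (dpow (m - b)) (dpow b))"
    proof (rule U.finsum_cong')
      show "(\<lambda>b. compose SymC (star V U F) \<Phi> (dpow (m - b)) (dpow b)) \<in> submsets m \<rightarrow> carrier U"
        using bilin_closed[OF FC_bilin[OF assms(2) comp]] sv sub by (auto simp del: FC_simps(5))
      fix b assume "b \<in> submsets m"
      then have b: "b \<subseteq># m" by simp
      show "(\<Oplus>\<^bsub>U\<^esub>a\<in>submsets b. ?g a (b - a) (m - b)) = compose SymC (star V U F) \<Phi> (dpow (m - b)) (dpow b)"
        using star_dpow[OF assms(2,3) \<Phi>c[OF sub(2)] content_sub[OF m b]] sv[OF sub(2)] by (simp add: compose_eq)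
    qed simp
    also have "\<dots> = contra (FC U) (compose SymC (star V U F) \<Phi>) (dpow m)"
      by (rule contra_dpow[OF assms(2) comp m, symmetric])
    finally show "star V U F (contra (FC V) \<Phi>) (dpow m) = contra (FC U) (compose SymC (star V U F) \<Phi>) (dpow m)" .
  qed
  then show ?thesis using lin by (simp add: contra_morphisms_def del: FC_simps(5))
qed

text \<open>Mathematically the counit. It is chosen by its values on the divided powers, so that no
  description of \<open>counit C\<close> has to be evaluated.\<close>

definition "eps0 = (SOME \<epsilon>. \<epsilon> \<in> lin_maps K C (self_module K) \<and>
  (\<forall>m \<in> content. \<epsilon> (dpow m) = kron K m {#}))"

lemma eps0: "eps0 \<in> lin_maps K C (self_module K)"
  "m \<in> content \<Longrightarrow> eps0 (dpow m) = kron K m {#}"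
proof -
  have "{#} \<in> content" by simp
  then have "\<exists>\<epsilon>. \<epsilon> \<in> lin_maps K C (self_module K) \<and> (\<forall>m \<in> content. \<epsilon> (dpow m) = kron K m {#})"
    using C_basis unfolding lin_basis_def by blast
  from someI_ex[OF this] show "eps0 \<in> lin_maps K C (self_module K)"
    "m \<in> content \<Longrightarrow> eps0 (dpow m) = kron K m {#}"
    unfolding eps0_def by auto
qed

text \<open>The generators of the free contramodule: \<open>v\<close> becomes the function with
  value \<open>v\<close> at \<open>dpow {#}\<close> and zero at all other divided powers.\<close>

definition "cst V = (\<lambda>v \<in> carrier V. \<lambda>c \<in> SymC. eps0 c \<odot>\<^bsub>V\<^esub> v)"

lemma cst_lin:
  assumes "module K V"
  shows "cst V \<in> lin_maps K V (FC V)"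
proof -
  interpret V: module K V by fact
  have e: "eps0 c \<in> carrier K" if "c \<in> SymC" for c using lin_maps_closed[OF eps0(1)] that by simp
  have "bilin K V C V (\<lambda>v c. eps0 c \<odot>\<^bsub>V\<^esub> v)"
    by (rule bilinI[OF assms C_module])
      (use e lin_maps_add[OF eps0(1)] lin_maps_smult[OF eps0(1)] in \<open>auto simp: V.smult_l_distr V.smult_r_distr V.m_comm V.smult_assoc1 simp flip: V.smult_assoc1\<close>)
  from bilin_curry[OF assms C_module this] show ?thesis by (simp add: cst_def lin_maps_FC)
qed

lemma cst_dpow:
  assumes "module K V" "v \<in> carrier V" "m \<in> content"
  shows "cst V v (dpow m) = (if m = {#} then v else \<zero>\<^bsub>V\<^esub>)"
proof -
  interpret V: module K V by fact
  show ?thesis using assms dpow_SymC[OF assms(3)] eps0(2)[OF assms(3)] by (simp add: cst_def)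
qed

lemma Mor_lin: "f \<in> contra_morphisms K C Q P \<Longrightarrow> f \<in> lin_maps K Q P"
  by (simp add: contra_morphisms_def)

text \<open>Every \<open>\<phi>\<close> is the contraaction applied to the family of generators
  \<open>cst V (\<phi> c)\<close>, so a morphism is determined by its values on generators.\<close>

lemma Mor_star:
  assumes "module K V" "module K U" "f \<in> Mor V U"
  shows "f = star V U (compose (carrier V) f (cst V))"
proof -
  interpret V: module K V by fact
  note fl = Mor_lin[OF assms(3)]
  have F: "compose (carrier V) f (cst V) \<in> lin_maps K V (FC U)" by (rule lin_maps_compose[OF assms(1) cst_lin[OF assms(1)] fl])
  show ?thesis
  proof (rule lin_maps_eqI[OF fl star_lin[OF assms(1,2) F]])
    fix \<phi> assume "\<phi> \<in> carrier (FC V)"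
    then have \<phi>: "\<phi> \<in> lin_maps K C V" by simp
    let ?\<Phi> = "compose SymC (cst V) \<phi>"
    have \<Phi>: "?\<Phi> \<in> lin_maps K C (FC V)" by (rule compose_C[OF \<phi> cst_lin[OF assms(1)]])
    have "contra (FC V) ?\<Phi> = \<phi>"
    proof (rule C_eqI[OF assms(1) contra_closed[OF assms(1) \<Phi>] \<phi>])
      fix m assume m: "m \<in> content"
      have sv: "dpow a \<in> SymC" if "a \<subseteq># m" for a using dpow_SymC content_sub[OF m that] by blast
      have \<phi>c: "\<phi> (dpow a) \<in> carrier V" if "a \<subseteq># m" for a using lin_maps_closed[OF \<phi>] sv[OF that] by simp
      have "contra (FC V) ?\<Phi> (dpow m) = (\<Oplus>\<^bsub>V\<^esub>a\<in>submsets m. if {#} = a then \<phi> (dpow (m - a)) else \<zero>\<^bsub>V\<^esub>)"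
        unfolding contra_dpow[OF assms(1) \<Phi> m]
      proof (rule V.finsum_cong')
        fix a assume "a \<in> submsets m"
        then show "?\<Phi> (dpow (m - a)) (dpow a) = (if {#} = a then \<phi> (dpow (m - a)) else \<zero>\<^bsub>V\<^esub>)"
          using cst_dpow[OF assms(1) \<phi>c content_sub[OF m], of "m - a" a] sv[of "m - a"] by (simp add: compose_eq)
      qed (use \<phi>c in auto)
      also have "\<dots> = \<phi> (dpow m)"
        using V.finsum_singleton[of "{#}" "submsets m" "\<lambda>a. \<phi> (dpow (m - a))"] finite_submsets \<phi>c by auto
      finally show "contra (FC V) ?\<Phi> (dpow m) = \<phi> (dpow m)" .
    qed
    then have "f \<phi> = f (contra (FC V) ?\<Phi>)" by simp
    also have "\<dots> = contra (FC U) (compose SymC f ?\<Phi>)"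
      using assms(3) \<Phi> by (simp add: contra_morphisms_def del: FC_simps(5))
    also have "compose SymC f ?\<Phi> = compose SymC (compose (carrier V) f (cst V)) \<phi>"
      using lin_maps_closed[OF \<phi>] by (auto simp: compose_def restrict_def fun_eq_iff)
    finally show "f \<phi> = star V U (compose (carrier V) f (cst V)) \<phi>"
      using \<phi> by (simp add: star_def del: FC_simps(5))
  qed
qed

lemma Mor_eqI:
  assumes "module K V" "module K U" "f \<in> Mor V U" "g \<in> Mor V U"
    and "\<And>v. v \<in> carrier V \<Longrightarrow> f (cst V v) = g (cst V v)"
  shows "f = g"
proof -
  have "compose (carrier V) f (cst V) = compose (carrier V) g (cst V)"
    using assms(5) by (auto simp: compose_def restrict_def fun_eq_iff)
  then show ?thesis using Mor_star[OF assms(1-3)] Mor_star[OF assms(1,2,4)] by simp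
qed

text \<open>\<open>cst V v\<close> vanishes on all divided powers but \<open>dpow {#}\<close>, so
  only the term \<open>a = m\<close> survives. With \<open>Mor_star\<close> this is the universal
  property: morphisms from \<open>FC V\<close> to \<open>FC U\<close> correspond to linear maps from
  \<open>V\<close> to \<open>FC U\<close>.\<close>

lemma star_cst:
  assumes "module K V" "module K U" "F \<in> lin_maps K V (FC U)" "v \<in> carrier V"
  shows "star V U F (cst V v) = F v"
proof -
  interpret U: module K U by fact
  have c: "cst V v \<in> lin_maps K C V" using lin_maps_closed[OF cst_lin[OF assms(1)] assms(4)] by simp
  have Fv: "F v \<in> lin_maps K C U" using lin_maps_closed[OF assms(3,4)] by simp
  have F0: "F \<zero>\<^bsub>V\<^esub> = (\<lambda>x \<in> SymC. \<zero>\<^bsub>U\<^esub>)" using lin_maps_zero[OF assms(1) FC_module[OF assms(2)] assms(3)] by simp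
  show ?thesis
  proof (rule C_eqI[OF assms(2) star_closed[OF assms(2,3) c] Fv])
    fix m assume m: "m \<in> content"
    have sv: "dpow a \<in> SymC" if "a \<subseteq># m" for a using dpow_SymC content_sub[OF m that] by blast
    have Fvc: "F v (dpow a) \<in> carrier U" if "a \<subseteq># m" for a using lin_maps_closed[OF Fv] sv[OF that] by simp
    have "star V U F (cst V v) (dpow m) = (\<Oplus>\<^bsub>U\<^esub>a\<in>submsets m. if m = a then F v (dpow a) else \<zero>\<^bsub>U\<^esub>)"
      unfolding star_dpow[OF assms(2,3) c m]
    proof (rule U.finsum_cong')
      fix a assume a: "a \<in> submsets m"
      then have "m - a = {#} \<longleftrightarrow> m = a" by (auto simp: Diff_eq_empty_iff_mset)
      then show "F (cst V v (dpow (m - a))) (dpow a) = (if m = a then F v (dpow a) else \<zero>\<^bsub>U\<^esub>)"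
        using cst_dpow[OF assms(1,4) content_sub[OF m], of "m - a"] sv a F0 by auto
    qed (use Fvc in auto)
    also have "\<dots> = F v (dpow m)"
      using U.finsum_singleton[of m "submsets m" "\<lambda>a. F v (dpow a)"] finite_submsets Fvc by auto
    finally show "star V U F (cst V v) (dpow m) = F v (dpow m)" .
  qed
qed

lemma Mor_compose:
  assumes "module K V" "f \<in> Mor V U" "g \<in> Mor U X"
  shows "compose (lin_maps K C V) g f \<in> Mor V X"
proof -
  note fl = Mor_lin[OF assms(2)] and gl = Mor_lin[OF assms(3)]
  have l: "compose (lin_maps K C V) g f \<in> lin_maps K (FC V) (FC X)"
    using lin_maps_compose[OF FC_module[OF assms(1)] fl gl] by simp
  have "compose (lin_maps K C V) g f (contra (FC V) \<Phi>) = contra (FC X) (compose SymC (compose (lin_maps K C V) g f) \<Phi>)"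
    if \<Phi>: "\<Phi> \<in> lin_maps K C (FC V)" for \<Phi>
  proof -
    have "compose (lin_maps K C V) g f (contra (FC V) \<Phi>) = g (f (contra (FC V) \<Phi>))"
      using contra_closed[OF assms(1) \<Phi>] by (simp add: compose_eq del: FC_simps(5))
    also have "\<dots> = g (contra (FC U) (compose SymC f \<Phi>))"
      using assms(2) \<Phi> by (simp add: contra_morphisms_def del: FC_simps(5))
    also have "\<dots> = contra (FC X) (compose SymC g (compose SymC f \<Phi>))"
      using assms(3) compose_C[OF \<Phi> fl] by (simp add: contra_morphisms_def del: FC_simps(5))
    also have "compose SymC g (compose SymC f \<Phi>) = compose SymC (compose (lin_maps K C V) g f) \<Phi>"
      using lin_maps_closed[OF \<Phi>] by (auto simp: compose_def restrict_def fun_eq_iff)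
    finally show ?thesis .
  qed
  then show ?thesis using l by (simp add: contra_morphisms_def del: FC_simps(5))
qed

end

section \<open>The Koszul differential\<close>

lemma dual_module_simps [simp]:
  "carrier (dual_module K M) = lin_maps K M (self_module K)"
  "zero (dual_module K M) = (\<lambda>x \<in> carrier M. \<zero>\<^bsub>K\<^esub>)"
  "add (dual_module K M) = (\<lambda>f g. \<lambda>x \<in> carrier M. f x \<oplus>\<^bsub>K\<^esub> g x)"
  "smult (dual_module K M) = (\<lambda>a f. \<lambda>x \<in> carrier M. a \<otimes>\<^bsub>K\<^esub> f x)"
  by (simp_all add: dual_module_def)

text \<open>For sums over a comultiplication whose second factor must have degree one. Each distinct
  letter of \<open>m\<close> contributes once, whatever its multiplicity, because removing different
  letters gives different multisets; this is differentiation of divided powers.\<close>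

lemma (in abelian_monoid) finsum_submset_single:
  assumes "\<And>a. a \<subseteq># m \<Longrightarrow> g a \<in> carrier G" "\<And>a. a \<subseteq># m \<Longrightarrow> size (m - a) \<noteq> 1 \<Longrightarrow> g a = \<zero>"
  shows "(\<Oplus>a\<in>submsets m. g a) = (\<Oplus>b\<in>set_mset m. g (m - {#b#}))"
proof -
  let ?h = "\<lambda>b. m - {#b#}"
  have inj: "inj_on ?h (set_mset m)"
  proof (rule inj_onI)
    fix b b' assume bb: "b \<in># m" "b' \<in># m" "m - {#b#} = m - {#b'#}"
    then have "count (m - {#b#}) b = count (m - {#b'#}) b" by simp
    moreover have "0 < count m b" using bb(1) by simp
    ultimately show "b = b'" by (cases "b = b'") (simp_all del: count_greater_zero_iff)
  qed
  have sub: "?h ` set_mset m \<subseteq> submsets m" by auto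
  have "(\<Oplus>a\<in>submsets m. g a) = (\<Oplus>a\<in>?h ` set_mset m. g a)"
  proof (rule add.finprod_mono_neutral_cong_right[OF finite_submsets sub])
    show "g a = \<zero>" if "a \<in> submsets m - ?h ` set_mset m" for a
    proof (rule assms(2))
      show a: "a \<subseteq># m" using that by simp
      show "size (m - a) \<noteq> 1"
      proof
        assume "size (m - a) = 1"
        then obtain b where b: "m - a = {#b#}" using size_1_singleton_mset by blast
        then have "b \<in># m" using in_diffD[of b m a] by simp
        moreover have "a = m - {#b#}" using submset_diff_diff[OF a] b by simp
        ultimately show False using that by auto
      qed
    qed
  qed (use assms(1) in auto)
  also have "\<dots> = (\<Oplus>b\<in>set_mset m. g (m - {#b#}))"
    by (rule finsum_reindex[OF _ inj]) (use assms(1) in auto)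
  finally show ?thesis .
qed

context based_space
begin

abbreviation "idC \<equiv> (\<lambda>c \<in> carrier C. c)"
abbreviation "pr \<equiv> Sym_proj1 K W"

lemma pr_closed: "c \<in> SymC \<Longrightarrow> pr c \<in> carrier W"
  using lin_maps_closed[OF Sym_proj1(1), of c] by simp

definition "comult1 = compose (carrier C) (tensor_map K C C C W idC pr) (comult C)"

lemma comult1_lin: "comult1 \<in> lin_maps K C (tensor K C W)"
  unfolding comult1_def
  by (rule lin_maps_compose[OF C_module C_comult(1) tensor_map_lin[OF C_module C_module C_module W_module lin_maps_id[OF C_module] Sym_proj1(1)]])

lemma submset_SymC: "m \<in> content \<Longrightarrow> a \<subseteq># m \<Longrightarrow> dpow a \<in> SymC"
  by (rule dpow_SymC[OF content_sub])

lemma comult1_dpow: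
  assumes "m \<in> content"
  shows "comult1 (dpow m) = (\<Oplus>\<^bsub>tensor K C W\<^esub>a\<in>submsets m. tens K C W (dpow a) (pr (dpow (m - a))))"
proof -
  interpret CW: module K "tensor K C W" by (rule tensor_module[OF C_module W_module])
  let ?T = "tensor_map K C C C W idC pr"
  have T: "?T \<in> lin_maps K (tensor K C C) (tensor K C W)"
    by (rule tensor_map_lin[OF C_module C_module C_module W_module lin_maps_id[OF C_module] Sym_proj1(1)])
  have sv: "dpow a \<in> carrier C" "dpow (m - a) \<in> carrier C" if "a \<subseteq># m" for a
    using submset_SymC[OF assms] that by auto
  have "comult1 (dpow m) = ?T (\<Oplus>\<^bsub>tensor K C C\<^esub>a\<in>submsets m. tens K C C (dpow a) (dpow (m - a)))"
    using dpow_SymC[OF assms] by (simp add: comult1_def compose_eq C_comult(2)[OF assms])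
  also have "\<dots> = (\<Oplus>\<^bsub>tensor K C W\<^esub>a\<in>submsets m. ?T (tens K C C (dpow a) (dpow (m - a))))"
    by (rule lin_maps_finsum[OF tensor_module[OF C_module C_module] CW.module_axioms T])
      (use sv tens_closed[OF C_module C_module] in auto)
  also have "\<dots> = (\<Oplus>\<^bsub>tensor K C W\<^esub>a\<in>submsets m. tens K C W (dpow a) (pr (dpow (m - a))))"
  proof (rule CW.finsum_cong')
    show "(\<lambda>a. tens K C W (dpow a) (pr (dpow (m - a)))) \<in> submsets m \<rightarrow> carrier (tensor K C W)"
      using sv pr_closed by (auto intro!: tens_closed[OF C_module W_module])
    fix a assume "a \<in> submsets m"
    then show "?T (tens K C C (dpow a) (dpow (m - a))) = tens K C W (dpow a) (pr (dpow (m - a)))"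
      using sv[of a] tensor_map_tens[OF C_module C_module C_module W_module lin_maps_id[OF C_module] Sym_proj1(1) sv[of a]] by simp
  qed simp
  finally show ?thesis .
qed

text \<open>The shape of \<open>koszul_codiff\<close> with an arbitrary map \<open>t\<close> in
  place of exterior multiplication. Exterior multiplication gives the Koszul coresolution,
  contraction of forms gives the differential \<open>bd\<close>, and one computation on generators
  serves both.\<close>

definition "der V V' t = (\<lambda>z \<in> carrier (tensor K C V).
  tensor_map K C (tensor K W V) C V' idC t
    (tensor_assoc K C W V (tensor_map K C V (tensor K C W) V comult1 (\<lambda>x \<in> carrier V. x) z)))"

lemma der_lin:
  assumes "module K V" "module K V'" "t \<in> lin_maps K (tensor K W V) V'"
  shows "der V V' t \<in> lin_maps K (tensor K C V) (tensor K C V')"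
proof -
  note CV = tensor_module[OF C_module assms(1)] and CW = tensor_module[OF C_module W_module]
    and WV = tensor_module[OF W_module assms(1)]
  let ?T1 = "tensor_map K C V (tensor K C W) V comult1 (\<lambda>x \<in> carrier V. x)"
  let ?T2 = "tensor_assoc K C W V"
  let ?T3 = "tensor_map K C (tensor K W V) C V' idC t"
  have T1: "?T1 \<in> lin_maps K (tensor K C V) (tensor K (tensor K C W) V)"
    by (rule tensor_map_lin[OF C_module assms(1) CW assms(1) comult1_lin lin_maps_id[OF assms(1)]])
  have T2: "?T2 \<in> lin_maps K (tensor K (tensor K C W) V) (tensor K C (tensor K W V))"
    by (rule tensor_assoc_lin[OF C_module W_module assms(1)])
  have T3: "?T3 \<in> lin_maps K (tensor K C (tensor K W V)) (tensor K C V')"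
    by (rule tensor_map_lin[OF C_module WV C_module assms(2) lin_maps_id[OF C_module] assms(3)])
  have "der V V' t = compose (carrier (tensor K C V)) ?T3 (compose (carrier (tensor K C V)) ?T2 ?T1)"
    by (auto simp: der_def compose_def restrict_def fun_eq_iff)
  then show ?thesis using lin_maps_compose[OF CV lin_maps_compose[OF CV T1 T2] T3] by simp
qed

lemma der_tens:
  assumes "module K V" "module K V'" "t \<in> lin_maps K (tensor K W V) V'" "m \<in> content" "v \<in> carrier V"
  shows "der V V' t (tens K C V (dpow m) v) =
    (\<Oplus>\<^bsub>tensor K C V'\<^esub>a\<in>submsets m. tens K C V' (dpow a) (t (tens K W V (pr (dpow (m - a))) v)))"
proof -
  note CW = tensor_module[OF C_module W_module]
    and WV = tensor_module[OF W_module assms(1)]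
  let ?T1 = "tensor_map K C V (tensor K C W) V comult1 (\<lambda>x \<in> carrier V. x)"
  let ?T2 = "tensor_assoc K C W V"
  let ?T3 = "tensor_map K C (tensor K W V) C V' idC t"
  have T2: "?T2 \<in> lin_maps K (tensor K (tensor K C W) V) (tensor K C (tensor K W V))"
    by (rule tensor_assoc_lin[OF C_module W_module assms(1)])
  have T3: "?T3 \<in> lin_maps K (tensor K C (tensor K W V)) (tensor K C V')"
    by (rule tensor_map_lin[OF C_module WV C_module assms(2) lin_maps_id[OF C_module] assms(3)])
  interpret R: module K "tensor K C V'" by (rule tensor_module[OF C_module assms(2)])
  have sm: "dpow m \<in> carrier C" using dpow_SymC[OF assms(4)] by simp
  have sv: "dpow a \<in> carrier C" "pr (dpow (m - a)) \<in> carrier W" if "a \<subseteq># m" for a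
    using submset_SymC[OF assms(4)] that pr_closed by auto
  have c1: "tens K C W (dpow a) (pr (dpow (m - a))) \<in> carrier (tensor K C W)" if "a \<subseteq># m" for a
    by (rule tens_closed[OF C_module W_module sv[OF that]])
  have c2: "tens K (tensor K C W) V (tens K C W (dpow a) (pr (dpow (m - a)))) v \<in> carrier (tensor K (tensor K C W) V)"
    if "a \<subseteq># m" for a
    by (rule tens_closed[OF CW assms(1) c1[OF that] assms(5)])
  have TT: "compose (carrier (tensor K (tensor K C W) V)) ?T3 ?T2 \<in> lin_maps K (tensor K (tensor K C W) V) (tensor K C V')"
    by (rule lin_maps_compose[OF tensor_module[OF CW assms(1)] T2 T3])
  have t1: "?T1 (tens K C V (dpow m) v) =
    (\<Oplus>\<^bsub>tensor K (tensor K C W) V\<^esub>a\<in>submsets m. tens K (tensor K C W) V (tens K C W (dpow a) (pr (dpow (m - a)))) v)"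
    using tensor_map_tens[OF C_module assms(1) CW assms(1) comult1_lin lin_maps_id[OF assms(1)] sm assms(5)] assms(5)
      bilin_finsum_left[OF tens_bilin[OF CW assms(1)] CW tensor_module[OF CW assms(1)], of "\<lambda>a. tens K C W (dpow a) (pr (dpow (m - a)))" "submsets m" v]
      c1 by (simp add: comult1_dpow[OF assms(4)] Pi_iff)
  have t1c: "?T1 (tens K C V (dpow m) v) \<in> carrier (tensor K (tensor K C W) V)"
    by (rule lin_maps_closed[OF tensor_map_lin[OF C_module assms(1) CW assms(1) comult1_lin lin_maps_id[OF assms(1)]] tens_closed[OF C_module assms(1) sm assms(5)]])
  have "der V V' t (tens K C V (dpow m) v) = compose (carrier (tensor K (tensor K C W) V)) ?T3 ?T2 (?T1 (tens K C V (dpow m) v))"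
    using tens_closed[OF C_module assms(1) sm assms(5)] t1c by (simp add: der_def compose_eq)
  also have "\<dots> = (\<Oplus>\<^bsub>tensor K C V'\<^esub>a\<in>submsets m. compose (carrier (tensor K (tensor K C W) V)) ?T3 ?T2
      (tens K (tensor K C W) V (tens K C W (dpow a) (pr (dpow (m - a)))) v))"
    unfolding t1 by (rule lin_maps_finsum[OF tensor_module[OF CW assms(1)] R.module_axioms TT]) (use c2 in auto)
  also have "\<dots> = (\<Oplus>\<^bsub>tensor K C V'\<^esub>a\<in>submsets m. tens K C V' (dpow a) (t (tens K W V (pr (dpow (m - a))) v)))"
  proof (rule R.finsum_cong')
    show "(\<lambda>a. tens K C V' (dpow a) (t (tens K W V (pr (dpow (m - a))) v))) \<in> submsets m \<rightarrow> carrier (tensor K C V')"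
      using sv(1) lin_maps_closed[OF assms(3) tens_closed[OF W_module assms(1) sv(2) assms(5)]]
      by (auto intro!: tens_closed[OF C_module assms(2)])
    fix a assume "a \<in> submsets m"
    then have a: "a \<subseteq># m" by simp
    note wv = tens_closed[OF W_module assms(1) sv(2)[OF a] assms(5)]
    show "compose (carrier (tensor K (tensor K C W) V)) ?T3 ?T2 (tens K (tensor K C W) V (tens K C W (dpow a) (pr (dpow (m - a)))) v) =
      tens K C V' (dpow a) (t (tens K W V (pr (dpow (m - a))) v))"
      using tensor_assoc_tens[OF C_module W_module assms(1) sv[OF a] assms(5)] c2[OF a]
        tensor_map_tens[OF C_module WV C_module assms(2) lin_maps_id[OF C_module] assms(3) sv(1)[OF a] wv] sv(1)[OF a]
      by (simp add: compose_eq)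
  qed simp
  finally show ?thesis .
qed

section \<open>Contraction of forms and the Koszul differential on generators\<close>

abbreviation "Lam \<equiv> ext_power K W"
abbreviation "A n \<equiv> dual_module K (Lam n)"
abbreviation "dW \<equiv> dual_module K W"

lemma Lam_module: "module K (Lam n)"
  by (rule ext_power_module[OF W_module])

lemma dual_mod: "module K M \<Longrightarrow> module K (dual_module K M)"
  unfolding dual_module_def by (rule hom_module_module[OF _ self_mod])

lemma A_module: "module K (A n)"
  by (rule dual_mod[OF Lam_module])

lemma dW_module: "module K dW"
  by (rule dual_mod[OF W_module])

lemma A_finsum: "g \<in> I \<rightarrow> carrier (A n) \<Longrightarrow> x \<in> carrier (Lam n) \<Longrightarrow>
    (\<Oplus>\<^bsub>A n\<^esub>i\<in>I. g i) x = (\<Oplus>\<^bsub>self_module K\<^esub>i\<in>I. g i x)"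
  using hom_module_finsum[OF Lam_module self_mod] by (simp add: dual_module_def)

text \<open>Contraction of the form \<open>\<eta>\<close> by the vector \<open>w\<close>, as the
  transpose of left exterior multiplication.\<close>

definition "iota n w \<eta> = (\<lambda>x \<in> carrier (Lam n). \<eta> (lwedge K W n w x))"

lemma iota_closed:
  assumes "w \<in> carrier W" "\<eta> \<in> carrier (A (Suc n))"
  shows "iota n w \<eta> \<in> carrier (A n)"
  using lin_maps_compose[OF Lam_module lwedge_lin[OF W_module assms(1)], of \<eta> n "self_module K"] assms(2)
  by (simp add: iota_def compose_def cong: restrict_cong)

lemma iota_bilin: "bilin K W (A (Suc n)) (A n) (iota n)"
proof (rule bilinI[OF W_module A_module])
  interpret W: module K W by (rule W_module)
  show "iota n x y \<in> carrier (A n)" if "x \<in> carrier W" "y \<in> carrier (A (Suc n))" for x y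
    by (rule iota_closed[OF that])
  have lc: "lwedge K W n w x \<in> carrier (Lam (Suc n))" if "w \<in> carrier W" "x \<in> carrier (Lam n)" for w x
    by (rule lwedge_closed[OF W_module that])
  show "iota n x (y \<oplus>\<^bsub>A (Suc n)\<^esub> y') = iota n x y \<oplus>\<^bsub>A n\<^esub> iota n x y'"
    if "x \<in> carrier W" for x y y'
    using lc[OF that] by (simp add: iota_def cong: restrict_cong)
  show "iota n x (a \<odot>\<^bsub>A (Suc n)\<^esub> y) = a \<odot>\<^bsub>A n\<^esub> iota n x y" if "x \<in> carrier W" for a x y
    using lc[OF that] by (simp add: iota_def cong: restrict_cong)
  have lin: "(\<lambda>w \<in> carrier W. lwedge K W n w x) \<in> lin_maps K W (Lam (Suc n))" if "x \<in> carrier (Lam n)" for x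
    using lwedge_bilin[OF W_module, of n] that by (simp add: bilin_def)
  show "iota n (x \<oplus>\<^bsub>W\<^esub> x') y = iota n x y \<oplus>\<^bsub>A n\<^esub> iota n x' y"
    if "x \<in> carrier W" "x' \<in> carrier W" "y \<in> carrier (A (Suc n))" for x x' y
  proof -
    have "y (lwedge K W n (x \<oplus>\<^bsub>W\<^esub> x') u) = y (lwedge K W n x u) \<oplus>\<^bsub>K\<^esub> y (lwedge K W n x' u)" if u: "u \<in> carrier (Lam n)" for u
      using lin_maps_add[OF lin[OF u] \<open>x \<in> carrier W\<close> \<open>x' \<in> carrier W\<close>]
        lin_maps_add[of y K "Lam (Suc n)" "self_module K"] \<open>y \<in> carrier (A (Suc n))\<close> \<open>x \<in> carrier W\<close> \<open>x' \<in> carrier W\<close> lc u by simp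
    then show ?thesis by (simp add: iota_def cong: restrict_cong)
  qed
  show "iota n (a \<odot>\<^bsub>W\<^esub> x) y = a \<odot>\<^bsub>A n\<^esub> iota n x y"
    if "a \<in> carrier K" "x \<in> carrier W" "y \<in> carrier (A (Suc n))" for a x y
  proof -
    have "y (lwedge K W n (a \<odot>\<^bsub>W\<^esub> x) u) = a \<otimes>\<^bsub>K\<^esub> y (lwedge K W n x u)" if u: "u \<in> carrier (Lam n)" for u
      using lin_maps_smult[OF lin[OF u] \<open>a \<in> carrier K\<close> \<open>x \<in> carrier W\<close>]
        lin_maps_smult[of y K "Lam (Suc n)" "self_module K" a] \<open>y \<in> carrier (A (Suc n))\<close> \<open>x \<in> carrier W\<close> \<open>a \<in> carrier K\<close> lc u by simp
    then show ?thesis by (simp add: iota_def cong: restrict_cong)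
  qed
qed

text \<open>The values of the Koszul differential on the generators \<open>cst\<close>; the factor
  \<open>pr\<close> confines them to degree one of the symmetric coalgebra.\<close>

definition "Fk n = (\<lambda>\<eta> \<in> carrier (A (Suc n)). \<lambda>c \<in> SymC. iota n (pr c) \<eta>)"

lemma Fk_lin: "Fk n \<in> lin_maps K (A (Suc n)) (FC (A n))"
proof -
  have "bilin K C (A (Suc n)) (A n) (\<lambda>c \<eta>. (\<lambda>x \<in> carrier (A n). x) (iota n (pr c) ((\<lambda>x \<in> carrier (A (Suc n)). x) \<eta>)))"
    by (rule bilin_compose[OF iota_bilin C_module A_module Sym_proj1(1) lin_maps_id[OF A_module] lin_maps_id[OF A_module]])
  then have "bilin K C (A (Suc n)) (A n) (\<lambda>c \<eta>. iota n (pr c) \<eta>)"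
    using iota_closed pr_closed unfolding bilin_def by (simp cong: restrict_cong)
  from bilin_curry[OF A_module C_module bilin_flip[OF this]] show ?thesis
    unfolding Fk_def lin_maps_FC by simp
qed

lemma koszul_codiff_der: "koszul_codiff K W n = der (Lam n) (Lam (Suc n)) (ext_mult K W n)"
  by (simp add: koszul_codiff_def der_def comult1_def Let_def)

text \<open>Both sides are compared at \<open>dpow m\<close> and a vector \<open>x\<close> of the
  exterior power. The codifferential and the contraaction use the two factors of the
  comultiplication in opposite order; exchanging \<open>a\<close> and \<open>m - a\<close>
  reconciles them, which is cocommutativity.\<close>

lemma koszul_diff_star: "koszul_diff K W n = star (A (Suc n)) (A n) (Fk n)"
proof
  fix \<phi>
  interpret S: module K "self_module K" by (rule self_mod)
  note cd = der_lin[OF Lam_module Lam_module ext_mult_lin[OF W_module], of n, folded koszul_codiff_der]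
  show "koszul_diff K W n \<phi> = star (A (Suc n)) (A n) (Fk n) \<phi>"
  proof (cases "\<phi> \<in> lin_maps K C (A (Suc n))")
    case True
    have b\<phi>: "bilin K C (Lam (Suc n)) (self_module K) \<phi>"
      by (rule bilin_uncurry[OF C_module Lam_module]) (use True in \<open>simp add: dual_module_def\<close>)
    let ?L = "tensor_lift K C (Lam (Suc n)) (self_module K) \<phi>"
    note CL = tensor_module[OF C_module Lam_module]
    have L: "?L \<in> lin_maps K (tensor K C (Lam (Suc n))) (self_module K)"
      by (rule tensor_lift_lin[OF C_module Lam_module self_mod b\<phi>])
    have kd: "koszul_diff K W n \<phi> = (\<lambda>c \<in> carrier C. \<lambda>\<omega> \<in> carrier (Lam n). ?L (koszul_codiff K W n (tens K C (Lam n) c \<omega>)))"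
      using True by (simp add: koszul_diff_def koszul_contra_def Let_def)
    have "bilin K C (Lam n) (self_module K) (\<lambda>c \<omega>. compose (carrier (tensor K C (Lam n))) ?L (koszul_codiff K W n)
       (tens K C (Lam n) (idC c) ((\<lambda>x \<in> carrier (Lam n). x) \<omega>)))"
      by (rule bilin_compose[OF tens_bilin[OF C_module Lam_module] C_module Lam_module lin_maps_id[OF C_module] lin_maps_id[OF Lam_module] lin_maps_compose[OF CL cd L]])
    from bilin_curry[OF C_module Lam_module this]
    have lin: "koszul_diff K W n \<phi> \<in> lin_maps K C (A n)"
      unfolding kd dual_module_def
      by (simp add: compose_eq tens_closed[OF C_module Lam_module] cong: restrict_cong del: C_simps)
    show ?thesis
    proof (rule C_eqI[OF A_module lin star_closed[OF A_module Fk_lin True]])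
      fix m assume m: "m \<in> content"
      have sv: "dpow a \<in> carrier C" "pr (dpow a) \<in> carrier W" if "a \<subseteq># m" for a
        using submset_SymC[OF m that] pr_closed by auto
      have \<phi>c: "\<phi> (dpow a) \<in> carrier (A (Suc n))" if "a \<subseteq># m" for a
        by (rule lin_maps_closed[OF True sv(1)[OF that]])
      have ic: "iota n (pr (dpow a)) (\<phi> (dpow b)) \<in> carrier (A n)" if "a \<subseteq># m" "b \<subseteq># m" for a b
        by (rule iota_closed[OF sv(2)[OF that(1)] \<phi>c[OF that(2)]])
      have "koszul_diff K W n \<phi> (dpow m) \<in> carrier (A n)"
        by (rule lin_maps_closed[OF lin]) (use dpow_SymC[OF m] in simp)
      then have l1: "koszul_diff K W n \<phi> (dpow m) \<in> lin_maps K (Lam n) (self_module K)" by simp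
      have st: "star (A (Suc n)) (A n) (Fk n) \<phi> (dpow m) = (\<Oplus>\<^bsub>A n\<^esub>a\<in>submsets m. Fk n (\<phi> (dpow (m - a))) (dpow a))"
        by (rule star_dpow[OF A_module Fk_lin True m])
      have "star (A (Suc n)) (A n) (Fk n) \<phi> (dpow m) \<in> carrier (A n)"
        by (rule lin_maps_closed[OF star_closed[OF A_module Fk_lin True]]) (use dpow_SymC[OF m] in simp)
      then have l2: "star (A (Suc n)) (A n) (Fk n) \<phi> (dpow m) \<in> lin_maps K (Lam n) (self_module K)" by simp
      show "koszul_diff K W n \<phi> (dpow m) = star (A (Suc n)) (A n) (Fk n) \<phi> (dpow m)"
      proof (rule lin_maps_eqI[OF l1 l2])
        fix x assume x: "x \<in> carrier (Lam n)"
        have lw: "lwedge K W n (pr (dpow a)) x \<in> carrier (Lam (Suc n))" if "a \<subseteq># m" for a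
          by (rule lwedge_closed[OF W_module sv(2)[OF that] x])
        have tc: "tens K C (Lam (Suc n)) (dpow a) (lwedge K W n (pr (dpow b)) x) \<in> carrier (tensor K C (Lam (Suc n)))" if "a \<subseteq># m" "b \<subseteq># m" for a b
          by (rule tens_closed[OF C_module Lam_module sv(1)[OF that(1)] lw[OF that(2)]])
        have pc: "\<phi> (dpow a) (lwedge K W n (pr (dpow b)) x) \<in> carrier (self_module K)" if "a \<subseteq># m" "b \<subseteq># m" for a b
          by (rule bilin_closed[OF b\<phi> sv(1)[OF that(1)] lw[OF that(2)]])
        have "koszul_diff K W n \<phi> (dpow m) x = ?L (\<Oplus>\<^bsub>tensor K C (Lam (Suc n))\<^esub>a\<in>submsets m.
            tens K C (Lam (Suc n)) (dpow a) (lwedge K W n (pr (dpow (m - a))) x))"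
          unfolding kd koszul_codiff_der
          using der_tens[OF Lam_module Lam_module ext_mult_lin[OF W_module] m x] dpow_SymC[OF m] x
          by (simp add: lwedge_def)
        also have "\<dots> = (\<Oplus>\<^bsub>self_module K\<^esub>a\<in>submsets m. ?L (tens K C (Lam (Suc n)) (dpow a) (lwedge K W n (pr (dpow (m - a))) x)))"
          by (rule lin_maps_finsum[OF CL self_mod L]) (use tc in auto)
        also have "\<dots> = (\<Oplus>\<^bsub>self_module K\<^esub>a\<in>submsets m. \<phi> (dpow a) (lwedge K W n (pr (dpow (m - a))) x))"
          by (rule S.finsum_cong') (use pc tensor_lift_tens[OF C_module Lam_module self_mod b\<phi> sv(1) lw] in auto)
        also have "\<dots> = (\<Oplus>\<^bsub>self_module K\<^esub>a\<in>submsets m. \<phi> (dpow (m - a)) (lwedge K W n (pr (dpow (m - (m - a)))) x))"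
          by (rule S.finsum_bij[OF bij_betw_submset_diff]) (use pc in auto)
        also have "\<dots> = (\<Oplus>\<^bsub>self_module K\<^esub>a\<in>submsets m. Fk n (\<phi> (dpow (m - a))) (dpow a) x)"
        proof (rule S.finsum_cong')
          have Fke: "Fk n (\<phi> (dpow (m - a))) (dpow a) = iota n (pr (dpow a)) (\<phi> (dpow (m - a)))" if "a \<subseteq># m" for a
            using \<phi>c[of "m - a"] submset_SymC[OF m that] by (simp add: Fk_def)
          show "(\<lambda>a. Fk n (\<phi> (dpow (m - a))) (dpow a) x) \<in> submsets m \<rightarrow> carrier (self_module K)"
            using Fke pc x by (auto simp: iota_def)
          fix a assume "a \<in> submsets m"
          moreover from this have "m - (m - a) = a" by (simp add: submset_diff_diff)
          ultimately show "\<phi> (dpow (m - a)) (lwedge K W n (pr (dpow (m - (m - a)))) x) = Fk n (\<phi> (dpow (m - a))) (dpow a) x"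
            using Fke[of a] x by (simp add: iota_def)
        qed simp
        also have "\<dots> = star (A (Suc n)) (A n) (Fk n) \<phi> (dpow m) x"
          unfolding st
        proof (rule A_finsum[symmetric, OF _ x])
          show "(\<lambda>a. Fk n (\<phi> (dpow (m - a))) (dpow a)) \<in> submsets m \<rightarrow> carrier (A n)"
            using ic \<phi>c submset_SymC[OF m] unfolding Fk_def by auto
        qed
        finally show "koszul_diff K W n \<phi> (dpow m) x = star (A (Suc n)) (A n) (Fk n) \<phi> (dpow m) x" .
      qed
    qed
  next
    case False
    then show ?thesis by (simp add: star_def koszul_diff_def koszul_contra_def Let_def)
  qed
qed

lemma koszul_diff_morphism: "koszul_diff K W n \<in> Mor (A (Suc n)) (A n)"
  unfolding koszul_diff_star by (rule star_morphism[OF A_module A_module Fk_lin])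

section \<open>The predual complex\<close>

text \<open>For a free contramodule on \<open>dW\<close>, the complex of morphisms is dual to the complex with terms
  \<open>D n\<close> and differentials \<open>bd n\<close> below, tensored with \<open>W\<close>.\<close>

abbreviation "D n \<equiv> tensor K C (A n)"

definition "bd n = der (A (Suc n)) (A n) (tensor_lift K W (A (Suc n)) (A n) (iota n))"

lemma D_module: "module K (D n)"
  by (rule tensor_module[OF C_module A_module])

lemma bd_lin: "bd n \<in> lin_maps K (D (Suc n)) (D n)"
  unfolding bd_def
  by (rule der_lin[OF A_module A_module tensor_lift_lin[OF W_module A_module A_module iota_bilin]])

lemma D_tens_closed: "c \<in> SymC \<Longrightarrow> \<eta> \<in> carrier (A n) \<Longrightarrow> tens K C (A n) c \<eta> \<in> carrier (D n)"
  by (rule tens_closed[OF C_module A_module]) simp_all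

lemma bd_tens:
  assumes m: "m \<in> content" and \<eta>: "\<eta> \<in> carrier (A (Suc n))"
  shows "bd n (tens K C (A (Suc n)) (dpow m) \<eta>) =
    (\<Oplus>\<^bsub>D n\<^esub>a\<in>submsets m. tens K C (A n) (dpow a) (iota n (pr (dpow (m - a))) \<eta>))"
proof -
  interpret D: module K "D n" by (rule D_module)
  have sv: "dpow a \<in> SymC" "pr (dpow a) \<in> carrier W" if "a \<subseteq># m" for a
    using submset_SymC[OF m that] pr_closed by auto
  show ?thesis
    unfolding bd_def der_tens[OF A_module A_module tensor_lift_lin[OF W_module A_module A_module iota_bilin] m \<eta>]
    by (rule D.finsum_cong')
      (use tensor_lift_tens[OF W_module A_module A_module iota_bilin sv(2) \<eta>] D_tens_closed[OF sv(1) iota_closed[OF sv(2) \<eta>]] in auto)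
qed

lemma bd_tens_single:
  assumes m: "m \<in> content" and \<eta>: "\<eta> \<in> carrier (A (Suc n))"
  shows "bd n (tens K C (A (Suc n)) (dpow m) \<eta>) =
    (\<Oplus>\<^bsub>D n\<^esub>b\<in>set_mset m. tens K C (A n) (dpow (m - {#b#})) (iota n b \<eta>))"
proof -
  interpret D: module K "D n" by (rule D_module)
  have sv: "dpow a \<in> SymC" "pr (dpow a) \<in> carrier W" if "a \<subseteq># m" for a
    using submset_SymC[OF m that] pr_closed by auto
  have "bd n (tens K C (A (Suc n)) (dpow m) \<eta>) =
    (\<Oplus>\<^bsub>D n\<^esub>b\<in>set_mset m. tens K C (A n) (dpow (m - {#b#})) (iota n (pr (dpow (m - (m - {#b#})))) \<eta>))"
    unfolding bd_tens[OF assms]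
  proof (rule D.finsum_submset_single)
    show "tens K C (A n) (dpow a) (iota n (pr (dpow (m - a))) \<eta>) \<in> carrier (D n)" if "a \<subseteq># m" for a
      by (rule D_tens_closed[OF sv(1)[OF that] iota_closed[OF sv(2) \<eta>]]) simp
    show "tens K C (A n) (dpow a) (iota n (pr (dpow (m - a))) \<eta>) = \<zero>\<^bsub>D n\<^esub>" if "a \<subseteq># m" "size (m - a) \<noteq> 1" for a
    proof -
      have "pr (dpow (m - a)) = \<zero>\<^bsub>W\<^esub>" by (rule Sym_proj1(2)[OF content_sub[OF m] that(2)]) simp
      then have "iota n (pr (dpow (m - a))) \<eta> = \<zero>\<^bsub>A n\<^esub>"
        using bilin_zero_left[OF iota_bilin W_module A_module \<eta>] by simp
      then show ?thesis
        using bilin_zero_right[OF tens_bilin[OF C_module A_module] A_module D_module, of "dpow a" n] sv(1)[OF that(1)] by simp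
    qed
  qed
  also have "\<dots> = (\<Oplus>\<^bsub>D n\<^esub>b\<in>set_mset m. tens K C (A n) (dpow (m - {#b#})) (iota n b \<eta>))"
  proof (rule D.finsum_cong')
    have bB: "b \<in> B" if "b \<in># m" for b using that m by auto
    show "(\<lambda>b. tens K C (A n) (dpow (m - {#b#})) (iota n b \<eta>)) \<in> set_mset m \<rightarrow> carrier (D n)"
      using D_tens_closed[OF sv(1) iota_closed[OF subsetD[OF B_subset bB] \<eta>]] by auto
    fix b assume b: "b \<in> set_mset m"
    then have "m - (m - {#b#}) = {#b#}" by (simp add: submset_diff_diff)
    then show "tens K C (A n) (dpow (m - {#b#})) (iota n (pr (dpow (m - (m - {#b#})))) \<eta>) =
      tens K C (A n) (dpow (m - {#b#})) (iota n b \<eta>)"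
      using Sym_proj1(3)[OF bB[OF b]] by simp
  qed simp
  finally show ?thesis .
qed

text \<open>Only the symmetric factor is reduced to basis elements. The second factor will be a full
  dual space, whose elements are handled as functionals.\<close>

lemma tens_dpow_span:
  assumes "module K V"
  shows "lin_span K (tensor K C V) {tens K C V (dpow m) v | m v. m \<in> content \<and> v \<in> carrier V} = carrier (tensor K C V)"
    (is "lin_span K ?T ?G = _")
proof
  note T = tensor_module[OF C_module assms]
  have G: "?G \<subseteq> carrier ?T" using tens_closed[OF C_module assms] dpow_SymC by auto
  show "lin_span K ?T ?G \<subseteq> carrier ?T" by (rule lin_span_closed[OF T G])
  note N = lin_span_submodule[OF T G]
  have "tens K C V c v \<in> lin_span K ?T ?G" if c: "c \<in> carrier C" and v: "v \<in> carrier V" for c v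
  proof -
    have l: "(\<lambda>c \<in> carrier C. tens K C V c v) \<in> lin_maps K C ?T"
      using tens_bilin[OF C_module assms] v by (simp add: bilin_def)
    have "dpow ` content \<subseteq> {c \<in> carrier C. (\<lambda>c \<in> carrier C. tens K C V c v) c \<in> lin_span K ?T ?G}"
    proof
      fix y assume "y \<in> dpow ` content"
      then obtain m where m: "m \<in> content" "y = dpow m" by auto
      have "tens K C V (dpow m) v \<in> lin_span K ?T ?G"
        by (rule subsetD[OF lin_span_superset]) (use m v in blast)
      then show "y \<in> {c \<in> carrier C. (\<lambda>c \<in> carrier C. tens K C V c v) c \<in> lin_span K ?T ?G}"
        using m dpow_SymC by simp
    qed
    from lin_span_least[OF preimage_submodule[OF C_module T l N] this] show ?thesis
      using C_basis c unfolding lin_basis_def by auto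
  qed
  then have "lin_span K ?T ((\<lambda>(x, y). tens K C V x y) ` (carrier C \<times> carrier V)) \<subseteq> lin_span K ?T ?G"
    by (intro lin_span_least[OF N]) auto
  then show "carrier ?T \<subseteq> lin_span K ?T ?G" unfolding tensor_span[OF C_module assms] .
qed

lemma tens_dpow_eqI:
  assumes "module K V" "module K N" "f \<in> lin_maps K (tensor K C V) N" "g \<in> lin_maps K (tensor K C V) N"
    and "\<And>m v. m \<in> content \<Longrightarrow> v \<in> carrier V \<Longrightarrow> f (tens K C V (dpow m) v) = g (tens K C V (dpow m) v)"
  shows "f = g"
  by (rule lin_maps_eqI_span[OF tensor_module[OF C_module assms(1)] assms(2-4) tens_dpow_span[OF assms(1)]])
    (use assms(5) in auto)

lemma iota_swap:
  assumes "u \<in> carrier W" "v \<in> carrier W" "\<eta> \<in> carrier (A (Suc (Suc n)))"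
  shows "iota n u (iota (Suc n) v \<eta>) = \<ominus>\<^bsub>A n\<^esub> iota n v (iota (Suc n) u \<eta>)"
    and "iota n u (iota (Suc n) u \<eta>) = \<zero>\<^bsub>A n\<^esub>"
proof -
  interpret An: module K "A n" by (rule A_module)
  interpret E: module K "Lam (Suc (Suc n))" by (rule Lam_module)
  have \<eta>: "\<eta> \<in> lin_maps K (Lam (Suc (Suc n))) (self_module K)" using assms(3) by simp
  have e: "iota n p (iota (Suc n) q \<eta>) = (\<lambda>x \<in> carrier (Lam n). \<eta> (lwedge K W (Suc n) q (lwedge K W n p x)))"
    if "p \<in> carrier W" for p q
    using lwedge_closed[OF W_module that] by (simp add: iota_def cong: restrict_cong)
  have c: "iota n p (iota (Suc n) q \<eta>) \<in> carrier (A n)" if "p \<in> carrier W" "q \<in> carrier W" for p q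
    by (intro iota_closed that assms)
  show "iota n u (iota (Suc n) u \<eta>) = \<zero>\<^bsub>A n\<^esub>"
    using lwedge_sq[OF W_module assms(1)] lin_maps_zero[OF Lam_module self_mod \<eta>] by (simp add: e assms cong: restrict_cong)
  have "iota n u (iota (Suc n) v \<eta>) \<oplus>\<^bsub>A n\<^esub> iota n v (iota (Suc n) u \<eta>) = \<zero>\<^bsub>A n\<^esub>"
  proof -
    have "\<eta> (lwedge K W (Suc n) v (lwedge K W n u x)) \<oplus>\<^bsub>K\<^esub> \<eta> (lwedge K W (Suc n) u (lwedge K W n v x)) = \<zero>\<^bsub>K\<^esub>"
      if x: "x \<in> carrier (Lam n)" for x
    proof -
      have l: "lwedge K W (Suc n) p (lwedge K W n q x) \<in> carrier (Lam (Suc (Suc n)))" if "p \<in> carrier W" "q \<in> carrier W" for p q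
        by (intro lwedge_closed[OF W_module] that x)
      have "\<eta> (lwedge K W (Suc n) v (lwedge K W n u x)) \<oplus>\<^bsub>K\<^esub> \<eta> (lwedge K W (Suc n) u (lwedge K W n v x)) =
        \<eta> (lwedge K W (Suc n) v (lwedge K W n u x) \<oplus>\<^bsub>Lam (Suc (Suc n))\<^esub> lwedge K W (Suc n) u (lwedge K W n v x))"
        using lin_maps_add[OF \<eta> l l] assms by simp
      also have "\<dots> = \<zero>\<^bsub>K\<^esub>"
        using lwedge_swap[OF W_module assms(2,1) x] l assms lin_maps_zero[OF Lam_module self_mod \<eta>] by (simp add: E.l_neg)
      finally show ?thesis .
    qed
    then show ?thesis by (simp add: e assms cong: restrict_cong)
  qed
  then show "iota n u (iota (Suc n) v \<eta>) = \<ominus>\<^bsub>A n\<^esub> iota n v (iota (Suc n) u \<eta>)"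
    using An.minus_equality c assms by metis
qed

text \<open>The double differential is a sum over the decompositions \<open>m = a + c + d\<close>,
  with the form contracted by the parts of degree one belonging to \<open>d\<close> and
  \<open>c\<close>. For fixed \<open>a\<close> the exchange of \<open>c\<close> and \<open>d\<close>
  changes the sign, so the inner sum cancels in pairs.\<close>

lemma bd_bd:
  assumes "z \<in> carrier (D (Suc (Suc n)))"
  shows "bd n (bd (Suc n) z) = \<zero>\<^bsub>D n\<^esub>"
proof -
  interpret D: module K "D n" by (rule D_module)
  interpret An: module K "A n" by (rule A_module)
  note D2 = D_module[of "Suc (Suc n)"]
  have "compose (carrier (D (Suc (Suc n)))) (bd n) (bd (Suc n)) = (\<lambda>z \<in> carrier (D (Suc (Suc n))). \<zero>\<^bsub>D n\<^esub>)"
  proof (rule tens_dpow_eqI[OF A_module D_module lin_maps_compose[OF D2 bd_lin bd_lin] lin_maps_const_zero[OF D2 D_module]])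
    fix m \<eta> assume m: "m \<in> content" and \<eta>: "\<eta> \<in> carrier (A (Suc (Suc n)))"
    let ?t = "\<lambda>a c d. tens K C (A n) (dpow a) (iota n (pr (dpow c)) (iota (Suc n) (pr (dpow d)) \<eta>))"
    have sv: "dpow a \<in> SymC" "pr (dpow a) \<in> carrier W" if "a \<subseteq># m" for a
      using submset_SymC[OF m that] pr_closed by auto
    have i1: "iota (Suc n) (pr (dpow d)) \<eta> \<in> carrier (A (Suc n))" if "d \<subseteq># m" for d
      by (rule iota_closed[OF sv(2)[OF that] \<eta>])
    have i2: "iota n (pr (dpow c)) (iota (Suc n) (pr (dpow d)) \<eta>) \<in> carrier (A n)" if "c \<subseteq># m" "d \<subseteq># m" for c d
      by (rule iota_closed[OF sv(2)[OF that(1)] i1[OF that(2)]])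
    have tc: "?t a c d \<in> carrier (D n)" if "a + c + d = m" for a c d
      by (intro D_tens_closed sv(1) i2) (use that in \<open>auto simp: ac_simps\<close>)
    have t1: "tens K C (A (Suc n)) (dpow b) (iota (Suc n) (pr (dpow (m - b))) \<eta>) \<in> carrier (D (Suc n))" if "b \<subseteq># m" for b
      by (intro D_tens_closed sv(1) i1) (use that in auto)
    have "bd n (bd (Suc n) (tens K C (A (Suc (Suc n))) (dpow m) \<eta>)) =
      (\<Oplus>\<^bsub>D n\<^esub>b\<in>submsets m. bd n (tens K C (A (Suc n)) (dpow b) (iota (Suc n) (pr (dpow (m - b))) \<eta>)))"
      unfolding bd_tens[OF m \<eta>] by (rule lin_maps_finsum[OF D_module D_module bd_lin]) (use t1 in auto)
    also have "\<dots> = (\<Oplus>\<^bsub>D n\<^esub>b\<in>submsets m. \<Oplus>\<^bsub>D n\<^esub>a\<in>submsets b. ?t a (b - a) (m - b))"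
    proof (rule D.finsum_cong')
      show "(\<lambda>b. \<Oplus>\<^bsub>D n\<^esub>a\<in>submsets b. ?t a (b - a) (m - b)) \<in> submsets m \<rightarrow> carrier (D n)"
        by (auto intro!: D.finsum_closed tc simp: subset_mset.add_diff_inverse)
      fix b assume "b \<in> submsets m"
      then show "bd n (tens K C (A (Suc n)) (dpow b) (iota (Suc n) (pr (dpow (m - b))) \<eta>)) = (\<Oplus>\<^bsub>D n\<^esub>a\<in>submsets b. ?t a (b - a) (m - b))"
        by (intro bd_tens content_sub[OF m] i1) auto
    qed simp
    also have "\<dots> = (\<Oplus>\<^bsub>D n\<^esub>a\<in>submsets m. \<Oplus>\<^bsub>D n\<^esub>c\<in>submsets (m - a). ?t a c (m - a - c))"
      by (rule D.finsum_submset_assoc[OF tc, symmetric])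
    also have "\<dots> = \<zero>\<^bsub>D n\<^esub>"
    proof (rule D.add.finprod_one_eqI)
      fix a assume "a \<in> submsets m"
      then have a: "a \<subseteq># m" by simp
      have sub: "c \<subseteq># m" "m - a - c \<subseteq># m" if "c \<subseteq># m - a" for c
        using subset_mset.order_trans[OF that, of m] by (auto simp: diff_diff_add_mset)
      have "(\<Oplus>\<^bsub>D n\<^esub>c\<in>submsets (m - a). ?t a c (m - a - c)) =
        tens K C (A n) (dpow a) (\<Oplus>\<^bsub>A n\<^esub>c\<in>submsets (m - a). iota n (pr (dpow c)) (iota (Suc n) (pr (dpow (m - a - c))) \<eta>))"
        by (rule bilin_finsum_right[OF tens_bilin[OF C_module A_module] A_module D_module, symmetric])
          (use i2 sub sv(1)[OF a] in auto)
      also have "(\<Oplus>\<^bsub>A n\<^esub>c\<in>submsets (m - a). iota n (pr (dpow c)) (iota (Suc n) (pr (dpow (m - a - c))) \<eta>)) = \<zero>\<^bsub>A n\<^esub>"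
      proof (rule An.finsum_antisymmetric[where s = "\<lambda>c. m - a - c", OF finite_submsets])
        show ss: "m - a - (m - a - c) = c" if "c \<in> submsets (m - a)" for c
          using that by (simp only: mem_Collect_eq submset_diff_diff)
        show "m - a - c \<in> submsets (m - a)" for c by (simp only: mem_Collect_eq diff_subset_eq_self)
        fix c assume "c \<in> submsets (m - a)"
        then have c: "c \<subseteq># m - a" by simp
        show "iota n (pr (dpow c)) (iota (Suc n) (pr (dpow (m - a - c))) \<eta>) \<in> carrier (A n)"
          by (rule i2[OF sub[OF c]])
        show "iota n (pr (dpow (m - a - c))) (iota (Suc n) (pr (dpow (m - a - (m - a - c)))) \<eta>) =
          \<ominus>\<^bsub>A n\<^esub> iota n (pr (dpow c)) (iota (Suc n) (pr (dpow (m - a - c))) \<eta>)"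
          using iota_swap(1)[OF sv(2)[OF sub(2)[OF c]] sv(2)[OF sub(1)[OF c]] \<eta>] ss[of c] c by simp
        show "iota n (pr (dpow c)) (iota (Suc n) (pr (dpow (m - a - c))) \<eta>) = \<zero>\<^bsub>A n\<^esub>" if "m - a - c = c"
          unfolding that by (rule iota_swap(2)[OF sv(2)[OF sub(1)[OF c]] sv(2)[OF sub(1)[OF c]] \<eta>])
      qed
      also have "tens K C (A n) (dpow a) \<zero>\<^bsub>A n\<^esub> = \<zero>\<^bsub>D n\<^esub>"
        by (rule bilin_zero_right[OF tens_bilin[OF C_module A_module] A_module D_module]) (use sv(1)[OF a] in simp)
      finally show "(\<Oplus>\<^bsub>D n\<^esub>c\<in>submsets (m - a). ?t a c (m - a - c)) = \<zero>\<^bsub>D n\<^esub>" .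
    qed
    finally show "compose (carrier (D (Suc (Suc n)))) (bd n) (bd (Suc n)) (tens K C (A (Suc (Suc n))) (dpow m) \<eta>) =
      (\<lambda>z \<in> carrier (D (Suc (Suc n))). \<zero>\<^bsub>D n\<^esub>) (tens K C (A (Suc (Suc n))) (dpow m) \<eta>)"
      using D_tens_closed[OF dpow_SymC[OF m] \<eta>] by (simp add: compose_eq del: dual_module_simps)
  qed
  from fun_cong[OF this, of z] show ?thesis using assms by (simp add: compose_eq)
qed

text \<open>The bridge between the two complexes: under the correspondence of \<open>G\<close> with
  \<open>L\<close>, composition with the Koszul differential becomes composition with
  \<open>bd n\<close>.\<close>

lemma star_Fk_bd:
  assumes U: "module K U" and G: "G \<in> lin_maps K (A n) (FC U)" and L: "L \<in> lin_maps K (D n) U"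
    and GL: "\<And>\<eta> c. \<eta> \<in> carrier (A n) \<Longrightarrow> c \<in> SymC \<Longrightarrow> G \<eta> c = L (tens K C (A n) c \<eta>)"
    and \<eta>: "\<eta> \<in> carrier (A (Suc n))" and m: "m \<in> content"
  shows "star (A n) U G (Fk n \<eta>) (dpow m) = L (bd n (tens K C (A (Suc n)) (dpow m) \<eta>))"
proof -
  interpret U: module K U by fact
  have sv: "dpow a \<in> SymC" "pr (dpow a) \<in> carrier W" if "a \<subseteq># m" for a
    using submset_SymC[OF m that] pr_closed by auto
  have F: "Fk n \<eta> \<in> lin_maps K C (A n)" using lin_maps_closed[OF Fk_lin \<eta>] by simp
  have tc: "tens K C (A n) (dpow a) (iota n (pr (dpow (m - a))) \<eta>) \<in> carrier (D n)" if "a \<subseteq># m" for a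
    by (intro D_tens_closed sv(1) iota_closed sv(2) \<eta>) (use that in auto)
  have "star (A n) U G (Fk n \<eta>) (dpow m) = (\<Oplus>\<^bsub>U\<^esub>a\<in>submsets m. G (Fk n \<eta> (dpow (m - a))) (dpow a))"
    by (rule star_dpow[OF U G F m])
  also have "\<dots> = (\<Oplus>\<^bsub>U\<^esub>a\<in>submsets m. L (tens K C (A n) (dpow a) (iota n (pr (dpow (m - a))) \<eta>)))"
  proof (rule U.finsum_cong')
    show "(\<lambda>a. L (tens K C (A n) (dpow a) (iota n (pr (dpow (m - a))) \<eta>))) \<in> submsets m \<rightarrow> carrier U"
      using lin_maps_closed[OF L tc] by auto
    fix a assume "a \<in> submsets m"
    then have a: "a \<subseteq># m" by simp
    have "Fk n \<eta> (dpow (m - a)) = iota n (pr (dpow (m - a))) \<eta>"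
      using \<eta> sv(1)[of "m - a"] by (simp add: Fk_def)
    then show "G (Fk n \<eta> (dpow (m - a))) (dpow a) = L (tens K C (A n) (dpow a) (iota n (pr (dpow (m - a))) \<eta>))"
      using GL[OF iota_closed[OF sv(2) \<eta>] sv(1)[OF a], of "m - a"] by simp
  qed simp
  also have "\<dots> = L (bd n (tens K C (A (Suc n)) (dpow m) \<eta>))"
    unfolding bd_tens[OF m \<eta>] by (rule lin_maps_finsum[OF D_module U L, symmetric]) (use tc in auto)
  finally show ?thesis .
qed

lemma predual_exists:
  assumes "module K V" "module K U" "F \<in> lin_maps K V (FC U)"
  shows "\<exists>L \<in> lin_maps K (tensor K C V) U. \<forall>v \<in> carrier V. \<forall>c \<in> SymC. L (tens K C V c v) = F v c"
proof -
  have b: "bilin K C V U (\<lambda>c v. F v c)"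
    using bilin_flip[OF bilin_uncurry[OF assms(1) C_module assms(3)[unfolded lin_maps_FC]]] by simp
  show ?thesis
    using tensor_lift_lin[OF C_module assms(1,2) b] tensor_lift_tens[OF C_module assms(1,2) b] by (intro bexI) auto
qed

end

section \<open>Exactness of the predual complex\<close>

context based_space
begin

section \<open>Contraction by coordinate functionals\<close>

definition "cfun e = (SOME \<epsilon>. \<epsilon> \<in> lin_maps K W (self_module K) \<and> (\<forall>b \<in> B. \<epsilon> b = kron K b e))"

lemma cfun:
  assumes "e \<in> B"
  shows "cfun e \<in> lin_maps K W (self_module K)" "b \<in> B \<Longrightarrow> cfun e b = kron K b e"
proof -
  have "\<exists>\<epsilon>. \<epsilon> \<in> lin_maps K W (self_module K) \<and> (\<forall>b \<in> B. \<epsilon> b = kron K b e)"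
    using B_basis assms unfolding lin_basis_def by blast
  from someI_ex[OF this] show "cfun e \<in> lin_maps K W (self_module K)" "b \<in> B \<Longrightarrow> cfun e b = kron K b e"
    unfolding cfun_def by auto
qed

definition "ctr n e = (SOME c. c \<in> lin_maps K (Lam (Suc n)) (Lam n) \<and>
  (\<forall>ws. set ws \<subseteq> carrier W \<and> length ws = Suc n \<longrightarrow> c (wedge K W ws) = contract_word K W (cfun e) ws))"

lemma ctr:
  assumes "e \<in> B"
  shows ctr_lin: "ctr n e \<in> lin_maps K (Lam (Suc n)) (Lam n)"
    and ctr_wedge: "set ws \<subseteq> carrier W \<Longrightarrow> length ws = Suc n \<Longrightarrow> ctr n e (wedge K W ws) = contract_word K W (cfun e) ws"
proof -
  have "\<exists>c. c \<in> lin_maps K (Lam (Suc n)) (Lam n) \<and>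
    (\<forall>ws. set ws \<subseteq> carrier W \<and> length ws = Suc n \<longrightarrow> c (wedge K W ws) = contract_word K W (cfun e) ws)"
    using contraction_exists[OF W_module cfun(1)[OF assms], of n] by blast
  from someI_ex[OF this] show "ctr n e \<in> lin_maps K (Lam (Suc n)) (Lam n)"
    "set ws \<subseteq> carrier W \<Longrightarrow> length ws = Suc n \<Longrightarrow> ctr n e (wedge K W ws) = contract_word K W (cfun e) ws"
    unfolding ctr_def by auto
qed

lemma lwedge_lin': "w \<in> carrier W \<Longrightarrow> (\<lambda>x \<in> carrier (Lam n). lwedge K W n w x) \<in> lin_maps K (Lam n) (Lam (Suc n))"
  by (rule lwedge_lin[OF W_module])

lemma lwedge_zero: "w \<in> carrier W \<Longrightarrow> lwedge K W n w \<zero>\<^bsub>Lam n\<^esub> = \<zero>\<^bsub>Lam (Suc n)\<^esub>"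
  by (rule bilin_zero_right[OF lwedge_bilin[OF W_module] Lam_module Lam_module])

lemma lwedge_diff:
  assumes "w \<in> carrier W" "x \<in> carrier (Lam n)" "y \<in> carrier (Lam n)"
  shows "lwedge K W n w (x \<ominus>\<^bsub>Lam n\<^esub> y) = lwedge K W n w x \<ominus>\<^bsub>Lam (Suc n)\<^esub> lwedge K W n w y"
proof -
  interpret L: module K "Lam n" by (rule Lam_module)
  show ?thesis using lin_maps_a_minus[OF Lam_module Lam_module lwedge_lin'[OF assms(1)] assms(2,3)] assms(2,3) by simp
qed

lemma ctr_lwedge_0:
  assumes e: "e \<in> B" and b: "b \<in> B" and x: "x \<in> carrier (Lam 0)"
  shows "ctr 0 e (lwedge K W 0 b x) = (if b = e then x else \<zero>\<^bsub>Lam 0\<^esub>)"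
proof -
  interpret L: module K "Lam 0" by (rule Lam_module)
  have bW: "b \<in> carrier W" using b B_subset by auto
  have cb: "cfun e b \<in> carrier K" using lin_maps_closed[OF cfun(1)[OF e] bW] by simp
  have "compose (carrier (Lam 0)) (ctr 0 e) (\<lambda>x \<in> carrier (Lam 0). lwedge K W 0 b x) = (\<lambda>x \<in> carrier (Lam 0). cfun e b \<odot>\<^bsub>Lam 0\<^esub> (\<lambda>x \<in> carrier (Lam 0). x) x)"
  proof (rule ext_power_eqI[OF W_module Lam_module lin_maps_compose[OF Lam_module lwedge_lin'[OF bW] ctr_lin[OF e]]
        lin_maps_scale[OF Lam_module Lam_module lin_maps_id[OF Lam_module] cb]])
    fix ws :: "'w list" assume ws: "set ws \<subseteq> carrier W" "length ws = 0"
    then show "compose (carrier (Lam 0)) (ctr 0 e) (\<lambda>x \<in> carrier (Lam 0). lwedge K W 0 b x) (wedge K W ws) =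
      (\<lambda>x \<in> carrier (Lam 0). cfun e b \<odot>\<^bsub>Lam 0\<^esub> (\<lambda>x \<in> carrier (Lam 0). x) x) (wedge K W ws)"
      using wedge_closed[OF W_module ws] lwedge_wedge[OF W_module bW, of "[]" 0] ctr_wedge[OF e, of "[b]" 0] bW
      by (simp add: compose_eq)
  qed
  from fun_cong[OF this, of x] show ?thesis
    using x cfun(2)[OF e b] by (simp add: compose_eq)
qed

text \<open>The Leibniz rule of \<open>contract_word\<close>, carried from words to the whole
  exterior power by linearity. Degree zero is separate in \<open>ctr_lwedge_0\<close>, because
  \<open>x\<close> itself cannot be contracted there.\<close>

lemma ctr_lwedge_Suc:
  assumes e: "e \<in> B" and b: "b \<in> B" and x: "x \<in> carrier (Lam (Suc n))"
  shows "ctr (Suc n) e (lwedge K W (Suc n) b x) =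
    (if b = e then x else \<zero>\<^bsub>Lam (Suc n)\<^esub>) \<ominus>\<^bsub>Lam (Suc n)\<^esub> lwedge K W n b (ctr n e x)"
proof -
  interpret L: module K "Lam (Suc n)" by (rule Lam_module)
  have bW: "b \<in> carrier W" using b B_subset by auto
  have cb: "cfun e b \<in> carrier K" using lin_maps_closed[OF cfun(1)[OF e] bW] by simp
  have m1: "\<ominus>\<^bsub>K\<^esub> \<one>\<^bsub>K\<^esub> \<in> carrier K" by simp
  let ?l = "compose (carrier (Lam (Suc n))) (\<lambda>x \<in> carrier (Lam n). lwedge K W n b x) (ctr n e)"
  have l: "?l \<in> lin_maps K (Lam (Suc n)) (Lam (Suc n))"
    by (rule lin_maps_compose[OF Lam_module ctr_lin[OF e] lwedge_lin'[OF bW]])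
  have cc: "ctr n e y \<in> carrier (Lam n)" if "y \<in> carrier (Lam (Suc n))" for y by (rule lin_maps_closed[OF ctr_lin[OF e] that])
  let ?r1 = "\<lambda>x \<in> carrier (Lam (Suc n)). cfun e b \<odot>\<^bsub>Lam (Suc n)\<^esub> (\<lambda>x \<in> carrier (Lam (Suc n)). x) x"
  let ?r2 = "\<lambda>x \<in> carrier (Lam (Suc n)). (\<ominus>\<^bsub>K\<^esub> \<one>\<^bsub>K\<^esub>) \<odot>\<^bsub>Lam (Suc n)\<^esub> ?l x"
  have r1: "?r1 \<in> lin_maps K (Lam (Suc n)) (Lam (Suc n))"
    by (rule lin_maps_scale[OF Lam_module Lam_module lin_maps_id[OF Lam_module] cb])
  have r2: "?r2 \<in> lin_maps K (Lam (Suc n)) (Lam (Suc n))"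
    by (rule lin_maps_scale[OF Lam_module Lam_module l m1])
  have val: "?r1 y \<oplus>\<^bsub>Lam (Suc n)\<^esub> ?r2 y = cfun e b \<odot>\<^bsub>Lam (Suc n)\<^esub> y \<ominus>\<^bsub>Lam (Suc n)\<^esub> lwedge K W n b (ctr n e y)"
    if y: "y \<in> carrier (Lam (Suc n))" for y
    using y cc[OF y] lwedge_closed[OF W_module bW cc[OF y]] by (simp add: compose_eq a_minus_def L.smult_l_minus)
  have "compose (carrier (Lam (Suc n))) (ctr (Suc n) e) (\<lambda>x \<in> carrier (Lam (Suc n)). lwedge K W (Suc n) b x) =
    (\<lambda>x \<in> carrier (Lam (Suc n)). ?r1 x \<oplus>\<^bsub>Lam (Suc n)\<^esub> ?r2 x)"
  proof (rule ext_power_eqI[OF W_module Lam_module lin_maps_compose[OF Lam_module lwedge_lin'[OF bW] ctr_lin[OF e]]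
        lin_maps_plus[OF Lam_module Lam_module r1 r2]])
    fix ws :: "'w list" assume ws: "set ws \<subseteq> carrier W" "length ws = Suc n"
    note wc = wedge_closed[OF W_module ws]
    have "(\<lambda>x \<in> carrier (Lam (Suc n)). ?r1 x \<oplus>\<^bsub>Lam (Suc n)\<^esub> ?r2 x) (wedge K W ws) =
      cfun e b \<odot>\<^bsub>Lam (Suc n)\<^esub> wedge K W ws \<ominus>\<^bsub>Lam (Suc n)\<^esub> lwedge K W n b (contract_word K W (cfun e) ws)"
      using val[OF wc] wc ctr_wedge[OF e ws] by (simp only: restrict_apply if_True)
    also have "\<dots> = contract_word K W (cfun e) (b # ws)"
      using contract_word_Cons[OF W_module cfun(1)[OF e], of b ws n] ws bW by simp
    also have "\<dots> = compose (carrier (Lam (Suc n))) (ctr (Suc n) e) (\<lambda>x \<in> carrier (Lam (Suc n)). lwedge K W (Suc n) b x) (wedge K W ws)"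
      using wc lwedge_wedge[OF W_module bW ws] ctr_wedge[OF e, of "b # ws" "Suc n"] ws bW by (simp add: compose_eq)
    finally show "compose (carrier (Lam (Suc n))) (ctr (Suc n) e) (\<lambda>x \<in> carrier (Lam (Suc n)). lwedge K W (Suc n) b x) (wedge K W ws) =
      (\<lambda>x \<in> carrier (Lam (Suc n)). ?r1 x \<oplus>\<^bsub>Lam (Suc n)\<^esub> ?r2 x) (wedge K W ws)" by (rule sym)
  qed
  from fun_cong[OF this, of x] have "ctr (Suc n) e (lwedge K W (Suc n) b x) = ?r1 x \<oplus>\<^bsub>Lam (Suc n)\<^esub> ?r2 x"
    using x by (simp add: compose_eq)
  then show ?thesis unfolding val[OF x] using cfun(2)[OF e b] x by simp
qed

text \<open>On wedges of basis vectors, \<open>qop n e\<close> is the projection onto those that contain the factor \<open>e\<close>.\<close>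

definition "qop n e x = lwedge K W n e (ctr n e x)"

lemma qop_lin:
  assumes "e \<in> B"
  shows "(\<lambda>x \<in> carrier (Lam (Suc n)). qop n e x) \<in> lin_maps K (Lam (Suc n)) (Lam (Suc n))"
proof -
  have eW: "e \<in> carrier W" using assms B_subset by auto
  from lin_maps_compose[OF Lam_module ctr_lin[OF assms] lwedge_lin'[OF eW], of n] show ?thesis
    using lin_maps_closed[OF ctr_lin[OF assms]] by (simp add: compose_def qop_def cong: restrict_cong)
qed

lemma qop_closed: "e \<in> B \<Longrightarrow> x \<in> carrier (Lam (Suc n)) \<Longrightarrow> qop n e x \<in> carrier (Lam (Suc n))"
  using lin_maps_closed[OF qop_lin, of e x n] by simp

text \<open>Induction over the word by the Leibniz rule. For \<open>b = e\<close> its second term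
  contains \<open>e \<and> e\<close>. For \<open>b \<noteq> e\<close> moving \<open>e\<close> past
  \<open>b\<close> produces a sign that cancels the sign of the rule, and the operator passes to the
  tail.\<close>

lemma qop_wedge:
  assumes e: "e \<in> B" and "set bs \<subseteq> B" "length bs = Suc n"
  shows "qop n e (wedge K W bs) = (if e \<in> set bs then wedge K W bs else \<zero>\<^bsub>Lam (Suc n)\<^esub>)"
  using assms(2,3)
proof (induction bs arbitrary: n)
  case (Cons b cs)
  have eW: "e \<in> carrier W" and b: "b \<in> B" and bW: "b \<in> carrier W" and cW: "set cs \<subseteq> carrier W"
    using e Cons.prems B_subset by auto
  show ?case
  proof (cases n)
    case 0
    then have cs: "cs = []" using Cons.prems by simp
    have w: "wedge K W [] \<in> carrier (Lam 0)" by (rule wedge_closed[OF W_module]) auto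
    have "qop n e (wedge K W (b # cs)) = lwedge K W 0 e (ctr 0 e (lwedge K W 0 b (wedge K W [])))"
      using lwedge_wedge[OF W_module bW, of "[]" 0] cs 0 by (simp add: qop_def)
    then show ?thesis
      using ctr_lwedge_0[OF e b w] lwedge_wedge[OF W_module eW, of "[]" 0] lwedge_zero[OF eW, of 0] cs 0 by auto
  next
    case (Suc k)
    interpret L: module K "Lam (Suc k)" by (rule Lam_module)
    interpret L2: module K "Lam (Suc (Suc k))" by (rule Lam_module)
    let ?x = "wedge K W cs"
    have len: "length cs = Suc k" using Cons.prems Suc by simp
    have x: "?x \<in> carrier (Lam (Suc k))" by (rule wedge_closed[OF W_module cW len])
    have y: "ctr k e ?x \<in> carrier (Lam k)" by (rule lin_maps_closed[OF ctr_lin[OF e] x])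
    have by_: "lwedge K W k b (ctr k e ?x) \<in> carrier (Lam (Suc k))" by (rule lwedge_closed[OF W_module bW y])
    have IH: "qop k e ?x = (if e \<in> set cs then ?x else \<zero>\<^bsub>Lam (Suc k)\<^esub>)"
      by (rule Cons.IH) (use Cons.prems len in auto)
    have "qop n e (wedge K W (b # cs)) = lwedge K W (Suc k) e ((if b = e then ?x else \<zero>\<^bsub>Lam (Suc k)\<^esub>) \<ominus>\<^bsub>Lam (Suc k)\<^esub> lwedge K W k b (ctr k e ?x))"
      using lwedge_wedge[OF W_module bW cW len] ctr_lwedge_Suc[OF e b x] Suc by (simp add: qop_def)
    also have "\<dots> = lwedge K W (Suc k) e (if b = e then ?x else \<zero>\<^bsub>Lam (Suc k)\<^esub>) \<ominus>\<^bsub>Lam (Suc (Suc k))\<^esub> lwedge K W (Suc k) e (lwedge K W k b (ctr k e ?x))"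
      by (rule lwedge_diff[OF eW _ by_]) (use x in auto)
    also have "\<dots> = (if e \<in> set (b # cs) then wedge K W (b # cs) else \<zero>\<^bsub>Lam (Suc (Suc k))\<^esub>)"
    proof (cases "b = e")
      case True
      then show ?thesis
        using lwedge_sq[OF W_module eW y] lwedge_wedge[OF W_module eW cW len] wedge_closed[OF W_module, of "e # cs" "Suc (Suc k)"] eW cW len
          L2.add.inv_one
        by (simp add: a_minus_def a_inv_def)
    next
      case False
      have "lwedge K W (Suc k) e (lwedge K W k b (ctr k e ?x)) = \<ominus>\<^bsub>Lam (Suc (Suc k))\<^esub> lwedge K W (Suc k) b (qop k e ?x)"
        unfolding qop_def by (rule lwedge_swap[OF W_module eW bW y])
      then show ?thesis
        using False IH lwedge_zero[OF eW, of "Suc k"] lwedge_zero[OF bW, of "Suc k"] lwedge_wedge[OF W_module bW cW len]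
          wedge_closed[OF W_module, of "b # cs" "Suc (Suc k)"] bW cW len lwedge_closed[OF W_module bW qop_closed[OF e x]]
        by (auto simp: a_minus_def)
    qed
    finally show ?thesis using Suc by simp
  qed
qed simp

text \<open>Exterior multiplication of forms by the functional dual to \<open>e\<close>. As forms
  are arbitrary functionals on an exterior power, it is obtained as the transpose of contraction
  instead of from a product of forms.\<close>

definition "Eop n e = (\<lambda>\<eta> \<in> carrier (A n). compose (carrier (Lam (Suc n))) \<eta> (ctr n e))"

definition "Qop n e = (\<lambda>\<eta> \<in> carrier (A (Suc n)). \<lambda>x \<in> carrier (Lam (Suc n)). \<eta> (qop n e x))"

lemma transpose_lin:
  assumes "module K M" "module K N" "f \<in> lin_maps K M N"
  shows "(\<lambda>\<eta> \<in> carrier (dual_module K N). compose (carrier M) \<eta> f) \<in> lin_maps K (dual_module K N) (dual_module K M)"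
proof (rule lin_maps_restrictI[OF dual_mod[OF assms(2)]])
  show "compose (carrier M) \<eta> f \<in> carrier (dual_module K M)" if "\<eta> \<in> carrier (dual_module K N)" for \<eta>
    using lin_maps_compose[OF assms(1,3)] that by simp
qed (auto simp: compose_def lin_maps_closed[OF assms(3)] cong: restrict_cong)

lemma Eop_lin: "e \<in> B \<Longrightarrow> Eop n e \<in> lin_maps K (A n) (A (Suc n))"
  unfolding Eop_def by (rule transpose_lin[OF Lam_module Lam_module ctr_lin])

lemma Qop_lin:
  assumes "e \<in> B"
  shows "Qop n e \<in> lin_maps K (A (Suc n)) (A (Suc n))"
  using transpose_lin[OF Lam_module Lam_module qop_lin[OF assms], of n] by (simp add: Qop_def compose_def cong: restrict_cong)

lemma dual_ext: "\<eta> \<in> carrier (dual_module K M) \<Longrightarrow> (\<lambda>x \<in> carrier M. \<eta> x) = \<eta>"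
  using lin_maps_arb[of \<eta> K M "self_module K"] by (auto simp: restrict_def fun_eq_iff)

lemma iota_Eop_0:
  assumes "e \<in> B" "b \<in> B" "\<eta> \<in> carrier (A 0)"
  shows "iota 0 b (Eop 0 e \<eta>) = (if b = e then \<eta> else \<zero>\<^bsub>A 0\<^esub>)"
proof -
  have bW: "b \<in> carrier W" using assms B_subset by auto
  have \<eta>: "\<eta> \<in> lin_maps K (Lam 0) (self_module K)" using assms(3) by simp
  have "iota 0 b (Eop 0 e \<eta>) = (\<lambda>x \<in> carrier (Lam 0). \<eta> (if b = e then x else \<zero>\<^bsub>Lam 0\<^esub>))"
    using assms(3) lwedge_closed[OF W_module bW, of _ 0] ctr_lwedge_0[OF assms(1,2)]
    by (simp add: iota_def Eop_def compose_eq cong: restrict_cong)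
  then show ?thesis using dual_ext[OF assms(3)] lin_maps_zero[OF Lam_module self_mod \<eta>] by auto
qed

text \<open>This and \<open>iota_Eop_other\<close> are the transposed Leibniz rule: contraction by
  \<open>b\<close> anticommutes with multiplication by the functional dual to \<open>e\<close>, up
  to the identity when \<open>b = e\<close>. Contraction by \<open>e\<close> followed by that
  multiplication is \<open>Qop n e\<close>.\<close>

lemma iota_Eop_same:
  assumes "e \<in> B" "\<eta> \<in> carrier (A (Suc n))"
  shows "iota (Suc n) e (Eop (Suc n) e \<eta>) \<oplus>\<^bsub>A (Suc n)\<^esub> Qop n e \<eta> = \<eta>"
proof -
  interpret L: module K "Lam (Suc n)" by (rule Lam_module)
  have eW: "e \<in> carrier W" using assms B_subset by auto
  have \<eta>: "\<eta> \<in> lin_maps K (Lam (Suc n)) (self_module K)" using assms(2) by simp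
  have "\<eta> (ctr (Suc n) e (lwedge K W (Suc n) e x)) \<oplus>\<^bsub>K\<^esub> \<eta> (qop n e x) = \<eta> x" if x: "x \<in> carrier (Lam (Suc n))" for x
  proof -
    have c: "ctr (Suc n) e (lwedge K W (Suc n) e x) = x \<ominus>\<^bsub>Lam (Suc n)\<^esub> qop n e x"
      using ctr_lwedge_Suc[OF assms(1,1) x] by (simp add: qop_def)
    have q: "qop n e x \<in> carrier (Lam (Suc n))" by (rule qop_closed[OF assms(1) x])
    have "\<eta> (x \<ominus>\<^bsub>Lam (Suc n)\<^esub> qop n e x) \<oplus>\<^bsub>self_module K\<^esub> \<eta> (qop n e x) = \<eta> ((x \<ominus>\<^bsub>Lam (Suc n)\<^esub> qop n e x) \<oplus>\<^bsub>Lam (Suc n)\<^esub> qop n e x)"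
      by (rule lin_maps_add[OF \<eta> L.minus_closed[OF x q] q, symmetric])
    also have "(x \<ominus>\<^bsub>Lam (Suc n)\<^esub> qop n e x) \<oplus>\<^bsub>Lam (Suc n)\<^esub> qop n e x = x"
      using x q by (simp add: a_minus_def L.a_assoc L.l_neg)
    finally show ?thesis by (simp add: c)
  qed
  then have "iota (Suc n) e (Eop (Suc n) e \<eta>) \<oplus>\<^bsub>A (Suc n)\<^esub> Qop n e \<eta> = (\<lambda>x \<in> carrier (Lam (Suc n)). \<eta> x)"
    using assms(2) lwedge_closed[OF W_module eW, of _ "Suc n"]
    by (simp add: iota_def Eop_def Qop_def compose_eq cong: restrict_cong)
  then show ?thesis using dual_ext[OF assms(2)] by simp
qed

lemma iota_Eop_other:
  assumes "e \<in> B" "b \<in> B" "b \<noteq> e" "\<eta> \<in> carrier (A (Suc n))"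
  shows "iota (Suc n) b (Eop (Suc n) e \<eta>) \<oplus>\<^bsub>A (Suc n)\<^esub> Eop n e (iota n b \<eta>) = \<zero>\<^bsub>A (Suc n)\<^esub>"
proof -
  interpret L: module K "Lam (Suc n)" by (rule Lam_module)
  have bW: "b \<in> carrier W" using assms B_subset by auto
  have \<eta>: "\<eta> \<in> lin_maps K (Lam (Suc n)) (self_module K)" using assms(4) by simp
  have ib: "iota n b \<eta> \<in> carrier (A n)" by (rule iota_closed[OF bW assms(4)])
  have cc: "ctr n e x \<in> carrier (Lam n)" if "x \<in> carrier (Lam (Suc n))" for x
    by (rule lin_maps_closed[OF ctr_lin[OF assms(1)] that])
  have "\<eta> (ctr (Suc n) e (lwedge K W (Suc n) b x)) \<oplus>\<^bsub>K\<^esub> \<eta> (lwedge K W n b (ctr n e x)) = \<zero>\<^bsub>K\<^esub>" if x: "x \<in> carrier (Lam (Suc n))" for x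
  proof -
    let ?y = "lwedge K W n b (ctr n e x)"
    have y: "?y \<in> carrier (Lam (Suc n))" by (rule lwedge_closed[OF W_module bW cc[OF x]])
    have c: "ctr (Suc n) e (lwedge K W (Suc n) b x) = \<ominus>\<^bsub>Lam (Suc n)\<^esub> ?y"
      using ctr_lwedge_Suc[OF assms(1,2) x] assms(3) y by (simp add: a_minus_def)
    have "\<eta> (\<ominus>\<^bsub>Lam (Suc n)\<^esub> ?y) \<oplus>\<^bsub>self_module K\<^esub> \<eta> ?y = \<eta> (\<ominus>\<^bsub>Lam (Suc n)\<^esub> ?y \<oplus>\<^bsub>Lam (Suc n)\<^esub> ?y)"
      by (rule lin_maps_add[OF \<eta> L.a_inv_closed[OF y] y, symmetric])
    also have "\<dots> = \<zero>\<^bsub>K\<^esub>" using y lin_maps_zero[OF Lam_module self_mod \<eta>] by (simp add: L.l_neg)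
    finally show ?thesis by (simp add: c)
  qed
  then show ?thesis
    using assms(4) ib cc lwedge_closed[OF W_module bW, of _ "Suc n"]
    by (simp add: iota_def Eop_def compose_eq cong: restrict_cong)
qed

text \<open>The numerical factor that multiplication of divided powers would bring is left out.
  Removing the new \<open>e\<close> afterwards therefore returns the original index with coefficient
  one in every characteristic.\<close>

definition "shift e = (SOME f. f \<in> lin_maps K C C \<and> (\<forall>m \<in> content. f (dpow m) = dpow (add_mset e m)))"

lemma shift:
  assumes "e \<in> B"
  shows "shift e \<in> lin_maps K C C" "m \<in> content \<Longrightarrow> shift e (dpow m) = dpow (add_mset e m)"
proof -
  have "(\<lambda>m. dpow (add_mset e m)) \<in> content \<rightarrow> carrier C" using dpow_SymC assms by auto
  from lin_basis_lift[OF K_field C_basis C_module C_module this]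
  have "\<exists>f. f \<in> lin_maps K C C \<and> (\<forall>m \<in> content. f (dpow m) = dpow (add_mset e m))" by blast
  from someI_ex[OF this] show "shift e \<in> lin_maps K C C" "m \<in> content \<Longrightarrow> shift e (dpow m) = dpow (add_mset e m)"
    unfolding shift_def by auto
qed

definition "hty n e = tensor_map K C (A n) C (A (Suc n)) (shift e) (Eop n e)"

definition "TQ n e = tensor_map K C (A (Suc n)) C (A (Suc n)) idC (Qop n e)"

lemma hty_lin: "e \<in> B \<Longrightarrow> hty n e \<in> lin_maps K (D n) (D (Suc n))"
  unfolding hty_def by (rule tensor_map_lin[OF C_module A_module C_module A_module shift(1) Eop_lin])

lemma hty_tens:
  assumes "e \<in> B" "m \<in> content" "\<eta> \<in> carrier (A n)"
  shows "hty n e (tens K C (A n) (dpow m) \<eta>) = tens K C (A (Suc n)) (dpow (add_mset e m)) (Eop n e \<eta>)"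
  using tensor_map_tens[OF C_module A_module C_module A_module shift(1)[OF assms(1)] Eop_lin[OF assms(1)], of "dpow m" \<eta> n]
    dpow_SymC[OF assms(2)] assms(3) shift(2)[OF assms(1,2)] by (simp add: hty_def)

lemma TQ_lin: "e \<in> B \<Longrightarrow> TQ n e \<in> lin_maps K (D (Suc n)) (D (Suc n))"
  unfolding TQ_def by (rule tensor_map_lin[OF C_module A_module C_module A_module lin_maps_id[OF C_module] Qop_lin])

lemma TQ_tens:
  assumes "e \<in> B" "c \<in> SymC" "\<eta> \<in> carrier (A (Suc n))"
  shows "TQ n e (tens K C (A (Suc n)) c \<eta>) = tens K C (A (Suc n)) c (Qop n e \<eta>)"
  using tensor_map_tens[OF C_module A_module C_module A_module lin_maps_id[OF C_module] Qop_lin[OF assms(1)], of c \<eta> n]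
    assms(2,3) by (simp add: TQ_def)

lemma tens_add_right:
  assumes "c \<in> SymC" "x \<in> carrier (A n)" "y \<in> carrier (A n)"
  shows "tens K C (A n) c (x \<oplus>\<^bsub>A n\<^esub> y) = tens K C (A n) c x \<oplus>\<^bsub>D n\<^esub> tens K C (A n) c y"
proof -
  interpret L: module K "A n" by (rule A_module)
  have "(\<lambda>x \<in> carrier (A n). tens K C (A n) c x) \<in> lin_maps K (A n) (D n)"
    using tens_bilin[OF C_module A_module, of n] assms(1) by (simp add: bilin_def)
  from lin_maps_add[OF this assms(2,3)] show ?thesis
    using assms(2,3) L.a_closed[OF assms(2,3)] by (simp del: dual_module_simps)
qed

lemma tens_zero_right: "c \<in> SymC \<Longrightarrow> tens K C (A n) c \<zero>\<^bsub>A n\<^esub> = \<zero>\<^bsub>D n\<^esub>"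
  by (rule bilin_zero_right[OF tens_bilin[OF C_module A_module] A_module D_module]) simp

lemma bd_hty:
  assumes e: "e \<in> B" and m: "m \<in> content" "e \<notin># m" and \<eta>: "\<eta> \<in> carrier (A n)"
  shows "bd n (hty n e (tens K C (A n) (dpow m) \<eta>)) =
    tens K C (A n) (dpow m) (iota n e (Eop n e \<eta>)) \<oplus>\<^bsub>D n\<^esub>
    (\<Oplus>\<^bsub>D n\<^esub>b\<in>set_mset m. tens K C (A n) (dpow (add_mset e (m - {#b#}))) (iota n b (Eop n e \<eta>)))"
proof -
  interpret D: module K "D n" by (rule D_module)
  have E: "Eop n e \<eta> \<in> carrier (A (Suc n))" by (rule lin_maps_closed[OF Eop_lin[OF e] \<eta>])
  have em: "add_mset e m \<in> content" using e m by simp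
  have ib: "iota n b (Eop n e \<eta>) \<in> carrier (A n)" if "b \<in> B" for b
    using iota_closed[OF _ E] that B_subset by auto
  have c: "tens K C (A n) (dpow (add_mset e m - {#b#})) (iota n b (Eop n e \<eta>)) \<in> carrier (D n)" if "b \<in># add_mset e m" for b
    by (intro D_tens_closed ib submset_SymC[OF em]) (use that em in auto)
  have "bd n (hty n e (tens K C (A n) (dpow m) \<eta>)) =
    (\<Oplus>\<^bsub>D n\<^esub>b\<in>insert e (set_mset m). tens K C (A n) (dpow (add_mset e m - {#b#})) (iota n b (Eop n e \<eta>)))"
    unfolding hty_tens[OF e m(1) \<eta>] bd_tens_single[OF em E] by simp
  also have "\<dots> = tens K C (A n) (dpow (add_mset e m - {#e#})) (iota n e (Eop n e \<eta>)) \<oplus>\<^bsub>D n\<^esub>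
    (\<Oplus>\<^bsub>D n\<^esub>b\<in>set_mset m. tens K C (A n) (dpow (add_mset e m - {#b#})) (iota n b (Eop n e \<eta>)))"
    by (rule D.finsum_insert) (use m c c[of e] in auto)
  also have "(\<Oplus>\<^bsub>D n\<^esub>b\<in>set_mset m. tens K C (A n) (dpow (add_mset e m - {#b#})) (iota n b (Eop n e \<eta>))) =
    (\<Oplus>\<^bsub>D n\<^esub>b\<in>set_mset m. tens K C (A n) (dpow (add_mset e (m - {#b#}))) (iota n b (Eop n e \<eta>)))"
  proof (rule D.finsum_cong')
    \<comment> \<open>Since \<open>e\<close> is not in \<open>m\<close>, the vector \<open>b\<close>
      differs from \<open>e\<close>, so adding \<open>e\<close> and removing \<open>b\<close>
      commute.\<close>
    have eq: "add_mset e m - {#b#} = add_mset e (m - {#b#})" if "b \<in># m" for b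
      using that m(2) by auto
    show "(\<lambda>b. tens K C (A n) (dpow (add_mset e (m - {#b#}))) (iota n b (Eop n e \<eta>))) \<in> set_mset m \<rightarrow> carrier (D n)"
      using c eq by fastforce
    show "tens K C (A n) (dpow (add_mset e m - {#b#})) (iota n b (Eop n e \<eta>)) =
      tens K C (A n) (dpow (add_mset e (m - {#b#}))) (iota n b (Eop n e \<eta>))" if "b \<in> set_mset m" for b
      using eq[OF that] by simp
  qed simp
  finally show ?thesis by simp
qed

text \<open>The differential after the homotopy has one extra term, for the removal of the new
  \<open>e\<close>. The terms for \<open>b\<close> in \<open>m\<close> cancel by
  \<open>iota_Eop_other\<close>, and by \<open>iota_Eop_same\<close> the extra term falls short of
  \<open>t\<close> exactly by \<open>TQ n e t\<close>.\<close>

lemma homotopy_tens: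
  assumes e: "e \<in> B" and m: "m \<in> content" "e \<notin># m" and \<eta>: "\<eta> \<in> carrier (A (Suc n))"
  defines "t \<equiv> tens K C (A (Suc n)) (dpow m) \<eta>"
  shows "bd (Suc n) (hty (Suc n) e t) \<oplus>\<^bsub>D (Suc n)\<^esub> (hty n e (bd n t) \<oplus>\<^bsub>D (Suc n)\<^esub> TQ n e t) = t"
proof -
  interpret D: module K "D (Suc n)" by (rule D_module)
  let ?D = "D (Suc n)"
  have bB: "b \<in> B" "b \<noteq> e" if "b \<in># m" for b using that m by auto
  have sm: "dpow m \<in> SymC" by (rule dpow_SymC[OF m(1)])
  have mb: "m - {#b#} \<in> content" for b by (rule content_sub[OF m(1)]) simp
  have smb: "dpow (add_mset e (m - {#b#})) \<in> SymC" for b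
    by (rule dpow_SymC) (use mb[of b] e in auto)
  have E: "Eop (Suc n) e \<eta> \<in> carrier (A (Suc (Suc n)))" by (rule lin_maps_closed[OF Eop_lin[OF e] \<eta>])
  have i1: "iota (Suc n) b (Eop (Suc n) e \<eta>) \<in> carrier (A (Suc n))" if "b \<in> B" for b
    using iota_closed[OF _ E] that B_subset by auto
  have i0: "iota n b \<eta> \<in> carrier (A n)" if "b \<in> B" for b using iota_closed[OF _ \<eta>] that B_subset by auto
  have Ei: "Eop n e (iota n b \<eta>) \<in> carrier (A (Suc n))" if "b \<in> B" for b by (rule lin_maps_closed[OF Eop_lin[OF e] i0[OF that]])
  have Q: "Qop n e \<eta> \<in> carrier (A (Suc n))" by (rule lin_maps_closed[OF Qop_lin[OF e] \<eta>])
  let ?u = "\<lambda>b. tens K C (A (Suc n)) (dpow (add_mset e (m - {#b#}))) (iota (Suc n) b (Eop (Suc n) e \<eta>))"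
  let ?v = "\<lambda>b. tens K C (A (Suc n)) (dpow (add_mset e (m - {#b#}))) (Eop n e (iota n b \<eta>))"
  let ?p = "tens K C (A (Suc n)) (dpow m) (iota (Suc n) e (Eop (Suc n) e \<eta>))"
  let ?q = "tens K C (A (Suc n)) (dpow m) (Qop n e \<eta>)"
  have u: "?u b \<in> carrier ?D" and v: "?v b \<in> carrier ?D" if "b \<in># m" for b
    using D_tens_closed[OF smb i1] D_tens_closed[OF smb Ei] bB[OF that] by auto
  have p: "?p \<in> carrier ?D" and q: "?q \<in> carrier ?D"
    using D_tens_closed[OF sm i1[OF e]] D_tens_closed[OF sm Q] by auto
  have "hty n e (bd n t) = (\<Oplus>\<^bsub>?D\<^esub>b\<in>set_mset m. hty n e (tens K C (A n) (dpow (m - {#b#})) (iota n b \<eta>)))"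
    unfolding t_def bd_tens_single[OF m(1) \<eta>]
    by (rule lin_maps_finsum[OF D_module D_module hty_lin[OF e]]) (auto intro!: D_tens_closed dpow_SymC[OF mb] i0 bB(1))
  also have "\<dots> = (\<Oplus>\<^bsub>?D\<^esub>b\<in>set_mset m. ?v b)"
    by (rule D.finsum_cong') (use v hty_tens[OF e mb i0] bB in auto)
  finally have hb: "hty n e (bd n t) = (\<Oplus>\<^bsub>?D\<^esub>b\<in>set_mset m. ?v b)" .
  have uv: "?u b \<oplus>\<^bsub>?D\<^esub> ?v b = \<zero>\<^bsub>?D\<^esub>" if "b \<in># m" for b
    using tens_add_right[OF smb i1 Ei, of b] bB[OF that] iota_Eop_other[OF e bB[OF that] \<eta>] tens_zero_right[OF smb] by metis
  have zero: "(\<Oplus>\<^bsub>?D\<^esub>b\<in>set_mset m. ?u b) \<oplus>\<^bsub>?D\<^esub> (\<Oplus>\<^bsub>?D\<^esub>b\<in>set_mset m. ?v b) = \<zero>\<^bsub>?D\<^esub>"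
  proof -
    have "(\<Oplus>\<^bsub>?D\<^esub>b\<in>set_mset m. ?u b \<oplus>\<^bsub>?D\<^esub> ?v b) = (\<Oplus>\<^bsub>?D\<^esub>b\<in>set_mset m. ?u b) \<oplus>\<^bsub>?D\<^esub> (\<Oplus>\<^bsub>?D\<^esub>b\<in>set_mset m. ?v b)"
      by (rule D.finsum_addf) (use u v in auto)
    moreover have "(\<Oplus>\<^bsub>?D\<^esub>b\<in>set_mset m. ?u b \<oplus>\<^bsub>?D\<^esub> ?v b) = \<zero>\<^bsub>?D\<^esub>"
      by (rule D.add.finprod_one_eqI) (use uv in auto)
    ultimately show ?thesis by simp
  qed
  let ?U = "\<Oplus>\<^bsub>?D\<^esub>b\<in>set_mset m. ?u b" and ?V = "\<Oplus>\<^bsub>?D\<^esub>b\<in>set_mset m. ?v b"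
  have UV: "?U \<in> carrier ?D" "?V \<in> carrier ?D" using u v by (auto intro!: D.finsum_closed)
  have "bd (Suc n) (hty (Suc n) e t) \<oplus>\<^bsub>?D\<^esub> (hty n e (bd n t) \<oplus>\<^bsub>?D\<^esub> TQ n e t) = (?p \<oplus>\<^bsub>?D\<^esub> ?U) \<oplus>\<^bsub>?D\<^esub> (?V \<oplus>\<^bsub>?D\<^esub> ?q)"
    using bd_hty[OF e m \<eta>] hb TQ_tens[OF e sm \<eta>] by (simp add: t_def)
  also have "\<dots> = (?U \<oplus>\<^bsub>?D\<^esub> ?V) \<oplus>\<^bsub>?D\<^esub> (?p \<oplus>\<^bsub>?D\<^esub> ?q)"
    using p q UV by (simp add: D.add.m_ac)
  also have "\<dots> = ?p \<oplus>\<^bsub>?D\<^esub> ?q" using zero p q by simp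
  also have "\<dots> = tens K C (A (Suc n)) (dpow m) (iota (Suc n) e (Eop (Suc n) e \<eta>) \<oplus>\<^bsub>A (Suc n)\<^esub> Qop n e \<eta>)"
    by (rule tens_add_right[OF sm i1[OF e] Q, symmetric])
  also have "\<dots> = t" unfolding t_def iota_Eop_same[OF e \<eta>] ..
  finally show ?thesis .
qed

text \<open>Only the index of the divided power is restricted; \<open>\<eta>\<close> may be nonzero
  on wedges that contain members of \<open>E\<close>. This is why the remainder \<open>TQ\<close>
  occurs in \<open>homotopy\<close>.\<close>

definition "avoiding n E = {tens K C (A n) (dpow m) \<eta> | m \<eta>. m \<in> content \<and> set_mset m \<inter> E = {} \<and> \<eta> \<in> carrier (A n)}"

lemma avoiding_closed: "avoiding n E \<subseteq> carrier (D n)"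
  unfolding avoiding_def using D_tens_closed[OF dpow_SymC] by blast

lemma homotopy:
  assumes e: "e \<in> B" "e \<in> E" and z: "z \<in> lin_span K (D (Suc n)) (avoiding (Suc n) E)"
  shows "bd (Suc n) (hty (Suc n) e z) \<oplus>\<^bsub>D (Suc n)\<^esub> (hty n e (bd n z) \<oplus>\<^bsub>D (Suc n)\<^esub> TQ n e z) = z"
proof -
  let ?D = "D (Suc n)"
  let ?f = "compose (carrier ?D) (bd (Suc n)) (hty (Suc n) e)" and ?g = "compose (carrier ?D) (hty n e) (bd n)"
  have f: "?f \<in> lin_maps K ?D ?D" by (rule lin_maps_compose[OF D_module hty_lin[OF e(1)] bd_lin])
  have g: "?g \<in> lin_maps K ?D ?D" by (rule lin_maps_compose[OF D_module bd_lin hty_lin[OF e(1)]])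
  note gq = lin_maps_plus[OF D_module D_module g TQ_lin[OF e(1)]]
  note R = lin_maps_plus[OF D_module D_module f gq]
  have zD: "z \<in> carrier ?D" using z lin_span_closed[OF D_module avoiding_closed] by auto
  have "(\<lambda>x \<in> carrier ?D. ?f x \<oplus>\<^bsub>?D\<^esub> (\<lambda>x \<in> carrier ?D. ?g x \<oplus>\<^bsub>?D\<^esub> TQ n e x) x) z = (\<lambda>x \<in> carrier ?D. x) z"
  proof (rule lin_maps_eq_on_span[OF D_module D_module R lin_maps_id[OF D_module] _ avoiding_closed z])
    fix t assume t: "t \<in> avoiding (Suc n) E"
    then have tD: "t \<in> carrier ?D" using avoiding_closed by auto
    obtain m \<eta> where m: "t = tens K C (A (Suc n)) (dpow m) \<eta>" "m \<in> content" "set_mset m \<inter> E = {}" "\<eta> \<in> carrier (A (Suc n))"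
      using t unfolding avoiding_def by blast
    then have "e \<notin># m" using e by auto
    from homotopy_tens[OF e(1) m(2) this m(4)] tD
    show "(\<lambda>x \<in> carrier ?D. ?f x \<oplus>\<^bsub>?D\<^esub> (\<lambda>x \<in> carrier ?D. ?g x \<oplus>\<^bsub>?D\<^esub> TQ n e x) x) t = (\<lambda>x \<in> carrier ?D. x) t"
      by (simp add: compose_eq m(1))
  qed
  then show ?thesis using zD by (simp add: compose_eq)
qed

text \<open>\<open>TQ\<close> acts on the form alone and leaves the index untouched, so the homotopy
  for the next member of \<open>E\<close> applies to its value.\<close>

lemma TQ_avoiding:
  assumes e: "e \<in> B" and z: "z \<in> lin_span K (D (Suc n)) (avoiding (Suc n) E)"
  shows "TQ n e z \<in> lin_span K (D (Suc n)) (avoiding (Suc n) E)"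
proof -
  let ?D = "D (Suc n)"
  let ?N = "lin_span K ?D (avoiding (Suc n) E)"
  have N: "submodule ?N K ?D" by (rule lin_span_submodule[OF D_module avoiding_closed])
  have "avoiding (Suc n) E \<subseteq> {x \<in> carrier ?D. TQ n e x \<in> ?N}"
  proof
    fix t assume t: "t \<in> avoiding (Suc n) E"
    then obtain m \<eta> where m: "t = tens K C (A (Suc n)) (dpow m) \<eta>" "m \<in> content" "set_mset m \<inter> E = {}" "\<eta> \<in> carrier (A (Suc n))"
      unfolding avoiding_def by blast
    have "TQ n e t = tens K C (A (Suc n)) (dpow m) (Qop n e \<eta>)"
      unfolding m(1) by (rule TQ_tens[OF e dpow_SymC[OF m(2)] m(4)])
    then have "TQ n e t \<in> avoiding (Suc n) E"
      unfolding avoiding_def using m lin_maps_closed[OF Qop_lin[OF e] m(4)] by blast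
    then have "TQ n e t \<in> ?N" by (rule subsetD[OF lin_span_superset])
    moreover have "t \<in> carrier ?D" using t avoiding_closed by auto
    ultimately show "t \<in> {x \<in> carrier ?D. TQ n e x \<in> ?N}" by blast
  qed
  from lin_span_least[OF preimage_submodule[OF D_module D_module TQ_lin[OF e] N] this] z show ?thesis by auto
qed

section \<open>Iterated projections and the vanishing of functionals on cycles\<close>

primrec TQs where
  "TQs n [] = (\<lambda>z \<in> carrier (D (Suc n)). z)"
| "TQs n (e # es) = compose (carrier (D (Suc n))) (TQs n es) (TQ n e)"

lemma TQs_lin: "set es \<subseteq> B \<Longrightarrow> TQs n es \<in> lin_maps K (D (Suc n)) (D (Suc n))"
  by (induction es) (auto intro: lin_maps_id[OF D_module] lin_maps_compose[OF D_module TQ_lin])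

text \<open>Each \<open>Qop n e\<close> erases the values on basis wedges without \<open>e\<close>,
  so the composite keeps only the wedges that contain all of \<open>es\<close>. Values on basis
  wedges are enough to record, because these span.\<close>

lemma TQs_tens:
  assumes "set es \<subseteq> B" "c \<in> SymC" "\<eta> \<in> carrier (A (Suc n))"
  shows "\<exists>\<eta>' \<in> carrier (A (Suc n)). TQs n es (tens K C (A (Suc n)) c \<eta>) = tens K C (A (Suc n)) c \<eta>' \<and>
    (\<forall>bs. set bs \<subseteq> B \<and> length bs = Suc n \<longrightarrow> \<eta>' (wedge K W bs) = (if set es \<subseteq> set bs then \<eta> (wedge K W bs) else \<zero>\<^bsub>K\<^esub>))"
  using assms(1,3)
proof (induction es arbitrary: \<eta>)
  case Nil
  then show ?case using D_tens_closed[OF assms(2) Nil.prems(2)] by (intro bexI[of _ \<eta>]) (auto simp del: dual_module_simps)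
next
  case (Cons e es)
  have e: "e \<in> B" using Cons.prems by simp
  have Q: "Qop n e \<eta> \<in> carrier (A (Suc n))" by (rule lin_maps_closed[OF Qop_lin[OF e] Cons.prems(2)])
  obtain \<eta>' where \<eta>': "\<eta>' \<in> carrier (A (Suc n))" "TQs n es (tens K C (A (Suc n)) c (Qop n e \<eta>)) = tens K C (A (Suc n)) c \<eta>'"
    "\<And>bs. set bs \<subseteq> B \<Longrightarrow> length bs = Suc n \<Longrightarrow> \<eta>' (wedge K W bs) = (if set es \<subseteq> set bs then Qop n e \<eta> (wedge K W bs) else \<zero>\<^bsub>K\<^esub>)"
    using Cons.IH[OF _ Q] Cons.prems(1) by auto
  have \<eta>: "\<eta> \<in> lin_maps K (Lam (Suc n)) (self_module K)" using Cons.prems(2) by simp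
  have "Qop n e \<eta> (wedge K W bs) = (if e \<in> set bs then \<eta> (wedge K W bs) else \<zero>\<^bsub>K\<^esub>)" if bs: "set bs \<subseteq> B" "length bs = Suc n" for bs
    using qop_wedge[OF e bs] wedge_closed[OF W_module subset_trans[OF bs(1) B_subset] bs(2)] Cons.prems(2) lin_maps_zero[OF Lam_module self_mod \<eta>]
    by (simp add: Qop_def)
  then show ?case
    using \<eta>' TQ_tens[OF e assms(2) Cons.prems(2)] D_tens_closed[OF assms(2) Cons.prems(2)]
    by (intro bexI[OF _ \<eta>'(1)]) (auto simp: compose_eq simp del: dual_module_simps)
qed

text \<open>A word of \<open>Suc n\<close> letters cannot contain more than \<open>Suc n\<close>
  distinct basis vectors, so no value of the form survives.\<close>

lemma TQs_zero:
  assumes es: "set es \<subseteq> B" "distinct es" "length es > Suc n" and z: "z \<in> carrier (D (Suc n))"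
  shows "TQs n es z = \<zero>\<^bsub>D (Suc n)\<^esub>"
proof -
  have span: "lin_span K W B = carrier W" using B_basis by (simp add: lin_basis_def)
  have "TQs n es = (\<lambda>z \<in> carrier (D (Suc n)). \<zero>\<^bsub>D (Suc n)\<^esub>)"
  proof (rule tens_dpow_eqI[OF A_module D_module TQs_lin[OF es(1)] lin_maps_const_zero[OF D_module D_module]])
    fix m \<eta> assume m: "m \<in> content" and \<eta>: "\<eta> \<in> carrier (A (Suc n))"
    obtain \<eta>' where \<eta>': "\<eta>' \<in> carrier (A (Suc n))" "TQs n es (tens K C (A (Suc n)) (dpow m) \<eta>) = tens K C (A (Suc n)) (dpow m) \<eta>'"
      "\<And>bs. set bs \<subseteq> B \<Longrightarrow> length bs = Suc n \<Longrightarrow> \<eta>' (wedge K W bs) = (if set es \<subseteq> set bs then \<eta> (wedge K W bs) else \<zero>\<^bsub>K\<^esub>)"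
      using TQs_tens[OF es(1) dpow_SymC[OF m] \<eta>] by blast
    have l: "\<eta>' \<in> lin_maps K (Lam (Suc n)) (self_module K)" using \<eta>'(1) by simp
    have "\<eta>' = (\<lambda>x \<in> carrier (Lam (Suc n)). \<zero>\<^bsub>self_module K\<^esub>)"
    proof (rule lin_maps_eqI_span[OF Lam_module self_mod l lin_maps_const_zero[OF Lam_module self_mod] ext_power_basis_span[OF W_module B_subset span]])
      fix y assume "y \<in> wedge K W ` tuples B (Suc n)"
      then obtain bs where bs: "y = wedge K W bs" "set bs \<subseteq> B" "length bs = Suc n" by auto
      have "\<not> set es \<subseteq> set bs"
      proof
        assume "set es \<subseteq> set bs"
        then have "card (set es) \<le> card (set bs)" by (intro card_mono) auto
        then show False using es(2,3) card_length[of bs] bs(3) by (simp add: distinct_card)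
      qed
      then show "\<eta>' y = (\<lambda>x \<in> carrier (Lam (Suc n)). \<zero>\<^bsub>self_module K\<^esub>) y"
        using \<eta>'(3)[OF bs(2,3)] bs wedge_closed[OF W_module subset_trans[OF bs(2) B_subset] bs(3)] by simp
    qed
    then have "\<eta>' = \<zero>\<^bsub>A (Suc n)\<^esub>" by simp
    then show "TQs n es (tens K C (A (Suc n)) (dpow m) \<eta>) = (\<lambda>z \<in> carrier (D (Suc n)). \<zero>\<^bsub>D (Suc n)\<^esub>) (tens K C (A (Suc n)) (dpow m) \<eta>)"
      using \<eta>'(2) tens_zero_right[OF dpow_SymC[OF m], of "Suc n"] D_tens_closed[OF dpow_SymC[OF m] \<eta>] by (simp del: dual_module_simps)
  qed
  then show ?thesis using z by simp
qed

text \<open>On a cycle the homotopy identity writes \<open>z\<close> as a boundary plus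
  \<open>TQ n e z\<close>. The functional does not see the boundary, and \<open>TQ n e z\<close> is
  again a cycle that avoids \<open>E\<close>, so the argument repeats. Vanishing of such functionals
  on cycles is the form of exactness that \<open>lin_map_factor\<close> consumes.\<close>

lemma functional_TQs:
  assumes N: "module K N" and F: "F \<in> lin_maps K (D (Suc n)) N"
    and Fbd: "\<And>z. z \<in> carrier (D (Suc (Suc n))) \<Longrightarrow> F (bd (Suc n) z) = \<zero>\<^bsub>N\<^esub>"
    and es: "set es \<subseteq> B" "set es \<subseteq> E"
    and z: "z \<in> lin_span K (D (Suc n)) (avoiding (Suc n) E)" "bd n z = \<zero>\<^bsub>D n\<^esub>"
  shows "F z = F (TQs n es z)"
  using es z
proof (induction es arbitrary: z)
  case Nil
  then show ?case using lin_span_closed[OF D_module avoiding_closed] by (auto simp: subset_iff)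
next
  case (Cons e es)
  let ?D = "D (Suc n)"
  interpret D: module K ?D by (rule D_module)
  interpret N: module K N by (rule N)
  interpret Dn: module K "D n" by (rule D_module)
  have e: "e \<in> B" "e \<in> E" using Cons.prems by auto
  have zD: "z \<in> carrier ?D" using Cons.prems(3) lin_span_closed[OF D_module avoiding_closed] by auto
  let ?y = "TQ n e z"
  have y: "?y \<in> lin_span K ?D (avoiding (Suc n) E)" by (rule TQ_avoiding[OF e(1) Cons.prems(3)])
  have yD: "?y \<in> carrier ?D" by (rule lin_maps_closed[OF TQ_lin[OF e(1)] zD])
  have hz: "hty (Suc n) e z \<in> carrier (D (Suc (Suc n)))" by (rule lin_maps_closed[OF hty_lin[OF e(1)] zD])
  have bhz: "bd (Suc n) (hty (Suc n) e z) \<in> carrier ?D" by (rule lin_maps_closed[OF bd_lin hz])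
  have dec: "z = bd (Suc n) (hty (Suc n) e z) \<oplus>\<^bsub>?D\<^esub> ?y"
    using homotopy[OF e Cons.prems(3)] Cons.prems(4) lin_maps_zero[OF D_module D_module hty_lin[OF e(1)], of n] yD by simp
  have "bd n z = bd n (bd (Suc n) (hty (Suc n) e z)) \<oplus>\<^bsub>D n\<^esub> bd n ?y"
    by (subst dec) (rule lin_maps_add[OF bd_lin bhz yD])
  then have "bd n ?y = \<zero>\<^bsub>D n\<^esub>"
    using Cons.prems(4) bd_bd[OF hz] lin_maps_closed[OF bd_lin yD] by simp
  then have "F ?y = F (TQs n es ?y)" using Cons.IH[OF _ _ y] Cons.prems by simp
  moreover have "F z = F (bd (Suc n) (hty (Suc n) e z)) \<oplus>\<^bsub>N\<^esub> F ?y"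
    by (subst dec) (rule lin_maps_add[OF F bhz yD])
  ultimately show ?case using Fbd[OF hz] lin_maps_closed[OF F yD] zD by (simp add: compose_eq)
qed

text \<open>Elements of \<open>D n\<close> are finite combinations of generators, and each generator
  uses one finite multiset. The complement \<open>- B0\<close> is taken in the whole type, so
  avoiding it confines the indices to \<open>B0\<close>.\<close>

lemma finite_variables:
  assumes "z \<in> carrier (D n)"
  obtains B0 where "finite B0" "z \<in> lin_span K (D n) (avoiding n (- B0))"
proof -
  interpret D: module K "D n" by (rule D_module)
  note N = lin_span_submodule[OF D_module avoiding_closed]
  let ?S = "{z \<in> carrier (D n). \<exists>B0. finite B0 \<and> z \<in> lin_span K (D n) (avoiding n (- B0))}"
  have mono: "lin_span K (D n) (avoiding n (- B0)) \<subseteq> lin_span K (D n) (avoiding n (- (B0 \<union> B1)))"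
    "lin_span K (D n) (avoiding n (- B1)) \<subseteq> lin_span K (D n) (avoiding n (- (B0 \<union> B1)))" for B0 B1
    by (rule lin_span_mono; unfold avoiding_def; blast)+
  have "submodule ?S K (D n)"
  proof (rule D.submoduleI)
    show "\<zero>\<^bsub>D n\<^esub> \<in> ?S" using submodule_zero[OF N, of n "- {}"] by auto
    show "\<ominus>\<^bsub>D n\<^esub> a \<in> ?S" if "a \<in> ?S" for a using that submodule_minus[OF N] by auto
    show "k \<odot>\<^bsub>D n\<^esub> a \<in> ?S" if "k \<in> carrier K" "a \<in> ?S" for k a using that submodule_smult[OF N] by auto
    fix a b assume a: "a \<in> ?S" and b: "b \<in> ?S"
    obtain B0 where B0: "finite B0" "a \<in> lin_span K (D n) (avoiding n (- B0))" using a by auto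
    obtain B1 where B1: "finite B1" "b \<in> lin_span K (D n) (avoiding n (- B1))" using b by auto
    have "a \<oplus>\<^bsub>D n\<^esub> b \<in> lin_span K (D n) (avoiding n (- (B0 \<union> B1)))"
      by (rule submodule_add[OF N subsetD[OF mono(1) B0(2)] subsetD[OF mono(2) B1(2)]])
    moreover have "finite (B0 \<union> B1)" using B0(1) B1(1) by simp
    moreover have "a \<oplus>\<^bsub>D n\<^esub> b \<in> carrier (D n)" by (rule D.a_closed) (use a b in auto)
    ultimately show "a \<oplus>\<^bsub>D n\<^esub> b \<in> ?S" by blast
  qed auto
  moreover have "{tens K C (A n) (dpow m) v | m v. m \<in> content \<and> v \<in> carrier (A n)} \<subseteq> ?S"
  proof
    fix t assume "t \<in> {tens K C (A n) (dpow m) v | m v. m \<in> content \<and> v \<in> carrier (A n)}"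
    then obtain m v where t: "t = tens K C (A n) (dpow m) v" "m \<in> content" "v \<in> carrier (A n)" by blast
    then have "t \<in> avoiding n (- set_mset m)" unfolding avoiding_def by blast
    then have "t \<in> lin_span K (D n) (avoiding n (- set_mset m))" by (rule subsetD[OF lin_span_superset])
    moreover have "t \<in> carrier (D n)" unfolding t(1) by (rule D_tens_closed[OF dpow_SymC[OF t(2)] t(3)])
    ultimately show "t \<in> ?S" by blast
  qed
  ultimately have "carrier (D n) \<subseteq> ?S"
    unfolding tens_dpow_span[OF A_module, symmetric] by (rule lin_span_least)
  then show ?thesis using assms that by blast
qed

lemma functional_vanishes_on_cycles:
  assumes inf: "infinite B" and N: "module K N" and F: "F \<in> lin_maps K (D (Suc n)) N"
    and Fbd: "\<And>z. z \<in> carrier (D (Suc (Suc n))) \<Longrightarrow> F (bd (Suc n) z) = \<zero>\<^bsub>N\<^esub>"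
    and z: "z \<in> carrier (D (Suc n))" "bd n z = \<zero>\<^bsub>D n\<^esub>"
  shows "F z = \<zero>\<^bsub>N\<^esub>"
proof -
  obtain B0 where B0: "finite B0" "z \<in> lin_span K (D (Suc n)) (avoiding (Suc n) (- B0))"
    using finite_variables[OF z(1)] by blast
  have "infinite (B - B0)" using inf B0(1) by simp
  \<comment> \<open>One vector more than the degree \<open>Suc n\<close> of the forms, all outside
    the finite set that carries the indices of \<open>z\<close>.\<close>
  then obtain S where S: "finite S" "card S = Suc (Suc n)" "S \<subseteq> B - B0"
    using infinite_arbitrarily_large by blast
  obtain es where es: "set es = S" "distinct es" using finite_distinct_list[OF S(1)] by blast
  have len: "length es = Suc (Suc n)" using es S(2) distinct_card by fastforce
  have "F z = F (TQs n es z)"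
    by (rule functional_TQs[OF N F Fbd _ _ B0(2) z(2)]) (use es S in auto)
  also have "TQs n es z = \<zero>\<^bsub>D (Suc n)\<^esub>" by (rule TQs_zero) (use es S len z in auto)
  finally show ?thesis using lin_maps_zero[OF D_module N F] by simp
qed

text \<open>In degree zero each generator is itself a boundary: a form of degree zero has no part
  containing \<open>e\<close>, so the homotopy for any \<open>e\<close> outside \<open>m\<close>
  leaves no remainder. Infinite \<open>B\<close> provides such an \<open>e\<close>.\<close>

lemma functional_vanishes_degree_0:
  assumes inf: "infinite B" and N: "module K N" and F: "F \<in> lin_maps K (D 0) N"
    and Fbd: "\<And>z. z \<in> carrier (D (Suc 0)) \<Longrightarrow> F (bd 0 z) = \<zero>\<^bsub>N\<^esub>"
    and m: "m \<in> content" and \<eta>: "\<eta> \<in> carrier (A 0)"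
  shows "F (tens K C (A 0) (dpow m) \<eta>) = \<zero>\<^bsub>N\<^esub>"
proof -
  interpret D: module K "D 0" by (rule D_module)
  have "\<not> B \<subseteq> set_mset m" using inf finite_subset by blast
  then obtain e where e: "e \<in> B" "e \<notin># m" by auto
  let ?t = "tens K C (A 0) (dpow m) \<eta>"
  have t: "?t \<in> carrier (D 0)" by (rule D_tens_closed[OF dpow_SymC[OF m] \<eta>])
  have smb: "dpow (add_mset e (m - {#b#})) \<in> SymC" for b
    by (rule dpow_SymC) (use content_sub[OF m, of "m - {#b#}"] e in auto)
  have "(\<Oplus>\<^bsub>D 0\<^esub>b\<in>set_mset m. tens K C (A 0) (dpow (add_mset e (m - {#b#}))) (iota 0 b (Eop 0 e \<eta>))) = \<zero>\<^bsub>D 0\<^esub>"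
  proof (rule D.add.finprod_one_eqI)
    fix b assume "b \<in> set_mset m"
    then have b: "b \<in> B" "b \<noteq> e" using m e by auto
    then show "tens K C (A 0) (dpow (add_mset e (m - {#b#}))) (iota 0 b (Eop 0 e \<eta>)) = \<zero>\<^bsub>D 0\<^esub>"
      using iota_Eop_0[OF e(1) b(1) \<eta>] tens_zero_right[OF smb[of b], of 0] by (simp del: dual_module_simps)
  qed
  then have "bd 0 (hty 0 e ?t) = ?t"
    using bd_hty[OF e(1) m e(2) \<eta>] iota_Eop_0[OF e(1) e(1) \<eta>] t by simp
  then show ?thesis using Fbd[OF lin_maps_closed[OF hty_lin[OF e(1)] t]] by simp
qed

end

section \<open>Morphism spaces as modules over the endomorphism ring\<close>

lemma abelian_group_cong:
  assumes "abelian_group G" "carrier G = carrier H" "add G = add H" "zero G = zero H"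
  shows "abelian_group H"
proof -
  interpret G: abelian_group G by fact
  show ?thesis
  proof (rule abelian_groupI)
    fix x assume "x \<in> carrier H"
    then show "\<exists>y\<in>carrier H. y \<oplus>\<^bsub>H\<^esub> x = \<zero>\<^bsub>H\<^esub>"
      using G.l_neg[of x] G.a_inv_closed[of x] unfolding assms(2-4) by blast
  qed (use G.a_closed G.zero_closed G.a_assoc G.a_comm G.l_zero in \<open>auto simp: assms(2-4)\<close>)
qed

text \<open>The counterpart of \<open>lin_maps_zero\<close> for modules over \<open>S\<close>, which
  need not be commutative; it argues by additivity.\<close>

lemma additive_zero:
  assumes "abelian_group M" "abelian_group N" "f \<in> lin_maps R M N"
  shows "f \<zero>\<^bsub>M\<^esub> = \<zero>\<^bsub>N\<^esub>"
proof -
  interpret M: abelian_group M by fact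
  interpret N: abelian_group N by fact
  have c: "f \<zero>\<^bsub>M\<^esub> \<in> carrier N" using lin_maps_closed[OF assms(3)] by simp
  have "f \<zero>\<^bsub>M\<^esub> = f \<zero>\<^bsub>M\<^esub> \<oplus>\<^bsub>N\<^esub> f \<zero>\<^bsub>M\<^esub>"
    using lin_maps_add[OF assms(3), of "\<zero>\<^bsub>M\<^esub>" "\<zero>\<^bsub>M\<^esub>"] by simp
  then show ?thesis using c by (metis N.add.l_cancel_one')
qed

text \<open>An infinite set is equipotent with its square, so letters can be prefixed one at a time.
  A surjection is what is needed to send a basis of \<open>W\<close> onto the wedges that span an
  exterior power.\<close>

lemma infinite_surj_words:
  assumes "infinite B"
  shows "\<exists>f. f ` B = tuples B n"
proof (induction n)
  case 0
  have "B \<noteq> {}" using assms by auto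
  then have "(\<lambda>_. []) ` B = tuples B 0" by auto
  then show ?case by blast
next
  case (Suc n)
  then obtain f where f: "f ` B = tuples B n" by blast
  obtain h where h: "bij_betw h B (B \<times> B)"
    using card_of_ordIso[of B "B \<times> B"] ordIso_symmetric[OF card_of_Times_same_infinite[OF assms]] by blast
  have "(\<lambda>b. fst (h b) # f (snd (h b))) ` B = (\<lambda>p. fst p # f (snd p)) ` (h ` B)" by (simp add: image_image)
  also have "\<dots> = (\<lambda>(b, ws). b # ws) ` (B \<times> f ` B)" unfolding bij_betw_imp_surj_on[OF h] by (auto simp: image_iff)
  also have "\<dots> = tuples B (Suc n)" unfolding f by (auto simp: length_Suc_conv image_iff)
  finally show ?case by blast
qed

context based_space
begin

section \<open>The endomorphism ring and its modules of morphisms\<close>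

lemma contra_morphisms_submodule:
  assumes "module K V" "module K U"
  shows "submodule (Mor V U) K (hom_module K (FC V) (FC U))"
proof -
  have PV: "module K (FC V)" and PU: "module K (FC U)" using assms FC_module by auto
  let ?H = "hom_module K (FC V) (FC U)" and ?CU = "hom_module K C (FC U)"
  have H: "module K ?H" by (rule hom_module_module[OF PV PU])
  have CU: "module K ?CU" by (rule hom_module_module[OF C_module PU])
  interpret H: module K ?H by (rule H)
  interpret CU: module K ?CU by (rule CU)
  note cl = contra_lin[OF assms(2)]
  have comm: "f (contra (FC V) \<Phi>) = contra (FC U) (compose SymC f \<Phi>)" "compose SymC f \<Phi> \<in> lin_maps K C (FC U)"
    if "f \<in> Mor V U" "\<Phi> \<in> lin_maps K C (FC V)" for f \<Phi>
    using that compose_C[OF that(2) Mor_lin[OF that(1)]] by (auto simp: contra_morphisms_def simp del: FC_simps(5))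
  have smult: "a \<odot>\<^bsub>?H\<^esub> f \<in> Mor V U"
    if a: "a \<in> carrier K" and f: "f \<in> Mor V U" for a f
  proof -
    note fl = Mor_lin[OF f]
    have "(a \<odot>\<^bsub>?H\<^esub> f) (contra (FC V) \<Phi>) = contra (FC U) (compose SymC (a \<odot>\<^bsub>?H\<^esub> f) \<Phi>)" if \<Phi>: "\<Phi> \<in> lin_maps K C (FC V)" for \<Phi>
    proof -
      have "compose SymC (a \<odot>\<^bsub>?H\<^esub> f) \<Phi> = a \<odot>\<^bsub>?CU\<^esub> compose SymC f \<Phi>"
        using lin_maps_closed[OF \<Phi>] by (auto simp: compose_def restrict_def fun_eq_iff)
      then show ?thesis
        using lin_maps_smult[OF cl a, of "compose SymC f \<Phi>"] comm[OF f \<Phi>] contra_closed[OF assms(1) \<Phi>]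
          CU.smult_closed[OF a, of "compose SymC f \<Phi>"] by (simp del: FC_simps(5))
    qed
    moreover have "a \<odot>\<^bsub>?H\<^esub> f \<in> lin_maps K (FC V) (FC U)" using H.smult_closed[OF a, of f] fl by simp
    ultimately show ?thesis by (simp add: contra_morphisms_def del: FC_simps(5))
  qed
  show ?thesis
  proof (rule H.submoduleI)
    show "Mor V U \<subseteq> carrier ?H" using Mor_lin by auto
    \<comment> \<open>The zero map is a multiple of any morphism; the extension of the zero map on
      generators supplies one.\<close>
    have "star V U (\<lambda>v \<in> carrier V. \<zero>\<^bsub>FC U\<^esub>) \<in> Mor V U"
      by (rule star_morphism[OF assms lin_maps_const_zero[OF assms(1) PU]])
    then have s: "\<zero>\<^bsub>K\<^esub> \<odot>\<^bsub>?H\<^esub> star V U (\<lambda>v \<in> carrier V. \<zero>\<^bsub>FC U\<^esub>) \<in> Mor V U"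
      "star V U (\<lambda>v \<in> carrier V. \<zero>\<^bsub>FC U\<^esub>) \<in> carrier ?H"
      using smult[OF H.R.zero_closed] Mor_lin by auto
    then show "\<zero>\<^bsub>?H\<^esub> \<in> Mor V U" using H.smult_l_null by metis
    show "\<ominus>\<^bsub>?H\<^esub> f \<in> Mor V U" if f: "f \<in> Mor V U" for f
    proof -
      have "(\<ominus>\<^bsub>K\<^esub> \<one>\<^bsub>K\<^esub>) \<odot>\<^bsub>?H\<^esub> f = \<ominus>\<^bsub>?H\<^esub> f"
        using H.smult_l_minus[OF H.one_closed, of f] H.smult_one[of f] Mor_lin[OF f] by (simp del: hom_module_simps(4))
      then show ?thesis using smult[OF _ f, of "\<ominus>\<^bsub>K\<^esub> \<one>\<^bsub>K\<^esub>"] by simp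
    qed
    show "a \<odot>\<^bsub>?H\<^esub> f \<in> Mor V U"
      if "a \<in> carrier K" "f \<in> Mor V U" for a f by (rule smult[OF that])
    fix f g assume f: "f \<in> Mor V U" and g: "g \<in> Mor V U"
    have "(f \<oplus>\<^bsub>?H\<^esub> g) (contra (FC V) \<Phi>) = contra (FC U) (compose SymC (f \<oplus>\<^bsub>?H\<^esub> g) \<Phi>)" if \<Phi>: "\<Phi> \<in> lin_maps K C (FC V)" for \<Phi>
    proof -
      have "compose SymC (f \<oplus>\<^bsub>?H\<^esub> g) \<Phi> = compose SymC f \<Phi> \<oplus>\<^bsub>?CU\<^esub> compose SymC g \<Phi>"
        using lin_maps_closed[OF \<Phi>] by (auto simp: compose_def restrict_def fun_eq_iff)
      then show ?thesis
        using lin_maps_add[OF cl, of "compose SymC f \<Phi>" "compose SymC g \<Phi>"] comm[OF f \<Phi>] comm[OF g \<Phi>] contra_closed[OF assms(1) \<Phi>]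
          CU.a_closed[of "compose SymC f \<Phi>" "compose SymC g \<Phi>"] by (simp del: FC_simps(5))
    qed
    moreover have "f \<oplus>\<^bsub>?H\<^esub> g \<in> lin_maps K (FC V) (FC U)"
      using H.a_closed[of f g] Mor_lin[OF f] Mor_lin[OF g] by simp
    ultimately show "f \<oplus>\<^bsub>?H\<^esub> g \<in> Mor V U" by (simp add: contra_morphisms_def del: FC_simps(5))
  qed
qed

lemma contra_hom_simps:
  "carrier (contra_hom K C Q P) = contra_morphisms K C Q P"
  "zero (contra_hom K C Q P) = (\<lambda>x \<in> carrier Q. \<zero>\<^bsub>P\<^esub>)"
  "add (contra_hom K C Q P) = (\<lambda>f g. \<lambda>x \<in> carrier Q. f x \<oplus>\<^bsub>P\<^esub> g x)"
  "smult (contra_hom K C Q P) = (\<lambda>s f. compose (carrier Q) s f)"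
  by (simp_all add: contra_hom_def)

lemma end_ring_simps:
  "carrier (contra_end_ring K C P) = contra_morphisms K C P P"
  "zero (contra_end_ring K C P) = (\<lambda>x \<in> carrier P. \<zero>\<^bsub>P\<^esub>)"
  "add (contra_end_ring K C P) = (\<lambda>f g. \<lambda>x \<in> carrier P. f x \<oplus>\<^bsub>P\<^esub> g x)"
  "monoid.mult (contra_end_ring K C P) = (\<lambda>s f. compose (carrier P) s f)"
  "one (contra_end_ring K C P) = (\<lambda>x \<in> carrier P. x)"
  by (simp_all add: contra_end_ring_def)

lemma contra_hom_abelian:
  assumes "module K V" "module K U"
  shows "abelian_group (contra_hom K C (FC V) (FC U))"
proof -
  have H: "module K (hom_module K (FC V) (FC U))" by (rule hom_module_module[OF FC_module FC_module]) fact+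
  from submodule.submodule_is_module[OF contra_morphisms_submodule[OF assms] H]
  have "abelian_group ((hom_module K (FC V) (FC U))\<lparr>carrier := Mor V U\<rparr>)"
    by (simp add: module_def)
  then show ?thesis by (rule abelian_group_cong) (simp_all add: contra_hom_simps)
qed

lemma Mor_closed: "f \<in> Mor V U \<Longrightarrow> \<phi> \<in> lin_maps K C V \<Longrightarrow> f \<phi> \<in> lin_maps K C U"
  using lin_maps_closed[OF Mor_lin, of f "FC V" "FC U" \<phi>] by simp

lemma Mor_ext: "f \<in> Mor V U \<Longrightarrow> (\<lambda>\<phi> \<in> lin_maps K C V. f \<phi>) = f"
  using lin_maps_arb[OF Mor_lin, of f "FC V" "FC U"] by (auto simp: restrict_def fun_eq_iff)

lemma Mor_id:
  assumes "module K V"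
  shows "idF V \<in> Mor V V"
proof -
  have "idF V \<in> lin_maps K (FC V) (FC V)" using lin_maps_id[OF FC_module[OF assms]] by simp
  moreover have "compose SymC (idF V) \<Phi> = \<Phi>" if "\<Phi> \<in> lin_maps K C (FC V)" for \<Phi>
    using lin_maps_closed[OF that] lin_maps_arb[OF that] by (auto simp: compose_def restrict_def fun_eq_iff)
  ultimately show ?thesis using contra_closed[OF assms] by (simp add: contra_morphisms_def del: FC_simps(5))
qed

lemma compose_assoc_maps:
  assumes "f \<in> Mor V U"
  shows "compose (lin_maps K C V) h (compose (lin_maps K C V) g f) = compose (lin_maps K C V) (compose (lin_maps K C U) h g) f"
  using Mor_closed[OF assms] by (auto simp: compose_def restrict_def fun_eq_iff)

lemma compose_add_left:
  assumes "f \<in> Mor V U"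
  shows "compose (lin_maps K C V) (\<lambda>\<phi> \<in> lin_maps K C U. s \<phi> \<oplus>\<^bsub>FC X\<^esub> t \<phi>) f =
    (\<lambda>\<phi> \<in> lin_maps K C V. compose (lin_maps K C V) s f \<phi> \<oplus>\<^bsub>FC X\<^esub> compose (lin_maps K C V) t f \<phi>)"
  using Mor_closed[OF assms] by (auto simp: compose_def restrict_def fun_eq_iff)

lemma compose_add_right:
  assumes "f \<in> Mor V U" "g \<in> Mor V U" "s \<in> Mor U X"
  shows "compose (lin_maps K C V) s (\<lambda>\<phi> \<in> lin_maps K C V. f \<phi> \<oplus>\<^bsub>FC U\<^esub> g \<phi>) =
    (\<lambda>\<phi> \<in> lin_maps K C V. compose (lin_maps K C V) s f \<phi> \<oplus>\<^bsub>FC X\<^esub> compose (lin_maps K C V) s g \<phi>)"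
  using lin_maps_add[OF Mor_lin[OF assms(3)]] Mor_closed[OF assms(1)] Mor_closed[OF assms(2)]
  by (simp add: compose_def cong: restrict_cong)

abbreviation "PW \<equiv> FC dW"
abbreviation "S \<equiv> contra_end_ring K C PW"
abbreviation "H V \<equiv> contra_hom K C (FC V) PW"

lemma S_ring: "ring S"
proof (rule ringI)
  have id: "compose (lin_maps K C dW) (idF dW) s = s" "compose (lin_maps K C dW) s (idF dW) = s"
    if "s \<in> Mor dW dW" for s
    using Mor_closed[OF that] Mor_ext[OF that] by (auto simp: compose_def cong: restrict_cong)
  show "abelian_group S"
    by (rule abelian_group_cong[OF contra_hom_abelian[OF dW_module dW_module]]) (simp_all add: contra_hom_simps end_ring_simps)
  show "monoid S"
    by (rule monoidI) (simp_all add: end_ring_simps Mor_compose[OF dW_module] Mor_id[OF dW_module]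
      compose_assoc_maps id del: dual_module_simps)
  show "(x \<oplus>\<^bsub>S\<^esub> y) \<otimes>\<^bsub>S\<^esub> z = x \<otimes>\<^bsub>S\<^esub> z \<oplus>\<^bsub>S\<^esub> y \<otimes>\<^bsub>S\<^esub> z"
    if "x \<in> carrier S" "y \<in> carrier S" "z \<in> carrier S" for x y z
    using that compose_add_left[of z dW dW dW x y] by (simp add: end_ring_simps del: dual_module_simps)
  show "z \<otimes>\<^bsub>S\<^esub> (x \<oplus>\<^bsub>S\<^esub> y) = z \<otimes>\<^bsub>S\<^esub> x \<oplus>\<^bsub>S\<^esub> z \<otimes>\<^bsub>S\<^esub> y"
    if "x \<in> carrier S" "y \<in> carrier S" "z \<in> carrier S" for x y z
    using that compose_add_right[of x dW dW y z dW] by (simp add: end_ring_simps del: dual_module_simps)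
qed

lemma H_left_module:
  assumes "module K V"
  shows "left_module S (H V)"
proof (intro left_module.intro left_module_axioms.intro S_ring contra_hom_abelian assms dW_module)
  show "a \<odot>\<^bsub>H V\<^esub> x \<in> carrier (H V)" if "a \<in> carrier S" "x \<in> carrier (H V)" for a x
    using that Mor_compose[OF assms] by (simp add: contra_hom_simps end_ring_simps del: dual_module_simps)
  show "(a \<oplus>\<^bsub>S\<^esub> b) \<odot>\<^bsub>H V\<^esub> x = a \<odot>\<^bsub>H V\<^esub> x \<oplus>\<^bsub>H V\<^esub> b \<odot>\<^bsub>H V\<^esub> x"
    if "a \<in> carrier S" "b \<in> carrier S" "x \<in> carrier (H V)" for a b x
    using that compose_add_left[of x V dW dW a b] by (simp add: contra_hom_simps end_ring_simps del: dual_module_simps)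
  show "a \<odot>\<^bsub>H V\<^esub> (x \<oplus>\<^bsub>H V\<^esub> y) = a \<odot>\<^bsub>H V\<^esub> x \<oplus>\<^bsub>H V\<^esub> a \<odot>\<^bsub>H V\<^esub> y"
    if "a \<in> carrier S" "x \<in> carrier (H V)" "y \<in> carrier (H V)" for a x y
    using that compose_add_right[of x V dW y a dW] by (simp add: contra_hom_simps end_ring_simps del: dual_module_simps)
  show "(a \<otimes>\<^bsub>S\<^esub> b) \<odot>\<^bsub>H V\<^esub> x = a \<odot>\<^bsub>H V\<^esub> (b \<odot>\<^bsub>H V\<^esub> x)"
    if "a \<in> carrier S" "b \<in> carrier S" "x \<in> carrier (H V)" for a b x
    using that compose_assoc_maps[of x V dW a b] by (simp add: contra_hom_simps end_ring_simps del: dual_module_simps)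
  show "\<one>\<^bsub>S\<^esub> \<odot>\<^bsub>H V\<^esub> x = x" if "x \<in> carrier (H V)" for x
    using that Mor_closed[of x V dW] Mor_ext[of x V dW]
    by (simp add: contra_hom_simps end_ring_simps compose_def del: dual_module_simps cong: restrict_cong)
qed

text \<open>The free contramodule functor applied to \<open>f\<close>, that is, postcomposition with
  \<open>f\<close>. Obtaining it by the universal property makes it a morphism at once.\<close>

definition "pmap V U f = star V U (compose (carrier V) (cst U) f)"

lemma pmap:
  assumes "module K V" "module K U" "f \<in> lin_maps K V U"
  shows "pmap V U f \<in> Mor V U"
    and "v \<in> carrier V \<Longrightarrow> pmap V U f (cst V v) = cst U (f v)"
  unfolding pmap_def
  using star_morphism[OF assms(1,2) lin_maps_compose[OF assms(1,3) cst_lin[OF assms(2)]]]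
    star_cst[OF assms(1,2) lin_maps_compose[OF assms(1,3) cst_lin[OF assms(2)]], of v]
  by (auto simp: compose_eq)

lemma cst_closed: "module K V \<Longrightarrow> v \<in> carrier V \<Longrightarrow> cst V v \<in> lin_maps K C V"
  using lin_maps_closed[OF cst_lin, of V v] by simp

text \<open>Since \<open>W\<close> is infinite-dimensional, the exterior powers have dimension at most that of \<open>W\<close>, so
  their duals are direct summands of the dual of \<open>W\<close>.\<close>

lemma dual_ext_power_retract:
  assumes "infinite B"
  shows "\<exists>i \<in> lin_maps K (A n) dW. \<exists>r \<in> lin_maps K dW (A n). \<forall>\<eta> \<in> carrier (A n). r (i \<eta>) = \<eta>"
proof -
  obtain f where f: "f ` B = tuples B n" using infinite_surj_words[OF assms, of n] by (rule exE)
  have span: "lin_span K W B = carrier W" using B_basis by (simp add: lin_basis_def)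
  have fw: "set (f b) \<subseteq> B" "length (f b) = n" if "b \<in> B" for b using f that by auto
  have "(\<lambda>b. wedge K W (f b)) \<in> B \<rightarrow> carrier (Lam n)"
    using wedge_closed[OF W_module subset_trans[OF fw(1) B_subset] fw(2)] by auto
  from lin_basis_lift[OF K_field B_basis W_module Lam_module this] obtain q where
    q: "q \<in> lin_maps K W (Lam n)" "\<And>b. b \<in> B \<Longrightarrow> q b = wedge K W (f b)" by blast
  \<comment> \<open>\<open>q\<close> sends a basis of \<open>W\<close> onto the wedges of basis
    words and is therefore surjective, so its transpose is injective and splits over the
    field.\<close>
  let ?i = "\<lambda>\<eta> \<in> carrier (A n). compose (carrier W) \<eta> q"
  have i: "?i \<in> lin_maps K (A n) dW" by (rule transpose_lin[OF W_module Lam_module q(1)])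
  have "\<exists>r \<in> lin_maps K dW (A n). \<forall>\<eta> \<in> carrier (A n). r (?i \<eta>) = (\<lambda>\<eta> \<in> carrier (A n). \<eta>) \<eta>"
  proof (rule lin_map_factor[OF K_field A_module dW_module A_module i lin_maps_id[OF A_module]])
    fix \<eta> assume \<eta>: "\<eta> \<in> carrier (A n)" and z: "?i \<eta> = \<zero>\<^bsub>dW\<^esub>"
    have l: "\<eta> \<in> lin_maps K (Lam n) (self_module K)" using \<eta> by simp
    have "\<eta> = (\<lambda>x \<in> carrier (Lam n). \<zero>\<^bsub>self_module K\<^esub>)"
    proof (rule lin_maps_eqI_span[OF Lam_module self_mod l lin_maps_const_zero[OF Lam_module self_mod] ext_power_basis_span[OF W_module B_subset span]])
      fix y assume "y \<in> wedge K W ` tuples B n"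
      then obtain b where b: "b \<in> B" "y = wedge K W (f b)" unfolding f[symmetric] by auto
      have bW: "b \<in> carrier W" using b B_subset by auto
      have "\<eta> (q b) = \<zero>\<^bsub>K\<^esub>" using fun_cong[OF z, of b] \<eta> bW by (simp add: compose_eq)
      then show "\<eta> y = (\<lambda>x \<in> carrier (Lam n). \<zero>\<^bsub>self_module K\<^esub>) y"
        using q(2)[OF b(1)] b(2) wedge_closed[OF W_module subset_trans[OF fw(1)[OF b(1)] B_subset] fw(2)[OF b(1)]] by simp
    qed
    then show "(\<lambda>\<eta> \<in> carrier (A n). \<eta>) \<eta> = \<zero>\<^bsub>A n\<^esub>" using \<eta> by simp
  qed
  then obtain r where r: "r \<in> lin_maps K dW (A n)"
    and ri: "\<forall>\<eta> \<in> carrier (A n). r (?i \<eta>) = (\<lambda>\<eta> \<in> carrier (A n). \<eta>) \<eta>" by (rule bexE)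
  have "r (?i \<eta>) = \<eta>" if "\<eta> \<in> carrier (A n)" for \<eta>
    using bspec[OF ri that] that by (simp only: restrict_apply if_True)
  then show ?thesis by (intro bexI[OF _ i] bexI[OF _ r] ballI)
qed

section \<open>Finite generation and projectivity\<close>

lemma koszul_retract:
  assumes "infinite B"
  obtains g \<rho> where "g \<in> Mor (A n) dW" "\<rho> \<in> Mor dW (A n)"
    "compose (lin_maps K C (A n)) \<rho> g = idF (A n)"
proof -
  obtain i r where i: "i \<in> lin_maps K (A n) dW" and r: "r \<in> lin_maps K dW (A n)" and ri: "\<And>\<eta>. \<eta> \<in> carrier (A n) \<Longrightarrow> r (i \<eta>) = \<eta>"
    using dual_ext_power_retract[OF assms, of n] by blast
  note g = pmap[OF A_module dW_module i] and \<rho> = pmap[OF dW_module A_module r]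
  have "compose (lin_maps K C (A n)) (pmap dW (A n) r) (pmap (A n) dW i) = idF (A n)"
  proof (rule Mor_eqI[OF A_module A_module Mor_compose[OF A_module g(1) \<rho>(1)] Mor_id[OF A_module]])
    fix v assume v: "v \<in> carrier (A n)"
    show "compose (lin_maps K C (A n)) (pmap dW (A n) r) (pmap (A n) dW i) (cst (A n) v) = idF (A n) (cst (A n) v)"
      using cst_closed[OF A_module v] g(2)[OF v] \<rho>(2)[OF lin_maps_closed[OF i v]] ri[OF v]
      by (simp add: compose_eq del: dual_module_simps)
  qed
  then show ?thesis using that g(1) \<rho>(1) by blast
qed

text \<open>A morphism out of a retract of \<open>PW\<close> factors through the embedding
  \<open>g\<close>. If it takes values in \<open>PW\<close>, the other factor
  \<open>x \<rho>\<close> is an element of \<open>S\<close>, so \<open>g\<close> generates the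
  module of morphisms.\<close>

lemma retract_factor:
  assumes g: "g \<in> Mor V dW" and \<rho>: "compose (lin_maps K C V) \<rho> g = idF V"
    and x: "x \<in> contra_morphisms K C (FC V) U"
  shows "compose (lin_maps K C V) (compose (lin_maps K C dW) x \<rho>) g = x"
proof -
  have "compose (lin_maps K C V) (compose (lin_maps K C dW) x \<rho>) g = compose (lin_maps K C V) x (idF V)"
    unfolding compose_assoc_maps[OF g, symmetric] \<rho> ..
  also have "\<dots> = x"
    using lin_maps_arb[OF Mor_lin[OF x]] by (auto simp: compose_def restrict_def fun_eq_iff)
  finally show ?thesis .
qed

lemma H_finitely_generated:
  assumes "infinite B"
  shows "finitely_generated S (H (A n))"
proof -
  obtain g \<rho> where g: "g \<in> Mor (A n) dW" and \<rho>: "\<rho> \<in> Mor dW (A n)"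
    "compose (lin_maps K C (A n)) \<rho> g = idF (A n)" using koszul_retract[OF assms] by blast
  interpret M: left_module S "H (A n)" by (rule H_left_module[OF A_module])
  have carr: "submodule (carrier (H (A n))) S (H (A n))"
    by (intro submodule.intro submodule_axioms.intro M.smult_closed M.add.subgroup_self)
  have gc: "g \<in> carrier (H (A n))" using g by (simp add: contra_hom_simps)
  have "carrier (H (A n)) \<subseteq> N" if N: "submodule N S (H (A n))" "{g} \<subseteq> N" for N
  proof
    fix x assume "x \<in> carrier (H (A n))"
    then have x: "x \<in> Mor (A n) dW" by (simp add: contra_hom_simps)
    have s: "compose (lin_maps K C dW) x \<rho> \<in> carrier S"
      using Mor_compose[OF dW_module \<rho>(1) x] by (simp add: end_ring_simps del: dual_module_simps)
    have "compose (lin_maps K C dW) x \<rho> \<odot>\<^bsub>H (A n)\<^esub> g \<in> N"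
      using submodule.smult_closed[OF N(1) s] N(2) by auto
    then show "x \<in> N" using retract_factor[OF g \<rho>(2) x] by (simp add: contra_hom_simps del: dual_module_simps)
  qed
  then have "lin_span S (H (A n)) {g} = carrier (H (A n))"
    unfolding lin_span_def using carr gc by (intro equalityI Inter_greatest Inter_lower) auto
  then show ?thesis unfolding finitely_generated_def using gc by (intro exI[of _ "{g}"]) auto
qed

text \<open>The map \<open>x \<mapsto> x \<rho>\<close> is \<open>S\<close>-linear into
  \<open>S\<close>, and acting on \<open>g\<close> recovers \<open>x\<close> from its value. A lift
  is therefore given by the choice of a preimage \<open>x0\<close> of \<open>f g\<close>.\<close>

lemma H_projective:
  assumes "infinite B"
  shows "projective_module TYPE('t) S (H (A n))"
  unfolding projective_module_def
proof (intro conjI allI impI H_left_module A_module)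
  fix X Y :: "(((nat \<Rightarrow> ('w list \<Rightarrow> 'k) set) \<Rightarrow> 'w \<Rightarrow> 'k) \<Rightarrow> (nat \<Rightarrow> ('w list \<Rightarrow> 'k) set) \<Rightarrow> 'w \<Rightarrow> 'k, 't) module"
  fix p f
  assume a: "left_module S X \<and> left_module S Y \<and> p \<in> lin_maps S X Y \<and> p ` carrier X = carrier Y \<and> f \<in> lin_maps S (H (A n)) Y"
  then have p: "p \<in> lin_maps S X Y" and surj: "p ` carrier X = carrier Y" and f: "f \<in> lin_maps S (H (A n)) Y" by auto
  interpret X: left_module S X using a by simp
  interpret Y: left_module S Y using a by simp
  interpret M: left_module S "H (A n)" by (rule H_left_module[OF A_module])
  obtain g \<rho> where g: "g \<in> Mor (A n) dW" and \<rho>: "\<rho> \<in> Mor dW (A n)"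
    "compose (lin_maps K C (A n)) \<rho> g = idF (A n)" using koszul_retract[OF assms] by blast
  have gc: "g \<in> carrier (H (A n))" using g by (simp add: contra_hom_simps)
  obtain x0 where x0: "x0 \<in> carrier X" "p x0 = f g" using lin_maps_closed[OF f gc] surj by (metis imageE)
  let ?s = "\<lambda>x. compose (lin_maps K C dW) x \<rho>"
  have s: "?s x \<in> carrier S" if "x \<in> carrier (H (A n))" for x
    using Mor_compose[OF dW_module \<rho>(1)] that by (simp add: contra_hom_simps end_ring_simps del: dual_module_simps)
  have s_add: "?s (x \<oplus>\<^bsub>H (A n)\<^esub> y) = ?s x \<oplus>\<^bsub>S\<^esub> ?s y" for x y
    using compose_add_left[OF \<rho>(1), of dW x y] by (simp add: contra_hom_simps end_ring_simps del: dual_module_simps)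
  have s_mult: "?s (a \<odot>\<^bsub>H (A n)\<^esub> x) = a \<otimes>\<^bsub>S\<^esub> ?s x" for a x
    using compose_assoc_maps[OF \<rho>(1), of a x] by (simp add: contra_hom_simps end_ring_simps del: dual_module_simps)
  have fac: "?s x \<odot>\<^bsub>H (A n)\<^esub> g = x" if "x \<in> carrier (H (A n))" for x
    using retract_factor[OF g \<rho>(2), of x] that by (simp add: contra_hom_simps del: dual_module_simps)
  let ?h = "\<lambda>x \<in> carrier (H (A n)). ?s x \<odot>\<^bsub>X\<^esub> x0"
  have "?h \<in> lin_maps S (H (A n)) X"
    unfolding lin_maps_def[of S]
  proof (intro CollectI conjI ballI)
    show "?h \<in> carrier (H (A n)) \<rightarrow>\<^sub>E carrier X" using X.smult_closed[OF s x0(1)] by auto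
    show "?h (x \<oplus>\<^bsub>H (A n)\<^esub> y) = ?h x \<oplus>\<^bsub>X\<^esub> ?h y" if "x \<in> carrier (H (A n))" "y \<in> carrier (H (A n))" for x y
      using that M.a_closed[OF that] s_add X.smult_l_distr[OF s[OF that(1)] s[OF that(2)] x0(1)] by simp
    show "?h (a \<odot>\<^bsub>H (A n)\<^esub> x) = a \<odot>\<^bsub>X\<^esub> ?h x" if "a \<in> carrier S" "x \<in> carrier (H (A n))" for a x
      using that M.smult_closed[OF that] s_mult X.smult_assoc[OF that(1) s[OF that(2)] x0(1)] by simp
  qed
  moreover have "p (?h x) = f x" if x: "x \<in> carrier (H (A n))" for x
    using lin_maps_smult[OF p s[OF x] x0(1)] x0(2) lin_maps_smult[OF f s[OF x] gc] fac[OF x] x by simp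
  ultimately show "\<exists>h \<in> lin_maps S (H (A n)) X. \<forall>x \<in> carrier (H (A n)). p (h x) = f x" by (intro bexI) auto
qed

section \<open>The complex of morphisms\<close>

definition "dn n f = compose (lin_maps K C (A (Suc n))) f (koszul_diff K W n)"

lemma dn_closed: "f \<in> Mor (A n) dW \<Longrightarrow> dn n f \<in> Mor (A (Suc n)) dW"
  unfolding dn_def by (rule Mor_compose[OF A_module koszul_diff_morphism])

lemma dn_cst:
  assumes "f \<in> Mor (A n) dW" "\<eta> \<in> carrier (A (Suc n))"
  shows "dn n f (cst (A (Suc n)) \<eta>) = f (Fk n \<eta>)"
  using cst_closed[OF A_module assms(2)] star_cst[OF A_module A_module Fk_lin assms(2)]
  by (simp add: dn_def compose_eq koszul_diff_star del: dual_module_simps)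

text \<open>By the universal property a morphism is a linear map from \<open>A n\<close> to
  functions on \<open>C\<close> with values in \<open>dW\<close>, which is the same as a linear map
  from \<open>D n\<close> to \<open>dW\<close>.\<close>

lemma morphism_predual:
  assumes "f \<in> Mor (A n) dW"
  obtains L where "L \<in> lin_maps K (D n) dW"
    "\<And>\<eta> c. \<eta> \<in> carrier (A n) \<Longrightarrow> c \<in> SymC \<Longrightarrow> L (tens K C (A n) c \<eta>) = f (cst (A n) \<eta>) c"
proof -
  have F: "compose (carrier (A n)) f (cst (A n)) \<in> lin_maps K (A n) PW"
    by (rule lin_maps_compose[OF A_module cst_lin[OF A_module] Mor_lin[OF assms]])
  from predual_exists[OF A_module dW_module F] that show ?thesis by (auto simp: compose_eq)
qed

lemma dn_predual:
  assumes f: "f \<in> Mor (A n) dW" and L: "L \<in> lin_maps K (D n) dW"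
    and fL: "\<And>\<eta> c. \<eta> \<in> carrier (A n) \<Longrightarrow> c \<in> SymC \<Longrightarrow> L (tens K C (A n) c \<eta>) = f (cst (A n) \<eta>) c"
    and \<eta>: "\<eta> \<in> carrier (A (Suc n))" and m: "m \<in> content"
  shows "dn n f (cst (A (Suc n)) \<eta>) (dpow m) = L (bd n (tens K C (A (Suc n)) (dpow m) \<eta>))"
proof -
  have F: "compose (carrier (A n)) f (cst (A n)) \<in> lin_maps K (A n) PW"
    by (rule lin_maps_compose[OF A_module cst_lin[OF A_module] Mor_lin[OF f]])
  have "dn n f (cst (A (Suc n)) \<eta>) = star (A n) dW (compose (carrier (A n)) f (cst (A n))) (Fk n \<eta>)"
    unfolding dn_cst[OF f \<eta>] using Mor_star[OF A_module dW_module f] by metis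
  then show ?thesis
    using star_Fk_bd[OF dW_module F L _ \<eta> m] fL by (simp add: compose_eq del: dual_module_simps)
qed

lemma morphism_zeroI:
  assumes "f \<in> Mor (A n) dW"
    and "\<And>\<eta> m. \<eta> \<in> carrier (A n) \<Longrightarrow> m \<in> content \<Longrightarrow> f (cst (A n) \<eta>) (dpow m) = \<zero>\<^bsub>dW\<^esub>"
  shows "f = \<zero>\<^bsub>H (A n)\<^esub>"
proof -
  interpret M: left_module S "H (A n)" by (rule H_left_module[OF A_module])
  interpret P: module K PW by (rule FC_module[OF dW_module])
  have z: "\<zero>\<^bsub>H (A n)\<^esub> \<in> Mor (A n) dW" using M.zero_closed by (simp add: contra_hom_simps(1))
  show ?thesis
  proof (rule Mor_eqI[OF A_module dW_module assms(1) z])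
    fix v assume v: "v \<in> carrier (A n)"
    have c: "cst (A n) v \<in> lin_maps K C (A n)" by (rule cst_closed[OF A_module v])
    have "f (cst (A n) v) = \<zero>\<^bsub>PW\<^esub>"
    proof (rule C_eqI[OF dW_module Mor_closed[OF assms(1) c]])
      show "\<zero>\<^bsub>PW\<^esub> \<in> lin_maps K C dW" using P.zero_closed by simp
      show "f (cst (A n) v) (dpow m) = \<zero>\<^bsub>PW\<^esub> (dpow m)" if "m \<in> content" for m
        using assms(2)[OF v that] dpow_SymC[OF that] by simp
    qed
    then show "f (cst (A n) v) = \<zero>\<^bsub>H (A n)\<^esub> (cst (A n) v)" using c by (simp add: contra_hom_simps del: dual_module_simps)
  qed
qed

text \<open>The map on \<open>D (Suc n)\<close> that belongs to \<open>dn n f\<close> is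
  \<open>L\<close> after \<open>bd n\<close>, so the claim follows from
  \<open>bd_bd\<close>.\<close>

lemma dn_dn:
  assumes f: "f \<in> Mor (A n) dW"
  shows "dn (Suc n) (dn n f) = \<zero>\<^bsub>H (A (Suc (Suc n)))\<^esub>"
proof (rule morphism_zeroI[OF dn_closed[OF dn_closed[OF f]]])
  fix \<eta> m assume \<eta>: "\<eta> \<in> carrier (A (Suc (Suc n)))" and m: "m \<in> content"
  obtain L where L: "L \<in> lin_maps K (D n) dW"
    "\<And>\<eta> c. \<eta> \<in> carrier (A n) \<Longrightarrow> c \<in> SymC \<Longrightarrow> L (tens K C (A n) c \<eta>) = f (cst (A n) \<eta>) c"
    using morphism_predual[OF f] by blast
  obtain L' where L': "L' \<in> lin_maps K (D (Suc n)) dW"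
    "\<And>\<eta> c. \<eta> \<in> carrier (A (Suc n)) \<Longrightarrow> c \<in> SymC \<Longrightarrow> L' (tens K C (A (Suc n)) c \<eta>) = dn n f (cst (A (Suc n)) \<eta>) c"
    using morphism_predual[OF dn_closed[OF f]] by blast
  have "L' = compose (carrier (D (Suc n))) L (bd n)"
  proof (rule tens_dpow_eqI[OF A_module dW_module L'(1) lin_maps_compose[OF D_module bd_lin L(1)]])
    fix m v assume m: "m \<in> content" and v: "v \<in> carrier (A (Suc n))"
    show "L' (tens K C (A (Suc n)) (dpow m) v) = compose (carrier (D (Suc n))) L (bd n) (tens K C (A (Suc n)) (dpow m) v)"
      using L'(2)[OF v dpow_SymC[OF m]] dn_predual[OF f L v m] D_tens_closed[OF dpow_SymC[OF m] v]
      by (simp add: compose_eq del: dual_module_simps)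
  qed
  moreover have t: "tens K C (A (Suc (Suc n))) (dpow m) \<eta> \<in> carrier (D (Suc (Suc n)))" by (rule D_tens_closed[OF dpow_SymC[OF m] \<eta>])
  ultimately have "dn (Suc n) (dn n f) (cst (A (Suc (Suc n))) \<eta>) (dpow m) = L (bd n (bd (Suc n) (tens K C (A (Suc (Suc n))) (dpow m) \<eta>)))"
    using dn_predual[OF dn_closed[OF f] L' \<eta> m] lin_maps_closed[OF bd_lin t] by (simp add: compose_eq del: dual_module_simps)
  then show "dn (Suc n) (dn n f) (cst (A (Suc (Suc n))) \<eta>) (dpow m) = \<zero>\<^bsub>dW\<^esub>"
    using bd_bd[OF t] lin_maps_zero[OF D_module dW_module L(1)] by (simp del: dual_module_simps)
qed

lemma dn_lin: "(\<lambda>f \<in> carrier (H (A n)). dn n f) \<in> lin_maps S (H (A n)) (H (A (Suc n)))"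
proof -
  interpret M: left_module S "H (A n)" by (rule H_left_module[OF A_module])
  show ?thesis
    unfolding lin_maps_def
  proof (intro CollectI conjI ballI)
    show "(\<lambda>f \<in> carrier (H (A n)). dn n f) \<in> carrier (H (A n)) \<rightarrow>\<^sub>E carrier (H (A (Suc n)))"
      using dn_closed by (auto simp: contra_hom_simps)
    show "(\<lambda>f \<in> carrier (H (A n)). dn n f) (x \<oplus>\<^bsub>H (A n)\<^esub> y) = (\<lambda>f \<in> carrier (H (A n)). dn n f) x \<oplus>\<^bsub>H (A (Suc n))\<^esub> (\<lambda>f \<in> carrier (H (A n)). dn n f) y"
      if "x \<in> carrier (H (A n))" "y \<in> carrier (H (A n))" for x y
      using that M.a_closed[OF that] compose_add_left[OF koszul_diff_morphism[of n], of dW x y]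
      by (simp add: dn_def contra_hom_simps(2,3) del: dual_module_simps)
    show "(\<lambda>f \<in> carrier (H (A n)). dn n f) (a \<odot>\<^bsub>H (A n)\<^esub> x) = a \<odot>\<^bsub>H (A (Suc n))\<^esub> (\<lambda>f \<in> carrier (H (A n)). dn n f) x"
      if "a \<in> carrier S" "x \<in> carrier (H (A n))" for a x
      using that M.smult_closed[OF that] compose_assoc_maps[OF koszul_diff_morphism[of n], of a x]
      by (simp add: dn_def contra_hom_simps(4) del: dual_module_simps)
  qed
qed

text \<open>A cocycle \<open>f\<close> corresponds to a map \<open>L\<close> that kills boundaries.
  By exactness of the predual complex \<open>L\<close> kills cycles, so it factors through
  \<open>bd k\<close> as \<open>G\<close>, and the morphism belonging to \<open>G\<close> is the
  required preimage. In degree zero every element is a boundary and \<open>L\<close> vanishes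
  outright.\<close>

lemma dn_kernel:
  assumes inf: "infinite B" and f: "f \<in> Mor (A n) dW" and z: "dn n f = \<zero>\<^bsub>H (A (Suc n))\<^esub>"
  shows "n = 0 \<Longrightarrow> f = \<zero>\<^bsub>H (A n)\<^esub>"
    and "n = Suc k \<Longrightarrow> \<exists>g \<in> Mor (A k) dW. dn k g = f"
proof -
  obtain L where L: "L \<in> lin_maps K (D n) dW"
    "\<And>\<eta> c. \<eta> \<in> carrier (A n) \<Longrightarrow> c \<in> SymC \<Longrightarrow> L (tens K C (A n) c \<eta>) = f (cst (A n) \<eta>) c"
    using morphism_predual[OF f] by blast
  have "compose (carrier (D (Suc n))) L (bd n) = (\<lambda>z \<in> carrier (D (Suc n)). \<zero>\<^bsub>dW\<^esub>)"
  proof (rule tens_dpow_eqI[OF A_module dW_module lin_maps_compose[OF D_module bd_lin L(1)] lin_maps_const_zero[OF D_module dW_module]])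
    fix m v assume m: "m \<in> content" and v: "v \<in> carrier (A (Suc n))"
    show "compose (carrier (D (Suc n))) L (bd n) (tens K C (A (Suc n)) (dpow m) v) = (\<lambda>z \<in> carrier (D (Suc n)). \<zero>\<^bsub>dW\<^esub>) (tens K C (A (Suc n)) (dpow m) v)"
      using dn_predual[OF f L v m] z cst_closed[OF A_module v] dpow_SymC[OF m] D_tens_closed[OF dpow_SymC[OF m] v]
      by (simp add: compose_eq contra_hom_simps del: dual_module_simps)
  qed
  then have Leq: "compose (carrier (D (Suc n))) L (bd n) y = (\<lambda>z \<in> carrier (D (Suc n)). \<zero>\<^bsub>dW\<^esub>) y" for y by (rule fun_cong)
  have Lbd: "L (bd n y) = \<zero>\<^bsub>dW\<^esub>" if "y \<in> carrier (D (Suc n))" for y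
    using Leq[of y] that by (simp only: compose_eq restrict_apply if_True)
  show "f = \<zero>\<^bsub>H (A n)\<^esub>" if "n = 0"
  proof (rule morphism_zeroI[OF f])
    fix \<eta> m assume \<eta>: "\<eta> \<in> carrier (A n)" and m: "m \<in> content"
    show "f (cst (A n) \<eta>) (dpow m) = \<zero>\<^bsub>dW\<^esub>"
      using functional_vanishes_degree_0[OF inf dW_module, of L m \<eta>] L(1) Lbd that \<eta> m L(2)[OF \<eta> dpow_SymC[OF m]]
      by (simp del: dual_module_simps)
  qed
  show "\<exists>g \<in> Mor (A k) dW. dn k g = f" if n: "n = Suc k"
  proof -
    have "\<exists>G \<in> lin_maps K (D k) dW. \<forall>x \<in> carrier (D n). G (bd k x) = L x"
      unfolding n
    proof (rule lin_map_factor[OF K_field D_module D_module dW_module bd_lin])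
      show "L \<in> lin_maps K (D (Suc k)) dW" using L(1) n by simp
      show "L x = \<zero>\<^bsub>dW\<^esub>" if "x \<in> carrier (D (Suc k))" "bd k x = \<zero>\<^bsub>D k\<^esub>" for x
        by (rule functional_vanishes_on_cycles[OF inf dW_module _ _ that]) (use L(1) Lbd n in auto)
    qed
    then obtain G where G: "G \<in> lin_maps K (D k) dW" "\<And>x. x \<in> carrier (D n) \<Longrightarrow> G (bd k x) = L x" by blast
    \<comment> \<open>\<open>G\<close> is turned back into a linear map from \<open>A k\<close> to
      \<open>PW\<close>, whose extension \<open>?g\<close> is the morphism sought.\<close>
    have "bilin K (A k) C dW (\<lambda>\<eta> c. G (tens K C (A k) c \<eta>))"
      using bilin_flip[OF bilin_compose[OF tens_bilin[OF C_module A_module] C_module A_module lin_maps_id[OF C_module] lin_maps_id[OF A_module] G(1)]]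
      by (simp add: bilin_def del: dual_module_simps cong: restrict_cong)
    from bilin_curry[OF A_module C_module this]
    have g0: "(\<lambda>\<eta> \<in> carrier (A k). \<lambda>c \<in> SymC. G (tens K C (A k) c \<eta>)) \<in> lin_maps K (A k) PW" (is "?g0 \<in> _")
      by (simp add: lin_maps_FC del: dual_module_simps)
    let ?g = "star (A k) dW ?g0"
    have g: "?g \<in> Mor (A k) dW" by (rule star_morphism[OF A_module dW_module g0])
    have gG: "G (tens K C (A k) c \<eta>) = ?g (cst (A k) \<eta>) c" if "\<eta> \<in> carrier (A k)" "c \<in> SymC" for \<eta> c
      using star_cst[OF A_module dW_module g0 that(1)] that by (simp del: dual_module_simps)
    have fn: "f \<in> Mor (A (Suc k)) dW" using f n by simp
    have "dn k ?g = f"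
    proof (rule Mor_eqI[OF A_module dW_module dn_closed[OF g] fn])
      fix v assume v: "v \<in> carrier (A (Suc k))"
      have c: "cst (A (Suc k)) v \<in> lin_maps K C (A (Suc k))" by (rule cst_closed[OF A_module v])
      show "dn k ?g (cst (A (Suc k)) v) = f (cst (A (Suc k)) v)"
      proof (rule C_eqI[OF dW_module Mor_closed[OF dn_closed[OF g] c] Mor_closed[OF fn c]])
        fix m assume m: "m \<in> content"
        have "dn k ?g (cst (A (Suc k)) v) (dpow m) = G (bd k (tens K C (A (Suc k)) (dpow m) v))"
          by (rule dn_predual[OF g G(1) gG v m])
        also have "\<dots> = L (tens K C (A (Suc k)) (dpow m) v)"
          by (rule G(2)) (use D_tens_closed[OF dpow_SymC[OF m] v] n in simp)
        also have "\<dots> = f (cst (A (Suc k)) v) (dpow m)"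
          using L(2)[of v "dpow m"] v dpow_SymC[OF m] n by (simp del: dual_module_simps)
        finally show "dn k ?g (cst (A (Suc k)) v) (dpow m) = f (cst (A (Suc k)) v) (dpow m)" .
      qed
    qed
    then show ?thesis using g by blast
  qed
qed

text \<open>All elements of the image of the first Koszul differential vanish at \<open>dpow {#}\<close>.\<close>

lemma koszul_diff_0_not_split:
  assumes "\<tau> \<in> Mor (A 0) (A (Suc 0))"
  shows "compose (lin_maps K C (A 0)) (koszul_diff K W 0) \<tau> \<noteq> idF (A 0)"
proof
  assume eq: "compose (lin_maps K C (A 0)) (koszul_diff K W 0) \<tau> = idF (A 0)"
  interpret K: field K by (rule K_field)
  interpret A0: module K "A 0" by (rule A_module)
  have em: "{#} \<in> content" by simp
  \<comment> \<open>The functional with value one on the empty wedge is a nonzero form of degree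
    zero. Its generator \<open>cst (A 0) \<eta>\<close> takes this value at \<open>dpow {#}\<close>
    and will witness the contradiction.\<close>
  have "multilin K W 0 (self_module K) (\<lambda>_. \<one>\<^bsub>K\<^esub>)" by (auto simp: multilin_def)
  from ext_power_lift[OF W_module self_mod this] obtain \<eta> where
    \<eta>: "\<eta> \<in> carrier (A 0)" "\<eta> (wedge K W []) = \<one>\<^bsub>K\<^esub>" by auto
  have w: "wedge K W [] \<in> carrier (Lam 0)" by (rule wedge_closed[OF W_module]) auto
  have c: "cst (A 0) \<eta> \<in> lin_maps K C (A 0)" by (rule cst_closed[OF A_module \<eta>(1)])
  define \<psi> where "\<psi> = \<tau> (cst (A 0) \<eta>)"
  have \<psi>: "\<psi> \<in> lin_maps K C (A (Suc 0))" unfolding \<psi>_def by (rule Mor_closed[OF assms c])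
  have s0: "dpow {#} \<in> carrier C" using dpow_SymC[OF em] by simp
  have p0: "\<psi> (dpow {#}) \<in> carrier (A (Suc 0))" by (rule lin_maps_closed[OF \<psi> s0])
  have pr0: "pr (dpow {#}) = \<zero>\<^bsub>W\<^esub>" by (rule Sym_proj1(2)) auto
  have "cst (A 0) \<eta> = koszul_diff K W 0 \<psi>" using fun_cong[OF eq, of "cst (A 0) \<eta>"] c by (simp add: compose_eq \<psi>_def del: dual_module_simps)
  then have "\<eta> = koszul_diff K W 0 \<psi> (dpow {#})" using cst_dpow[OF A_module \<eta>(1) em] by simp
  also have "\<dots> = (\<Oplus>\<^bsub>A 0\<^esub>a\<in>submsets {#}. Fk 0 (\<psi> (dpow ({#} - a))) (dpow a))"
    unfolding koszul_diff_star by (rule star_dpow[OF A_module Fk_lin \<psi> em])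
  also have "\<dots> = \<zero>\<^bsub>A 0\<^esub>"
  proof (rule A0.add.finprod_one_eqI)
    fix a :: "'w multiset" assume "a \<in> submsets {#}"
    then have "a = {#}" by simp
    then show "Fk 0 (\<psi> (dpow ({#} - a))) (dpow a) = \<zero>\<^bsub>A 0\<^esub>"
      using p0 s0 pr0 bilin_zero_left[OF iota_bilin W_module A_module p0] by (simp add: Fk_def del: dual_module_simps)
  qed
  finally have "\<eta> (wedge K W []) = \<zero>\<^bsub>K\<^esub>" using w by simp
  then show False using \<eta>(2) by simp
qed

section \<open>The cochain complex: acyclicity and noncontractibility\<close>

abbreviation "X \<equiv> hom_complex K C (koszul_contra K W) (koszul_diff K W) PW"

lemma X_obj: "obj X (int n) = H (A n)" "i < 0 \<Longrightarrow> obj X i = zero_module undefined"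
  by (simp_all add: hom_complex_def Let_def koszul_contra_def)

lemma X_diff: "differential X (int n) = (\<lambda>f \<in> carrier (H (A n)). dn n f)"
  "i < 0 \<Longrightarrow> differential X i = (\<lambda>f \<in> carrier (obj X i). \<zero>\<^bsub>obj X (i + 1)\<^esub>)"
proof -
  show "differential X (int n) = (\<lambda>f \<in> carrier (H (A n)). dn n f)"
    by (simp add: hom_complex_def Let_def koszul_contra_def dn_def)
  show "i < 0 \<Longrightarrow> differential X i = (\<lambda>f \<in> carrier (obj X i). \<zero>\<^bsub>obj X (i + 1)\<^esub>)"
    by (simp add: hom_complex_def Let_def)
qed

lemma zero_module_simps [simp]: "carrier (zero_module z) = {z}" "zero (zero_module z) = z"
  "add (zero_module z) = (\<lambda>_ _. z)" "smult (zero_module z) = (\<lambda>_ _. z)"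
  by (simp_all add: zero_module_def)

lemma zero_left_module: "left_module S (zero_module z)"
proof (intro left_module.intro left_module_axioms.intro S_ring)
  show "abelian_group (zero_module z)" by (rule abelian_groupI) auto
qed auto

lemma zero_finitely_generated: "finitely_generated S (zero_module z)"
proof -
  interpret M: left_module S "zero_module z" by (rule zero_left_module)
  have "submodule {z} S (zero_module z)"
    using M.add.subgroup_self by (auto intro!: submodule.intro submodule_axioms.intro)
  moreover have "z \<in> N" if "submodule N S (zero_module z)" for N using submodule_zero[OF that] by simp
  ultimately have "lin_span S (zero_module z) {} = {z}" unfolding lin_span_def by blast
  then show ?thesis unfolding finitely_generated_def by (intro exI[of _ "{}"]) simp
qed

lemma zero_projective: "projective_module TYPE('t) S (zero_module z)"
  unfolding projective_module_def
proof (intro conjI allI impI zero_left_module)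
  fix Y Z :: "(((nat \<Rightarrow> ('w list \<Rightarrow> 'k) set) \<Rightarrow> 'w \<Rightarrow> 'k) \<Rightarrow> (nat \<Rightarrow> ('w list \<Rightarrow> 'k) set) \<Rightarrow> 'w \<Rightarrow> 'k, 't) module"
  fix p f
  assume a: "left_module S Y \<and> left_module S Z \<and> p \<in> lin_maps S Y Z \<and> p ` carrier Y = carrier Z \<and> f \<in> lin_maps S (zero_module z) Z"
  interpret Y: left_module S Y using a by simp
  interpret Z: left_module S Z using a by simp
  interpret M: left_module S "zero_module z" by (rule zero_left_module)
  have "a \<odot>\<^bsub>Y\<^esub> \<zero>\<^bsub>Y\<^esub> = \<zero>\<^bsub>Y\<^esub>" if "a \<in> carrier S" for a
    using Y.smult_r_distr[OF that Y.zero_closed Y.zero_closed] Y.smult_closed[OF that Y.zero_closed]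
    by (simp add: Y.add.l_cancel_one')
  then have "(\<lambda>x \<in> carrier (zero_module z). \<zero>\<^bsub>Y\<^esub>) \<in> lin_maps S (zero_module z) Y" by (auto simp: lin_maps_def)
  moreover have "p \<zero>\<^bsub>Y\<^esub> = \<zero>\<^bsub>Z\<^esub>" "f z = \<zero>\<^bsub>Z\<^esub>"
    using additive_zero[OF Y.abelian_group_axioms Z.abelian_group_axioms, of p S]
      additive_zero[OF M.abelian_group_axioms Z.abelian_group_axioms, of f S] a by auto
  ultimately show "\<exists>h \<in> lin_maps S (zero_module z) Y. \<forall>x \<in> carrier (zero_module z). p (h x) = f x"
    by (intro bexI) auto
qed

lemma int_cases_nat: "(\<And>n. i = int n \<Longrightarrow> P) \<Longrightarrow> (i < 0 \<Longrightarrow> P) \<Longrightarrow> P"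
  by (cases "0 \<le> i") (auto elim: nonneg_int_cases)

lemma X_left_module: "left_module S (obj X i)"
  by (cases i rule: int_cases_nat) (simp_all add: X_obj H_left_module[OF A_module] zero_left_module del: dual_module_simps)

lemma X_cochain: "cochain_complex S X"
  unfolding cochain_complex_def
proof (intro conjI allI ballI X_left_module)
  fix i
  interpret M: left_module S "obj X (i + 1)" by (rule X_left_module)
  show "differential X i \<in> lin_maps S (obj X i) (obj X (i + 1))"
  proof (cases i rule: int_cases_nat)
    case (1 n)
    then show ?thesis using dn_lin[of n] X_obj(1)[of "Suc n"] by (simp add: X_diff X_obj add.commute)
  next
    case 2
    have "a \<odot>\<^bsub>obj X (i + 1)\<^esub> \<zero>\<^bsub>obj X (i + 1)\<^esub> = \<zero>\<^bsub>obj X (i + 1)\<^esub>" if "a \<in> carrier S" for a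
      using M.smult_r_distr[OF that M.zero_closed M.zero_closed] M.smult_closed[OF that M.zero_closed]
      by (simp add: M.add.l_cancel_one')
    then show ?thesis unfolding X_diff(2)[OF 2] unfolding X_obj(2)[OF 2] by (auto simp: lin_maps_def)
  qed
next
  fix i x assume x: "x \<in> carrier (obj X i)"
  interpret M: left_module S "obj X (i + 1)" by (rule X_left_module)
  show "differential X (i + 1) (differential X i x) = \<zero>\<^bsub>obj X (i + 1 + 1)\<^esub>"
  proof (cases i rule: int_cases_nat)
    case (1 n)
    have i1: "i + 1 = int (Suc n)" "int (Suc n) + 1 = int (Suc (Suc n))" using 1 by simp_all
    have "x \<in> Mor (A n) dW" using x unfolding 1 X_obj by (simp add: contra_hom_simps)
    then show ?thesis unfolding i1 unfolding 1 X_diff X_obj using dn_dn[of x n] dn_closed[of x n] by (simp add: contra_hom_simps(1))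
  next
    \<comment> \<open>The differential is zero in negative degrees, so it remains that the next one
      preserves zero; at the passage from degree -1 to degree 0 this is additivity of
      \<open>dn\<close>.\<close>
    case 2
    then have d: "differential X i x = \<zero>\<^bsub>obj X (i + 1)\<^esub>" using x by (simp add: X_diff(2))
    show ?thesis
    proof (cases "i + 1" rule: int_cases_nat)
      case (1 n)
      have i2: "i + 1 + 1 = int (Suc n)" using 1 by simp
      have "(\<lambda>f \<in> carrier (H (A n)). dn n f) \<zero>\<^bsub>H (A n)\<^esub> = \<zero>\<^bsub>H (A (Suc n))\<^esub>"
        by (rule additive_zero[OF _ _ dn_lin]) (rule contra_hom_abelian[OF A_module dW_module])+
      then show ?thesis unfolding d unfolding i2 unfolding 1 X_diff X_obj .
    next
      case 2
      then show ?thesis unfolding d unfolding X_diff(2)[OF 2] using M.zero_closed by simp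
    qed
  qed
qed

lemma X_bounded_below: "bounded_below X"
  unfolding bounded_below_def by (rule exI[of _ 0]) (simp add: X_obj(2))

lemma X_acyclic:
  assumes inf: "infinite B"
  shows "acyclic_complex X"
  unfolding acyclic_complex_def
proof
  fix i
  show "{x \<in> carrier (obj X i). differential X i x = \<zero>\<^bsub>obj X (i + 1)\<^esub>} = differential X (i - 1) ` carrier (obj X (i - 1))"
  proof (cases i rule: int_cases_nat)
    case (1 n)
    have i1: "i + 1 = int (Suc n)" using 1 by simp
    have ker: "{x \<in> carrier (obj X i). differential X i x = \<zero>\<^bsub>obj X (i + 1)\<^esub>} =
      {f \<in> Mor (A n) dW. dn n f = \<zero>\<^bsub>H (A (Suc n))\<^esub>}"
      unfolding i1 unfolding 1 X_diff X_obj by (auto simp: contra_hom_simps(1))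
    interpret M: left_module S "H (A n)" by (rule H_left_module[OF A_module])
    have z: "\<zero>\<^bsub>H (A n)\<^esub> \<in> Mor (A n) dW" using M.zero_closed by (simp add: contra_hom_simps(1))
    show ?thesis
    proof (cases n)
      case 0
      have "(\<lambda>f \<in> carrier (H (A n)). dn n f) \<zero>\<^bsub>H (A n)\<^esub> = \<zero>\<^bsub>H (A (Suc n))\<^esub>"
        by (rule additive_zero[OF _ _ dn_lin]) (rule contra_hom_abelian[OF A_module dW_module])+
      then have dz: "dn n \<zero>\<^bsub>H (A n)\<^esub> = \<zero>\<^bsub>H (A (Suc n))\<^esub>" using M.zero_closed by simp
      have "{f \<in> Mor (A n) dW. dn n f = \<zero>\<^bsub>H (A (Suc n))\<^esub>} = {\<zero>\<^bsub>H (A n)\<^esub>}"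
      proof (intro equalityI subsetI)
        fix f assume "f \<in> {f \<in> Mor (A n) dW. dn n f = \<zero>\<^bsub>H (A (Suc n))\<^esub>}"
        then have f: "f \<in> Mor (A n) dW" "dn n f = \<zero>\<^bsub>H (A (Suc n))\<^esub>"
          by (simp_all only: mem_Collect_eq)
        show "f \<in> {\<zero>\<^bsub>H (A n)\<^esub>}" unfolding singleton_iff by (rule dn_kernel(1)[OF inf f 0])
      next
        fix f assume "f \<in> {\<zero>\<^bsub>H (A n)\<^esub>}"
        then have "f = \<zero>\<^bsub>H (A n)\<^esub>" by (rule singletonD)
        then show "f \<in> {f \<in> Mor (A n) dW. dn n f = \<zero>\<^bsub>H (A (Suc n))\<^esub>}"
          using z dz by (simp only: mem_Collect_eq simp_thms)
      qed
      \<comment> \<open>The incoming differential starts from the zero module in degree -1, so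
        exactness in degree zero means that the kernel is zero.\<close>
      moreover have "differential X (i - 1) ` carrier (obj X (i - 1)) = {\<zero>\<^bsub>H (A n)\<^esub>}"
      proof -
        have neg: "i - 1 < 0" using 0 1 by simp
        have "obj X (i - 1 + 1) = H (A n)" using X_obj(1)[of n] 1 by simp
        then show ?thesis unfolding X_diff(2)[OF neg] by (simp add: X_obj(2)[OF neg])
      qed
      ultimately show ?thesis using ker by simp
    next
      case (Suc k)
      have i0: "i - 1 = int k" using 1 Suc by simp
      have "differential X (i - 1) ` carrier (obj X (i - 1)) = dn k ` Mor (A k) dW"
        unfolding i0 X_diff X_obj by (auto simp: contra_hom_simps(1))
      moreover have "{f \<in> Mor (A n) dW. dn n f = \<zero>\<^bsub>H (A (Suc n))\<^esub>} = dn k ` Mor (A k) dW"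
      proof
        show "dn k ` Mor (A k) dW \<subseteq> {f \<in> Mor (A n) dW. dn n f = \<zero>\<^bsub>H (A (Suc n))\<^esub>}"
          using dn_dn[of _ k] dn_closed[of _ k] Suc by auto
        show "{f \<in> Mor (A n) dW. dn n f = \<zero>\<^bsub>H (A (Suc n))\<^esub>} \<subseteq> dn k ` Mor (A k) dW"
          using dn_kernel(2)[OF inf _ _ Suc] by blast
      qed
      ultimately show ?thesis using ker by simp
    qed
  next
    case 2
    then have neg: "i - 1 < 0" by simp
    show ?thesis unfolding X_diff(2)[OF 2] X_diff(2)[OF neg] unfolding X_obj(2)[OF 2] X_obj(2)[OF neg] using X_obj(2)[OF 2] by auto
  qed
qed

text \<open>In degree zero a contraction reduces to a map \<open>h 1\<close> with
  \<open>h 1 (dn 0 x) = x\<close>. As \<open>g1\<close> generates its module over \<open>S\<close>,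
  linearity makes \<open>h 1\<close> composition with a morphism \<open>\<tau>\<close> built from
  \<open>h 1 g1\<close>. So \<open>g0\<close> is unchanged by composition with the first Koszul
  differential after \<open>\<tau>\<close>, and cancelling \<open>g0\<close> by
  \<open>\<rho>0\<close> gives the splitting that \<open>koszul_diff_0_not_split\<close>
  excludes.\<close>

lemma X_not_contractible:
  assumes inf: "infinite B"
  shows "\<not> contractible_complex S X"
proof
  assume "contractible_complex S X"
  then obtain h where h: "\<And>i. h i \<in> lin_maps S (obj X i) (obj X (i - 1))"
    and hom: "\<And>i x. x \<in> carrier (obj X i) \<Longrightarrow>
      x = differential X (i - 1) (h i x) \<oplus>\<^bsub>obj X i\<^esub> h (i + 1) (differential X i x)"
    unfolding contractible_complex_def by blast
  have o: "obj X 0 = H (A 0)" "obj X 1 = H (A (Suc 0))" "obj X (-1) = zero_module undefined"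
    using X_obj(1)[of 0] X_obj(1)[of "Suc 0"] X_obj(2)[of "-1"] by simp_all
  interpret M: left_module S "H (A 0)" by (rule H_left_module[OF A_module])
  have h1: "h 1 \<in> lin_maps S (H (A (Suc 0))) (H (A 0))" using h[of 1] o by simp
  \<comment> \<open>The term in degree -1 has \<open>undefined\<close> as its only element, and the
    differential out of it is zero, so this summand drops out of the homotopy equation.\<close>
  have h0: "h 0 x = undefined" if "x \<in> carrier (H (A 0))" for x
    using lin_maps_closed[OF h[of 0], of x] that o by simp
  have d: "differential X 0 x = dn 0 x" "differential X (-1) undefined = \<zero>\<^bsub>H (A 0)\<^esub>" if "x \<in> carrier (H (A 0))" for x
    using X_diff(1)[of 0] X_diff(2)[of "-1"] that o by simp_all
  have id: "x = h 1 (dn 0 x)" if x: "x \<in> carrier (H (A 0))" for x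
  proof -
    have "dn 0 x \<in> carrier (H (A (Suc 0)))" using dn_closed[of x 0] x by (simp add: contra_hom_simps(1))
    then have "h 1 (dn 0 x) \<in> carrier (H (A 0))" by (rule lin_maps_closed[OF h1])
    then show ?thesis using hom[of x 0] x o h0[OF x] d[OF x] by simp
  qed
  obtain g0 \<rho>0 where g0: "g0 \<in> Mor (A 0) dW" and \<rho>0: "\<rho>0 \<in> Mor dW (A 0)"
    "compose (lin_maps K C (A 0)) \<rho>0 g0 = idF (A 0)" using koszul_retract[OF inf] by blast
  obtain g1 \<rho>1 where g1: "g1 \<in> Mor (A (Suc 0)) dW" and \<rho>1: "\<rho>1 \<in> Mor dW (A (Suc 0))"
    "compose (lin_maps K C (A (Suc 0))) \<rho>1 g1 = idF (A (Suc 0))" using koszul_retract[OF inf] by blast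
  have g1H: "g1 \<in> carrier (H (A (Suc 0)))" using g1 by (simp add: contra_hom_simps(1))
  define t where "t = h 1 g1"
  have t: "t \<in> Mor (A 0) dW"
    unfolding t_def using lin_maps_closed[OF h1 g1H] by (simp add: contra_hom_simps(1))
  let ?\<tau> = "compose (lin_maps K C (A 0)) \<rho>1 t"
  have \<tau>: "?\<tau> \<in> Mor (A 0) (A (Suc 0))" by (rule Mor_compose[OF A_module t \<rho>1(1)])
  let ?y = "dn 0 g0"
  have y: "?y \<in> Mor (A (Suc 0)) dW" by (rule dn_closed[OF g0])
  let ?s = "compose (lin_maps K C dW) ?y \<rho>1"
  have s: "?s \<in> carrier S" using Mor_compose[OF dW_module \<rho>1(1) y] by (simp add: end_ring_simps del: dual_module_simps)
  have "g0 = h 1 ?y" by (rule id) (use g0 in \<open>simp add: contra_hom_simps(1)\<close>)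
  also have "?y = ?s \<odot>\<^bsub>H (A (Suc 0))\<^esub> g1"
    using retract_factor[OF g1 \<rho>1(2) y] by (simp add: contra_hom_simps del: dual_module_simps)
  also have "h 1 (?s \<odot>\<^bsub>H (A (Suc 0))\<^esub> g1) = ?s \<odot>\<^bsub>H (A 0)\<^esub> t"
    unfolding t_def by (rule lin_maps_smult[OF h1 s g1H])
  also have "\<dots> = compose (lin_maps K C (A 0)) ?y ?\<tau>"
    using compose_assoc_maps[OF t, of ?y \<rho>1] by (simp add: contra_hom_simps del: dual_module_simps)
  also have "\<dots> = compose (lin_maps K C (A 0)) g0 (compose (lin_maps K C (A 0)) (koszul_diff K W 0) ?\<tau>)"
    unfolding dn_def by (rule compose_assoc_maps[OF \<tau>, symmetric])
  finally have eq: "g0 = compose (lin_maps K C (A 0)) g0 (compose (lin_maps K C (A 0)) (koszul_diff K W 0) ?\<tau>)" .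
  let ?e = "compose (lin_maps K C (A 0)) (koszul_diff K W 0) ?\<tau>"
  have e: "?e \<in> Mor (A 0) (A 0)"
    by (rule Mor_compose[OF A_module \<tau> koszul_diff_morphism])
  have "compose (lin_maps K C (A 0)) \<rho>0 g0 = compose (lin_maps K C (A 0)) (compose (lin_maps K C (A 0)) \<rho>0 g0) ?e"
    by (subst eq) (rule compose_assoc_maps[OF e])
  then have "idF (A 0) = compose (lin_maps K C (A 0)) (idF (A 0)) ?e"
    unfolding \<rho>0(2) .
  also have "\<dots> = ?e"
    using Mor_closed[OF e] by (auto simp: compose_def restrict_def fun_eq_iff)
  finally show False using koszul_diff_0_not_split[OF \<tau>] by simp
qed

lemma X_fg_projective:
  assumes "infinite B"
  shows "finitely_generated S (obj X i)" "projective_module TYPE('t) S (obj X i)"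
proof -
  show "finitely_generated S (obj X i)"
    by (cases i rule: int_cases_nat) (simp_all add: X_obj H_finitely_generated[OF assms] zero_finitely_generated del: dual_module_simps)
  show "projective_module TYPE('t) S (obj X i)"
    by (cases i rule: int_cases_nat) (simp_all add: X_obj H_projective[OF assms] zero_projective del: dual_module_simps)
qed

end

theorem corollary7p3:
  fixes K :: "'k ring" and W :: "('k, 'w) module"
  assumes "field K" and "Module.module K W"
    and "\<not> finitely_generated K W"
  shows "let
      C = Sym K W;
      P = free_contramodule K C (dual_module K W);
      S = contra_end_ring K C P;
      X = hom_complex K C (koszul_contra K W) (koszul_diff K W) P
    in cochain_complex S X \<and>
       bounded_below X \<and>
       \<not> contractible_complex S X \<and>
       acyclic_complex X \<and>
       (\<forall>i. finitely_generated S (obj X i) \<and> projective_module TYPE('t) S (obj X i))"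
proof -
  obtain B where B: "B \<subseteq> carrier W" "lin_basis K W B (\<lambda>b. b)"
    using lin_basis_exists[OF assms(1,2)] by blast
  interpret based_space K W B by (intro based_space.intro assms(1,2) B)
  have inf: "infinite B"
  proof
    assume "finite B"
    moreover have "lin_span K W B = carrier W" using B(2) by (simp add: lin_basis_def)
    ultimately show False using assms(3) B(1) by (auto simp: finitely_generated_def)
  qed
  show ?thesis
    unfolding Let_def
    using X_cochain X_bounded_below X_not_contractible[OF inf] X_acyclic[OF inf] X_fg_projective[OF inf] by blast
qed

end
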